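(* Let $A\to B$ be a ring homomorphism with $\Omega^1_{B/A}=0$. Then the $A$-algebra $Y:=H_0(L\Omega^\bullet_{B/A}/F^2)$, together with the surjection $Y\to H_0(L\Omega^\bullet_{B/A}/F^1)\cong B$, is a first-order thickening of $B$, and it is a universal first-order thickening of the $A$-algebra $B$, i.e. an initial object of the category of first-order thickenings of $B$.
   Context: All rings are commutative with unit. For a ring map $A\to B$, let $P_\bullet\to B$ be the standard simplicial resolution: $P_0=A[x_b:b\in B]$ is the polynomial algebra on the underlying set of $B$, $P_{i+1}=A[P_i]$, with face maps induced by the evaluation homomorphisms $A[S]\to S$ and degeneracy maps induced by the set maps $S\to A[S]$, $s\mapsto x_s$. The derived de Rham complex $L\Omega^\bullet_{B/A}$ is the total complex (direct-sum convention) of the double complex whose $n$-th column is the de Rham complex $\Omega^\bullet_{P_n/A}$ and whose horizontal differentials are alternating sums of the maps induced by the face maps; we use homological grading in which $\Omega^i_{P_n/A}$ sits in degree $n-i$. Its Hodge filtration $F^i$ is induced by the subcomplexes $\Omega^{\geq i}_{P_n/A}$. Via the shuffle product it is a filtered differential graded $A$-algebra, so each $H_0(L\Omega^\bullet_{B/A}/F^i)$ is an $A$-algebra; $H_0(L\Omega^\bullet_{B/A}/F^1)\cong B$. A first-order thickening of the $A$-algebra $B$ is a surjective $A$-algebra homomorphism $Y\to B$ whose kernel $I$ satisfies $I^2=0$; morphisms of first-order thickenings are $A$-algebra maps compatible with the surjections onto $B$. *)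

theory Defs
  imports
    "HOL-Algebra.Indexed_Polynomials"
    "HOL-Algebra.Ideal_Product"
    "HOL-Algebra.Free_Abelian_Groups"
    "HOL-Library.FSet"
begin

section \<open>Maps induced on quotient groups\<close>

text \<open>The maps into \<open>G Mod H\<close> induced by \<open>h\<close> on a coset \<open>U\<close>, or on a pair of cosets \<open>U\<close>, \<open>V\<close>.\<close>

definition quot_map ::
  "('g, 'k) monoid_scheme \<Rightarrow> 'g set \<Rightarrow> ('x \<Rightarrow> 'g) \<Rightarrow> 'x set \<Rightarrow> 'g set" where
  "quot_map G H h U = the_elem ((\<lambda>x. H #>\<^bsub>G\<^esub> h x) ` U)"

definition quot_map2 ::
  "('g, 'k) monoid_scheme \<Rightarrow> 'g set \<Rightarrow> ('x \<Rightarrow> 'y \<Rightarrow> 'g) \<Rightarrow> 'x set \<Rightarrow> 'y set \<Rightarrow> 'g set" where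
  "quot_map2 G H h U V = the_elem ((\<lambda>(x, y). H #>\<^bsub>G\<^esub> h x y) ` (U \<times> V))"


section \<open>Polynomial algebras on a set of variables\<close>

definition poly_alg :: "('a, 'm) ring_scheme \<Rightarrow> 'v set \<Rightarrow> ('v multiset \<Rightarrow> 'a) ring" where
  "poly_alg A S =
    \<lparr>carrier = ring.indexed_pset A S (carrier A),
     monoid.mult = (\<lambda>p q m. \<Oplus>\<^bsub>A\<^esub>n\<in>{n. n \<subseteq># m}. p n \<otimes>\<^bsub>A\<^esub> q (m - n)),
     one = ring.indexed_const A \<one>\<^bsub>A\<^esub>,
     ring.zero = ring.indexed_const A \<zero>\<^bsub>A\<^esub>,
     add = ring.indexed_padd A\<rparr>"

definition poly_alg_eval ::
  "('a, 'm) ring_scheme \<Rightarrow> ('r, 'k) ring_scheme \<Rightarrow> ('a \<Rightarrow> 'r) \<Rightarrow> ('v \<Rightarrow> 'r) \<Rightarrow>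
    ('v multiset \<Rightarrow> 'a) \<Rightarrow> 'r" where
  "poly_alg_eval A R \<sigma> \<rho> p =
    (\<Oplus>\<^bsub>R\<^esub>m\<in>{m. p m \<noteq> \<zero>\<^bsub>A\<^esub>}.
      \<sigma> (p m) \<otimes>\<^bsub>R\<^esub> (\<Otimes>\<^bsub>R\<^esub>v\<in>set_mset m. \<rho> v [^]\<^bsub>R\<^esub> count m v))"


section \<open>The de Rham complex of an algebra\<close>

text \<open>Let \<open>R\<close> be an \<open>A\<close>-algebra with structure map \<open>\<sigma>\<close>.  The group \<open>\<Omega>\<^sup>i = \<Lambda>\<^sup>i\<^sub>R \<Omega>\<^sup>1\<close> of relative
  differential \<open>i\<close>-forms is presented as the abelian group on the symbols
  \<open>(r, [x\<^sub>1, \<dots>, x\<^sub>i])\<close>, standing for \<open>r dx\<^sub>1 \<and> \<dots> \<and> dx\<^sub>i\<close>, modulo additivity in \<open>r\<close>, the defining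
  relations of the universal \<open>A\<close>-derivation \<open>d\<close> in each slot, and alternation.\<close>

definition form_symbols :: "('r, 'k) ring_scheme \<Rightarrow> nat \<Rightarrow> ('r \<times> 'r list) set" where
  "form_symbols R i = {(r, xs). r \<in> carrier R \<and> set xs \<subseteq> carrier R \<and> length xs = i}"

inductive_set form_relations ::
  "('a, 'm) ring_scheme \<Rightarrow> ('r, 'k) ring_scheme \<Rightarrow> ('a \<Rightarrow> 'r) \<Rightarrow> nat \<Rightarrow> ('r \<times> 'r list \<Rightarrow>\<^sub>0 int) set"
  for A R \<sigma> i where
  coeff_add:
    "\<lbrakk>(r, xs) \<in> form_symbols R i; (s, xs) \<in> form_symbols R i\<rbrakk> \<Longrightarrow>
      frag_of (r \<oplus>\<^bsub>R\<^esub> s, xs) - frag_of (r, xs) - frag_of (s, xs) \<in> form_relations A R \<sigma> i"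
| d_add:
    "\<lbrakk>(r, us @ x # vs) \<in> form_symbols R i; y \<in> carrier R\<rbrakk> \<Longrightarrow>
      frag_of (r, us @ (x \<oplus>\<^bsub>R\<^esub> y) # vs) - frag_of (r, us @ x # vs) - frag_of (r, us @ y # vs)
        \<in> form_relations A R \<sigma> i"
| d_mult:
    "\<lbrakk>(r, us @ x # vs) \<in> form_symbols R i; y \<in> carrier R\<rbrakk> \<Longrightarrow>
      frag_of (r, us @ (x \<otimes>\<^bsub>R\<^esub> y) # vs)
        - frag_of (r \<otimes>\<^bsub>R\<^esub> x, us @ y # vs) - frag_of (r \<otimes>\<^bsub>R\<^esub> y, us @ x # vs)
        \<in> form_relations A R \<sigma> i"
| d_const:
    "\<lbrakk>(r, us @ \<sigma> a # vs) \<in> form_symbols R i; a \<in> carrier A\<rbrakk> \<Longrightarrow>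
      frag_of (r, us @ \<sigma> a # vs) \<in> form_relations A R \<sigma> i"
| alternating:
    "(r, us @ x # vs @ x # ws) \<in> form_symbols R i \<Longrightarrow>
      frag_of (r, us @ x # vs @ x # ws) \<in> form_relations A R \<sigma> i"

definition form_null ::
  "('a, 'm) ring_scheme \<Rightarrow> ('r, 'k) ring_scheme \<Rightarrow> ('a \<Rightarrow> 'r) \<Rightarrow> nat \<Rightarrow> ('r \<times> 'r list \<Rightarrow>\<^sub>0 int) set" where
  "form_null A R \<sigma> i =
    generate (free_Abelian_group (form_symbols R i)) (form_relations A R \<sigma> i)"

definition forms ::
  "('a, 'm) ring_scheme \<Rightarrow> ('r, 'k) ring_scheme \<Rightarrow> ('a \<Rightarrow> 'r) \<Rightarrow> nat \<Rightarrow>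
    ('r \<times> 'r list \<Rightarrow>\<^sub>0 int) set monoid" where
  "forms A R \<sigma> i = free_Abelian_group (form_symbols R i) Mod form_null A R \<sigma> i"

text \<open>\<open>d (r dx\<^sub>1 \<and> \<dots> \<and> dx\<^sub>i) = 1 dr \<and> dx\<^sub>1 \<and> \<dots> \<and> dx\<^sub>i\<close>\<close>

definition form_d ::
  "('a, 'm) ring_scheme \<Rightarrow> ('r, 'k) ring_scheme \<Rightarrow> ('a \<Rightarrow> 'r) \<Rightarrow> nat \<Rightarrow>
    ('r \<times> 'r list \<Rightarrow>\<^sub>0 int) set \<Rightarrow> ('r \<times> 'r list \<Rightarrow>\<^sub>0 int) set" where
  "form_d A R \<sigma> i =
    quot_map (free_Abelian_group (form_symbols R (Suc i))) (form_null A R \<sigma> (Suc i))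
      (frag_extend (\<lambda>(r, xs). frag_of (\<one>\<^bsub>R\<^esub>, r # xs)))"


section \<open>The standard simplicial resolution\<close>

text \<open>All iterated polynomial algebras \<open>P\<^sub>0 = A[B]\<close>, \<open>P\<^sub>n\<^sub>+\<^sub>1 = A[P\<^sub>n]\<close> have their variables in one
  type: a variable is either an element of \<open>B\<close> or a polynomial of the previous stage, the latter
  being recorded by the finite graph of its nonzero coefficients.\<close>

datatype ('a, 'b) var = Base 'b | Poly "(('a, 'b) var multiset \<times> 'a) fset"

type_synonym ('a, 'b) pol = "('a, 'b) var multiset \<Rightarrow> 'a"
type_synonym ('a, 'b) form = "(('a, 'b) pol \<times> ('a, 'b) pol list \<Rightarrow>\<^sub>0 int) set"

text \<open>An element of the total complex assigns to \<open>(n, i)\<close> its component in \<open>\<Omega>\<^sup>i\<close> of \<open>P\<^sub>n\<close>.\<close>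

type_synonym ('a, 'b) chain = "nat \<times> nat \<Rightarrow> ('a, 'b) form"

context
  fixes A :: "('a, 'm) ring_scheme"
    and B :: "('b, 'n) ring_scheme"
    and f :: "'a \<Rightarrow> 'b"
begin

definition encode :: "('a, 'b) pol \<Rightarrow> ('a, 'b) var" where
  "encode p = Poly (Abs_fset {(m, p m) |m. p m \<noteq> \<zero>\<^bsub>A\<^esub>})"

definition decode :: "('a, 'b) var \<Rightarrow> ('a, 'b) pol" where
  "decode = inv_into (carrier (poly_alg A UNIV)) encode"

primrec res_vars :: "nat \<Rightarrow> ('a, 'b) var set" where
  "res_vars 0 = Base ` carrier B"
| "res_vars (Suc n) = encode ` carrier (poly_alg A (res_vars n))"

definition res :: "nat \<Rightarrow> ('a, 'b) pol ring" where
  "res n = poly_alg A (res_vars n)"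

abbreviation (input) scalar :: "'a \<Rightarrow> ('a, 'b) pol" where
  "scalar \<equiv> ring.indexed_const A"

abbreviation (input) indet :: "('a, 'b) var \<Rightarrow> ('a, 'b) pol" where
  "indet \<equiv> ring.indexed_var A"

definition augmentation :: "('a, 'b) pol \<Rightarrow> 'b" where
  "augmentation = poly_alg_eval A B f (case_var id (\<lambda>_. \<zero>\<^bsub>B\<^esub>))"

text \<open>With \<open>T S = A[S]\<close>, we have \<open>P\<^sub>n = T\<^sup>n\<^sup>+\<^sup>1 B\<close>, and \<open>face n j : P\<^sub>n \<rightarrow> P\<^sub>n\<^sub>-\<^sub>1\<close> (for \<open>n \<ge> 1\<close>, \<open>j \<le> n\<close>)
  is \<open>T\<^sup>j\<close> applied to the evaluation \<open>A[T\<^sup>n\<^sup>-\<^sup>j B] \<rightarrow> T\<^sup>n\<^sup>-\<^sup>j B\<close>.  Likewise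
  \<open>degeneracy n j : P\<^sub>n \<rightarrow> P\<^sub>n\<^sub>+\<^sub>1\<close> (for \<open>j \<le> n\<close>) is \<open>T\<^sup>j\<^sup>+\<^sup>1\<close> applied to the inclusion of variables
  \<open>T\<^sup>n\<^sup>-\<^sup>j B \<rightarrow> A[T\<^sup>n\<^sup>-\<^sup>j B]\<close>.\<close>

primrec face :: "nat \<Rightarrow> nat \<Rightarrow> ('a, 'b) pol \<Rightarrow> ('a, 'b) pol" where
  "face n 0 = poly_alg_eval A (res (n - 1)) scalar decode"
| "face n (Suc j) = poly_alg_eval A (res (n - 1)) scalar
    (\<lambda>v. indet (if n = 1 then Base (augmentation (decode v))
             else encode (face (n - 1) j (decode v))))"

primrec degeneracy :: "nat \<Rightarrow> nat \<Rightarrow> ('a, 'b) pol \<Rightarrow> ('a, 'b) pol" where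
  "degeneracy n 0 = poly_alg_eval A (res (Suc n)) scalar (\<lambda>v. indet (encode (indet v)))"
| "degeneracy n (Suc j) = poly_alg_eval A (res (Suc n)) scalar
    (\<lambda>v. indet (encode (degeneracy (n - 1) j (decode v))))"

text \<open>\<open>s\<^bsub>j\<^sub>k\<^esub> \<circ> \<dots> \<circ> s\<^bsub>j\<^sub>1\<^esub>\<close> on \<open>P\<^sub>n\<close>, for the list \<open>[j\<^sub>1, \<dots>, j\<^sub>k]\<close>\<close>

primrec degeneracies :: "nat \<Rightarrow> nat list \<Rightarrow> ('a, 'b) pol \<Rightarrow> ('a, 'b) pol" where
  "degeneracies n [] = id"
| "degeneracies n (j # js) = degeneracies (Suc n) js \<circ> degeneracy n j"


section \<open>The derived de Rham complex\<close>

abbreviation (input) \<Omega> :: "nat \<Rightarrow> nat \<Rightarrow> ('a, 'b) form monoid" where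
  "\<Omega> n i \<equiv> forms A (res n) scalar i"

abbreviation (input) into_\<Omega> ::
  "nat \<Rightarrow> nat \<Rightarrow> ('x \<Rightarrow> (('a, 'b) pol \<times> ('a, 'b) pol list \<Rightarrow>\<^sub>0 int)) \<Rightarrow> 'x set \<Rightarrow> ('a, 'b) form" where
  "into_\<Omega> n i \<equiv>
    quot_map (free_Abelian_group (form_symbols (res n) i)) (form_null A (res n) scalar i)"

definition horizontal_d :: "nat \<Rightarrow> nat \<Rightarrow> ('a, 'b) form \<Rightarrow> ('a, 'b) form" where
  "horizontal_d n i = into_\<Omega> n i
    (frag_extend (\<lambda>(r, xs). \<Sum>j\<le>Suc n.
      frag_cmul ((-1) ^ j) (frag_of (face (Suc n) j r, map (face (Suc n) j) xs))))"

text \<open>The shuffle product \<open>\<Omega>\<^sup>i(P\<^sub>p) \<times> \<Omega>\<^sup>j(P\<^sub>q) \<rightarrow> \<Omega>\<^sup>i\<^sup>+\<^sup>j(P\<^sub>p\<^sub>+\<^sub>q)\<close>, \<open>(x, y) \<mapsto> \<Sum> \<plusminus> s\<^sub>N x \<and> s\<^sub>M y\<close>.  A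
  \<open>(p, q)\<close>-shuffle is given by a \<open>p\<close>-element subset \<open>M\<close> of \<open>{..<p + q}\<close> with complement \<open>N\<close>; its
  sign is that of the permutation listing \<open>M\<close> and then \<open>N\<close> in increasing order.\<close>

definition shuffle ::
  "nat \<Rightarrow> nat \<Rightarrow> nat \<Rightarrow> nat \<Rightarrow> ('a, 'b) form \<Rightarrow> ('a, 'b) form \<Rightarrow> ('a, 'b) form" where
  "shuffle p i q j =
    quot_map2 (free_Abelian_group (form_symbols (res (p + q)) (i + j)))
      (form_null A (res (p + q)) scalar (i + j))
      (\<lambda>c c'. frag_extend (\<lambda>(r, xs). frag_extend (\<lambda>(s, ys).
        \<Sum>M | M \<subseteq> {..<p + q} \<and> card M = p.
          let N = {..<p + q} - M;
              sN = degeneracies p (sorted_list_of_set N);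
              sM = degeneracies q (sorted_list_of_set M)
          in frag_cmul ((-1) ^ card {(m, n). m \<in> M \<and> n \<in> N \<and> n < m})
               (frag_of (sN r \<otimes>\<^bsub>res (p + q)\<^esub> sM s, map sN xs @ map sM ys))) c') c)"

definition bidegrees :: "int \<Rightarrow> (nat \<times> nat) set" where
  "bidegrees k = {(n, i). int n - int i = k}"

definition L\<Omega> :: "int \<Rightarrow> ('a, 'b) chain monoid" where
  "L\<Omega> k = sum_group (bidegrees k) (\<lambda>(n, i). \<Omega> n i)"

text \<open>The total differential is \<open>\<partial> + (-1)\<^sup>n d\<close> on \<open>\<Omega>\<^sup>i(P\<^sub>n)\<close>, and the product of \<open>x \<in> \<Omega>\<^sup>i(P\<^sub>p)\<close> and
  \<open>y \<in> \<Omega>\<^sup>j(P\<^sub>q)\<close> is \<open>(-1)\<^sup>i\<^sup>q\<close> times their shuffle product.\<close>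

definition L\<Omega>_d :: "int \<Rightarrow> ('a, 'b) chain \<Rightarrow> ('a, 'b) chain" where
  "L\<Omega>_d k \<omega> = (\<lambda>(n, i)\<in>bidegrees (k - 1).
     horizontal_d n i (\<omega> (Suc n, i)) \<otimes>\<^bsub>\<Omega> n i\<^esub>
     (case i of
        0 \<Rightarrow> \<one>\<^bsub>\<Omega> n i\<^esub>
      | Suc i' \<Rightarrow> form_d A (res n) scalar i' (\<omega> (n, i')) [^]\<^bsub>\<Omega> n i\<^esub> ((-1) ^ n :: int)))"

definition L\<Omega>_mult ::
  "int \<Rightarrow> int \<Rightarrow> ('a, 'b) chain \<Rightarrow> ('a, 'b) chain \<Rightarrow> ('a, 'b) chain" where
  "L\<Omega>_mult k l \<omega> \<eta> = (\<lambda>(n, i)\<in>bidegrees (k + l).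
     finprod (\<Omega> n i)
       (\<lambda>((p, a), (q, b)).
         shuffle p a q b (\<omega> (p, a)) (\<eta> (q, b)) [^]\<^bsub>\<Omega> n i\<^esub> ((-1) ^ (a * q) :: int))
       {((p, a), (q, b)).
         (p, a) \<in> bidegrees k \<and> (q, b) \<in> bidegrees l \<and> p + q = n \<and> a + b = i})"

definition L\<Omega>_incl :: "('a, 'b) pol \<Rightarrow> ('a, 'b) chain" where
  "L\<Omega>_incl r = (\<lambda>(n, i)\<in>bidegrees 0.
     if (n, i) = (0, 0)
     then form_null A (res 0) scalar 0 #>\<^bsub>free_Abelian_group (form_symbols (res 0) 0)\<^esub> frag_of (r, [])
     else \<one>\<^bsub>\<Omega> n i\<^esub>)"

definition Hodge :: "nat \<Rightarrow> int \<Rightarrow> ('a, 'b) chain set" where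
  "Hodge j k = {\<omega> \<in> carrier (L\<Omega> k). \<forall>(n, i)\<in>bidegrees k. i < j \<longrightarrow> \<omega> (n, i) = \<one>\<^bsub>\<Omega> n i\<^esub>}"


section \<open>The algebras \<open>H\<^sub>0(L\<Omega>/F\<^sup>j)\<close>\<close>

definition L\<Omega>_quot :: "nat \<Rightarrow> int \<Rightarrow> ('a, 'b) chain set monoid" where
  "L\<Omega>_quot j k = L\<Omega> k Mod Hodge j k"

definition L\<Omega>_quot_d :: "nat \<Rightarrow> int \<Rightarrow> ('a, 'b) chain set \<Rightarrow> ('a, 'b) chain set" where
  "L\<Omega>_quot_d j k = quot_map (L\<Omega> (k - 1)) (Hodge j (k - 1)) (L\<Omega>_d k)"

definition L\<Omega>_quot_mult ::
  "nat \<Rightarrow> int \<Rightarrow> int \<Rightarrow> ('a, 'b) chain set \<Rightarrow> ('a, 'b) chain set \<Rightarrow> ('a, 'b) chain set" where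
  "L\<Omega>_quot_mult j k l = quot_map2 (L\<Omega> (k + l)) (Hodge j (k + l)) (L\<Omega>_mult k l)"

definition cycles :: "nat \<Rightarrow> int \<Rightarrow> ('a, 'b) chain set monoid" where
  "cycles j k =
    (L\<Omega>_quot j k)\<lparr>carrier := kernel (L\<Omega>_quot j k) (L\<Omega>_quot j (k - 1)) (L\<Omega>_quot_d j k)\<rparr>"

definition boundaries :: "nat \<Rightarrow> int \<Rightarrow> ('a, 'b) chain set set" where
  "boundaries j k = L\<Omega>_quot_d j (k + 1) ` carrier (L\<Omega>_quot j (k + 1))"

definition H0_of :: "nat \<Rightarrow> ('a, 'b) pol \<Rightarrow> ('a, 'b) chain set set" where
  "H0_of j r = boundaries j 0 #>\<^bsub>cycles j 0\<^esub> (Hodge j 0 #>\<^bsub>L\<Omega> 0\<^esub> L\<Omega>_incl r)"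

definition H0 :: "nat \<Rightarrow> ('a, 'b) chain set set ring" where
  "H0 j =
    \<lparr>carrier = carrier (cycles j 0 Mod boundaries j 0),
     monoid.mult = quot_map2 (cycles j 0) (boundaries j 0) (L\<Omega>_quot_mult j 0 0),
     one = H0_of j \<one>\<^bsub>res 0\<^esub>,
     ring.zero = \<one>\<^bsub>cycles j 0 Mod boundaries j 0\<^esub>,
     add = monoid.mult (cycles j 0 Mod boundaries j 0)\<rparr>"

definition H0_structure_map :: "nat \<Rightarrow> 'a \<Rightarrow> ('a, 'b) chain set set" where
  "H0_structure_map j a = H0_of j (scalar a)"

text \<open>The map \<open>H\<^sub>0(L\<Omega>/F\<^sup>2) \<rightarrow> H\<^sub>0(L\<Omega>/F\<^sup>1)\<close> given by \<open>F\<^sup>2 \<subseteq> F\<^sup>1\<close>\<close>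

definition H0_reduction :: "('a, 'b) chain set set \<Rightarrow> ('a, 'b) chain set set" where
  "H0_reduction = quot_map (cycles 1 0) (boundaries 1 0) (quot_map (L\<Omega> 0) (Hodge 1 0) id)"

text \<open>The isomorphism \<open>H\<^sub>0(L\<Omega>/F\<^sup>1) \<rightarrow> B\<close> induced by the augmentation \<open>P\<^sub>0 \<rightarrow> B\<close>; an element of
  \<open>\<Omega>\<^sup>0(P\<^sub>0) \<cong> P\<^sub>0\<close> is represented by an integer combination of symbols \<open>(r, [])\<close>.\<close>

definition L\<Omega>_augmentation :: "('a, 'b) chain \<Rightarrow> 'b" where
  "L\<Omega>_augmentation \<omega> = the_elem
    ((\<lambda>c. \<Oplus>\<^bsub>B\<^esub>s\<in>Poly_Mapping.keys c. [Poly_Mapping.lookup c s] \<cdot>\<^bsub>B\<^esub> augmentation (fst s)) ` \<omega> (0, 0))"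

definition H0_F1_iso :: "('a, 'b) chain set set \<Rightarrow> 'b" where
  "H0_F1_iso Z = the_elem ((\<lambda>z. the_elem (L\<Omega>_augmentation ` z)) ` Z)"


section \<open>First-order thickenings\<close>

definition first_order_thickening :: "('y, 'k) ring_scheme \<Rightarrow> ('a \<Rightarrow> 'y) \<Rightarrow> ('y \<Rightarrow> 'b) \<Rightarrow> bool" where
  "first_order_thickening Y \<phi> \<pi> \<longleftrightarrow>
    cring Y \<and> \<phi> \<in> ring_hom A Y \<and>
    \<pi> \<in> ring_hom Y B \<and> (\<forall>a\<in>carrier A. \<pi> (\<phi> a) = f a) \<and>
    \<pi> ` carrier Y = carrier B \<and>
    ideal_prod Y (a_kernel Y B \<pi>) (a_kernel Y B \<pi>) = {\<zero>\<^bsub>Y\<^esub>}"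

text \<open>Morphisms are taken to be extensional, so that equality of functions is equality on
  \<open>carrier Y\<close>.\<close>

definition thickening_hom ::
  "('y, 'k) ring_scheme \<Rightarrow> ('a \<Rightarrow> 'y) \<Rightarrow> ('y \<Rightarrow> 'b) \<Rightarrow>
   ('z, 'l) ring_scheme \<Rightarrow> ('a \<Rightarrow> 'z) \<Rightarrow> ('z \<Rightarrow> 'b) \<Rightarrow> ('y \<Rightarrow> 'z) set" where
  "thickening_hom Y \<phi> \<pi> Z \<phi>' \<pi>' =
    {h \<in> ring_hom Y Z \<inter> extensional (carrier Y).
      (\<forall>a\<in>carrier A. h (\<phi> a) = \<phi>' a) \<and> (\<forall>y\<in>carrier Y. \<pi>' (h y) = \<pi> y)}"

end

end

theory Submission
  imports Defs
begin

text \<open>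
  In degree 0 the complex \<open>L\<Omega>/F\<^sup>2\<close> consists of the pairs \<open>(x, \<omega>)\<close> with \<open>x \<in> P\<^sub>0\<close> and \<open>\<omega> \<in> \<Omega>\<^sup>1(P\<^sub>1)\<close>. Such a pair is
  a cycle if \<open>dx + \<partial>\<omega> = 0\<close>, and the boundaries are the pairs \<open>(\<partial>y, \<partial>\<eta> - dy)\<close>. The map to \<open>B\<close> sends
  \<open>(x, \<omega>)\<close> to the image of \<open>x\<close>. If \<open>\<Omega>\<^sup>1(B) = 0\<close>, then \<open>\<partial> : \<Omega>\<^sup>1(P\<^sub>1) \<rightarrow> \<Omega>\<^sup>1(P\<^sub>0)\<close> is onto, so every \<open>x\<close> extends
  to a cycle and \<open>Y \<rightarrow> B\<close> is onto. A class in the kernel has a representative \<open>(0, \<omega>)\<close>, and the product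
  of two of these vanishes modulo \<open>F\<^sup>2\<close>.

  Given a thickening \<open>T \<rightarrow> B\<close>, lift \<open>P\<^sub>0 \<rightarrow> B\<close> to \<open>g : P\<^sub>0 \<rightarrow> T\<close>. Put \<open>\<psi>(r dy) = d\<^sub>1 r \<cdot> (d\<^sub>0 y - d\<^sub>1 y)\<close>; then
  \<open>(x, \<omega>) \<mapsto> g(x + \<psi> \<omega>)\<close> is a morphism \<open>Y \<rightarrow> T\<close>. It does not depend on \<open>g\<close>, since two lifts differ by a
  derivation \<open>D\<close>, and \<open>D(x + \<psi> \<omega>)\<close> is the value of \<open>D\<close> on \<open>dx + \<partial>\<omega> = 0\<close>. Choosing preimages of the variables
  gives a homomorphism \<open>s : P\<^sub>0 \<rightarrow> Y\<close> over \<open>B\<close>, and a homotopy shows that the class of \<open>(x, \<omega>)\<close> is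
  \<open>s(x + \<psi> \<omega>)\<close>. So every morphism \<open>h : Y \<rightarrow> T\<close> has the form above with \<open>g = h \<circ> s\<close>, whence uniqueness.
\<close>

section \<open>Polynomial algebras\<close>

text \<open>Let J be the kernel of P_0 \<rightarrow> B. The expression x + \<psi> \<omega> is best
  read modulo J^2. There \<psi> respects the product rule and \<psi> \<partial> vanishes, because
  each defect is a product of two elements of J. Moreover, in \<Omega>^1(P_0) \<otimes> B the
  differential of \<psi> \<omega> is the image of \<partial>\<omega>, so the cycle condition says
  that d(x + \<psi> \<omega>) vanishes there; this is why derivations into a square-zero kernel do
  not see it. The main obstacle is the coefficients of forms on P_1: an element r of P_1 has two
  shadows s_0 d_0 r and s_0 d_1 r, and multiplication by them agrees only up to a boundary from
  \<Omega>^1(P_2). One shuffle homotopy controls this. It makes the boundaries an ideal among the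
  cycles, so that Y has a product, and it also gives the formula for s on \<psi> \<omega>. All
  computations take place on integer combinations of symbols, modulo the subgroup of
  relations.\<close>

lemma finite_subset_mset: "finite {n. n \<subseteq># m}"
proof (induction m)
  case empty
  then show ?case by simp
next
  case (add x m)
  have "{n. n \<subseteq># add_mset x m} \<subseteq> {n. n \<subseteq># m} \<union> add_mset x ` {n. n \<subseteq># m}"
  proof
    fix n assume n: "n \<in> {n. n \<subseteq># add_mset x m}"
    show "n \<in> {n. n \<subseteq># m} \<union> add_mset x ` {n. n \<subseteq># m}"
    proof (cases "x \<in># n")
      case True
      then obtain n' where n': "n = add_mset x n'" by (meson mset_add)
      then show ?thesis using n by auto
    next
      case False
      then show ?thesis using n
        by (metis UnI1 add_mset_add_single diff_single_trivial mem_Collect_eq subset_eq_diff_conv)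
    qed
  qed
  with add show ?case by (meson finite_UnI finite_imageI finite_subset)
qed

context cring
begin

lemma poly_alg_simps:
  "carrier (poly_alg R S) = indexed_pset S (carrier R)"
  "\<one>\<^bsub>poly_alg R S\<^esub> = indexed_const \<one>"
  "\<zero>\<^bsub>poly_alg R S\<^esub> = indexed_const \<zero>"
  "p \<oplus>\<^bsub>poly_alg R S\<^esub> q = indexed_padd p q"
  "p \<otimes>\<^bsub>poly_alg R S\<^esub> q = (\<lambda>m. \<Oplus>n\<in>{n. n \<subseteq># m}. p n \<otimes> q (m - n))"
  by (auto simp: poly_alg_def)

lemma poly_alg_coeff:
  assumes "p \<in> carrier (poly_alg R S)"
  shows "p m \<in> carrier R"
  using assms indexed_pset_in_carrier[of "carrier R" p S]
  by (simp add: poly_alg_simps carrier_coeff_def)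

text \<open>Both facts come from one induction over the generation of \<open>indexed_pset\<close>.
  Finite support makes evaluation a finite sum and lets \<open>encode\<close> store a polynomial as
  an \<open>fset\<close>; the bound on the monomials keeps evaluation inside the set where the
  variables have prescribed values.\<close>

lemma poly_alg_support:
  assumes "p \<in> carrier (poly_alg R S)"
  shows "finite {m. p m \<noteq> \<zero>}" and "p m \<noteq> \<zero> \<Longrightarrow> set_mset m \<subseteq> S"
proof -
  have "finite {m. p m \<noteq> \<zero>} \<and> (\<forall>m. p m \<noteq> \<zero> \<longrightarrow> set_mset m \<subseteq> S)"
    using assms unfolding poly_alg_simps
  proof (induction rule: indexed_pset.induct)
    case (indexed_const k)
    have "{m. indexed_const k m \<noteq> \<zero>} \<subseteq> {{#}}" by (auto simp: indexed_const_def)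
    then show ?case
      using finite_subset by (fastforce simp: indexed_const_def)
  next
    case (indexed_padd P Q)
    have "{m. local.indexed_padd P Q m \<noteq> \<zero>} \<subseteq> {m. P m \<noteq> \<zero>} \<union> {m. Q m \<noteq> \<zero>}"
      by (auto simp: indexed_padd_def)
    moreover from this have "set_mset m \<subseteq> S" if "local.indexed_padd P Q m \<noteq> \<zero>" for m
      using that indexed_padd.IH by blast
    ultimately show ?case
      using indexed_padd.IH by (meson finite_UnI finite_subset)
  next
    case (indexed_pmult P i)
    have "{m. local.indexed_pmult P i m \<noteq> \<zero>} \<subseteq> add_mset i ` {m. P m \<noteq> \<zero>}"
    proof
      fix m assume "m \<in> {m. local.indexed_pmult P i m \<noteq> \<zero>}"
      then have "i \<in># m" "P (m - {#i#}) \<noteq> \<zero>"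
        by (auto simp: indexed_pmult_def split: if_splits)
      then show "m \<in> add_mset i ` {m. P m \<noteq> \<zero>}"
        by (intro image_eqI[where x = "m - {#i#}"]) auto
    qed
    moreover have "set_mset m \<subseteq> S" if "local.indexed_pmult P i m \<noteq> \<zero>" for m
    proof -
      from that have i: "i \<in># m" and "P (m - {#i#}) \<noteq> \<zero>"
        by (auto simp: indexed_pmult_def split: if_splits)
      then have "set_mset (m - {#i#}) \<subseteq> S" using indexed_pmult.IH by blast
      moreover have "m = add_mset i (m - {#i#})" using i by simp
      ultimately show ?thesis using indexed_pmult.hyps
        by (metis insert_subset set_mset_add_mset_insert)
    qed
    ultimately show ?case
      using indexed_pmult.IH by (meson finite_imageI finite_subset)
  qed
  then show "finite {m. p m \<noteq> \<zero>}" and "p m \<noteq> \<zero> \<Longrightarrow> set_mset m \<subseteq> S" by auto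
qed

text \<open>\<open>encode\<close> and \<open>decode\<close> are inverse to each other on polynomials
  in all variables at once; the inclusion transfers this to every stage of the resolution.\<close>

lemma poly_alg_mono:
  assumes "S \<subseteq> S'" shows "carrier (poly_alg R S) \<subseteq> carrier (poly_alg R S')"
proof
  fix p assume "p \<in> carrier (poly_alg R S)"
  then show "p \<in> carrier (poly_alg R S')"
    unfolding poly_alg_simps
    by (induction rule: indexed_pset.induct) (use assms in \<open>auto intro: indexed_pset.intros\<close>)
qed

text \<open>With multiplication by a single variable as the generating step, the convolution product
  has to be understood only for constants and variables.\<close>

lemma poly_alg_induct [consumes 1, case_names const add mult_var]:
  assumes "p \<in> carrier (poly_alg R S)"
    and "\<And>k. k \<in> carrier R \<Longrightarrow> P (indexed_const k)"
    and "\<And>p q. \<lbrakk>p \<in> carrier (poly_alg R S); q \<in> carrier (poly_alg R S); P p; P q\<rbrakk> \<Longrightarrow>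
      P (p \<oplus>\<^bsub>poly_alg R S\<^esub> q)"
    and "\<And>p v. \<lbrakk>p \<in> carrier (poly_alg R S); v \<in> S; P p\<rbrakk> \<Longrightarrow> P (indexed_pmult p v)"
  shows "P p"
  using assms(1) unfolding poly_alg_simps
  by (induction rule: indexed_pset.induct) (use assms in \<open>auto simp: poly_alg_simps\<close>)

text \<open>Only the splitting of \<open>m\<close> with empty second part contributes to the
  convolution, that is \<open>n = m\<close>.\<close>

lemma const_mult_poly_alg:
  assumes "k \<in> carrier R" "p \<in> carrier (poly_alg R S)"
  shows "p \<otimes>\<^bsub>poly_alg R S\<^esub> indexed_const k = (\<lambda>m. p m \<otimes> k)"
proof
  fix m
  have "(p \<otimes>\<^bsub>poly_alg R S\<^esub> indexed_const k) m
      = (\<Oplus>n\<in>{n. n \<subseteq># m}. if m = n then p n \<otimes> k else \<zero>)"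
    unfolding poly_alg_simps indexed_const_def
    using assms poly_alg_coeff[OF assms(2)]
    by (intro finsum_cong')
       (auto simp: Pi_def dest: subset_mset.antisym[OF _ Diff_eq_empty_iff_mset[THEN iffD1]])
  also have "\<dots> = p m \<otimes> k"
    using finsum_singleton[of m "{n. n \<subseteq># m}" "\<lambda>n. p n \<otimes> k"]
      finite_subset_mset assms poly_alg_coeff[OF assms(2)] by (auto simp: Pi_def)
  finally show "(p \<otimes>\<^bsub>poly_alg R S\<^esub> indexed_const k) m = p m \<otimes> k" .
qed

text \<open>A splitting of \<open>m\<close> contributes only if \<open>v\<close> is left over in
  \<open>m - n\<close>; such \<open>n\<close> are exactly the submultisets of \<open>m\<close> with
  one \<open>v\<close> removed. Together with \<open>const_mult_poly_alg\<close> this determines all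
  products by induction on the right factor.\<close>

lemma poly_alg_mult_pmult:
  assumes "p \<in> carrier (poly_alg R S)" "q \<in> carrier (poly_alg R S)"
  shows "p \<otimes>\<^bsub>poly_alg R S\<^esub> indexed_pmult q v = indexed_pmult (p \<otimes>\<^bsub>poly_alg R S\<^esub> q) v"
proof
  fix m
  note c = poly_alg_coeff[OF assms(1)] poly_alg_coeff[OF assms(2)]
  show "(p \<otimes>\<^bsub>poly_alg R S\<^esub> indexed_pmult q v) m = indexed_pmult (p \<otimes>\<^bsub>poly_alg R S\<^esub> q) v m"
  proof (cases "v \<in># m")
    case False
    then have "v \<notin># m - n" for n by (meson in_diffD)
    with False c show ?thesis
      by (simp add: poly_alg_simps indexed_pmult_def)
  next
    case True
    then obtain m' where m: "m = add_mset v m'" by (meson mset_add)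
    have "v \<in># m - n \<longleftrightarrow> n \<subseteq># m'" if "n \<subseteq># m" for n
    proof
      assume "v \<in># m - n"
      then have "{#v#} \<subseteq># m - n" by simp
      then have "{#v#} + n \<subseteq># m" using that
        by (metis subset_mset.le_diff_conv2)
      then show "n \<subseteq># m'" by (simp add: m)
    next
      assume "n \<subseteq># m'"
      then obtain k where "m' = n + k" by (auto simp: mset_subset_eq_exists_conv)
      then show "v \<in># m - n" by (simp add: m)
    qed
    then have "(\<Oplus>n\<in>{n. n \<subseteq># m}. p n \<otimes> indexed_pmult q v (m - n))
      = (\<Oplus>n\<in>{n. n \<subseteq># m'}. p n \<otimes> q (m' - n))"
      (is "?l = ?r")
    proof -
      assume v: "\<And>n. n \<subseteq># m \<Longrightarrow> v \<in># m - n \<longleftrightarrow> n \<subseteq># m'"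
      have m'm: "n \<subseteq># m" if "n \<subseteq># m'" for n
        using that by (metis add_mset_add_single m mset_subset_eq_add_left subset_mset.order_trans)
      have e: "m - n - {#v#} = m' - n" for n
        by (simp add: m diff_right_commute)
      show ?thesis
      proof (rule add.finprod_mono_neutral_cong_right)
        show "finite {n. n \<subseteq># m}" by (rule finite_subset_mset)
        show "{n. n \<subseteq># m'} \<subseteq> {n. n \<subseteq># m}" using m'm by auto
        show "p i \<otimes> indexed_pmult q v (m - i) = \<zero>" if "i \<in> {n. n \<subseteq># m} - {n. n \<subseteq># m'}" for i
          using that v c by (auto simp: indexed_pmult_def)
        show "p x \<otimes> indexed_pmult q v (m - x) = p x \<otimes> q (m' - x)" if "x \<in> {n. n \<subseteq># m'}" for x
          using that v m'm e by (simp add: indexed_pmult_def)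
      qed (use c in \<open>auto simp: indexed_pmult_def\<close>)
    qed
    then show ?thesis using True
      by (simp add: poly_alg_simps indexed_pmult_def m)
  qed
qed

text \<open>The involution \<open>n \<mapsto> m - n\<close> on the submultisets of \<open>m\<close>
  exchanges the two factors of the convolution.\<close>

lemma poly_alg_mult_comm:
  fixes S :: "'v set"
  assumes "p \<in> carrier (poly_alg R S)" "q \<in> carrier (poly_alg R S)"
  shows "p \<otimes>\<^bsub>poly_alg R S\<^esub> q = q \<otimes>\<^bsub>poly_alg R S\<^esub> p"
proof
  fix m :: "'v multiset"
  note c = poly_alg_coeff[OF assms(1)] poly_alg_coeff[OF assms(2)]
  have dd: "m - (m - n) = n" if "n \<subseteq># m" for n
    using that by (auto simp: mset_subset_eq_exists_conv)
  have bij: "bij_betw (\<lambda>n. m - n) {n. n \<subseteq># m} {n. n \<subseteq># m}"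
    by (rule bij_betwI[where g = "\<lambda>n. m - n"]) (simp_all add: dd Pi_def)
  have "(\<Oplus>n\<in>(\<lambda>n. m - n) ` {n. n \<subseteq># m}. p n \<otimes> q (m - n))
      = (\<Oplus>n\<in>{n. n \<subseteq># m}. p (m - n) \<otimes> q (m - (m - n)))"
    using bij c by (intro finsum_reindex) (simp_all add: bij_betw_def Pi_def)
  also have "\<dots> = (\<Oplus>n\<in>{n. n \<subseteq># m}. q n \<otimes> p (m - n))"
    using c by (intro finsum_cong') (simp_all add: m_comm dd Pi_def)
  finally show "(p \<otimes>\<^bsub>poly_alg R S\<^esub> q) m = (q \<otimes>\<^bsub>poly_alg R S\<^esub> p) m"
    using bij by (simp add: poly_alg_simps bij_betw_def)
qed

lemma poly_alg_distr:
  assumes "p \<in> carrier (poly_alg R S)" "q \<in> carrier (poly_alg R S)" "r \<in> carrier (poly_alg R S)"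
  shows "p \<otimes>\<^bsub>poly_alg R S\<^esub> (q \<oplus>\<^bsub>poly_alg R S\<^esub> r) =
    (p \<otimes>\<^bsub>poly_alg R S\<^esub> q) \<oplus>\<^bsub>poly_alg R S\<^esub> (p \<otimes>\<^bsub>poly_alg R S\<^esub> r)"
  unfolding poly_alg_simps indexed_padd_def
  using poly_alg_coeff[OF assms(1)] poly_alg_coeff[OF assms(2)] poly_alg_coeff[OF assms(3)]
  by (intro ext) (simp add: r_distr finsum_addf Pi_def)

lemma poly_alg_add_closed:
  assumes "p \<in> carrier (poly_alg R S)" "q \<in> carrier (poly_alg R S)"
  shows "p \<oplus>\<^bsub>poly_alg R S\<^esub> q \<in> carrier (poly_alg R S)"
  using assms by (simp add: poly_alg_simps indexed_pset.indexed_padd)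

lemma poly_alg_pmult_closed:
  assumes "p \<in> carrier (poly_alg R S)" "v \<in> S"
  shows "indexed_pmult p v \<in> carrier (poly_alg R S)"
  using assms by (simp add: poly_alg_simps indexed_pset.indexed_pmult)

lemma poly_alg_const_closed:
  assumes "k \<in> carrier R" shows "indexed_const k \<in> carrier (poly_alg R S)"
  using assms by (simp add: poly_alg_simps indexed_pset.indexed_const)

lemma poly_alg_scale_closed:
  fixes S :: "'v set"
  assumes "p \<in> carrier (poly_alg R S)" "k \<in> carrier R"
  shows "(\<lambda>m. p m \<otimes> k) \<in> carrier (poly_alg R S)"
  using assms(1)
proof (induction rule: poly_alg_induct)
  case (const k')
  have "(\<lambda>m :: 'v multiset. indexed_const k' m \<otimes> k) = indexed_const (k' \<otimes> k)"
    using assms(2) by (auto simp: indexed_const_def)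
  then show ?case using const assms(2) by (simp add: poly_alg_const_closed)
next
  case (add p q)
  then have "(\<lambda>m. (p \<oplus>\<^bsub>poly_alg R S\<^esub> q) m \<otimes> k) = (\<lambda>m. p m \<otimes> k) \<oplus>\<^bsub>poly_alg R S\<^esub> (\<lambda>m. q m \<otimes> k)"
    using assms(2) poly_alg_coeff[of p S] poly_alg_coeff[of q S] by (simp add: poly_alg_simps(4) indexed_padd_def l_distr)
  then show ?case using add by (simp add: poly_alg_add_closed)
next
  case (mult_var p v)
  then have "(\<lambda>m. indexed_pmult p v m \<otimes> k) = indexed_pmult (\<lambda>m. p m \<otimes> k) v"
    using assms(2) by (auto simp: indexed_pmult_def)
  then show ?case using mult_var by (simp add: poly_alg_pmult_closed)
qed

lemma poly_alg_mult_closed: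
  assumes "p \<in> carrier (poly_alg R S)" "q \<in> carrier (poly_alg R S)"
  shows "p \<otimes>\<^bsub>poly_alg R S\<^esub> q \<in> carrier (poly_alg R S)"
  using assms(2)
  by (induction rule: poly_alg_induct)
     (use assms(1) in \<open>simp_all add: const_mult_poly_alg poly_alg_scale_closed poly_alg_distr
        poly_alg_add_closed poly_alg_mult_pmult poly_alg_pmult_closed\<close>)

lemma poly_alg_mult_assoc:
  assumes p: "p \<in> carrier (poly_alg R S)" and q: "q \<in> carrier (poly_alg R S)"
    and r: "r \<in> carrier (poly_alg R S)"
  shows "(p \<otimes>\<^bsub>poly_alg R S\<^esub> q) \<otimes>\<^bsub>poly_alg R S\<^esub> r = p \<otimes>\<^bsub>poly_alg R S\<^esub> (q \<otimes>\<^bsub>poly_alg R S\<^esub> r)"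
  using r
proof (induction rule: poly_alg_induct)
  case (const k)
  have "(\<lambda>m. (p \<otimes>\<^bsub>poly_alg R S\<^esub> q) m \<otimes> k) = p \<otimes>\<^bsub>poly_alg R S\<^esub> (\<lambda>m. q m \<otimes> k)"
    unfolding poly_alg_simps
    using const poly_alg_coeff[OF p] poly_alg_coeff[OF q]
    by (intro ext) (simp add: finsum_ldistr finite_subset_mset Pi_def m_assoc)
  then show ?case using p q const by (simp add: const_mult_poly_alg poly_alg_mult_closed)
next
  case (add r r')
  then show ?case using p q by (simp add: poly_alg_distr poly_alg_mult_closed)
next
  case (mult_var r v)
  then show ?case using p q by (simp add: poly_alg_mult_pmult poly_alg_mult_closed)
qed

lemma cring_poly_alg: "cring (poly_alg R S)"
proof (rule cringI)
  show "abelian_group (poly_alg R S)"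
  proof (rule abelian_groupI)
    fix p q r
    assume p: "p \<in> carrier (poly_alg R S)" and q: "q \<in> carrier (poly_alg R S)"
      and r: "r \<in> carrier (poly_alg R S)"
    note c = poly_alg_coeff[OF p] poly_alg_coeff[OF q] poly_alg_coeff[OF r]
    show "(p \<oplus>\<^bsub>poly_alg R S\<^esub> q) \<oplus>\<^bsub>poly_alg R S\<^esub> r = p \<oplus>\<^bsub>poly_alg R S\<^esub> (q \<oplus>\<^bsub>poly_alg R S\<^esub> r)"
      using c by (simp add: poly_alg_simps indexed_padd_def a_assoc)
  next
    fix p q
    assume p: "p \<in> carrier (poly_alg R S)" and q: "q \<in> carrier (poly_alg R S)"
    note c = poly_alg_coeff[OF p] poly_alg_coeff[OF q]
    show "p \<oplus>\<^bsub>poly_alg R S\<^esub> q = q \<oplus>\<^bsub>poly_alg R S\<^esub> p"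
      using c by (simp add: poly_alg_simps indexed_padd_def a_comm)
  next
    fix p
    assume p: "p \<in> carrier (poly_alg R S)"
    show "\<zero>\<^bsub>poly_alg R S\<^esub> \<oplus>\<^bsub>poly_alg R S\<^esub> p = p"
      using poly_alg_coeff[OF p] by (simp add: poly_alg_simps indexed_padd_def indexed_zero_def)
    \<comment> \<open>Negation is scaling by \<open>\<ominus> \<one>\<close>, for which closure is
      already known.\<close>
    have "(\<lambda>m. p m \<otimes> \<ominus> \<one>) \<oplus>\<^bsub>poly_alg R S\<^esub> p = \<zero>\<^bsub>poly_alg R S\<^esub>"
      using poly_alg_coeff[OF p]
      by (simp add: poly_alg_simps indexed_padd_def indexed_zero_def r_minus l_neg)
    then show "\<exists>q\<in>carrier (poly_alg R S). q \<oplus>\<^bsub>poly_alg R S\<^esub> p = \<zero>\<^bsub>poly_alg R S\<^esub>"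
      using poly_alg_scale_closed[OF p, of "\<ominus> \<one>"] by auto
  qed (simp_all add: poly_alg_add_closed poly_alg_const_closed poly_alg_simps(3))
  show "comm_monoid (poly_alg R S)"
  proof (rule comm_monoidI)
    fix p assume p: "p \<in> carrier (poly_alg R S)"
    have "p \<otimes>\<^bsub>poly_alg R S\<^esub> \<one>\<^bsub>poly_alg R S\<^esub> = p"
      using p poly_alg_coeff[OF p] by (simp add: poly_alg_simps(2) const_mult_poly_alg)
    then show "\<one>\<^bsub>poly_alg R S\<^esub> \<otimes>\<^bsub>poly_alg R S\<^esub> p = p"
      using p poly_alg_const_closed[of \<one> S] by (simp add: poly_alg_mult_comm poly_alg_simps(2))
  qed (auto simp: poly_alg_mult_closed poly_alg_mult_assoc poly_alg_const_closed poly_alg_simps(2)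
        intro: poly_alg_mult_comm)
next
  fix p q r
  assume "p \<in> carrier (poly_alg R S)" "q \<in> carrier (poly_alg R S)" "r \<in> carrier (poly_alg R S)"
  then show "(p \<oplus>\<^bsub>poly_alg R S\<^esub> q) \<otimes>\<^bsub>poly_alg R S\<^esub> r =
    p \<otimes>\<^bsub>poly_alg R S\<^esub> r \<oplus>\<^bsub>poly_alg R S\<^esub> q \<otimes>\<^bsub>poly_alg R S\<^esub> r"
    by (simp add: poly_alg_mult_comm[of _ _ r] poly_alg_add_closed poly_alg_distr)
qed

lemma indexed_const_hom: "indexed_const \<in> ring_hom R (poly_alg R S)"
proof (rule ring_hom_memI)
  fix x y assume xy: "x \<in> carrier R" "y \<in> carrier R"
  show "indexed_const (x \<otimes> y) = indexed_const x \<otimes>\<^bsub>poly_alg R S\<^esub> indexed_const y"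
    using xy const_mult_poly_alg[OF xy(2) poly_alg_const_closed[OF xy(1), of S]]
    by (auto simp: indexed_const_def)
qed (auto simp: poly_alg_const_closed poly_alg_simps(2,4) indexed_padd_const)

lemma indexed_var_closed:
  assumes "v \<in> S" shows "indexed_var v \<in> carrier (poly_alg R S)"
  unfolding indexed_var_def using assms by (simp add: poly_alg_const_closed poly_alg_pmult_closed)

lemma indexed_pmult_eq:
  assumes "p \<in> carrier (poly_alg R S)"
  shows "indexed_pmult p v = p \<otimes>\<^bsub>poly_alg R S\<^esub> indexed_var v"
proof -
  have "p \<otimes>\<^bsub>poly_alg R S\<^esub> indexed_const \<one> = p"
    using assms poly_alg_coeff[OF assms] by (simp add: const_mult_poly_alg)
  then show ?thesis
    unfolding indexed_var_def using assms by (simp add: poly_alg_mult_pmult poly_alg_const_closed)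
qed

text \<open>The uniqueness half of the universal property of A[S]; all simplicial identities below
  rest on it.\<close>

lemma poly_alg_hom_eq:
  assumes "g \<in> ring_hom (poly_alg R S) T" "h \<in> ring_hom (poly_alg R S) T"
    and "\<And>k. k \<in> carrier R \<Longrightarrow> g (indexed_const k) = h (indexed_const k)"
    and "\<And>v. v \<in> S \<Longrightarrow> g (indexed_var v) = h (indexed_var v)"
    and "p \<in> carrier (poly_alg R S)"
  shows "g p = h p"
  using assms(5)
proof (induction rule: poly_alg_induct)
  case (const k)
  then show ?case using assms(3) by simp
next
  case (add p q)
  then show ?case using assms(1,2) by (simp add: ring_hom_add)
next
  case (mult_var p v)
  then show ?case using assms(1,2,4)
    by (simp add: indexed_pmult_eq ring_hom_mult indexed_var_closed)
qed

end

section \<open>Evaluation of polynomials in a commutative ring\<close>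

definition monomial_eval :: "('r, 'k) ring_scheme \<Rightarrow> ('v \<Rightarrow> 'r) \<Rightarrow> 'v multiset \<Rightarrow> 'r" where
  "monomial_eval T \<rho> m = (\<Otimes>\<^bsub>T\<^esub>v\<in>set_mset m. \<rho> v [^]\<^bsub>T\<^esub> count m v)"

lemma (in cring) monomial_eval_closed:
  assumes "\<And>v. v \<in># m \<Longrightarrow> \<rho> v \<in> carrier R"
  shows "monomial_eval R \<rho> m \<in> carrier R"
  unfolding monomial_eval_def using assms by (intro finprod_closed) auto

lemma (in cring) monomial_eval_add_mset:
  assumes "\<And>u. u \<in># add_mset v m \<Longrightarrow> \<rho> u \<in> carrier R"
  shows "monomial_eval R \<rho> (add_mset v m) = monomial_eval R \<rho> m \<otimes> \<rho> v"
proof -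
  let ?M = "set_mset m - {v}"
  have v: "\<rho> v \<in> carrier R" and u: "\<And>u. u \<in># m \<Longrightarrow> \<rho> u \<in> carrier R" using assms by auto
  have F: "(\<Otimes>u\<in>?M. \<rho> u [^] count (add_mset v m) u) = (\<Otimes>u\<in>?M. \<rho> u [^] count m u)" (is "?F' = ?F")
    using u by (intro finprod_cong') auto
  have Fc: "?F \<in> carrier R" using u by (intro finprod_closed) auto
  have a: "set_mset (add_mset v m) = insert v ?M" by auto
  have "monomial_eval R \<rho> (add_mset v m) = \<rho> v [^] count (add_mset v m) v \<otimes> ?F'"
    unfolding monomial_eval_def a using v u by (subst finprod_insert) auto
  then have 1: "monomial_eval R \<rho> (add_mset v m) = (\<rho> v [^] count m v \<otimes> ?F) \<otimes> \<rho> v"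
    using F v Fc by (simp add: m_ac)
  have 2: "monomial_eval R \<rho> m = \<rho> v [^] count m v \<otimes> ?F"
  proof (cases "v \<in># m")
    case True
    then have "set_mset m = insert v ?M" by auto
    then have "monomial_eval R \<rho> m = (\<Otimes>u\<in>insert v ?M. \<rho> u [^] count m u)"
      by (simp add: monomial_eval_def)
    also have "\<dots> = \<rho> v [^] count m v \<otimes> ?F"
      using v u by (subst finprod_insert) auto
    finally show ?thesis .
  next
    case False
    then show ?thesis using Fc by (simp add: monomial_eval_def count_eq_zero_iff[THEN iffD2])
  qed
  show ?thesis using 1 2 by simp
qed

locale poly_alg_evaluation =
  A: cring A + R: cring R
  for A :: "('a, 'm) ring_scheme" (structure) and R :: "('r, 'k) ring_scheme" (structure)
    and S :: "'v set" and \<sigma> and \<rho> +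
  assumes \<sigma>: "\<sigma> \<in> ring_hom A R" and \<rho>: "\<And>v. v \<in> S \<Longrightarrow> \<rho> v \<in> carrier R"
begin

abbreviation "ev \<equiv> poly_alg_eval A R \<sigma> \<rho>"

lemma \<sigma>_zero: "\<sigma> \<zero>\<^bsub>A\<^esub> = \<zero>\<^bsub>R\<^esub>"
  using ring_hom_zero[OF \<sigma> A.ring_axioms R.ring_axioms] .

text \<open>Allowing any finite set that contains the support lets the values of \<open>p\<close>,
  \<open>q\<close> and their sum be written over one index set.\<close>

lemma eval_superset:
  assumes "p \<in> carrier (poly_alg A S)" "finite M" "\<And>m. p m \<noteq> \<zero>\<^bsub>A\<^esub> \<Longrightarrow> m \<in> M"
    and "\<And>m. m \<in> M \<Longrightarrow> set_mset m \<subseteq> S"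
  shows "ev p = (\<Oplus>\<^bsub>R\<^esub>m\<in>M. \<sigma> (p m) \<otimes>\<^bsub>R\<^esub> monomial_eval R \<rho> m)"
proof -
  have mc: "monomial_eval R \<rho> m \<in> carrier R" if "m \<in> M" for m
    using \<rho> assms(4)[OF that] by (intro R.monomial_eval_closed) auto
  show ?thesis
    unfolding poly_alg_eval_def monomial_eval_def[symmetric]
    by (rule R.add.finprod_mono_neutral_cong_left)
       (use assms mc \<sigma>_zero A.poly_alg_coeff[OF assms(1)] ring_hom_closed[OF \<sigma>] in auto)
qed

lemma eval_const:
  assumes "k \<in> carrier A" shows "ev (ring.indexed_const A k) = \<sigma> k"
proof -
  have "ev (ring.indexed_const A k) = (\<Oplus>\<^bsub>R\<^esub>m\<in>{{#}}. \<sigma> (ring.indexed_const A k m) \<otimes>\<^bsub>R\<^esub> monomial_eval R \<rho> m)"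
    using assms
    by (intro eval_superset A.poly_alg_const_closed) (auto simp: A.indexed_const_def split: if_splits)
  also have "\<dots> = \<sigma> k"
    using ring_hom_closed[OF \<sigma> assms] by (simp add: A.indexed_const_def monomial_eval_def)
  finally show ?thesis .
qed

lemma eval_add:
  assumes p: "p \<in> carrier (poly_alg A S)" and q: "q \<in> carrier (poly_alg A S)"
  shows "ev (p \<oplus>\<^bsub>poly_alg A S\<^esub> q) = ev p \<oplus>\<^bsub>R\<^esub> ev q"
proof -
  let ?M = "{m. p m \<noteq> \<zero>\<^bsub>A\<^esub>} \<union> {m. q m \<noteq> \<zero>\<^bsub>A\<^esub>}"
  have fin: "finite ?M" using A.poly_alg_support(1) p q by auto
  have sub: "set_mset m \<subseteq> S" if "m \<in> ?M" for m
    using that A.poly_alg_support(2)[OF p] A.poly_alg_support(2)[OF q] by blast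
  have mc: "monomial_eval R \<rho> m \<in> carrier R" if "m \<in> ?M" for m
    using \<rho> sub[OF that] by (intro R.monomial_eval_closed) auto
  note c = A.poly_alg_coeff[OF p] A.poly_alg_coeff[OF q]
  have "ev (p \<oplus>\<^bsub>poly_alg A S\<^esub> q) =
      (\<Oplus>\<^bsub>R\<^esub>m\<in>?M. \<sigma> ((p \<oplus>\<^bsub>poly_alg A S\<^esub> q) m) \<otimes>\<^bsub>R\<^esub> monomial_eval R \<rho> m)"
    using p q fin sub
    by (intro eval_superset A.poly_alg_add_closed) (auto simp: A.poly_alg_simps(4) A.indexed_padd_def)
  also have "\<dots> = (\<Oplus>\<^bsub>R\<^esub>m\<in>?M. \<sigma> (p m) \<otimes>\<^bsub>R\<^esub> monomial_eval R \<rho> m \<oplus>\<^bsub>R\<^esub> \<sigma> (q m) \<otimes>\<^bsub>R\<^esub> monomial_eval R \<rho> m)"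
    by (rule R.finsum_cong')
       (use c mc in \<open>auto simp: A.poly_alg_simps(4) A.indexed_padd_def ring_hom_add[OF \<sigma>] ring_hom_closed[OF \<sigma>] R.l_distr\<close>)
  also have "\<dots> = (\<Oplus>\<^bsub>R\<^esub>m\<in>?M. \<sigma> (p m) \<otimes>\<^bsub>R\<^esub> monomial_eval R \<rho> m) \<oplus>\<^bsub>R\<^esub> (\<Oplus>\<^bsub>R\<^esub>m\<in>?M. \<sigma> (q m) \<otimes>\<^bsub>R\<^esub> monomial_eval R \<rho> m)"
    using c mc by (intro R.finsum_addf) (auto simp: ring_hom_closed[OF \<sigma>])
  also have "(\<Oplus>\<^bsub>R\<^esub>m\<in>?M. \<sigma> (p m) \<otimes>\<^bsub>R\<^esub> monomial_eval R \<rho> m) = ev p"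
    using p fin sub by (intro eval_superset[symmetric]) auto
  also have "(\<Oplus>\<^bsub>R\<^esub>m\<in>?M. \<sigma> (q m) \<otimes>\<^bsub>R\<^esub> monomial_eval R \<rho> m) = ev q"
    using q fin sub by (intro eval_superset[symmetric]) auto
  finally show ?thesis .
qed

lemma eval_closed:
  assumes "p \<in> carrier (poly_alg A S)" shows "ev p \<in> carrier R"
  unfolding poly_alg_eval_def monomial_eval_def[symmetric]
  using A.poly_alg_support(2)[OF assms] \<rho> A.poly_alg_coeff[OF assms] ring_hom_closed[OF \<sigma>]
  by (auto intro!: R.finsum_closed R.m_closed R.monomial_eval_closed)

text \<open>Multiplication by \<open>v\<close> translates the support along
  \<open>add_mset v\<close>, so the sum is reindexed and each monomial value gains a factor
  \<open>\<rho> v\<close>.\<close>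

lemma eval_pmult:
  assumes p: "p \<in> carrier (poly_alg A S)" and v: "v \<in> S"
  shows "ev (ring.indexed_pmult A p v) = ev p \<otimes>\<^bsub>R\<^esub> \<rho> v"
proof -
  let ?M = "{m. p m \<noteq> \<zero>\<^bsub>A\<^esub>}"
  note c = A.poly_alg_coeff[OF p]
  have fin: "finite ?M" using A.poly_alg_support(1) p by auto
  have sub: "set_mset m \<subseteq> S" if "m \<in> ?M" for m
    using that A.poly_alg_support(2)[OF p] by blast
  have mc: "monomial_eval R \<rho> m \<in> carrier R" if "m \<in> ?M" for m
    using \<rho> sub[OF that] by (intro R.monomial_eval_closed) auto
  have me: "monomial_eval R \<rho> (add_mset v m) = monomial_eval R \<rho> m \<otimes>\<^bsub>R\<^esub> \<rho> v" if "m \<in> ?M" for m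
    using \<rho> sub[OF that] v by (intro R.monomial_eval_add_mset) auto
  have "ev (ring.indexed_pmult A p v) =
      (\<Oplus>\<^bsub>R\<^esub>m\<in>add_mset v ` ?M. \<sigma> (ring.indexed_pmult A p v m) \<otimes>\<^bsub>R\<^esub> monomial_eval R \<rho> m)"
  proof (rule eval_superset)
    show "m \<in> add_mset v ` ?M" if "ring.indexed_pmult A p v m \<noteq> \<zero>\<^bsub>A\<^esub>" for m
    proof -
      from that have "v \<in># m" "p (m - {#v#}) \<noteq> \<zero>\<^bsub>A\<^esub>"
        by (auto simp: A.indexed_pmult_def split: if_splits)
      then show ?thesis by (intro image_eqI[where x = "m - {#v#}"]) auto
    qed
  qed (use p v fin in \<open>auto simp: A.poly_alg_pmult_closed dest!: A.poly_alg_support(2)[OF p]\<close>)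
  also have "\<dots> = (\<Oplus>\<^bsub>R\<^esub>m\<in>?M. \<sigma> (p m) \<otimes>\<^bsub>R\<^esub> monomial_eval R \<rho> (add_mset v m))"
    by (subst R.finsum_reindex)
       (use c mc me \<rho>[OF v] in \<open>auto simp: A.indexed_pmult_def ring_hom_closed[OF \<sigma>] inj_on_def\<close>)
  also have "\<dots> = (\<Oplus>\<^bsub>R\<^esub>m\<in>?M. (\<sigma> (p m) \<otimes>\<^bsub>R\<^esub> monomial_eval R \<rho> m) \<otimes>\<^bsub>R\<^esub> \<rho> v)"
    by (rule R.finsum_cong')
       (use c mc me \<rho>[OF v] in \<open>auto simp: ring_hom_closed[OF \<sigma>] R.m_assoc\<close>)
  also have "\<dots> = ev p \<otimes>\<^bsub>R\<^esub> \<rho> v"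
    unfolding poly_alg_eval_def monomial_eval_def[symmetric]
    by (rule R.finsum_ldistr[symmetric])
       (use fin c mc \<rho>[OF v] in \<open>auto simp: ring_hom_closed[OF \<sigma>]\<close>)
  finally show ?thesis .
qed

lemma eval_var:
  assumes "v \<in> S" shows "ev (ring.indexed_var A v) = \<rho> v"
  unfolding A.indexed_var_def
  using assms \<rho> ring_hom_one[OF \<sigma>] by (simp add: eval_pmult A.poly_alg_const_closed eval_const)

text \<open>Induction on the right factor reduces to constants and variables; the constant case
  needs a second induction on the left factor.\<close>

lemma eval_mult:
  assumes p: "p \<in> carrier (poly_alg A S)" and q: "q \<in> carrier (poly_alg A S)"
  shows "ev (p \<otimes>\<^bsub>poly_alg A S\<^esub> q) = ev p \<otimes>\<^bsub>R\<^esub> ev q"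
  using q
proof (induction rule: A.poly_alg_induct)
  case (const k)
  have "ev (p \<otimes>\<^bsub>poly_alg A S\<^esub> ring.indexed_const A k) = ev p \<otimes>\<^bsub>R\<^esub> \<sigma> k"
    using p
  proof (induction rule: A.poly_alg_induct)
    case (const k')
    then show ?case using \<open>k \<in> carrier A\<close> ring_hom_mult[OF A.indexed_const_hom, of k' k S] ring_hom_mult[OF \<sigma>, of k' k]
      by (simp add: eval_const flip: ring_hom_mult[OF A.indexed_const_hom])
  next
    case (add p q)
    interpret P: cring "poly_alg A S" by (rule A.cring_poly_alg)
    show ?case using add \<open>k \<in> carrier A\<close> ring_hom_closed[OF \<sigma>]
      by (simp add: P.l_distr A.poly_alg_const_closed eval_add A.poly_alg_mult_closed R.l_distr eval_closed)
  next
    case (mult_var p v)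
    interpret P: cring "poly_alg A S" by (rule A.cring_poly_alg)
    have "ring.indexed_pmult A p v \<otimes>\<^bsub>poly_alg A S\<^esub> ring.indexed_const A k
        = ring.indexed_pmult A (p \<otimes>\<^bsub>poly_alg A S\<^esub> ring.indexed_const A k) v"
      using mult_var \<open>k \<in> carrier A\<close>
      by (simp add: A.poly_alg_mult_pmult[symmetric] A.poly_alg_mult_comm[of _ S "ring.indexed_const A k"]
           A.poly_alg_const_closed A.poly_alg_pmult_closed)
    then show ?case using mult_var \<open>k \<in> carrier A\<close> \<rho> ring_hom_closed[OF \<sigma>]
      by (simp add: eval_pmult A.poly_alg_mult_closed A.poly_alg_const_closed R.m_ac eval_closed)
  qed
  then show ?case using const by (simp add: eval_const)
next
  case (add q r)
  interpret P: cring "poly_alg A S" by (rule A.cring_poly_alg)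
  show ?case using p add by (simp add: P.r_distr eval_add eval_closed R.r_distr)
next
  case (mult_var q v)
  then show ?case using p \<rho>
    by (simp add: A.poly_alg_mult_pmult eval_pmult A.poly_alg_mult_closed eval_closed R.m_assoc)
qed

lemma eval_hom: "ev \<in> ring_hom (poly_alg A S) R"
  by (rule ring_hom_memI)
     (auto simp: eval_closed eval_mult eval_add A.poly_alg_simps(2) eval_const ring_hom_one[OF \<sigma>])

end

section \<open>The standard simplicial resolution\<close>

locale algebra_map = A: cring A + B: cring B
  for A :: "('a, 'm) ring_scheme" (structure) and B :: "('b, 'n) ring_scheme" (structure) +
  fixes f :: "'a \<Rightarrow> 'b"
  assumes f: "f \<in> ring_hom A B"
begin

abbreviation (input) P :: "nat \<Rightarrow> ('a, 'b) pol ring" where "P \<equiv> res A B"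
abbreviation (input) cst :: "'a \<Rightarrow> ('a, 'b) pol" where "cst \<equiv> ring.indexed_const A"
abbreviation (input) ind :: "('a, 'b) var \<Rightarrow> ('a, 'b) pol" where "ind \<equiv> ring.indexed_var A"
abbreviation (input) enc :: "('a, 'b) pol \<Rightarrow> ('a, 'b) var" where "enc \<equiv> encode A"
abbreviation (input) dec :: "('a, 'b) var \<Rightarrow> ('a, 'b) pol" where "dec \<equiv> decode A"
abbreviation (input) aug :: "('a, 'b) pol \<Rightarrow> 'b" where "aug \<equiv> augmentation A B f"
abbreviation (input) d :: "nat \<Rightarrow> nat \<Rightarrow> ('a, 'b) pol \<Rightarrow> ('a, 'b) pol" where "d \<equiv> face A B f"
abbreviation (input) s :: "nat \<Rightarrow> nat \<Rightarrow> ('a, 'b) pol \<Rightarrow> ('a, 'b) pol" where "s \<equiv> degeneracy A B"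

lemma P_cring: "cring (P n)"
  unfolding res_def by (rule A.cring_poly_alg)

lemma P_ring: "ring (P n)"
  using P_cring cring.axioms(1) by blast

lemma cst_hom: "cst \<in> ring_hom A (P n)"
  unfolding res_def by (rule A.indexed_const_hom)

lemma cst_closed: "a \<in> carrier A \<Longrightarrow> cst a \<in> carrier (P n)"
  unfolding res_def by (rule A.poly_alg_const_closed)

lemma ind_closed: "v \<in> res_vars A B n \<Longrightarrow> ind v \<in> carrier (P n)"
  unfolding res_def by (rule A.indexed_var_closed)

text \<open>A polynomial is recovered from the graph of its nonzero coefficients; finite support is
  what makes \<open>Abs_fset\<close> injective on these graphs.\<close>

lemma encode_inj: "inj_on enc (carrier (poly_alg A UNIV))"
proof (rule inj_onI)
  fix p q :: "('a, 'b) pol"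
  assume p: "p \<in> carrier (poly_alg A UNIV)" and q: "q \<in> carrier (poly_alg A UNIV)"
    and eq: "enc p = enc q"
  have fin: "finite {(m, r m) |m. r m \<noteq> \<zero>\<^bsub>A\<^esub>}" if "r \<in> carrier (poly_alg A UNIV)" for r :: "('a, 'b) pol"
    using A.poly_alg_support(1)[OF that] by (simp add: setcompr_eq_image)
  from eq have "{(m, p m) |m. p m \<noteq> \<zero>\<^bsub>A\<^esub>} = {(m, q m) |m. q m \<noteq> \<zero>\<^bsub>A\<^esub>}"
    using fin[OF p] fin[OF q] by (simp add: encode_def Abs_fset_inject)
  then have "(m, c) \<in> {(m, p m) |m. p m \<noteq> \<zero>\<^bsub>A\<^esub>} \<longleftrightarrow> (m, c) \<in> {(m, q m) |m. q m \<noteq> \<zero>\<^bsub>A\<^esub>}" for m c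
    by simp
  then have "p m \<noteq> \<zero>\<^bsub>A\<^esub> \<and> c = p m \<longleftrightarrow> q m \<noteq> \<zero>\<^bsub>A\<^esub> \<and> c = q m" for m c
    by auto
  then show "p = q" by (metis ext)
qed

lemma decode_encode: "p \<in> carrier (P n) \<Longrightarrow> dec (enc p) = p"
  unfolding decode_def res_def
  using A.poly_alg_mono[of "res_vars A B n" UNIV] encode_inj by (auto intro: inv_into_f_f)

lemma res_vars_SucE:
  assumes "v \<in> res_vars A B (Suc n)"
  obtains p where "p \<in> carrier (P n)" "v = enc p"
  using assms by (auto simp: res_def)

lemma encode_res_vars: "p \<in> carrier (P n) \<Longrightarrow> enc p \<in> res_vars A B (Suc n)"
  by (simp add: res_def)

lemma eval_facts:
  assumes "cring R" "\<sigma> \<in> ring_hom A R" "\<And>v. v \<in> res_vars A B n \<Longrightarrow> \<rho> v \<in> carrier R"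
  shows "poly_alg_eval A R \<sigma> \<rho> \<in> ring_hom (P n) R"
    and "a \<in> carrier A \<Longrightarrow> poly_alg_eval A R \<sigma> \<rho> (cst a) = \<sigma> a"
    and "v \<in> res_vars A B n \<Longrightarrow> poly_alg_eval A R \<sigma> \<rho> (ind v) = \<rho> v"
proof -
  interpret R: cring R by fact
  interpret ev: poly_alg_evaluation A R "res_vars A B n" \<sigma> \<rho>
    by unfold_locales (use assms in auto)
  show "poly_alg_eval A R \<sigma> \<rho> \<in> ring_hom (P n) R"
    and "a \<in> carrier A \<Longrightarrow> poly_alg_eval A R \<sigma> \<rho> (cst a) = \<sigma> a"
    and "v \<in> res_vars A B n \<Longrightarrow> poly_alg_eval A R \<sigma> \<rho> (ind v) = \<rho> v"
    unfolding res_def by (auto intro: ev.eval_hom ev.eval_const ev.eval_var)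
qed

lemma P_hom_eq:
  assumes "g \<in> ring_hom (P n) T" "h \<in> ring_hom (P n) T"
    and "\<And>a. a \<in> carrier A \<Longrightarrow> g (cst a) = h (cst a)"
    and "\<And>v. v \<in> res_vars A B n \<Longrightarrow> g (ind v) = h (ind v)"
    and "p \<in> carrier (P n)"
  shows "g p = h p"
  using assms unfolding res_def by (rule A.poly_alg_hom_eq)

lemma aug_hom: "aug \<in> ring_hom (P 0) B"
  and aug_cst: "a \<in> carrier A \<Longrightarrow> aug (cst a) = f a"
  and aug_X: "b \<in> carrier B \<Longrightarrow> aug (ind (Base b)) = b"
proof -
  have c: "case_var id (\<lambda>_. \<zero>\<^bsub>B\<^esub>) v \<in> carrier B" if "v \<in> res_vars A B 0" for v
    using that by auto
  show "aug \<in> ring_hom (P 0) B" unfolding augmentation_def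
    using B.cring_axioms f c by (rule eval_facts)
  show "a \<in> carrier A \<Longrightarrow> aug (cst a) = f a" unfolding augmentation_def
    using B.cring_axioms f c by (rule eval_facts)
  show "b \<in> carrier B \<Longrightarrow> aug (ind (Base b)) = b" unfolding augmentation_def
    using eval_facts(3)[OF B.cring_axioms f c, where n = 0 and v = "Base b"] by simp
qed

lemma aug_closed: "p \<in> carrier (P 0) \<Longrightarrow> aug p \<in> carrier B"
  using ring_hom_closed[OF aug_hom] .

text \<open>\<open>face n (Suc j)\<close> sends a variable to the code of a lower face, so it lands
  in the right stage only once the lower face is known to do so. Hence the homomorphism property and
  the values on generators are proved in one induction. At the lowest stage the augmentation takes
  the place of the lower face.\<close>

lemma face_hom_facts:
  assumes "j \<le> Suc n"
  shows "d (Suc n) j \<in> ring_hom (P (Suc n)) (P n) \<and>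
    (\<forall>a\<in>carrier A. d (Suc n) j (cst a) = cst a) \<and>
    (\<forall>p\<in>carrier (P n). d (Suc n) j (ind (enc p)) =
      (case j of 0 \<Rightarrow> p | Suc j' \<Rightarrow> ind (if n = 0 then Base (aug p) else enc (d n j' p))))"
  using assms
proof (induction n arbitrary: j)
  case 0
  show ?case
  proof (cases j)
    case 0
    have c: "dec v \<in> carrier (P 0)" if "v \<in> res_vars A B (Suc 0)" for v
      using that by (elim res_vars_SucE) (simp add: decode_encode)
    show ?thesis
      using eval_facts[OF P_cring cst_hom c, of "Suc 0"] encode_res_vars[of _ 0] decode_encode
      by (simp add: 0)
  next
    case (Suc j')
    let ?\<rho> = "\<lambda>v. ind (Base (aug (dec v)))"
    have c: "?\<rho> v \<in> carrier (P 0)" if "v \<in> res_vars A B (Suc 0)" for v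
      using that by (elim res_vars_SucE) (simp add: decode_encode ind_closed aug_closed)
    show ?thesis
      using eval_facts[OF P_cring cst_hom c, of "Suc 0"] encode_res_vars[of _ 0] decode_encode
      by (simp add: Suc)
  qed
next
  case (Suc n)
  show ?case
  proof (cases j)
    case 0
    have c: "dec v \<in> carrier (P (Suc n))" if "v \<in> res_vars A B (Suc (Suc n))" for v
      using that by (elim res_vars_SucE) (simp add: decode_encode)
    show ?thesis
      using eval_facts[OF P_cring cst_hom c, of "Suc (Suc n)"] encode_res_vars[of _ "Suc n"] decode_encode
      by (simp add: 0 del: res_vars.simps)
  next
    case (Suc j')
    let ?\<rho> = "\<lambda>v. ind (enc (d (Suc n) j' (dec v)))"
    have h: "d (Suc n) j' \<in> ring_hom (P (Suc n)) (P n)"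
      using Suc.IH[of j'] Suc.prems Suc by auto
    have c: "?\<rho> v \<in> carrier (P (Suc n))" if "v \<in> res_vars A B (Suc (Suc n))" for v
      using that h by (elim res_vars_SucE)
        (simp add: decode_encode ind_closed encode_res_vars ring_hom_closed del: res_vars.simps)
    show ?thesis
      using eval_facts[OF P_cring cst_hom c, of "Suc (Suc n)"] encode_res_vars[of _ "Suc n"] decode_encode
      by (simp add: Suc del: res_vars.simps)
  qed
qed

lemma face_hom: "j \<le> Suc n \<Longrightarrow> d (Suc n) j \<in> ring_hom (P (Suc n)) (P n)"
  and face_cst: "\<lbrakk>j \<le> Suc n; a \<in> carrier A\<rbrakk> \<Longrightarrow> d (Suc n) j (cst a) = cst a"
  and face_0_X: "p \<in> carrier (P n) \<Longrightarrow> d (Suc n) 0 (ind (enc p)) = p"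
  and face_1_Suc_X: "p \<in> carrier (P 0) \<Longrightarrow> d (Suc 0) (Suc 0) (ind (enc p)) = ind (Base (aug p))"
  and face_Suc_X: "\<lbrakk>j \<le> Suc n; p \<in> carrier (P (Suc n))\<rbrakk> \<Longrightarrow>
    d (Suc (Suc n)) (Suc j) (ind (enc p)) = ind (enc (d (Suc n) j p))"
  using face_hom_facts[of j n] face_hom_facts[of 0 n] face_hom_facts[of "Suc 0" 0]
    face_hom_facts[of "Suc j" "Suc n"]
  by (simp_all del: face.simps)

text \<open>As for the faces, a degeneracy of positive index applies a lower degeneracy inside the
  code of a variable, so all properties go through one induction.\<close>

lemma degeneracy_hom_facts:
  assumes "j \<le> n"
  shows "s n j \<in> ring_hom (P n) (P (Suc n)) \<and>
    (\<forall>a\<in>carrier A. s n j (cst a) = cst a) \<and>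
    (j = 0 \<longrightarrow> (\<forall>v\<in>res_vars A B n. s n j (ind v) = ind (enc (ind v)))) \<and>
    (\<forall>n' j'. n = Suc n' \<longrightarrow> j = Suc j' \<longrightarrow> (\<forall>p\<in>carrier (P n'). s n j (ind (enc p)) = ind (enc (s n' j' p))))"
  using assms
proof (induction n arbitrary: j)
  case 0
  have c: "ind (enc (ind v)) \<in> carrier (P (Suc 0))" if "v \<in> res_vars A B 0" for v
    using that ind_closed encode_res_vars by metis
  show ?case
    using eval_facts[OF P_cring cst_hom c] 0 by (simp del: res_vars.simps)
next
  case (Suc n)
  show ?case
  proof (cases j)
    case 0
    have c: "ind (enc (ind v)) \<in> carrier (P (Suc (Suc n)))" if "v \<in> res_vars A B (Suc n)" for v
      using that ind_closed encode_res_vars by metis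
    show ?thesis
      using eval_facts[OF P_cring cst_hom c] 0 by (simp del: res_vars.simps)
  next
    case (Suc j')
    have h: "s n j' \<in> ring_hom (P n) (P (Suc n))"
      using Suc.IH[of j'] Suc.prems Suc by auto
    have c: "ind (enc (s n j' (dec v))) \<in> carrier (P (Suc (Suc n)))" if "v \<in> res_vars A B (Suc n)" for v
      using that h by (elim res_vars_SucE)
        (simp add: decode_encode ind_closed encode_res_vars ring_hom_closed del: res_vars.simps)
    show ?thesis
      using eval_facts[OF P_cring cst_hom c, of "Suc n"] encode_res_vars[of _ n] decode_encode
      by (simp add: Suc del: res_vars.simps)
  qed
qed

lemma degeneracy_hom: "j \<le> n \<Longrightarrow> s n j \<in> ring_hom (P n) (P (Suc n))"
  and degeneracy_cst: "\<lbrakk>j \<le> n; a \<in> carrier A\<rbrakk> \<Longrightarrow> s n j (cst a) = cst a"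
  and degeneracy_0_X: "v \<in> res_vars A B n \<Longrightarrow> s n 0 (ind v) = ind (enc (ind v))"
  and degeneracy_Suc_X: "\<lbrakk>j \<le> n; p \<in> carrier (P n)\<rbrakk> \<Longrightarrow>
    s (Suc n) (Suc j) (ind (enc p)) = ind (enc (s n j p))"
  using degeneracy_hom_facts[of j n] degeneracy_hom_facts[of 0 n] degeneracy_hom_facts[of "Suc j" "Suc n"]
  by (simp_all del: degeneracy.simps)

declare face.simps [simp del] degeneracy.simps [simp del] res_vars.simps [simp del]

lemma face_closed: "\<lbrakk>j \<le> Suc n; p \<in> carrier (P (Suc n))\<rbrakk> \<Longrightarrow> d (Suc n) j p \<in> carrier (P n)"
  using ring_hom_closed[OF face_hom] .

lemma degeneracy_closed: "\<lbrakk>j \<le> n; p \<in> carrier (P n)\<rbrakk> \<Longrightarrow> s n j p \<in> carrier (P (Suc n))"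
  using ring_hom_closed[OF degeneracy_hom] .

lemma P_Suc_hom_eq:
  assumes "g \<in> ring_hom (P (Suc n)) T" "h \<in> ring_hom (P (Suc n)) T"
    and "\<And>a. a \<in> carrier A \<Longrightarrow> g (cst a) = h (cst a)"
    and "\<And>p. p \<in> carrier (P n) \<Longrightarrow> g (ind (enc p)) = h (ind (enc p))"
    and "p \<in> carrier (P (Suc n))"
  shows "g p = h p"
proof (rule P_hom_eq[OF assms(1-3) _ assms(5)])
  fix v assume "v \<in> res_vars A B (Suc n)"
  then show "g (ind v) = h (ind v)" by (elim res_vars_SucE) (simp add: assms(4))
qed

text \<open>Simplicial identities are equations between composites out of a polynomial algebra, so
  they are checked on constants and on the variables coded by elements of the previous
  stage.\<close>

lemma comp_hom_eq:
  assumes "g \<in> ring_hom (P m) T" "h \<in> ring_hom (P (Suc n)) (P m)"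
    and "g' \<in> ring_hom (P m') T" "h' \<in> ring_hom (P (Suc n)) (P m')"
    and "\<And>a. a \<in> carrier A \<Longrightarrow> g (h (cst a)) = g' (h' (cst a))"
    and "\<And>p. p \<in> carrier (P n) \<Longrightarrow> g (h (ind (enc p))) = g' (h' (ind (enc p)))"
    and "p \<in> carrier (P (Suc n))"
  shows "g (h p) = g' (h' p)"
proof -
  have "(g \<circ> h) p = (g' \<circ> h') p"
    by (rule P_Suc_hom_eq[OF ring_hom_trans[OF assms(2,1)] ring_hom_trans[OF assms(4,3)]])
       (simp_all add: assms(5-7))
  then show ?thesis by simp
qed

text \<open>On the variable belonging to \<open>p\<close> the two faces are \<open>p\<close> and the
  variable of \<open>aug p\<close>; both have augmentation \<open>aug p\<close>.\<close>

lemma aug_face: "p \<in> carrier (P (Suc 0)) \<Longrightarrow> aug (d (Suc 0) 0 p) = aug (d (Suc 0) (Suc 0) p)"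
  by (rule comp_hom_eq[OF aug_hom face_hom aug_hom face_hom])
     (simp_all add: face_cst face_0_X face_1_Suc_X aug_X aug_closed)

lemma face_face:
  assumes "p \<in> carrier (P (Suc (Suc 0)))"
  shows face_0_1: "d (Suc 0) 0 (d (Suc (Suc 0)) (Suc 0) p) = d (Suc 0) 0 (d (Suc (Suc 0)) 0 p)"
    and face_0_2: "d (Suc 0) 0 (d (Suc (Suc 0)) (Suc (Suc 0)) p) = d (Suc 0) (Suc 0) (d (Suc (Suc 0)) 0 p)"
    and face_1_2: "d (Suc 0) (Suc 0) (d (Suc (Suc 0)) (Suc (Suc 0)) p) =
      d (Suc 0) (Suc 0) (d (Suc (Suc 0)) (Suc 0) p)"
  by (rule comp_hom_eq[OF face_hom face_hom face_hom face_hom];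
      simp add: assms face_cst face_0_X face_1_Suc_X face_Suc_X face_closed aug_face)+

lemma face_0_deg_0:
  assumes "p \<in> carrier (P n)" shows "d (Suc n) 0 (s n 0 p) = p"
proof -
  have "(d (Suc n) 0 \<circ> s n 0) p = id p"
  proof (rule P_hom_eq[OF _ _ _ _ assms])
    show "d (Suc n) 0 \<circ> s n 0 \<in> ring_hom (P n) (P n)"
      by (rule ring_hom_trans[OF degeneracy_hom face_hom]) auto
    show "id \<in> ring_hom (P n) (P n)" by (rule id_ring_hom)
  qed (simp_all add: degeneracy_cst face_cst degeneracy_0_X face_0_X ind_closed)
  then show ?thesis by simp
qed

text \<open>At the lowest stage the last face involves the augmentation, so this identity is treated
  separately: the variable of \<open>b\<close> goes to the variable of that variable, and from there
  back to the variable of its augmentation \<open>b\<close>.\<close>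

lemma face_1_deg_0_base:
  assumes "p \<in> carrier (P 0)" shows "d (Suc 0) (Suc 0) (s 0 0 p) = p"
proof -
  have "(d (Suc 0) (Suc 0) \<circ> s 0 0) p = id p"
  proof (rule P_hom_eq[OF _ _ _ _ assms])
    show "d (Suc 0) (Suc 0) \<circ> s 0 0 \<in> ring_hom (P 0) (P 0)"
      by (rule ring_hom_trans[OF degeneracy_hom face_hom]) auto
    fix v assume v: "v \<in> res_vars A B 0"
    then obtain b where "b \<in> carrier B" "v = Base b" by (auto simp: res_vars.simps)
    then show "(d (Suc 0) (Suc 0) \<circ> s 0 0) (ind v) = id (ind v)"
      using v by (simp add: degeneracy_0_X face_1_Suc_X ind_closed aug_X)
  next
    show "id \<in> ring_hom (P 0) (P 0)" by (rule id_ring_hom)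
  qed (simp_all add: degeneracy_cst face_cst)
  then show ?thesis by simp
qed

lemma face_degeneracy:
  assumes "p \<in> carrier (P (Suc 0))"
  shows face_1_deg_0: "d (Suc (Suc 0)) (Suc 0) (s (Suc 0) 0 p) = p"
    and face_2_deg_0: "d (Suc (Suc 0)) (Suc (Suc 0)) (s (Suc 0) 0 p) = s 0 0 (d (Suc 0) (Suc 0) p)"
    and face_0_deg_1: "d (Suc (Suc 0)) 0 (s (Suc 0) (Suc 0) p) = s 0 0 (d (Suc 0) 0 p)"
    and face_1_deg_1: "d (Suc (Suc 0)) (Suc 0) (s (Suc 0) (Suc 0) p) = p"
    and face_2_deg_1: "d (Suc (Suc 0)) (Suc (Suc 0)) (s (Suc 0) (Suc 0) p) = p"
proof -
  have id: "g (h q) = q" if "g \<in> ring_hom (P (Suc (Suc 0))) (P (Suc 0))" "h \<in> ring_hom (P (Suc 0)) (P (Suc (Suc 0)))"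
    "\<And>a. a \<in> carrier A \<Longrightarrow> g (h (cst a)) = cst a"
    "\<And>p. p \<in> carrier (P 0) \<Longrightarrow> g (h (ind (enc p))) = ind (enc p)" "q \<in> carrier (P (Suc 0))" for g h q
    using comp_hom_eq[OF that(1,2) id_ring_hom id_ring_hom, of q] that by simp
  note simps = degeneracy_cst face_cst degeneracy_0_X face_0_X ind_closed encode_res_vars face_Suc_X
    face_1_Suc_X degeneracy_Suc_X degeneracy_closed aug_closed face_0_deg_0 face_1_deg_0_base
  note hom = face_hom degeneracy_hom
  show "d (Suc (Suc 0)) (Suc 0) (s (Suc 0) 0 p) = p"
    "d (Suc (Suc 0)) (Suc 0) (s (Suc 0) (Suc 0) p) = p"
    "d (Suc (Suc 0)) (Suc (Suc 0)) (s (Suc 0) (Suc 0) p) = p"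
    by (rule id; use assms in \<open>simp add: hom simps\<close>)+
  have b: "Base (aug q) \<in> res_vars A B 0" if "q \<in> carrier (P 0)" for q
    using that by (simp add: aug_closed res_vars.simps)
  show "d (Suc (Suc 0)) (Suc (Suc 0)) (s (Suc 0) 0 p) = s 0 0 (d (Suc 0) (Suc 0) p)"
    "d (Suc (Suc 0)) 0 (s (Suc 0) (Suc 0) p) = s 0 0 (d (Suc 0) 0 p)"
    by (rule comp_hom_eq[where n = 0 and T = "P (Suc 0)"]; (rule hom)?;
        use assms in \<open>simp add: simps b\<close>)+
qed

end

text \<open>\<open>quot_map\<close> picks the unique element of the set of all cosets obtained from
  representatives, so independence of the representative is exactly what has to be supplied.\<close>

lemma quot_map_eqI:
  assumes "U \<noteq> {}" "\<And>x. x \<in> U \<Longrightarrow> H #>\<^bsub>G\<^esub> h x = c"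
  shows "quot_map G H h U = c"
proof -
  have "(\<lambda>x. H #>\<^bsub>G\<^esub> h x) ` U = {c}" using assms by auto
  then show ?thesis by (simp add: quot_map_def)
qed

lemma quot_map2_eqI:
  assumes "U \<noteq> {}" "V \<noteq> {}" "\<And>x y. \<lbrakk>x \<in> U; y \<in> V\<rbrakk> \<Longrightarrow> H #>\<^bsub>G\<^esub> h x y = c"
  shows "quot_map2 G H h U V = c"
proof -
  have "(\<lambda>(x, y). H #>\<^bsub>G\<^esub> h x y) ` (U \<times> V) = {c}"
    using assms by auto
  then show ?thesis by (simp add: quot_map2_def)
qed

lemma (in comm_group) rcoset_eq_iff:
  assumes "subgroup H G" "a \<in> carrier G" "b \<in> carrier G"
  shows "H #> a = H #> b \<longleftrightarrow> a \<otimes> inv b \<in> H"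
proof -
  interpret H: subgroup H G by fact
  have "H #> a = H #> b \<longleftrightarrow> a \<in> H #> b"
    using repr_independence[OF _ assms(3,1), of a] rcos_self[OF assms(2,1)] by auto
  then show ?thesis using H.rcos_module[OF is_group assms(3,2)] by simp
qed

lemma (in comm_group) mult_rcoset:
  assumes "subgroup H G" "a \<in> carrier G" "b \<in> carrier G"
  shows "(H #> a) <#> (H #> b) = H #> (a \<otimes> b)"
  using normal.rcos_sum[OF subgroup_imp_normal[OF assms(1)] assms(2,3)] .

section \<open>Differential forms\<close>

type_synonym 'r form_chain = "'r \<times> 'r list \<Rightarrow>\<^sub>0 int"

lemma frag_extend_compose':
  "frag_extend f (frag_extend g c) = frag_extend (\<lambda>x. frag_extend f (g x)) c"
  using subset_UNIV
  by (induction c rule: frag_induction) (auto simp: frag_extend_diff)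

lemma frag_extend_plus_fun: "frag_extend (\<lambda>x. f x + g x) c = frag_extend f c + frag_extend g c"
  using subset_UNIV
  by (induction c rule: frag_induction) (auto simp: frag_extend_diff)

lemma frag_extend_diff_fun: "frag_extend (\<lambda>x. f x - g x) c = frag_extend f c - frag_extend g c"
  using subset_UNIV
  by (induction c rule: frag_induction) (auto simp: frag_extend_diff)

lemma frag_extend_keys:
  assumes "Poly_Mapping.keys c \<subseteq> S" "\<And>x. x \<in> S \<Longrightarrow> Poly_Mapping.keys (g x) \<subseteq> S'"
  shows "Poly_Mapping.keys (frag_extend g c) \<subseteq> S'"
  using keys_frag_extend[of g c] assms by blast

lemma keys_add_subset:
  "\<lbrakk>Poly_Mapping.keys a \<subseteq> S; Poly_Mapping.keys b \<subseteq> S\<rbrakk> \<Longrightarrow> Poly_Mapping.keys (a + b) \<subseteq> S"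
  using Poly_Mapping.keys_add[of a b] by blast

lemma keys_diff_subset:
  fixes a b :: "'a \<Rightarrow>\<^sub>0 int"
  shows "\<lbrakk>Poly_Mapping.keys a \<subseteq> S; Poly_Mapping.keys b \<subseteq> S\<rbrakk> \<Longrightarrow> Poly_Mapping.keys (a - b) \<subseteq> S"
  using keys_diff[of a b] by blast

lemma keys_sum_subset:
  "(\<And>j. j \<in> J \<Longrightarrow> Poly_Mapping.keys (c j) \<subseteq> S) \<Longrightarrow> Poly_Mapping.keys (sum c J) \<subseteq> S"
  by (induction J rule: infinite_finite_induct) (simp_all add: keys_add_subset)

locale form_ring = R: cring R for R :: "('r, 'k) ring_scheme" (structure) +
  fixes A :: "('a, 'm) ring_scheme" and \<sigma> :: "'a \<Rightarrow> 'r"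
begin

abbreviation "F i \<equiv> free_Abelian_group (form_symbols R i)"
abbreviation "N i \<equiv> form_null A R \<sigma> i"
definition cls :: "nat \<Rightarrow> 'r form_chain \<Rightarrow> 'r form_chain set" where
  "cls i c = N i #>\<^bsub>F i\<^esub> c"

lemma form_relations_keys: "form_relations A R \<sigma> i \<subseteq> carrier (F i)"
proof
  fix c assume "c \<in> form_relations A R \<sigma> i"
  then show "c \<in> carrier (F i)"
    unfolding carrier_free_Abelian_group_iff
    by induction (simp_all add: form_symbols_def keys_diff_subset)
qed

lemma form_null_subgroup: "subgroup (N i) (F i)"
  unfolding form_null_def using group.generate_is_subgroup[OF _ form_relations_keys] by simp

lemma form_null_keys: "c \<in> N i \<Longrightarrow> Poly_Mapping.keys c \<subseteq> form_symbols R i"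
  using subgroup.mem_carrier[OF form_null_subgroup[of i]] by (simp only: carrier_free_Abelian_group_iff)

lemma form_null_zero [simp]: "0 \<in> N i"
  using subgroup.one_closed[OF form_null_subgroup] by simp

lemma form_null_add: "\<lbrakk>c \<in> N i; c' \<in> N i\<rbrakk> \<Longrightarrow> c + c' \<in> N i"
  using subgroup.m_closed[OF form_null_subgroup] by (metis mult_free_Abelian_group)

lemma form_null_minus: "c \<in> N i \<Longrightarrow> - c \<in> N i"
  using subgroup.m_inv_closed[OF form_null_subgroup] form_null_keys by (metis inv_free_Abelian_group)

lemma form_null_diff: "\<lbrakk>c \<in> N i; c' \<in> N i\<rbrakk> \<Longrightarrow> c - c' \<in> N i"
  using form_null_add[OF _ form_null_minus] by fastforce

lemma form_null_cmul: "c \<in> N i \<Longrightarrow> frag_cmul k c \<in> N i"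
  by (rule frag_closure_minus_cmul[where P = "\<lambda>c. c \<in> N i"]) (auto intro: form_null_diff)

lemma form_null_sum: "(\<And>j. j \<in> J \<Longrightarrow> c j \<in> N i) \<Longrightarrow> sum c J \<in> N i"
  by (induction J rule: infinite_finite_induct) (auto intro: form_null_add)

lemma form_null_relation: "c \<in> form_relations A R \<sigma> i \<Longrightarrow> c \<in> N i"
  unfolding form_null_def by (rule generate.incl)

text \<open>Closure under differences, starting from 0, replaces the separate product and inverse
  steps of \<open>generate\<close> and fits maps that are additive on chains.\<close>

lemma form_null_induct:
  assumes "c \<in> N i" and "Q 0" and "\<And>c. c \<in> form_relations A R \<sigma> i \<Longrightarrow> Q c"
    and "\<And>c c'. \<lbrakk>c \<in> N i; c' \<in> N i; Q c; Q c'\<rbrakk> \<Longrightarrow> Q (c - c')"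
  shows "Q c"
proof -
  have Qm: "Q (- c)" if "c \<in> N i" "Q c" for c
    using assms(4)[OF form_null_zero that(1) assms(2) that(2)] by simp
  show ?thesis
    using assms(1) unfolding form_null_def
  proof (induction rule: generate.induct)
    case (inv h)
    then have "h \<in> N i" "Poly_Mapping.keys h \<subseteq> form_symbols R i"
      using form_null_relation form_null_keys by auto
    then show ?case using inv assms(3) Qm by simp
  next
    case (eng h1 h2)
    then have "Q (h1 - (- h2))"
      using form_null_minus Qm by (intro assms(4)) (auto simp: form_null_def)
    then show ?case by simp
  qed (use assms in simp_all)
qed

lemma form_null_frag_extend:
  assumes "c \<in> N i" "\<And>c. c \<in> form_relations A R \<sigma> i \<Longrightarrow> frag_extend g c \<in> form_null A' R' \<sigma>' i'"
    and "cring R'"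
  shows "frag_extend g c \<in> form_null A' R' \<sigma>' i'"
proof -
  interpret R': form_ring R' A' \<sigma>' using assms(3) by (simp add: form_ring_def)
  show ?thesis
    by (rule form_null_induct[OF assms(1)])
       (use assms(2) in \<open>auto simp: frag_extend_diff intro: R'.form_null_diff\<close>)
qed

text \<open>The group operation is addition of finitely supported functions, whatever the set of
  symbols, so two chains are compared through their difference alone.\<close>

lemma cls_eq_iff: "cls i c = cls i c' \<longleftrightarrow> c - c' \<in> N i"
proof
  assume "cls i c = cls i c'"
  moreover have "c \<in> cls i c" unfolding cls_def r_coset_def using form_null_zero by force
  ultimately obtain n where "n \<in> N i" "c = n + c'" by (auto simp: cls_def r_coset_def)
  then show "c - c' \<in> N i" by simp
next
  have *: "cls i c \<subseteq> cls i c'" if "c - c' \<in> N i" for c c'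
  proof
    fix e assume "e \<in> cls i c"
    then obtain n where "n \<in> N i" "e = n + c" by (auto simp: cls_def r_coset_def)
    then have "e = (n + (c - c')) + c'" "n + (c - c') \<in> N i" using that form_null_add by auto
    then show "e \<in> cls i c'" unfolding cls_def r_coset_def mult_free_Abelian_group by blast
  qed
  assume "c - c' \<in> N i"
  moreover from form_null_minus[OF this] have "c' - c \<in> N i" by simp
  ultimately show "cls i c = cls i c'" using * by blast
qed

lemma cls_memD: "e \<in> cls i c \<Longrightarrow> cls i e = cls i c"
  unfolding cls_eq_iff by (auto simp: cls_def r_coset_def)

lemma cls_self: "c \<in> cls i c"
  unfolding cls_def r_coset_def using form_null_zero by force

lemma cls_mem_keys: "\<lbrakk>e \<in> cls i c; Poly_Mapping.keys c \<subseteq> form_symbols R i\<rbrakk> \<Longrightarrow>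
    Poly_Mapping.keys e \<subseteq> form_symbols R i"
  unfolding cls_def r_coset_def mult_free_Abelian_group
  using keys_add_subset[OF form_null_keys] by blast

lemma forms_carrier: "carrier (forms A R \<sigma> i) = cls i ` {c. Poly_Mapping.keys c \<subseteq> form_symbols R i}"
  by (auto simp: forms_def carrier_FactGroup cls_def)

lemma cls_closed: "Poly_Mapping.keys c \<subseteq> form_symbols R i \<Longrightarrow> cls i c \<in> carrier (forms A R \<sigma> i)"
  by (auto simp: forms_carrier)

lemma forms_one: "\<one>\<^bsub>forms A R \<sigma> i\<^esub> = cls i 0"
  by (simp add: forms_def cls_def r_coset_def)

lemma forms_comm_group: "comm_group (forms A R \<sigma> i)"
  unfolding forms_def
  by (rule comm_group.abelian_FactGroup[OF abelian_free_Abelian_group form_null_subgroup])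

lemma forms_group: "group (forms A R \<sigma> i)"
  using forms_comm_group comm_group.axioms(2) by blast

lemma forms_mult:
  assumes "Poly_Mapping.keys c \<subseteq> form_symbols R i" "Poly_Mapping.keys c' \<subseteq> form_symbols R i"
  shows "cls i c \<otimes>\<^bsub>forms A R \<sigma> i\<^esub> cls i c' = cls i (c + c')"
  using comm_group.mult_rcoset[OF abelian_free_Abelian_group form_null_subgroup, of c i c'] assms
  by (simp add: forms_def cls_def)

lemma forms_pow:
  assumes "Poly_Mapping.keys c \<subseteq> form_symbols R i"
  shows "cls i c [^]\<^bsub>forms A R \<sigma> i\<^esub> (k :: int) = cls i (frag_cmul k c)"
  using normal.FactGroup_int_pow[OF comm_group.subgroup_imp_normal[OF abelian_free_Abelian_group form_null_subgroup], of c i k] assms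
  by (simp add: forms_def cls_def)

lemma quot_map_cls:
  assumes "\<And>c. c \<in> N i \<Longrightarrow> frag_extend g c \<in> form_null A' R' \<sigma>' i'" and "cring R'"
  shows "quot_map (free_Abelian_group (form_symbols R' i')) (form_null A' R' \<sigma>' i') (frag_extend g) (cls i c)
    = form_ring.cls R' A' \<sigma>' i' (frag_extend g c)"
proof -
  interpret R': form_ring R' A' \<sigma>' using assms(2) by (simp add: form_ring_def)
  show ?thesis
  proof (rule quot_map_eqI)
    fix e assume "e \<in> cls i c"
    then have "e - c \<in> N i" using cls_memD cls_eq_iff by blast
    then have "frag_extend g e - frag_extend g c \<in> form_null A' R' \<sigma>' i'"
      using assms(1) by (simp flip: frag_extend_diff)
    then show "form_null A' R' \<sigma>' i' #>\<^bsub>free_Abelian_group (form_symbols R' i')\<^esub> frag_extend g e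
        = R'.cls i' (frag_extend g c)"
      unfolding R'.cls_def[symmetric] R'.cls_eq_iff .
  qed (use cls_self in blast)
qed

text \<open>Polarisation: alternation at \<open>x \<oplus> y\<close> in both slots, expanded by
  additivity, leaves the two mixed terms.\<close>

lemma form_null_swap:
  assumes "(r, us @ x # vs @ y # ws) \<in> form_symbols R i"
  shows "frag_of (r, us @ x # vs @ y # ws) + frag_of (r, us @ y # vs @ x # ws) \<in> N i"
proof -
  have c: "r \<in> carrier R" "set us \<subseteq> carrier R" "set vs \<subseteq> carrier R" "set ws \<subseteq> carrier R"
    "x \<in> carrier R" "y \<in> carrier R" "length us + length vs + length ws + 2 = i"
    using assms by (auto simp: form_symbols_def)
  let ?f = "\<lambda>a b. frag_of (r, us @ a # vs @ b # ws)"
  have add1: "?f (a \<oplus> b) e - ?f a e - ?f b e \<in> N i" if "a \<in> carrier R" "b \<in> carrier R" "e \<in> carrier R" for a b e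
    using that c by (intro form_null_relation form_relations.d_add) (auto simp: form_symbols_def)
  have add2: "?f e (a \<oplus> b) - ?f e a - ?f e b \<in> N i" if "a \<in> carrier R" "b \<in> carrier R" "e \<in> carrier R" for a b e
    using form_null_relation[OF form_relations.d_add[of r "us @ e # vs" a ws R i b]] that c
    by (auto simp: form_symbols_def)
  have alt: "?f a a \<in> N i" if "a \<in> carrier R" for a
    using that c by (intro form_null_relation form_relations.alternating) (auto simp: form_symbols_def)
  have "?f x y + ?f y x = ?f (x \<oplus> y) (x \<oplus> y) - ?f x x - ?f y y
      - (?f (x \<oplus> y) (x \<oplus> y) - ?f x (x \<oplus> y) - ?f y (x \<oplus> y))
      - (?f x (x \<oplus> y) - ?f x x - ?f x y) - (?f y (x \<oplus> y) - ?f y x - ?f y y)"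
    by simp
  also have "\<dots> \<in> N i"
    using c by (intro form_null_diff alt add1 add2) auto
  finally show ?thesis .
qed

lemma form_d_null:
  assumes "c \<in> N i"
  shows "frag_extend (\<lambda>(r, xs). frag_of (\<one>, r # xs)) c \<in> N (Suc i)"
proof (rule form_null_frag_extend[OF assms _ R.cring_axioms])
  fix c assume "c \<in> form_relations A R \<sigma> i"
  then show "frag_extend (\<lambda>(r, xs). frag_of (\<one>, r # xs)) c \<in> N (Suc i)"
  proof cases
    case (coeff_add r xs s)
    then show ?thesis
      using form_relations.d_add[of \<one> "[]" r xs R "Suc i" s]
      by (auto simp: frag_extend_diff form_symbols_def intro!: form_null_relation)
  next
    case (d_add r us x vs y)
    then show ?thesis
      using form_relations.d_add[of \<one> "r # us" x vs R "Suc i" y]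
      by (auto simp: frag_extend_diff form_symbols_def intro!: form_null_relation)
  next
    case (d_mult r us x vs y)
    then have c: "r \<in> carrier R" "set us \<subseteq> carrier R" "set vs \<subseteq> carrier R"
      "x \<in> carrier R" "y \<in> carrier R" "length us + length vs + 1 = i"
      by (auto simp: form_symbols_def)
    \<comment> \<open>The expansions of d(xy), d(rx) and d(ry) cancel except for the two terms in
      which dx and dy have coefficient r and opposite order; these cancel by
      \<open>form_null_swap\<close>.\<close>
    have 1: "frag_of (\<one>, r # us @ (x \<otimes> y) # vs) - frag_of (x, r # us @ y # vs) - frag_of (y, r # us @ x # vs) \<in> N (Suc i)"
      using form_null_relation[OF form_relations.d_mult[of \<one> "r # us" x vs R "Suc i" y]] c by (auto simp: form_symbols_def)
    have 2: "frag_of (\<one>, (r \<otimes> x) # us @ y # vs) - frag_of (r, x # us @ y # vs) - frag_of (x, r # us @ y # vs) \<in> N (Suc i)"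
      using form_null_relation[OF form_relations.d_mult[of \<one> "[]" r "us @ y # vs" R "Suc i" x]] c by (auto simp: form_symbols_def)
    have 3: "frag_of (\<one>, (r \<otimes> y) # us @ x # vs) - frag_of (r, y # us @ x # vs) - frag_of (y, r # us @ x # vs) \<in> N (Suc i)"
      using form_null_relation[OF form_relations.d_mult[of \<one> "[]" r "us @ x # vs" R "Suc i" y]] c by (auto simp: form_symbols_def)
    have 4: "frag_of (r, x # us @ y # vs) + frag_of (r, y # us @ x # vs) \<in> N (Suc i)"
      using form_null_swap[of r "[]" x us y vs "Suc i"] c by (auto simp: form_symbols_def)
    from form_null_diff[OF form_null_diff[OF form_null_diff[OF 1 2] 3] 4] show ?thesis
      by (simp add: d_mult(1) frag_extend_diff algebra_simps frag_extend_add)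
  next
    case (d_const r us a vs)
    then show ?thesis
      using form_relations.d_const[of \<one> "r # us" \<sigma> a vs R "Suc i" A]
      by (auto simp: form_symbols_def intro!: form_null_relation)
  next
    case (alternating r us x vs ws)
    then show ?thesis
      using form_relations.alternating[of \<one> "r # us" x vs ws R "Suc i" A \<sigma>]
      by (auto simp: form_symbols_def intro!: form_null_relation)
  qed
qed

lemma form_d_cls: "form_d A R \<sigma> i (cls i c) = cls (Suc i) (frag_extend (\<lambda>(r, xs). frag_of (\<one>, r # xs)) c)"
  unfolding form_d_def by (rule quot_map_cls[OF form_d_null R.cring_axioms])

end

section \<open>Functoriality and exterior products of forms\<close>

definition form_pullback :: "('r \<Rightarrow> 's) \<Rightarrow> 'r form_chain \<Rightarrow> 's form_chain" where
  "form_pullback g = frag_extend (\<lambda>(r, xs). frag_of (g r, map g xs))"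

lemma form_pullback_null:
  assumes "cring R" "cring R'" "g \<in> ring_hom R R'" "\<And>a. a \<in> carrier A \<Longrightarrow> g (\<sigma> a) = \<sigma>' a"
    and "c \<in> form_null A R \<sigma> i"
  shows "form_pullback g c \<in> form_null A R' \<sigma>' i"
proof -
  interpret R: form_ring R A \<sigma> using assms(1) by (simp add: form_ring_def)
  interpret R': form_ring R' A \<sigma>' using assms(2) by (simp add: form_ring_def)
  note g = ring_hom_closed[OF assms(3)] ring_hom_add[OF assms(3)] ring_hom_mult[OF assms(3)]
  have gs: "g ` S \<subseteq> carrier R'" if "S \<subseteq> carrier R" for S using that g(1) by auto
  show ?thesis unfolding form_pullback_def
  proof (rule R.form_null_frag_extend[OF assms(5) _ assms(2)])
    fix c assume "c \<in> form_relations A R \<sigma> i"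
    then show "frag_extend (\<lambda>(r, xs). frag_of (g r, map g xs)) c \<in> form_null A R' \<sigma>' i"
    proof cases
      case (coeff_add r xs s)
      then show ?thesis
        using form_relations.coeff_add[of "g r" "map g xs" R' i "g s"] g gs
        by (auto simp: frag_extend_diff form_symbols_def intro!: R'.form_null_relation)
    next
      case (d_add r us x vs y)
      then show ?thesis
        using form_relations.d_add[of "g r" "map g us" "g x" "map g vs" R' i "g y"] g gs
        by (auto simp: frag_extend_diff form_symbols_def intro!: R'.form_null_relation)
    next
      case (d_mult r us x vs y)
      then show ?thesis
        using form_relations.d_mult[of "g r" "map g us" "g x" "map g vs" R' i "g y"] g gs
        by (auto simp: frag_extend_diff form_symbols_def intro!: R'.form_null_relation)
    next
      case (d_const r us a vs)
      then show ?thesis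
        using form_relations.d_const[of "g r" "map g us" \<sigma>' a "map g vs" R' i A] g(1)[of "\<sigma> a"] g gs assms(4)[of a]
        by (auto simp: form_symbols_def intro!: R'.form_null_relation)
    next
      case (alternating r us x vs ws)
      then show ?thesis
        using form_relations.alternating[of "g r" "map g us" "g x" "map g vs" "map g ws" R' i A] g gs
        by (auto simp: form_symbols_def intro!: R'.form_null_relation)
    qed
  qed
qed

lemma form_pullback_keys:
  assumes "g \<in> ring_hom R R'" "Poly_Mapping.keys c \<subseteq> form_symbols R i"
  shows "Poly_Mapping.keys (form_pullback g c) \<subseteq> form_symbols R' i"
  unfolding form_pullback_def
  by (rule frag_extend_keys[OF assms(2)])
     (use ring_hom_closed[OF assms(1)] in \<open>auto simp: form_symbols_def subset_iff\<close>)

definition form_wedge ::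
  "('t, 'k) ring_scheme \<Rightarrow> ('r \<Rightarrow> 't) \<Rightarrow> ('s \<Rightarrow> 't) \<Rightarrow> 'r \<times> 'r list \<Rightarrow> 's \<times> 's list \<Rightarrow> 't form_chain" where
  "form_wedge T g h = (\<lambda>(r, xs) (s, ys). frag_of (g r \<otimes>\<^bsub>T\<^esub> h s, map g xs @ map h ys))"

lemma form_wedge_keys:
  assumes "cring T" "g \<in> ring_hom R T" "h \<in> ring_hom R' T" "u \<in> form_symbols R i" "v \<in> form_symbols R' j"
  shows "Poly_Mapping.keys (form_wedge T g h u v) \<subseteq> form_symbols T (i + j)"
proof -
  interpret T: cring T by fact
  show ?thesis
    using assms(4,5) ring_hom_closed[OF assms(2)] ring_hom_closed[OF assms(3)]
    by (auto simp: form_wedge_def form_symbols_def subset_iff)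
qed

text \<open>Compatibility of the product with the relations is checked one argument at a time, the
  other being a single symbol; bilinear extension then covers all chains.\<close>

lemma form_wedge_null_left:
  assumes "cring R" "cring T" "g \<in> ring_hom R T" "h \<in> ring_hom R' T"
    and "\<And>a. a \<in> carrier A \<Longrightarrow> g (\<sigma> a) = \<sigma>' a"
    and "c \<in> form_null A R \<sigma> i" "v \<in> form_symbols R' j"
  shows "frag_extend (\<lambda>u. form_wedge T g h u v) c \<in> form_null A T \<sigma>' (i + j)"
proof -
  interpret R: form_ring R A \<sigma> using assms(1) by (simp add: form_ring_def)
  interpret T: form_ring T A \<sigma>' using assms(2) by (simp add: form_ring_def)
  note g = ring_hom_closed[OF assms(3)] ring_hom_add[OF assms(3)] ring_hom_mult[OF assms(3)]
  note h = ring_hom_closed[OF assms(4)]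
  have gs: "g ` S \<subseteq> carrier T" if "S \<subseteq> carrier R" for S using that g(1) by auto
  obtain t ys where v: "v = (t, ys)" and t: "t \<in> carrier R'" "set ys \<subseteq> carrier R'" "length ys = j"
    using assms(7) by (auto simp: form_symbols_def)
  have t': "h t \<in> carrier T" "h ` set ys \<subseteq> carrier T" using t h by auto
  show ?thesis
  proof (rule R.form_null_frag_extend[OF assms(6) _ assms(2)])
    fix c assume "c \<in> form_relations A R \<sigma> i"
    then show "frag_extend (\<lambda>u. form_wedge T g h u v) c \<in> form_null A T \<sigma>' (i + j)"
    proof cases
      case (coeff_add r xs s)
      then show ?thesis
        using form_relations.coeff_add[of "g r \<otimes>\<^bsub>T\<^esub> h t" "map g xs @ map h ys" T "i + j" "g s \<otimes>\<^bsub>T\<^esub> h t"] g gs t t'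
        by (auto simp: frag_extend_diff form_symbols_def v form_wedge_def T.R.l_distr intro!: T.form_null_relation)
    next
      case (d_add r us x vs y)
      then show ?thesis
        using form_relations.d_add[of "g r \<otimes>\<^bsub>T\<^esub> h t" "map g us" "g x" "map g vs @ map h ys" T "i + j" "g y"] g gs t t'
        by (auto simp: frag_extend_diff form_symbols_def v form_wedge_def intro!: T.form_null_relation)
    next
      case (d_mult r us x vs y)
      then show ?thesis
        using form_relations.d_mult[of "g r \<otimes>\<^bsub>T\<^esub> h t" "map g us" "g x" "map g vs @ map h ys" T "i + j" "g y"] g gs t t'
        by (auto simp: frag_extend_diff form_symbols_def v form_wedge_def T.R.m_ac intro!: T.form_null_relation)
    next
      case (d_const r us a vs)
      then show ?thesis
        using form_relations.d_const[of "g r \<otimes>\<^bsub>T\<^esub> h t" "map g us" \<sigma>' a "map g vs @ map h ys" T "i + j" A] g(1)[of "\<sigma> a"] g gs t t' assms(5)[of a]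
        by (auto simp: form_symbols_def v form_wedge_def intro!: T.form_null_relation)
    next
      case (alternating r us x vs ws)
      then show ?thesis
        using form_relations.alternating[of "g r \<otimes>\<^bsub>T\<^esub> h t" "map g us" "g x" "map g vs" "map g ws @ map h ys" T "i + j" A] g gs t t'
        by (auto simp: form_symbols_def v form_wedge_def intro!: T.form_null_relation)
    qed
  qed
qed

lemma form_wedge_null_right:
  assumes "cring R'" "cring T" "g \<in> ring_hom R T" "h \<in> ring_hom R' T"
    and "\<And>a. a \<in> carrier A \<Longrightarrow> h (\<sigma> a) = \<sigma>' a"
    and "u \<in> form_symbols R i" "c \<in> form_null A R' \<sigma> j"
  shows "frag_extend (form_wedge T g h u) c \<in> form_null A T \<sigma>' (i + j)"
proof -
  interpret R: form_ring R' A \<sigma> using assms(1) by (simp add: form_ring_def)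
  interpret T: form_ring T A \<sigma>' using assms(2) by (simp add: form_ring_def)
  note h = ring_hom_closed[OF assms(4)] ring_hom_add[OF assms(4)] ring_hom_mult[OF assms(4)]
  note g = ring_hom_closed[OF assms(3)]
  have hs: "h ` S \<subseteq> carrier T" if "S \<subseteq> carrier R'" for S using that h(1) by auto
  obtain t ys where u: "u = (t, ys)" and t: "t \<in> carrier R" "set ys \<subseteq> carrier R" "length ys = i"
    using assms(6) by (auto simp: form_symbols_def)
  have t': "g t \<in> carrier T" "g ` set ys \<subseteq> carrier T" using t g by auto
  show ?thesis
  proof (rule R.form_null_frag_extend[OF assms(7) _ assms(2)])
    fix c assume "c \<in> form_relations A R' \<sigma> j"
    then show "frag_extend (form_wedge T g h u) c \<in> form_null A T \<sigma>' (i + j)"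
    proof cases
      case (coeff_add r xs s)
      then show ?thesis
        using form_relations.coeff_add[of "g t \<otimes>\<^bsub>T\<^esub> h r" "map g ys @ map h xs" T "i + j" "g t \<otimes>\<^bsub>T\<^esub> h s"] h hs t t'
        by (auto simp: frag_extend_diff form_symbols_def u form_wedge_def T.R.r_distr intro!: T.form_null_relation)
    next
      case (d_add r us x vs y)
      then show ?thesis
        using form_relations.d_add[of "g t \<otimes>\<^bsub>T\<^esub> h r" "map g ys @ map h us" "h x" "map h vs" T "i + j" "h y"] h hs t t'
        by (auto simp: frag_extend_diff form_symbols_def u form_wedge_def intro!: T.form_null_relation)
    next
      case (d_mult r us x vs y)
      then show ?thesis
        using form_relations.d_mult[of "g t \<otimes>\<^bsub>T\<^esub> h r" "map g ys @ map h us" "h x" "map h vs" T "i + j" "h y"] h hs t t'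
        by (auto simp: frag_extend_diff form_symbols_def u form_wedge_def T.R.m_ac intro!: T.form_null_relation)
    next
      case (d_const r us a vs)
      then show ?thesis
        using form_relations.d_const[of "g t \<otimes>\<^bsub>T\<^esub> h r" "map g ys @ map h us" \<sigma>' a "map h vs" T "i + j" A] h(1)[of "\<sigma> a"] h hs t t' assms(5)[of a]
        by (auto simp: form_symbols_def u form_wedge_def intro!: T.form_null_relation)
    next
      case (alternating r us x vs ws)
      then show ?thesis
        using form_relations.alternating[of "g t \<otimes>\<^bsub>T\<^esub> h r" "map g ys @ map h us" "h x" "map h vs" "map h ws" T "i + j" A] h hs t t'
        by (auto simp: form_symbols_def u form_wedge_def intro!: T.form_null_relation)
    qed
  qed
qed

text \<open>A bilinear extension can be carried out in either order. \<open>shuffle_frag\<close>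
  expands its left argument first, while vanishing in the left argument is known for a fixed symbol
  on the right.\<close>

lemma frag_extend_swap:
  "frag_extend (\<lambda>u. frag_extend (W u) c') c = frag_extend (\<lambda>v. frag_extend (\<lambda>u. W u v) c) c'"
  using subset_UNIV
proof (induction c rule: frag_induction)
  case zero
  then show ?case by (simp add: frag_extend_eq_0)
next
  case (one x)
  then show ?case by simp
next
  case (diff a b)
  then show ?case by (simp add: frag_extend_diff frag_extend_diff_fun)
qed

lemma frag_extend_sum_fun:
  "finite J \<Longrightarrow> frag_extend (\<lambda>x. \<Sum>j\<in>J. g j x) c = (\<Sum>j\<in>J. frag_extend (g j) c)"
  by (induction J rule: finite_induct) (simp_all add: frag_extend_plus_fun frag_extend_eq_0)

lemma frag_cmul_diff: "frag_cmul k (a - b) = frag_cmul k a - frag_cmul k b"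
  by (rule poly_mapping_eqI) (simp add: lookup_minus algebra_simps)

lemma frag_extend_cmul_fun: "frag_extend (\<lambda>x. frag_cmul k (g x)) c = frag_cmul k (frag_extend g c)"
  using subset_UNIV
  by (induction c rule: frag_induction) (simp_all add: frag_extend_diff frag_cmul_diff)

lemma (in form_ring) frag_extend_null:
  assumes "\<And>u. u \<in> Poly_Mapping.keys c \<Longrightarrow> g u \<in> N i"
  shows "frag_extend g c \<in> N i"
  unfolding frag_extend_def using assms by (intro form_null_sum form_null_cmul) auto

text \<open>The entries after position \<open>k\<close> are strictly larger and still lie below
  \<open>b\<close>, which bounds the entry at \<open>k\<close>. This keeps the iterated degeneracies
  of a shuffle in range: the one applied at step \<open>k\<close> acts on stage
  \<open>p + k\<close>, so its index may be at most \<open>p + k\<close>.\<close>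

lemma strict_sorted_nth_le:
  fixes L :: "nat list"
  assumes "sorted_wrt (<) L" "k < length L" "\<forall>x\<in>set L. x < b"
  shows "L ! k + length L \<le> b + k"
  using assms
proof (induction L arbitrary: b k rule: rev_induct)
  case Nil
  then show ?case by simp
next
  case (snoc x L)
  show ?case
  proof (cases "k = length L")
    case True
    then show ?thesis using snoc.prems by simp
  next
    case False
    then have k: "k < length L" using snoc.prems by simp
    have "\<forall>y\<in>set L. y < x" using snoc.prems by (auto simp: sorted_wrt_append)
    then have "L ! k + length L \<le> x + k"
      using snoc.IH[of k x] snoc.prems k by (auto simp: sorted_wrt_append)
    then show ?thesis using snoc.prems k by (simp add: nth_append)
  qed
qed

section \<open>Chain representatives of the double complex and of the shuffle product\<close>

context algebra_map
begin

sublocale Om: form_ring "P n" A cst for n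
  by (simp add: form_ring_def P_cring)

abbreviation (input) \<Omega>f :: "nat \<Rightarrow> nat \<Rightarrow> ('a, 'b) form monoid" where
  "\<Omega>f n i \<equiv> forms A (P n) cst i"
abbreviation (input) C :: "nat \<Rightarrow> nat \<Rightarrow> ('a, 'b) pol form_chain \<Rightarrow> ('a, 'b) form" where
  "C n i \<equiv> form_ring.cls (P n) A cst i"
abbreviation (input) Null :: "nat \<Rightarrow> nat \<Rightarrow> ('a, 'b) pol form_chain set" where
  "Null n i \<equiv> form_null A (P n) cst i"

text \<open>Chains representing \<open>\<Omega>\<^sup>i(P\<^sub>n)\<close>; \<open>hd\<close> and \<open>dR\<close> below lift the two differentials to them.\<close>

definition K :: "nat \<Rightarrow> nat \<Rightarrow> ('a, 'b) pol form_chain set" where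
  "K n i = {c. Poly_Mapping.keys c \<subseteq> form_symbols (P n) i}"

lemma K_add: "\<lbrakk>a \<in> K n i; b \<in> K n i\<rbrakk> \<Longrightarrow> a + b \<in> K n i"
  and K_diff: "\<lbrakk>a \<in> K n i; b \<in> K n i\<rbrakk> \<Longrightarrow> a - b \<in> K n i"
  and K_zero: "0 \<in> K n i"
  and K_minus: "a \<in> K n i \<Longrightarrow> - a \<in> K n i"
  and K_cmul: "a \<in> K n i \<Longrightarrow> frag_cmul k a \<in> K n i"
  and K_sum: "(\<And>j. j \<in> J \<Longrightarrow> c j \<in> K n i) \<Longrightarrow> sum c J \<in> K n i"
  unfolding K_def mem_Collect_eq
  by (simp_all add: keys_add_subset keys_diff_subset keys_sum_subset order.trans[OF keys_cmul])

lemma K_frag_extend: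
  assumes "c \<in> K n i" "\<And>u. u \<in> form_symbols (P n) i \<Longrightarrow> g u \<in> K m j"
  shows "frag_extend g c \<in> K m j"
  using frag_extend_keys[of c "form_symbols (P n) i" g "form_symbols (P m) j"] assms by (simp add: K_def)

lemma Null_K: "c \<in> Null n i \<Longrightarrow> c \<in> K n i"
  using Om.form_null_keys by (auto simp: K_def)

lemma \<Omega>_carrier: "carrier (\<Omega>f n i) = C n i ` K n i"
  by (simp add: Om.forms_carrier K_def)

lemma \<Omega>_mult: "\<lbrakk>c \<in> K n i; c' \<in> K n i\<rbrakk> \<Longrightarrow> C n i c \<otimes>\<^bsub>\<Omega>f n i\<^esub> C n i c' = C n i (c + c')"
  by (simp add: Om.forms_mult K_def)

lemma \<Omega>_pow: "c \<in> K n i \<Longrightarrow> C n i c [^]\<^bsub>\<Omega>f n i\<^esub> (k :: int) = C n i (frag_cmul k c)"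
  by (simp add: Om.forms_pow K_def)

lemma \<Omega>_closed: "c \<in> K n i \<Longrightarrow> C n i c \<in> carrier (\<Omega>f n i)"
  by (simp add: \<Omega>_carrier)

definition hd :: "nat \<Rightarrow> ('a, 'b) pol form_chain \<Rightarrow> ('a, 'b) pol form_chain" where
  "hd n = frag_extend (\<lambda>(r, xs). \<Sum>j\<le>Suc n.
      frag_cmul ((-1) ^ j) (frag_of (d (Suc n) j r, map (d (Suc n) j) xs)))"

definition dR :: "nat \<Rightarrow> ('a, 'b) pol form_chain \<Rightarrow> ('a, 'b) pol form_chain" where
  "dR n = frag_extend (\<lambda>(r, xs). frag_of (\<one>\<^bsub>P n\<^esub>, r # xs))"

lemma hd_pullback: "hd n c = (\<Sum>j\<le>Suc n. frag_cmul ((-1) ^ j) (form_pullback (d (Suc n) j) c))"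
  unfolding hd_def form_pullback_def
  by (subst frag_extend_cmul_fun[symmetric], subst frag_extend_sum_fun[symmetric])
     (simp_all add: case_prod_unfold)

lemma hd_null: "c \<in> Null (Suc n) i \<Longrightarrow> hd n c \<in> Null n i"
  unfolding hd_pullback
  by (intro Om.form_null_sum Om.form_null_cmul form_pullback_null[OF P_cring P_cring face_hom])
     (auto simp: face_cst)

lemma hd_K: "c \<in> K (Suc n) i \<Longrightarrow> hd n c \<in> K n i"
  unfolding hd_pullback
  by (intro K_sum K_cmul) (simp add: K_def form_pullback_keys[OF face_hom])

lemma horizontal_d_C: "horizontal_d A B f n i (C (Suc n) i c) = C n i (hd n c)"
  unfolding horizontal_d_def hd_def
  using Om.quot_map_cls[OF hd_null[unfolded hd_def] P_cring] by simp

lemma dR_K: "c \<in> K n i \<Longrightarrow> dR n c \<in> K n (Suc i)"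
  unfolding dR_def by (erule K_frag_extend) (auto simp: K_def form_symbols_def)

lemma form_d_C: "form_d A (P n) cst i (C n i c) = C n (Suc i) (dR n c)"
  unfolding dR_def by (rule Om.form_d_cls)

lemma degeneracies_hom:
  assumes "\<forall>k<length js. js ! k \<le> p + k"
  shows "degeneracies A B p js \<in> ring_hom (P p) (P (p + length js)) \<and>
    (\<forall>a\<in>carrier A. degeneracies A B p js (cst a) = cst a)"
  using assms
proof (induction js arbitrary: p)
  case Nil
  have "id \<in> ring_hom (P p) (P p)" by (rule id_ring_hom)
  then show ?case by (simp add: id_def)
next
  case (Cons j js)
  have j: "j \<le> p" using Cons.prems by auto
  have "\<forall>k<length js. js ! k \<le> Suc p + k" using Cons.prems by force
  then have IH: "degeneracies A B (Suc p) js \<in> ring_hom (P (Suc p)) (P (Suc p + length js))"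
    "\<forall>a\<in>carrier A. degeneracies A B (Suc p) js (cst a) = cst a" using Cons.IH[of "Suc p"] by simp_all
  show ?case
    using ring_hom_trans[OF degeneracy_hom[OF j] IH(1)] IH(2) degeneracy_cst[OF j]
    by (simp add: comp_def)
qed

lemma degeneracies_sorted_hom:
  assumes "N \<subseteq> {..<p + q}" "card N = q"
  shows "degeneracies A B p (sorted_list_of_set N) \<in> ring_hom (P p) (P (p + q))"
    and "a \<in> carrier A \<Longrightarrow> degeneracies A B p (sorted_list_of_set N) (cst a) = cst a"
proof -
  have fin: "finite N" using assms(1) finite_subset by blast
  have "sorted_list_of_set N ! k + length (sorted_list_of_set N) \<le> (p + q) + k" if "k < q" for k
    using that assms fin by (intro strict_sorted_nth_le) auto
  then have "\<forall>k<length (sorted_list_of_set N). sorted_list_of_set N ! k \<le> p + k"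
    using assms(2) by auto
  from degeneracies_hom[OF this] assms(2)
  show "degeneracies A B p (sorted_list_of_set N) \<in> ring_hom (P p) (P (p + q))"
    and "a \<in> carrier A \<Longrightarrow> degeneracies A B p (sorted_list_of_set N) (cst a) = cst a"
    by auto
qed

definition shuffle_symbols where
  "shuffle_symbols p q u v = (\<Sum>M | M \<subseteq> {..<p + q} \<and> card M = p.
     frag_cmul ((-1) ^ card {(m, n). m \<in> M \<and> n \<in> {..<p + q} - M \<and> n < m})
       (form_wedge (P (p + q)) (degeneracies A B p (sorted_list_of_set ({..<p + q} - M)))
          (degeneracies A B q (sorted_list_of_set M)) u v))"

lemma shuffle_homs:
  assumes "M \<subseteq> {..<p + q}" "card M = p"
  shows "degeneracies A B p (sorted_list_of_set ({..<p + q} - M)) \<in> ring_hom (P p) (P (p + q))"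
    and "degeneracies A B q (sorted_list_of_set M) \<in> ring_hom (P q) (P (p + q))"
    and "a \<in> carrier A \<Longrightarrow> degeneracies A B p (sorted_list_of_set ({..<p + q} - M)) (cst a) = cst a"
    and "a \<in> carrier A \<Longrightarrow> degeneracies A B q (sorted_list_of_set M) (cst a) = cst a"
proof -
  have "card ({..<p + q} - M) = q"
    using assms by (subst card_Diff_subset) (auto intro: finite_subset)
  then show "degeneracies A B p (sorted_list_of_set ({..<p + q} - M)) \<in> ring_hom (P p) (P (p + q))"
    and "a \<in> carrier A \<Longrightarrow> degeneracies A B p (sorted_list_of_set ({..<p + q} - M)) (cst a) = cst a"
    using degeneracies_sorted_hom[of "{..<p + q} - M" p q] by auto
  show "degeneracies A B q (sorted_list_of_set M) \<in> ring_hom (P q) (P (p + q))"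
    and "a \<in> carrier A \<Longrightarrow> degeneracies A B q (sorted_list_of_set M) (cst a) = cst a"
    using degeneracies_sorted_hom[of M q p] assms by (auto simp: add.commute)
qed

definition shuffle_frag where
  "shuffle_frag p q c c' = frag_extend (\<lambda>u. frag_extend (shuffle_symbols p q u) c') c"

lemma shuffle_symbols_K:
  assumes "u \<in> form_symbols (P p) i" "v \<in> form_symbols (P q) j"
  shows "shuffle_symbols p q u v \<in> K (p + q) (i + j)"
  unfolding shuffle_symbols_def
  by (intro K_sum K_cmul)
     (use form_wedge_keys[OF P_cring shuffle_homs(1,2) assms] in \<open>simp add: K_def\<close>)

lemma shuffle_frag_K:
  assumes "c \<in> K p i" "c' \<in> K q j"
  shows "shuffle_frag p q c c' \<in> K (p + q) (i + j)"
  unfolding shuffle_frag_def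
  by (rule K_frag_extend[OF assms(1)], rule K_frag_extend[OF assms(2)], rule shuffle_symbols_K)

lemma shuffle_frag_null_right:
  assumes "c \<in> K p i" "c' \<in> Null q j"
  shows "shuffle_frag p q c c' \<in> Null (p + q) (i + j)"
  unfolding shuffle_frag_def
proof (rule Om.frag_extend_null)
  fix u assume "u \<in> Poly_Mapping.keys c"
  then have u: "u \<in> form_symbols (P p) i" using assms(1) by (auto simp: K_def)
  have fin: "finite {M. M \<subseteq> {..<p + q} \<and> card M = p}" by (rule finite_subset[of _ "Pow {..<p + q}"]) auto
  show "frag_extend (shuffle_symbols p q u) c' \<in> Null (p + q) (i + j)"
    unfolding shuffle_symbols_def frag_extend_sum_fun[OF fin] frag_extend_cmul_fun
    by (intro Om.form_null_sum Om.form_null_cmul form_wedge_null_right[where R = "P p" and R' = "P q" and \<sigma> = cst] P_cring)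
       (use u assms(2) shuffle_homs in auto)
qed

lemma shuffle_frag_null_left:
  assumes "c \<in> Null p i" "c' \<in> K q j"
  shows "shuffle_frag p q c c' \<in> Null (p + q) (i + j)"
  unfolding shuffle_frag_def frag_extend_swap[of "shuffle_symbols p q"]
proof (rule Om.frag_extend_null)
  fix v assume "v \<in> Poly_Mapping.keys c'"
  then have v: "v \<in> form_symbols (P q) j" using assms(2) by (auto simp: K_def)
  have fin: "finite {M. M \<subseteq> {..<p + q} \<and> card M = p}" by (rule finite_subset[of _ "Pow {..<p + q}"]) auto
  show "frag_extend (\<lambda>u. shuffle_symbols p q u v) c \<in> Null (p + q) (i + j)"
    unfolding shuffle_symbols_def frag_extend_sum_fun[OF fin] frag_extend_cmul_fun
    by (intro Om.form_null_sum Om.form_null_cmul form_wedge_null_left[where R = "P p" and R' = "P q" and \<sigma> = cst] P_cring)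
       (use v assms(1) shuffle_homs in auto)
qed

lemma shuffle_frag_diff_left: "shuffle_frag p q (a - b) c = shuffle_frag p q a c - shuffle_frag p q b c"
  by (simp add: shuffle_frag_def frag_extend_diff)

lemma shuffle_frag_diff_right: "shuffle_frag p q c (a - b) = shuffle_frag p q c a - shuffle_frag p q c b"
  by (simp add: shuffle_frag_def frag_extend_diff frag_extend_diff_fun)

lemma shuffle_C:
  assumes "c \<in> K p i" "c' \<in> K q j"
  shows "shuffle A B p i q j (C p i c) (C q j c') = C (p + q) (i + j) (shuffle_frag p q c c')"
proof -
  have eq: "frag_extend (\<lambda>(r, xs). frag_extend (\<lambda>(s, ys).
        \<Sum>M | M \<subseteq> {..<p + q} \<and> card M = p.
          let N = {..<p + q} - M;
              sN = degeneracies A B p (sorted_list_of_set N);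
              sM = degeneracies A B q (sorted_list_of_set M)
          in frag_cmul ((-1) ^ card {(m, n). m \<in> M \<and> n \<in> N \<and> n < m})
               (frag_of (sN r \<otimes>\<^bsub>P (p + q)\<^esub> sM s, map sN xs @ map sM ys))) e') e = shuffle_frag p q e e'" for e e'
    unfolding shuffle_frag_def shuffle_symbols_def form_wedge_def Let_def case_prod_unfold ..
  show ?thesis
    unfolding shuffle_def eq
  proof (rule quot_map2_eqI)
    fix e e' assume e: "e \<in> C p i c" and e': "e' \<in> C q j c'"
    have eK: "e \<in> K p i" using Om.cls_mem_keys[OF e] assms(1) by (simp add: K_def)
    have ec: "e - c \<in> Null p i" using Om.cls_memD[OF e] by (simp add: Om.cls_eq_iff)
    have ec': "e' - c' \<in> Null q j" using Om.cls_memD[OF e'] by (simp add: Om.cls_eq_iff)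
    \<comment> \<open>Representatives are changed one factor at a time: ee' - cc' = (e - c)c' + e(e'
      - c').\<close>
    have "shuffle_frag p q (e - c) c' + shuffle_frag p q e (e' - c') \<in> Null (p + q) (i + j)"
      using shuffle_frag_null_left[OF ec assms(2)] shuffle_frag_null_right[OF eK ec'] by (rule Om.form_null_add)
    then have "C (p + q) (i + j) (shuffle_frag p q e e') = C (p + q) (i + j) (shuffle_frag p q c c')"
      unfolding Om.cls_eq_iff shuffle_frag_diff_left shuffle_frag_diff_right by simp
    then show "Null (p + q) (i + j) #>\<^bsub>free_Abelian_group (form_symbols (P (p + q)) (i + j))\<^esub> shuffle_frag p q e e'
      = C (p + q) (i + j) (shuffle_frag p q c c')"
      by (simp add: Om.cls_def)
  qed (use Om.cls_self in blast)+
qed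

section \<open>The derived de Rham complex\<close>

abbreviation (input) L where "L \<equiv> L\<Omega> A B"
abbreviation (input) Hdg where "Hdg \<equiv> Hodge A B"

lemma \<Omega>_group: "group (case x of (n, i) \<Rightarrow> \<Omega>f n i)"
  by (cases x) (simp add: Om.forms_group)

lemma L_carrier:
  "\<omega> \<in> carrier (L k) \<longleftrightarrow> \<omega> \<in> extensional (bidegrees k) \<and>
    (\<forall>(n, i)\<in>bidegrees k. \<omega> (n, i) \<in> carrier (\<Omega>f n i)) \<and>
    finite {(n, i)\<in>bidegrees k. \<omega> (n, i) \<noteq> \<one>\<^bsub>\<Omega>f n i\<^esub>}"
  unfolding L\<Omega>_def carrier_sum_group[OF \<Omega>_group]
  by (auto simp: PiE_iff case_prod_unfold)

lemma L_closed: "\<lbrakk>\<omega> \<in> carrier (L k); (n, i) \<in> bidegrees k\<rbrakk> \<Longrightarrow> \<omega> (n, i) \<in> carrier (\<Omega>f n i)"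
  unfolding L_carrier by auto

lemma L_rep:
  assumes "\<omega> \<in> carrier (L k)" "(n, i) \<in> bidegrees k"
  obtains c where "c \<in> K n i" "\<omega> (n, i) = C n i c"
  using L_closed[OF assms] by (auto simp: \<Omega>_carrier)

lemma L_mult_apply: "(n, i) \<in> bidegrees k \<Longrightarrow> (\<omega> \<otimes>\<^bsub>L k\<^esub> \<eta>) (n, i) = \<omega> (n, i) \<otimes>\<^bsub>\<Omega>f n i\<^esub> \<eta> (n, i)"
  by (simp add: L\<Omega>_def)

lemma L_inv_apply:
  "\<lbrakk>\<omega> \<in> carrier (L k); (n, i) \<in> bidegrees k\<rbrakk> \<Longrightarrow> (inv\<^bsub>L k\<^esub> \<omega>) (n, i) = inv\<^bsub>\<Omega>f n i\<^esub> \<omega> (n, i)"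
  unfolding L\<Omega>_def by (subst inv_sum_group) (simp_all add: \<Omega>_group)

lemma L_one_apply: "(n, i) \<in> bidegrees k \<Longrightarrow> \<one>\<^bsub>L k\<^esub> (n, i) = \<one>\<^bsub>\<Omega>f n i\<^esub>"
  by (simp add: L\<Omega>_def)

lemma L_group: "group (L k)"
  unfolding L\<Omega>_def by (rule sum_group) (rule \<Omega>_group)

lemma L_ext:
  assumes "\<omega> \<in> carrier (L k)" "\<eta> \<in> carrier (L k)"
    "\<And>n i. (n, i) \<in> bidegrees k \<Longrightarrow> \<omega> (n, i) = \<eta> (n, i)"
  shows "\<omega> = \<eta>"
  by (rule extensionalityI[of _ "bidegrees k"]) (use assms in \<open>auto simp: L_carrier\<close>)

lemma L_comm_group: "comm_group (L k)"
proof (rule group.group_comm_groupI[OF L_group])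
  fix \<omega> \<eta> assume w: "\<omega> \<in> carrier (L k)" "\<eta> \<in> carrier (L k)"
  interpret L: group "L k" by (rule L_group)
  show "\<omega> \<otimes>\<^bsub>L k\<^esub> \<eta> = \<eta> \<otimes>\<^bsub>L k\<^esub> \<omega>"
  proof (rule L_ext)
    fix n i assume ni: "(n, i) \<in> bidegrees k"
    interpret O: comm_group "\<Omega>f n i" by (rule Om.forms_comm_group)
    show "(\<omega> \<otimes>\<^bsub>L k\<^esub> \<eta>) (n, i) = (\<eta> \<otimes>\<^bsub>L k\<^esub> \<omega>) (n, i)"
      using ni w L_closed[OF _ ni] by (simp add: L_mult_apply O.m_comm)
  qed (use w in auto)
qed

lemma Hodge_iff:
  "\<omega> \<in> Hdg j k \<longleftrightarrow> \<omega> \<in> carrier (L k) \<and>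
    (\<forall>n i. (n, i) \<in> bidegrees k \<longrightarrow> i < j \<longrightarrow> \<omega> (n, i) = \<one>\<^bsub>\<Omega>f n i\<^esub>)"
  by (simp add: Hodge_def Ball_def)

lemma Hodge_subgroup: "subgroup (Hdg j k) (L k)"
proof -
  interpret L: comm_group "L k" by (rule L_comm_group)
  show ?thesis
  proof (rule L.subgroupI)
    show "Hdg j k \<subseteq> carrier (L k)" by (auto simp: Hodge_def)
    have "\<one>\<^bsub>L k\<^esub> \<in> Hdg j k" by (simp add: Hodge_iff L_one_apply)
    then show "Hdg j k \<noteq> {}" by blast
    fix \<omega> assume "\<omega> \<in> Hdg j k"
    then show "inv\<^bsub>L k\<^esub> \<omega> \<in> Hdg j k"
      using monoid.inv_one[OF group.is_monoid[OF Om.forms_group]] by (simp add: Hodge_iff L_inv_apply)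
  next
    fix \<omega> \<eta> assume "\<omega> \<in> Hdg j k" "\<eta> \<in> Hdg j k"
    moreover have "\<one>\<^bsub>\<Omega>f n i\<^esub> \<otimes>\<^bsub>\<Omega>f n i\<^esub> \<one>\<^bsub>\<Omega>f n i\<^esub> = \<one>\<^bsub>\<Omega>f n i\<^esub>" for n i
      using monoid.l_one[OF group.is_monoid[OF Om.forms_group] monoid.one_closed[OF group.is_monoid[OF Om.forms_group]]] .
    ultimately show "\<omega> \<otimes>\<^bsub>L k\<^esub> \<eta> \<in> Hdg j k"
      by (simp add: Hodge_iff L_mult_apply)
  qed
qed

text \<open>A coset of F^j remembers exactly the components with \<open>i < j\<close>; all
  comparisons in the truncated complexes go through this.\<close>

lemma Hodge_coset_eq_iff:
  assumes "\<omega> \<in> carrier (L k)" "\<eta> \<in> carrier (L k)"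
  shows "Hdg j k #>\<^bsub>L k\<^esub> \<omega> = Hdg j k #>\<^bsub>L k\<^esub> \<eta> \<longleftrightarrow>
    (\<forall>n i. (n, i) \<in> bidegrees k \<longrightarrow> i < j \<longrightarrow> \<omega> (n, i) = \<eta> (n, i))"
proof -
  interpret L: comm_group "L k" by (rule L_comm_group)
  have "(\<omega> \<otimes>\<^bsub>L k\<^esub> inv\<^bsub>L k\<^esub> \<eta>) (n, i) = \<one>\<^bsub>\<Omega>f n i\<^esub> \<longleftrightarrow> \<omega> (n, i) = \<eta> (n, i)" if ni: "(n, i) \<in> bidegrees k" for n i
  proof -
    interpret O: comm_group "\<Omega>f n i" by (rule Om.forms_comm_group)
    show ?thesis
      using ni assms L_closed[OF _ ni] by (simp add: L_mult_apply L_inv_apply O.inv_solve_right')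
  qed
  then show ?thesis
    unfolding L.rcoset_eq_iff[OF Hodge_subgroup assms] using assms by (simp add: Hodge_iff)
qed

lemma Hodge_coset_mem:
  assumes "\<omega> \<in> carrier (L k)" "\<eta> \<in> Hdg j k #>\<^bsub>L k\<^esub> \<omega>"
  shows "\<eta> \<in> carrier (L k)" and "Hdg j k #>\<^bsub>L k\<^esub> \<eta> = Hdg j k #>\<^bsub>L k\<^esub> \<omega>"
proof -
  interpret L: comm_group "L k" by (rule L_comm_group)
  show "\<eta> \<in> carrier (L k)" using subgroup.elemrcos_carrier[OF Hodge_subgroup L_group assms] .
  show "Hdg j k #>\<^bsub>L k\<^esub> \<eta> = Hdg j k #>\<^bsub>L k\<^esub> \<omega>"
    using L.repr_independence[OF assms(2,1) Hodge_subgroup] ..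
qed

definition mk_chain where
  "mk_chain k T g = (\<lambda>(n, i)\<in>bidegrees k. if (n, i) \<in> T then C n i (g (n, i)) else \<one>\<^bsub>\<Omega>f n i\<^esub>)"

lemma mk_chain_closed:
  assumes "finite T" "\<And>n i. (n, i) \<in> T \<Longrightarrow> g (n, i) \<in> K n i"
  shows "mk_chain k T g \<in> carrier (L k)"
proof -
  have "finite {(n, i)\<in>bidegrees k. mk_chain k T g (n, i) \<noteq> \<one>\<^bsub>\<Omega>f n i\<^esub>}"
    by (rule finite_subset[OF _ assms(1)]) (auto simp: mk_chain_def split: if_splits)
  moreover have "\<one>\<^bsub>\<Omega>f n i\<^esub> \<in> carrier (\<Omega>f n i)" for n i
    using Om.forms_group group.is_monoid monoid.one_closed by blast
  ultimately show ?thesis unfolding L_carrier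
    by (auto simp: mk_chain_def \<Omega>_closed assms(2))
qed

lemma mk_chain_apply:
  "(n, i) \<in> bidegrees k \<Longrightarrow> mk_chain k T g (n, i) = (if (n, i) \<in> T then C n i (g (n, i)) else C n i 0)"
  by (simp add: mk_chain_def Om.forms_one)

lemma L_d_apply:
  assumes "(n, i) \<in> bidegrees (k - 1)" "\<omega> (Suc n, i) = C (Suc n) i a"
    and "a \<in> K (Suc n) i" "\<And>i'. i = Suc i' \<Longrightarrow> \<omega> (n, i') = C n i' (b i') \<and> b i' \<in> K n i'"
  shows "L\<Omega>_d A B f k \<omega> (n, i) =
    C n i (hd n a + (case i of 0 \<Rightarrow> 0 | Suc i' \<Rightarrow> frag_cmul ((-1) ^ n) (dR n (b i'))))"
proof (cases i)
  case 0
  interpret O: comm_group "\<Omega>f n 0" by (rule Om.forms_comm_group)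
  show ?thesis
    using assms \<Omega>_closed[OF hd_K[OF assms(3)]] by (simp add: L\<Omega>_d_def horizontal_d_C 0)
next
  case (Suc i')
  then show ?thesis
    using assms(1-3) assms(4)[OF Suc]
    by (simp add: L\<Omega>_d_def horizontal_d_C form_d_C \<Omega>_pow \<Omega>_mult dR_K hd_K K_cmul)
qed

lemma bidegrees_pred: "(n, i) \<in> bidegrees (k - 1) \<Longrightarrow> (Suc n, i) \<in> bidegrees k"
  "(n, Suc i) \<in> bidegrees (k - 1) \<Longrightarrow> (n, i) \<in> bidegrees k"
  by (auto simp: bidegrees_def)

lemma L_d_closed:
  assumes w: "\<omega> \<in> carrier (L k)" shows "L\<Omega>_d A B f k \<omega> \<in> carrier (L (k - 1))"
proof -
  have "\<forall>x\<in>bidegrees k. \<exists>c. c \<in> K (fst x) (snd x) \<and> \<omega> x = C (fst x) (snd x) c"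
    using w by (metis L_rep prod.collapse)
  then obtain g where g: "\<And>x. x \<in> bidegrees k \<Longrightarrow> g x \<in> K (fst x) (snd x) \<and> \<omega> x = C (fst x) (snd x) (g x)"
    by metis
  have d: "L\<Omega>_d A B f k \<omega> (n, i) =
    C n i (hd n (g (Suc n, i)) + (case i of 0 \<Rightarrow> 0 | Suc i' \<Rightarrow> frag_cmul ((-1) ^ n) (dR n (g (n, i')))))"
    if "(n, i) \<in> bidegrees (k - 1)" for n i
    using that g bidegrees_pred[of n _ k] by (intro L_d_apply) auto
  have dK: "hd n (g (Suc n, i)) + (case i of 0 \<Rightarrow> 0 | Suc i' \<Rightarrow> frag_cmul ((-1) ^ n) (dR n (g (n, i')))) \<in> K n i"
    if "(n, i) \<in> bidegrees (k - 1)" for n i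
    using that g[of "(Suc n, i)"] g[of "(n, i - 1)"] bidegrees_pred[of n _ k]
    by (intro K_add) (auto intro!: hd_K K_cmul dR_K K_zero split: nat.splits)
  let ?T = "{(n, i)\<in>bidegrees k. \<omega> (n, i) \<noteq> \<one>\<^bsub>\<Omega>f n i\<^esub>}"
  have fin: "finite ?T" using w by (simp add: L_carrier)
  \<comment> \<open>A nontrivial component of the differential at (n, i) requires a nontrivial
    component of \<omega> at (n + 1, i) or (n, i - 1). This bounds the support and gives the
    direct-sum condition.\<close>
  have one: "L\<Omega>_d A B f k \<omega> (n, i) = \<one>\<^bsub>\<Omega>f n i\<^esub>"
    if ni: "(n, i) \<in> bidegrees (k - 1)" and "(Suc n, i) \<notin> ?T" "\<And>i'. i = Suc i' \<Longrightarrow> (n, i') \<notin> ?T" for n i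
  proof -
    have "L\<Omega>_d A B f k \<omega> (n, i) = C n i (hd n 0 + (case i of 0 \<Rightarrow> 0 | Suc i' \<Rightarrow> frag_cmul ((-1) ^ n) (dR n 0)))"
      using that bidegrees_pred[of n _ k] by (intro L_d_apply) (auto simp: Om.forms_one K_zero)
    then show ?thesis by (simp add: hd_def dR_def Om.forms_one split: nat.splits)
  qed
  have "finite {(n, i)\<in>bidegrees (k - 1). L\<Omega>_d A B f k \<omega> (n, i) \<noteq> \<one>\<^bsub>\<Omega>f n i\<^esub>}"
  proof (rule finite_subset)
    show "{(n, i)\<in>bidegrees (k - 1). L\<Omega>_d A B f k \<omega> (n, i) \<noteq> \<one>\<^bsub>\<Omega>f n i\<^esub>}
      \<subseteq> (\<lambda>(n, i). (n - 1, i)) ` ?T \<union> (\<lambda>(n, i). (n, Suc i)) ` ?T"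
    proof (rule subsetI)
      fix x assume "x \<in> {(n, i)\<in>bidegrees (k - 1). L\<Omega>_d A B f k \<omega> (n, i) \<noteq> \<one>\<^bsub>\<Omega>f n i\<^esub>}"
      then obtain n i where x: "x = (n, i)" and ni: "(n, i) \<in> bidegrees (k - 1)"
        "L\<Omega>_d A B f k \<omega> (n, i) \<noteq> \<one>\<^bsub>\<Omega>f n i\<^esub>" by auto
      then have "(Suc n, i) \<in> ?T \<or> (\<exists>i'. i = Suc i' \<and> (n, i') \<in> ?T)" using one by blast
      then show "x \<in> (\<lambda>(n, i). (n - 1, i)) ` ?T \<union> (\<lambda>(n, i). (n, Suc i)) ` ?T"
        unfolding x
      proof
        assume "(Suc n, i) \<in> ?T"
        then have "(n, i) \<in> (\<lambda>(n, i). (n - 1, i)) ` ?T" by (intro image_eqI[of _ _ "(Suc n, i)"]) simp_all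
        then show "(n, i) \<in> (\<lambda>(n, i). (n - 1, i)) ` ?T \<union> (\<lambda>(n, i). (n, Suc i)) ` ?T" ..
      next
        assume "\<exists>i'. i = Suc i' \<and> (n, i') \<in> ?T"
        then obtain i' where "i = Suc i'" "(n, i') \<in> ?T" by blast
        then have "(n, i) \<in> (\<lambda>(n, i). (n, Suc i)) ` ?T" by (intro image_eqI[of _ _ "(n, i')"]) simp_all
        then show "(n, i) \<in> (\<lambda>(n, i). (n - 1, i)) ` ?T \<union> (\<lambda>(n, i). (n, Suc i)) ` ?T" ..
      qed
    qed
  qed (use fin in simp)
  moreover have "L\<Omega>_d A B f k \<omega> \<in> extensional (bidegrees (k - 1))" by (simp add: L\<Omega>_d_def)
  moreover have "L\<Omega>_d A B f k \<omega> (n, i) \<in> carrier (\<Omega>f n i)" if "(n, i) \<in> bidegrees (k - 1)" for n i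
    unfolding d[OF that] by (rule \<Omega>_closed[OF dK[OF that]])
  ultimately show ?thesis unfolding L_carrier by blast
qed

text \<open>The faces preserve the form degree and d raises it, so components of the differential of
  form degree below \<open>j\<close> depend only on components of form degree below
  \<open>j\<close>.\<close>

lemma quot_d_coset:
  assumes w: "\<omega> \<in> carrier (L k)"
  shows "L\<Omega>_quot_d A B f j k (Hdg j k #>\<^bsub>L k\<^esub> \<omega>) = Hdg j (k - 1) #>\<^bsub>L (k - 1)\<^esub> L\<Omega>_d A B f k \<omega>"
  unfolding L\<Omega>_quot_d_def
proof (rule quot_map_eqI)
  interpret L: comm_group "L k" by (rule L_comm_group)
  show "Hdg j k #>\<^bsub>L k\<^esub> \<omega> \<noteq> {}" using L.rcos_self[OF w Hodge_subgroup] by blast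
  fix \<eta> assume e: "\<eta> \<in> Hdg j k #>\<^bsub>L k\<^esub> \<omega>"
  note e' = Hodge_coset_mem[OF w e]
  have "\<eta> (n, i) = \<omega> (n, i)" if "(n, i) \<in> bidegrees k" "i < j" for n i
    using e'(2) that unfolding Hodge_coset_eq_iff[OF e'(1) w] by blast
  then have "L\<Omega>_d A B f k \<eta> (n, i) = L\<Omega>_d A B f k \<omega> (n, i)" if "(n, i) \<in> bidegrees (k - 1)" "i < j" for n i
    using that bidegrees_pred[of n _ k] by (auto simp: L\<Omega>_d_def split: nat.splits)
  then show "Hdg j (k - 1) #>\<^bsub>L (k - 1)\<^esub> L\<Omega>_d A B f k \<eta> = Hdg j (k - 1) #>\<^bsub>L (k - 1)\<^esub> L\<Omega>_d A B f k \<omega>"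
    using Hodge_coset_eq_iff[OF L_d_closed[OF e'(1)] L_d_closed[OF w]] by blast
qed

abbreviation (input) pairs :: "nat \<Rightarrow> nat \<Rightarrow> ((nat \<times> nat) \<times> (nat \<times> nat)) set" where
  "pairs n i \<equiv> {((p, a), (q, b)). (p, a) \<in> bidegrees 0 \<and> (q, b) \<in> bidegrees 0 \<and> p + q = n \<and> a + b = i}"

lemma L_mult_term:
  assumes w: "\<omega> \<in> carrier (L 0)" and e: "\<eta> \<in> carrier (L 0)"
    and "((p, a), (q, b)) \<in> pairs n i"
  shows "shuffle A B p a q b (\<omega> (p, a)) (\<eta> (q, b)) [^]\<^bsub>\<Omega>f n i\<^esub> ((-1) ^ (a * q) :: int) \<in> carrier (\<Omega>f n i)"
proof -
  have 1: "(p, a) \<in> bidegrees 0" "(q, b) \<in> bidegrees 0" "n = p + q" "i = a + b" using assms(3) by auto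
  obtain c where c: "c \<in> K p a" "\<omega> (p, a) = C p a c" using L_rep[OF w 1(1)] .
  obtain c' where c': "c' \<in> K q b" "\<eta> (q, b) = C q b c'" using L_rep[OF e 1(2)] .
  show ?thesis unfolding 1(3,4)
    using c c' by (simp add: shuffle_C \<Omega>_pow shuffle_frag_K \<Omega>_closed K_cmul)
qed

lemma L_mult_closed:
  assumes w: "\<omega> \<in> carrier (L 0)" and e: "\<eta> \<in> carrier (L 0)"
  shows "L\<Omega>_mult A B 0 0 \<omega> \<eta> \<in> carrier (L 0)"
proof -
  have "finite {(n, i)\<in>bidegrees 0. \<omega> (n, i) \<noteq> \<one>\<^bsub>\<Omega>f n i\<^esub>}" (is "finite ?T")
    and "finite {(n, i)\<in>bidegrees 0. \<eta> (n, i) \<noteq> \<one>\<^bsub>\<Omega>f n i\<^esub>}" (is "finite ?U")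
    using w e by (auto simp: L_carrier)
  then have "finite (fst ` ?T)" "finite (fst ` ?U)" by blast+
  then obtain t u where t: "\<forall>x\<in>fst ` ?T. x \<le> t" and u: "\<forall>x\<in>fst ` ?U. x \<le> u"
    by (meson finite_nat_set_iff_bounded_le)
  \<comment> \<open>\<open>t\<close> and \<open>u\<close> bound the column indices in the two
    supports, and the product adds column indices. In total degree 0 the column index equals the
    form degree, so bounding one bounds both.\<close>
  have one: "L\<Omega>_mult A B 0 0 \<omega> \<eta> (n, i) = \<one>\<^bsub>\<Omega>f n i\<^esub>" if ni: "(n, i) \<in> bidegrees 0" "n > t + u" for n i
  proof -
    interpret O: comm_group "\<Omega>f n i" by (rule Om.forms_comm_group)
    have "shuffle A B p a q b (\<omega> (p, a)) (\<eta> (q, b)) [^]\<^bsub>\<Omega>f n i\<^esub> ((-1) ^ (a * q) :: int) = \<one>\<^bsub>\<Omega>f n i\<^esub>"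
      if "((p, a), (q, b)) \<in> pairs n i" for p a q b
    proof -
      have 1: "(p, a) \<in> bidegrees 0" "(q, b) \<in> bidegrees 0" "n = p + q" "i = a + b" using that by auto
      obtain c where c: "c \<in> K p a" "\<omega> (p, a) = C p a c" using L_rep[OF w 1(1)] .
      obtain c' where c': "c' \<in> K q b" "\<eta> (q, b) = C q b c'" using L_rep[OF e 1(2)] .
      have "p > t \<or> q > u" using ni(2) 1(3) by linarith
      moreover have "p \<le> t" if "(p, a) \<in> ?T" using bspec[OF t image_eqI[OF _ that]] by simp
      moreover have "q \<le> u" if "(q, b) \<in> ?U" using bspec[OF u image_eqI[OF _ that]] by simp
      ultimately have "(p, a) \<notin> ?T \<or> (q, b) \<notin> ?U" by linarith
      then have "\<omega> (p, a) = C p a 0 \<or> \<eta> (q, b) = C q b 0"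
        using 1(1,2) by (simp add: Om.forms_one)
      then have "shuffle A B p a q b (\<omega> (p, a)) (\<eta> (q, b)) = C (p + q) (a + b) 0"
        using shuffle_C[OF K_zero c'(1), of p a] shuffle_C[OF c(1) K_zero, of q b] c(2) c'(2)
        by (auto simp: shuffle_frag_def frag_extend_eq_0)
      then show ?thesis using 1 by (simp add: \<Omega>_pow K_zero Om.forms_one)
    qed
    then have "finprod (\<Omega>f n i) (\<lambda>((p, a), (q, b)).
         shuffle A B p a q b (\<omega> (p, a)) (\<eta> (q, b)) [^]\<^bsub>\<Omega>f n i\<^esub> ((-1) ^ (a * q) :: int)) (pairs n i) = \<one>\<^bsub>\<Omega>f n i\<^esub>"
      by (intro O.finprod_one_eqI) auto
    then show ?thesis using ni by (simp add: L\<Omega>_mult_def)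
  qed
  have "finite {(n, i)\<in>bidegrees 0. L\<Omega>_mult A B 0 0 \<omega> \<eta> (n, i) \<noteq> \<one>\<^bsub>\<Omega>f n i\<^esub>}"
  proof (rule finite_subset)
    show "{(n, i)\<in>bidegrees 0. L\<Omega>_mult A B 0 0 \<omega> \<eta> (n, i) \<noteq> \<one>\<^bsub>\<Omega>f n i\<^esub>} \<subseteq> {..t + u} \<times> {..t + u}"
    proof (rule subsetI)
      fix x assume "x \<in> {(n, i)\<in>bidegrees 0. L\<Omega>_mult A B 0 0 \<omega> \<eta> (n, i) \<noteq> \<one>\<^bsub>\<Omega>f n i\<^esub>}"
      then obtain n i where x: "x = (n, i)" "(n, i) \<in> bidegrees 0"
        "L\<Omega>_mult A B 0 0 \<omega> \<eta> (n, i) \<noteq> \<one>\<^bsub>\<Omega>f n i\<^esub>" by blast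
      then have "n \<le> t + u" using one not_less by blast
      then show "x \<in> {..t + u} \<times> {..t + u}" using x by (simp add: bidegrees_def)
    qed
  qed simp
  moreover have "L\<Omega>_mult A B 0 0 \<omega> \<eta> (n, i) \<in> carrier (\<Omega>f n i)" if "(n, i) \<in> bidegrees 0" for n i
  proof -
    interpret O: comm_group "\<Omega>f n i" by (rule Om.forms_comm_group)
    have "finprod (\<Omega>f n i) (\<lambda>((p, a), (q, b)).
         shuffle A B p a q b (\<omega> (p, a)) (\<eta> (q, b)) [^]\<^bsub>\<Omega>f n i\<^esub> ((-1) ^ (a * q) :: int)) (pairs n i) \<in> carrier (\<Omega>f n i)"
      using L_mult_term[OF w e] by (intro O.finprod_closed) (auto simp: Pi_def)
    then show ?thesis using that by (simp add: L\<Omega>_mult_def)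
  qed
  moreover have "L\<Omega>_mult A B 0 0 \<omega> \<eta> \<in> extensional (bidegrees 0)" by (simp add: L\<Omega>_mult_def)
  ultimately show ?thesis unfolding L_carrier by blast
qed

text \<open>A summand of the component of form degree \<open>i\<close> uses form degrees with
  \<open>a + b = i\<close>; if \<open>i < j\<close>, both lie below \<open>j\<close>.\<close>

lemma quot_mult_coset:
  assumes w: "\<omega> \<in> carrier (L 0)" and e: "\<eta> \<in> carrier (L 0)"
  shows "L\<Omega>_quot_mult A B j 0 0 (Hdg j 0 #>\<^bsub>L 0\<^esub> \<omega>) (Hdg j 0 #>\<^bsub>L 0\<^esub> \<eta>)
    = Hdg j 0 #>\<^bsub>L 0\<^esub> L\<Omega>_mult A B 0 0 \<omega> \<eta>"
  unfolding L\<Omega>_quot_mult_def add_0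
proof (rule quot_map2_eqI)
  interpret L: comm_group "L 0" by (rule L_comm_group)
  show "Hdg j 0 #>\<^bsub>L 0\<^esub> \<omega> \<noteq> {}" using L.rcos_self[OF w Hodge_subgroup] by blast
  show "Hdg j 0 #>\<^bsub>L 0\<^esub> \<eta> \<noteq> {}" using L.rcos_self[OF e Hodge_subgroup] by blast
  fix \<omega>' \<eta>' assume w': "\<omega>' \<in> Hdg j 0 #>\<^bsub>L 0\<^esub> \<omega>" and e': "\<eta>' \<in> Hdg j 0 #>\<^bsub>L 0\<^esub> \<eta>"
  note w'' = Hodge_coset_mem[OF w w'] and e'' = Hodge_coset_mem[OF e e']
  have eqw: "\<omega>' (n, i) = \<omega> (n, i)" if "(n, i) \<in> bidegrees 0" "i < j" for n i
    using w''(2) that unfolding Hodge_coset_eq_iff[OF w''(1) w] by blast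
  have eqe: "\<eta>' (n, i) = \<eta> (n, i)" if "(n, i) \<in> bidegrees 0" "i < j" for n i
    using e''(2) that unfolding Hodge_coset_eq_iff[OF e''(1) e] by blast
  have "L\<Omega>_mult A B 0 0 \<omega>' \<eta>' (n, i) = L\<Omega>_mult A B 0 0 \<omega> \<eta> (n, i)" if "(n, i) \<in> bidegrees 0" "i < j" for n i
  proof -
    interpret O: comm_group "\<Omega>f n i" by (rule Om.forms_comm_group)
    have key: "\<omega>' (p, a) = \<omega> (p, a)" "\<eta>' (q, b) = \<eta> (q, b)" if "((p, a), (q, b)) \<in> pairs n i" for p a q b
      using that \<open>i < j\<close> eqw[of p a] eqe[of q b] by simp_all
    have "finprod (\<Omega>f n i) (\<lambda>((p, a), (q, b)).
         shuffle A B p a q b (\<omega>' (p, a)) (\<eta>' (q, b)) [^]\<^bsub>\<Omega>f n i\<^esub> ((-1) ^ (a * q) :: int)) (pairs n i)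
      = finprod (\<Omega>f n i) (\<lambda>((p, a), (q, b)).
         shuffle A B p a q b (\<omega> (p, a)) (\<eta> (q, b)) [^]\<^bsub>\<Omega>f n i\<^esub> ((-1) ^ (a * q) :: int)) (pairs n i)"
    proof (rule O.finprod_cong')
      show "(\<lambda>((p, a), (q, b)). shuffle A B p a q b (\<omega> (p, a)) (\<eta> (q, b)) [^]\<^bsub>\<Omega>f n i\<^esub> ((-1) ^ (a * q) :: int))
          \<in> pairs n i \<rightarrow> carrier (\<Omega>f n i)"
        using L_mult_term[OF w e] by (auto simp: Pi_def)
    qed (use key in auto)
    then show ?thesis using that by (simp add: L\<Omega>_mult_def)
  qed
  then show "Hdg j 0 #>\<^bsub>L 0\<^esub> L\<Omega>_mult A B 0 0 \<omega>' \<eta>' = Hdg j 0 #>\<^bsub>L 0\<^esub> L\<Omega>_mult A B 0 0 \<omega> \<eta>"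
    using Hodge_coset_eq_iff[OF L_mult_closed[OF w''(1) e''(1)] L_mult_closed[OF w e]] by blast
qed

end

text \<open>The additive extension of \<phi> to the free abelian group, with values in any additive
  group; \<open>frag_extend\<close> has only free groups as targets. The formula is the one inside
  \<open>L\<Omega>_augmentation\<close>.\<close>

definition frag_lift :: "('g, 'k) ring_scheme \<Rightarrow> ('x \<Rightarrow> 'g) \<Rightarrow> ('x \<Rightarrow>\<^sub>0 int) \<Rightarrow> 'g" where
  "frag_lift M \<phi> c = (\<Oplus>\<^bsub>M\<^esub>s\<in>Poly_Mapping.keys c. [Poly_Mapping.lookup c s] \<cdot>\<^bsub>M\<^esub> \<phi> s)"

context abelian_group
begin

lemma frag_lift_superset:
  assumes "finite T" "Poly_Mapping.keys c \<subseteq> T" "\<And>x. x \<in> T \<Longrightarrow> \<phi> x \<in> carrier G"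
  shows "frag_lift G \<phi> c = (\<Oplus>s\<in>T. [Poly_Mapping.lookup c s] \<cdot> \<phi> s)"
  unfolding frag_lift_def
proof (rule add.finprod_mono_neutral_cong_left)
  show "[Poly_Mapping.lookup c i] \<cdot> \<phi> i = \<zero>" if "i \<in> T - Poly_Mapping.keys c" for i
    using that by (simp add: in_keys_iff add_pow_def)
qed (use assms in auto)

lemma frag_lift_closed:
  assumes "\<And>x. x \<in> Poly_Mapping.keys c \<Longrightarrow> \<phi> x \<in> carrier G"
  shows "frag_lift G \<phi> c \<in> carrier G"
  unfolding frag_lift_def using assms by (intro finsum_closed) auto

lemma frag_lift_add:
  assumes "Poly_Mapping.keys a \<subseteq> S" "Poly_Mapping.keys b \<subseteq> S" "\<And>x. x \<in> S \<Longrightarrow> \<phi> x \<in> carrier G"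
  shows "frag_lift G \<phi> (a + b) = frag_lift G \<phi> a \<oplus> frag_lift G \<phi> b"
proof -
  let ?T = "Poly_Mapping.keys a \<union> Poly_Mapping.keys b"
  have T: "finite ?T" "Poly_Mapping.keys a \<subseteq> ?T" "Poly_Mapping.keys b \<subseteq> ?T" "Poly_Mapping.keys (a + b) \<subseteq> ?T"
    using Poly_Mapping.keys_add[of a b] by auto
  have \<phi>: "\<phi> x \<in> carrier G" if "x \<in> ?T" for x using that assms by auto
  have "frag_lift G \<phi> (a + b) = (\<Oplus>s\<in>?T. [Poly_Mapping.lookup (a + b) s] \<cdot> \<phi> s)"
    using T \<phi> by (intro frag_lift_superset) auto
  also have "\<dots> = (\<Oplus>s\<in>?T. [Poly_Mapping.lookup a s] \<cdot> \<phi> s \<oplus> [Poly_Mapping.lookup b s] \<cdot> \<phi> s)"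
    using \<phi> by (intro finsum_cong') (auto simp: lookup_add add.int_pow_mult)
  also have "\<dots> = (\<Oplus>s\<in>?T. [Poly_Mapping.lookup a s] \<cdot> \<phi> s) \<oplus> (\<Oplus>s\<in>?T. [Poly_Mapping.lookup b s] \<cdot> \<phi> s)"
    using \<phi> by (intro finsum_addf) auto
  also have "(\<Oplus>s\<in>?T. [Poly_Mapping.lookup a s] \<cdot> \<phi> s) = frag_lift G \<phi> a"
    using T \<phi> by (intro frag_lift_superset[symmetric]) auto
  also have "(\<Oplus>s\<in>?T. [Poly_Mapping.lookup b s] \<cdot> \<phi> s) = frag_lift G \<phi> b"
    using T \<phi> by (intro frag_lift_superset[symmetric]) auto
  finally show ?thesis .
qed

lemma frag_lift_of: "\<phi> x \<in> carrier G \<Longrightarrow> frag_lift G \<phi> (frag_of x) = \<phi> x"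
  using add.finprod_insert[of "{}" x "\<lambda>s. [Poly_Mapping.lookup (frag_of x) s] \<cdot> \<phi> s"]
  by (simp add: frag_lift_def Pi_def)

lemma frag_lift_zero: "frag_lift G \<phi> 0 = \<zero>"
  by (simp add: frag_lift_def)

lemma frag_lift_minus:
  assumes "Poly_Mapping.keys a \<subseteq> S" "\<And>x. x \<in> S \<Longrightarrow> \<phi> x \<in> carrier G"
  shows "frag_lift G \<phi> (- a) = \<ominus> frag_lift G \<phi> a"
proof -
  have "frag_lift G \<phi> (- a) \<oplus> frag_lift G \<phi> a = \<zero>"
    using frag_lift_add[of "- a" S a \<phi>] assms by (simp add: frag_lift_zero)
  moreover have "frag_lift G \<phi> (- a) \<in> carrier G" "frag_lift G \<phi> a \<in> carrier G"
    using assms by (auto intro!: frag_lift_closed)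
  ultimately show ?thesis by (simp add: minus_equality)
qed

lemma frag_lift_diff:
  assumes "Poly_Mapping.keys a \<subseteq> S" "Poly_Mapping.keys b \<subseteq> S" "\<And>x. x \<in> S \<Longrightarrow> \<phi> x \<in> carrier G"
  shows "frag_lift G \<phi> (a - b) = frag_lift G \<phi> a \<ominus> frag_lift G \<phi> b"
  using frag_lift_add[of a S "- b" \<phi>] frag_lift_minus[of b S \<phi>] assms by (simp add: minus_eq)

end

lemma (in form_ring) frag_lift_null:
  assumes "abelian_group M" "c \<in> N i" "\<And>u. u \<in> form_symbols R i \<Longrightarrow> \<phi> u \<in> carrier M"
    and "\<And>c. c \<in> form_relations A R \<sigma> i \<Longrightarrow> frag_lift M \<phi> c = \<zero>\<^bsub>M\<^esub>"
  shows "frag_lift M \<phi> c = \<zero>\<^bsub>M\<^esub>"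
proof -
  interpret M: abelian_group M by fact
  show ?thesis
    using assms(2)
  proof (rule form_null_induct)
    fix c c' assume "c \<in> N i" "c' \<in> N i" "frag_lift M \<phi> c = \<zero>\<^bsub>M\<^esub>" "frag_lift M \<phi> c' = \<zero>\<^bsub>M\<^esub>"
    then show "frag_lift M \<phi> (c - c') = \<zero>\<^bsub>M\<^esub>"
      using M.frag_lift_diff[of c "form_symbols R i" c' \<phi>] form_null_keys assms(3) by (simp add: M.minus_eq)
  qed (use assms(4) M.frag_lift_zero in auto)
qed

section \<open>One-forms and scalar multiplication on chains\<close>

context form_ring
begin

abbreviation (input) dx :: "'r \<Rightarrow> 'r \<Rightarrow> 'r form_chain" where
  "dx r x \<equiv> frag_of (r, [x])"

lemma dx_add_left: "\<lbrakk>r \<in> carrier R; s \<in> carrier R; x \<in> carrier R\<rbrakk> \<Longrightarrow> dx (r \<oplus> s) x - dx r x - dx s x \<in> N (Suc 0)"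
  by (intro form_null_relation form_relations.coeff_add) (auto simp: form_symbols_def)

lemma dx_add_right: "\<lbrakk>r \<in> carrier R; x \<in> carrier R; y \<in> carrier R\<rbrakk> \<Longrightarrow> dx r (x \<oplus> y) - dx r x - dx r y \<in> N (Suc 0)"
  using form_null_relation[OF form_relations.d_add[of r "[]" x "[]" R "Suc 0" y]] by (auto simp: form_symbols_def)

lemma dx_mult: "\<lbrakk>r \<in> carrier R; x \<in> carrier R; y \<in> carrier R\<rbrakk> \<Longrightarrow>
    dx r (x \<otimes> y) - dx (r \<otimes> x) y - dx (r \<otimes> y) x \<in> N (Suc 0)"
  using form_null_relation[OF form_relations.d_mult[of r "[]" x "[]" R "Suc 0" y]] by (auto simp: form_symbols_def)

lemma dx_const: "\<lbrakk>r \<in> carrier R; a \<in> carrier A; \<sigma> a \<in> carrier R\<rbrakk> \<Longrightarrow> dx r (\<sigma> a) \<in> N (Suc 0)"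
  using form_null_relation[OF form_relations.d_const[of r "[]" \<sigma> a "[]" R "Suc 0" A]] by (auto simp: form_symbols_def)

lemma dx_zero_right: "r \<in> carrier R \<Longrightarrow> dx r \<zero> \<in> N (Suc 0)"
  using form_null_minus[OF dx_add_right[of r \<zero> \<zero>]] by simp

lemma dx_diff_left:
  assumes "r \<in> carrier R" "s \<in> carrier R" "x \<in> carrier R"
  shows "dx (r \<ominus> s) x - (dx r x - dx s x) \<in> N (Suc 0)"
proof -
  have "(r \<ominus> s) \<oplus> s = r" using assms by (simp add: R.minus_eq R.a_assoc R.l_neg)
  then show ?thesis using form_null_minus[OF dx_add_left[of "r \<ominus> s" s x]] assms by (simp add: algebra_simps)
qed

lemma dx_diff_right:
  assumes "r \<in> carrier R" "x \<in> carrier R" "y \<in> carrier R"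
  shows "dx r (x \<ominus> y) - (dx r x - dx r y) \<in> N (Suc 0)"
proof -
  have "(x \<ominus> y) \<oplus> y = x" using assms by (simp add: R.minus_eq R.a_assoc R.l_neg)
  then show ?thesis using form_null_minus[OF dx_add_right[of r "x \<ominus> y" y]] assms by (simp add: algebra_simps)
qed

definition smul :: "'r \<Rightarrow> 'r form_chain \<Rightarrow> 'r form_chain" where
  "smul a = frag_extend (\<lambda>(t, ys). frag_of (a \<otimes> t, ys))"

lemma smul_of [simp]: "smul a (frag_of (t, ys)) = frag_of (a \<otimes> t, ys)"
  by (simp add: smul_def)

lemma smul_add: "smul a (c + c') = smul a c + smul a c'"
  and smul_diff: "smul a (c - c') = smul a c - smul a c'"
  and smul_zero [simp]: "smul a 0 = 0"
  by (simp_all add: smul_def frag_extend_add frag_extend_diff)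

lemma smul_keys:
  "\<lbrakk>a \<in> carrier R; Poly_Mapping.keys c \<subseteq> form_symbols R i\<rbrakk> \<Longrightarrow> Poly_Mapping.keys (smul a c) \<subseteq> form_symbols R i"
  unfolding smul_def by (erule frag_extend_keys) (auto simp: form_symbols_def)

text \<open>Multiplication by \<open>a\<close> is the exterior product with the zero-form
  \<open>a\<close>, for which the relations have already been treated.\<close>

lemma smul_null:
  assumes a: "a \<in> carrier R" and c: "c \<in> N i"
  shows "smul a c \<in> N i"
proof -
  have "frag_extend (form_wedge R id id (a, [])) c \<in> form_null A R \<sigma> (0 + i)"
    by (rule form_wedge_null_right[OF R.cring_axioms R.cring_axioms id_ring_hom id_ring_hom _ _ c])
       (use a in \<open>auto simp: form_symbols_def\<close>)
  then show ?thesis by (simp add: smul_def form_wedge_def)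
qed

text \<open>On chains \<open>smul\<close> is exactly additive in the chain, but in the scalar only
  modulo the relations \<open>coeff_add\<close>. This is why several ring laws below hold for
  classes and not for representatives.\<close>

lemma smul_add_left:
  assumes "a \<in> carrier R" "b \<in> carrier R" "Poly_Mapping.keys c \<subseteq> form_symbols R i"
  shows "smul (a \<oplus> b) c - (smul a c + smul b c) \<in> N i"
  unfolding smul_def frag_extend_plus_fun[symmetric] frag_extend_diff_fun[symmetric]
proof (rule frag_extend_null)
  fix u assume "u \<in> Poly_Mapping.keys c"
  then obtain t ys where u: "u = (t, ys)" "t \<in> carrier R" "(t, ys) \<in> form_symbols R i"
    using assms(3) by (auto simp: form_symbols_def)
  have "frag_of (a \<otimes> t \<oplus> b \<otimes> t, ys) - frag_of (a \<otimes> t, ys) - frag_of (b \<otimes> t, ys) \<in> N i"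
    using u assms by (intro form_null_relation form_relations.coeff_add) (auto simp: form_symbols_def)
  then show "(case u of (t, ys) \<Rightarrow> frag_of ((a \<oplus> b) \<otimes> t, ys)) -
      ((case u of (t, ys) \<Rightarrow> frag_of (a \<otimes> t, ys)) + (case u of (t, ys) \<Rightarrow> frag_of (b \<otimes> t, ys))) \<in> N i"
    using u assms by (simp add: R.l_distr diff_diff_eq)
qed

lemma smul_diff_left:
  assumes "a \<in> carrier R" "b \<in> carrier R" "Poly_Mapping.keys c \<subseteq> form_symbols R i"
  shows "smul (a \<ominus> b) c - (smul a c - smul b c) \<in> N i"
proof -
  have "(a \<ominus> b) \<oplus> b = a" using assms by (simp add: R.minus_eq R.a_assoc R.l_neg)
  then show ?thesis using form_null_minus[OF smul_add_left[of "a \<ominus> b" b c i]] assms by (simp add: algebra_simps)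
qed

lemma smul_eqI:
  assumes "Poly_Mapping.keys c \<subseteq> form_symbols R i"
    and "\<And>t ys. (t, ys) \<in> form_symbols R i \<Longrightarrow> g (t, ys) = h (t, ys)"
  shows "frag_extend g c = frag_extend h c"
  using assms by (intro frag_extend_eq) auto

lemma smul_assoc:
  assumes "a \<in> carrier R" "b \<in> carrier R" "Poly_Mapping.keys c \<subseteq> form_symbols R i"
  shows "smul (a \<otimes> b) c = smul a (smul b c)"
  unfolding smul_def frag_extend_compose'
  using assms by (intro smul_eqI[OF assms(3)]) (auto simp: form_symbols_def R.m_assoc)

lemma smul_one:
  assumes "Poly_Mapping.keys c \<subseteq> form_symbols R i"
  shows "smul \<one> c = c"
proof -
  have "smul \<one> c = frag_extend frag_of c"
    unfolding smul_def by (intro smul_eqI[OF assms]) (auto simp: form_symbols_def)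
  then show ?thesis by (simp flip: frag_expansion)
qed

lemma smul_zero_left:
  assumes "Poly_Mapping.keys c \<subseteq> form_symbols R i"
  shows "smul \<zero> c \<in> N i"
  using form_null_minus[OF smul_add_left[of \<zero> \<zero> c i]] assms by simp

end

lemma form_pullback_of [simp]: "form_pullback g (frag_of (r, xs)) = frag_of (g r, map g xs)"
  by (simp add: form_pullback_def)

lemma form_pullback_add: "form_pullback g (c + c') = form_pullback g c + form_pullback g c'"
  and form_pullback_diff: "form_pullback g (c - c') = form_pullback g c - form_pullback g c'"
  and form_pullback_zero [simp]: "form_pullback g 0 = 0"
  by (simp_all add: form_pullback_def frag_extend_add frag_extend_diff)

lemma form_pullback_eqI:
  assumes "Poly_Mapping.keys c \<subseteq> form_symbols R i" "\<And>x. x \<in> carrier R \<Longrightarrow> g x = h x"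
  shows "form_pullback g c = form_pullback h c"
  unfolding form_pullback_def
proof (rule frag_extend_eq)
  fix u assume "u \<in> Poly_Mapping.keys c"
  then obtain r xs where "u = (r, xs)" "r \<in> carrier R" "set xs \<subseteq> carrier R"
    using assms(1) by (auto simp: form_symbols_def)
  moreover from this have "map g xs = map h xs" using assms(2) by auto
  ultimately show "(case u of (r, xs) \<Rightarrow> frag_of (g r, map g xs)) = (case u of (r, xs) \<Rightarrow> frag_of (h r, map h xs))"
    using assms(2) by (simp del: map_eq_conv)
qed

lemma form_pullback_comp: "form_pullback g (form_pullback h c) = form_pullback (\<lambda>x. g (h x)) c"
  unfolding form_pullback_def frag_extend_compose' by (simp add: case_prod_unfold comp_def)

lemma form_pullback_ident:
  assumes "Poly_Mapping.keys c \<subseteq> form_symbols R i" "\<And>x. x \<in> carrier R \<Longrightarrow> g x = x"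
  shows "form_pullback g c = c"
proof -
  have "form_pullback g c = form_pullback (\<lambda>x. x) c" using form_pullback_eqI[OF assms(1)] assms(2) .
  also have "\<dots> = c" by (simp add: form_pullback_def case_prod_unfold flip: frag_expansion)
  finally show ?thesis .
qed

lemma form_pullback_smul:
  assumes "cring R" "cring R'" "g \<in> ring_hom R R'" "a \<in> carrier R" "Poly_Mapping.keys c \<subseteq> form_symbols R i"
  shows "form_pullback g (form_ring.smul R a c) = form_ring.smul R' (g a) (form_pullback g c)"
proof -
  \<comment> \<open>\<open>smul\<close> mentions only the ring, so the base and the structure map of
    the locale are placeholders here.\<close>
  interpret R: form_ring R undefined undefined using assms(1) by (simp add: form_ring_def)
  interpret R': form_ring R' undefined undefined using assms(2) by (simp add: form_ring_def)
  show ?thesis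
    unfolding form_pullback_def R.smul_def R'.smul_def frag_extend_compose'
    using assms by (intro R.smul_eqI[OF assms(5)]) (auto simp: form_symbols_def ring_hom_mult[OF assms(3)])
qed

section \<open>Faces and degeneracies in low degrees, and the Leibniz homotopy\<close>

context algebra_map
begin

abbreviation (input) sm :: "nat \<Rightarrow> ('a, 'b) pol \<Rightarrow> ('a, 'b) pol form_chain \<Rightarrow>
    ('a, 'b) pol form_chain" where
  "sm n \<equiv> form_ring.smul (P n)"
abbreviation (input) dx :: "('a, 'b) pol \<Rightarrow> ('a, 'b) pol \<Rightarrow> ('a, 'b) pol form_chain" where
  "dx r x \<equiv> frag_of (r, [x])"
abbreviation (input) d0 :: "('a, 'b) pol \<Rightarrow> ('a, 'b) pol" where "d0 \<equiv> d (Suc 0) 0"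
abbreviation (input) d1 :: "('a, 'b) pol \<Rightarrow> ('a, 'b) pol" where "d1 \<equiv> d (Suc 0) (Suc 0)"
abbreviation (input) s0 :: "('a, 'b) pol \<Rightarrow> ('a, 'b) pol" where "s0 \<equiv> s 0 0"
abbreviation (input) pb :: "(('a, 'b) pol \<Rightarrow> ('a, 'b) pol) \<Rightarrow> ('a, 'b) pol form_chain \<Rightarrow>
    ('a, 'b) pol form_chain" where
  "pb \<equiv> form_pullback"

text \<open>The horizontal differential on zero-forms of P_1. By \<open>aug_pd\<close> and
  \<open>aug_eq_pd\<close> its image is the kernel of the augmentation.\<close>

definition pd :: "('a, 'b) pol \<Rightarrow> ('a, 'b) pol" where
  "pd y = d0 y \<ominus>\<^bsub>P 0\<^esub> d1 y"

lemma hd_0: "hd 0 c = pb d0 c - pb d1 c"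
  by (simp add: hd_pullback)

lemma hd_1: "hd (Suc 0) c = pb (d (Suc (Suc 0)) 0) c - pb (d (Suc (Suc 0)) (Suc 0)) c
    + pb (d (Suc (Suc 0)) (Suc (Suc 0))) c"
  by (simp add: hd_pullback)

lemma hd_add: "hd n (c + c') = hd n c + hd n c'"
  and hd_diff: "hd n (c - c') = hd n c - hd n c'"
  and hd_minus: "hd n (- c) = - hd n c"
  and hd_zero [simp]: "hd n 0 = 0"
  by (simp_all add: hd_def frag_extend_add frag_extend_diff frag_extend_minus)

lemma d0_hom: "d0 \<in> ring_hom (P (Suc 0)) (P 0)" and d1_hom: "d1 \<in> ring_hom (P (Suc 0)) (P 0)"
  and s0_hom: "s0 \<in> ring_hom (P 0) (P (Suc 0))"
  by (simp_all add: face_hom degeneracy_hom)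

lemmas d0_closed = ring_hom_closed[OF d0_hom]
  and d1_closed = ring_hom_closed[OF d1_hom]
  and s0_closed = ring_hom_closed[OF s0_hom]
  and d0_add = ring_hom_add[OF d0_hom]
  and d1_add = ring_hom_add[OF d1_hom]
  and s0_add = ring_hom_add[OF s0_hom]
  and d0_mult = ring_hom_mult[OF d0_hom]
  and d1_mult = ring_hom_mult[OF d1_hom]
  and s0_mult = ring_hom_mult[OF s0_hom]
  and d0_one = ring_hom_one[OF d0_hom]
  and d1_one = ring_hom_one[OF d1_hom]
  and s0_one = ring_hom_one[OF s0_hom]
  and d0_zero = ring_hom_zero[OF d0_hom P_ring P_ring]
  and d1_zero = ring_hom_zero[OF d1_hom P_ring P_ring]
  and s0_zero = ring_hom_zero[OF s0_hom P_ring P_ring]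

lemma ring_hom_diff:
  assumes "g \<in> ring_hom R T" "ring R" "ring T" "x \<in> carrier R" "y \<in> carrier R"
  shows "g (x \<ominus>\<^bsub>R\<^esub> y) = g x \<ominus>\<^bsub>T\<^esub> g y"
proof -
  interpret ring_hom_ring R T g using assms by (simp add: ring_hom_ring_def ring_hom_ring_axioms_def)
  show ?thesis using assms by (simp add: a_minus_def)
qed

lemmas d0_diff = ring_hom_diff[OF d0_hom P_ring P_ring]
  and d1_diff = ring_hom_diff[OF d1_hom P_ring P_ring]
  and s0_diff = ring_hom_diff[OF s0_hom P_ring P_ring]

lemma pd_closed: "y \<in> carrier (P (Suc 0)) \<Longrightarrow> pd y \<in> carrier (P 0)"
  by (simp add: pd_def d0_closed d1_closed)

lemma pd_add: "\<lbrakk>y \<in> carrier (P (Suc 0)); z \<in> carrier (P (Suc 0))\<rbrakk> \<Longrightarrow>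
    pd (y \<oplus>\<^bsub>P (Suc 0)\<^esub> z) = pd y \<oplus>\<^bsub>P 0\<^esub> pd z"
  using Om.R.a_ac[of _ 0] by (simp add: pd_def d0_add d1_add d0_closed d1_closed a_minus_def Om.R.minus_add)

lemma pd_minus: "y \<in> carrier (P (Suc 0)) \<Longrightarrow> pd (\<ominus>\<^bsub>P (Suc 0)\<^esub> y) = \<ominus>\<^bsub>P 0\<^esub> pd y"
proof -
  assume y: "y \<in> carrier (P (Suc 0))"
  have "pd (\<ominus>\<^bsub>P (Suc 0)\<^esub> y) \<oplus>\<^bsub>P 0\<^esub> pd y = pd \<zero>\<^bsub>P (Suc 0)\<^esub>"
    using y by (simp add: Om.R.l_neg flip: pd_add)
  also have "\<dots> = \<zero>\<^bsub>P 0\<^esub>" by (simp add: pd_def d0_zero d1_zero Om.R.r_right_minus_eq)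
  finally show ?thesis using y by (simp add: pd_closed Om.R.minus_equality)
qed

lemma pd_zero: "pd \<zero>\<^bsub>P (Suc 0)\<^esub> = \<zero>\<^bsub>P 0\<^esub>"
  by (simp add: pd_def d0_zero d1_zero Om.R.r_right_minus_eq)

lemma pd_mult_s0: "\<lbrakk>y \<in> carrier (P (Suc 0)); x \<in> carrier (P 0)\<rbrakk> \<Longrightarrow>
    pd (y \<otimes>\<^bsub>P (Suc 0)\<^esub> s0 x) = pd y \<otimes>\<^bsub>P 0\<^esub> x"
  by (simp add: pd_def d0_mult d1_mult d0_closed d1_closed s0_closed face_0_deg_0 face_1_deg_0_base
      a_minus_def Om.R.l_distr Om.R.l_minus)

lemma aug_pd: "y \<in> carrier (P (Suc 0)) \<Longrightarrow> aug (pd y) = \<zero>\<^bsub>B\<^esub>"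
  by (simp add: pd_def ring_hom_diff[OF aug_hom P_ring B.ring_axioms] d0_closed d1_closed aug_face
      aug_closed B.r_right_minus_eq)

text \<open>Exactness at P_0. The variable of P_1 belonging to \<open>x\<close> has faces
  \<open>x\<close> and the variable of \<open>aug x\<close>; subtracting the variable belonging to
  \<open>x'\<close> cancels the second faces.\<close>

lemma aug_eq_pd:
  assumes "x \<in> carrier (P 0)" "x' \<in> carrier (P 0)" "aug x = aug x'"
  obtains y where "y \<in> carrier (P (Suc 0))" "x \<ominus>\<^bsub>P 0\<^esub> x' = pd y"
proof
  let ?y = "ind (enc x) \<ominus>\<^bsub>P (Suc 0)\<^esub> ind (enc x')"
  have c: "ind (enc x) \<in> carrier (P (Suc 0))" "ind (enc x') \<in> carrier (P (Suc 0))"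
    using assms by (auto intro!: ind_closed encode_res_vars)
  then show "?y \<in> carrier (P (Suc 0))" by simp
  have b: "ind (Base (aug x')) \<in> carrier (P 0)"
    by (rule ind_closed) (simp add: res_vars.simps aug_closed assms)
  have "d0 ?y = x \<ominus>\<^bsub>P 0\<^esub> x'" "d1 ?y = \<zero>\<^bsub>P 0\<^esub>"
    using c assms b by (simp_all add: d0_diff d1_diff face_0_X face_1_Suc_X Om.R.r_right_minus_eq)
  then show "x \<ominus>\<^bsub>P 0\<^esub> x' = pd ?y" using assms by (simp add: pd_def a_minus_def)
qed

lemma K_dx: "\<lbrakk>r \<in> carrier (P n); x \<in> carrier (P n)\<rbrakk> \<Longrightarrow> dx r x \<in> K n (Suc 0)"
  by (simp add: K_def form_symbols_def)

lemma K_pb_s: "\<lbrakk>j \<le> n; c \<in> K n i\<rbrakk> \<Longrightarrow> pb (s n j) c \<in> K (Suc n) i"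
  using form_pullback_keys[OF degeneracy_hom] by (simp add: K_def)

lemma Null_pb_s: "\<lbrakk>j \<le> n; c \<in> Null n i\<rbrakk> \<Longrightarrow> pb (s n j) c \<in> Null (Suc n) i"
  by (rule form_pullback_null[OF P_cring P_cring degeneracy_hom]) (auto simp: degeneracy_cst)

lemma K_sm: "\<lbrakk>a \<in> carrier (P n); c \<in> K n i\<rbrakk> \<Longrightarrow> sm n a c \<in> K n i"
  using Om.smul_keys by (simp add: K_def)

lemma pb_d_sm: "\<lbrakk>j \<le> Suc n; a \<in> carrier (P (Suc n)); c \<in> K (Suc n) i\<rbrakk> \<Longrightarrow>
    pb (d (Suc n) j) (sm (Suc n) a c) = sm n (d (Suc n) j a) (pb (d (Suc n) j) c)"
  using form_pullback_smul[OF P_cring P_cring face_hom] by (simp add: K_def)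

text \<open>\<open>s0\<close> is split by both \<open>d0\<close> and \<open>d1\<close>, so the
  horizontal differential is linear over P_0 acting through \<open>s0\<close>.\<close>

lemma hd_0_sm_s0: "\<lbrakk>x \<in> carrier (P 0); c \<in> K (Suc 0) i\<rbrakk> \<Longrightarrow> hd 0 (sm (Suc 0) (s0 x) c) = sm 0 x (hd 0 c)"
  by (simp add: hd_0 pb_d_sm s0_closed face_0_deg_0 face_1_deg_0_base Om.smul_diff)

lemma hd_1_sm_s0:
  assumes "x \<in> carrier (P 0)" "c \<in> K (Suc (Suc 0)) i"
  shows "hd (Suc 0) (sm (Suc (Suc 0)) (s (Suc 0) 0 (s0 x)) c) = sm (Suc 0) (s0 x) (hd (Suc 0) c)"
  using assms
  by (simp add: hd_1 pb_d_sm degeneracy_closed s0_closed face_0_deg_0 face_1_deg_0 face_2_deg_0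
      face_1_deg_0_base Om.smul_diff Om.smul_add)

lemma hd_hd:
  assumes "c \<in> K (Suc (Suc 0)) i" shows "hd 0 (hd (Suc 0) c) = 0"
proof -
  have keys: "Poly_Mapping.keys c \<subseteq> form_symbols (P (Suc (Suc 0))) i" using assms by (simp add: K_def)
  have "pb d0 (pb (d (Suc (Suc 0)) (Suc 0)) c) = pb d0 (pb (d (Suc (Suc 0)) 0) c)"
    "pb d0 (pb (d (Suc (Suc 0)) (Suc (Suc 0))) c) = pb d1 (pb (d (Suc (Suc 0)) 0) c)"
    "pb d1 (pb (d (Suc (Suc 0)) (Suc (Suc 0))) c) = pb d1 (pb (d (Suc (Suc 0)) (Suc 0)) c)"
    unfolding form_pullback_comp
    by (rule form_pullback_eqI[OF keys]; simp add: face_0_1 face_0_2 face_1_2)+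
  then show ?thesis by (simp add: hd_0 hd_1 form_pullback_add form_pullback_diff)
qed

text \<open>The shuffle product of \<open>y\<close> and \<open>c\<close>; it gives \<open>s\<^sub>0(d\<^sub>0 y) \<cdot> c \<sim> s\<^sub>0(d\<^sub>1 y) \<cdot> c\<close> if \<open>\<partial>c = 0\<close>.\<close>

definition homotopy where
  "homotopy y c = sm (Suc (Suc 0)) (s (Suc 0) (Suc 0) y) (pb (s (Suc 0) 0) c)
     - sm (Suc (Suc 0)) (s (Suc 0) 0 y) (pb (s (Suc 0) (Suc 0)) c)"

lemma homotopy_K: "\<lbrakk>y \<in> carrier (P (Suc 0)); c \<in> K (Suc 0) i\<rbrakk> \<Longrightarrow> homotopy y c \<in> K (Suc (Suc 0)) i"
  unfolding homotopy_def by (intro K_diff K_sm K_pb_s degeneracy_closed) auto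

lemma pb_d_pb_s:
  assumes "c \<in> K (Suc 0) i"
  shows "pb (d (Suc (Suc 0)) 0) (pb (s (Suc 0) 0) c) = c"
    and "pb (d (Suc (Suc 0)) (Suc 0)) (pb (s (Suc 0) 0) c) = c"
    and "pb (d (Suc (Suc 0)) (Suc (Suc 0))) (pb (s (Suc 0) 0) c) = pb s0 (pb d1 c)"
    and "pb (d (Suc (Suc 0)) 0) (pb (s (Suc 0) (Suc 0)) c) = pb s0 (pb d0 c)"
    and "pb (d (Suc (Suc 0)) (Suc 0)) (pb (s (Suc 0) (Suc 0)) c) = c"
    and "pb (d (Suc (Suc 0)) (Suc (Suc 0))) (pb (s (Suc 0) (Suc 0)) c) = c"
proof -
  have keys: "Poly_Mapping.keys c \<subseteq> form_symbols (P (Suc 0)) i" using assms by (simp add: K_def)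
  show "pb (d (Suc (Suc 0)) 0) (pb (s (Suc 0) 0) c) = c"
    "pb (d (Suc (Suc 0)) (Suc 0)) (pb (s (Suc 0) 0) c) = c"
    "pb (d (Suc (Suc 0)) (Suc 0)) (pb (s (Suc 0) (Suc 0)) c) = c"
    "pb (d (Suc (Suc 0)) (Suc (Suc 0))) (pb (s (Suc 0) (Suc 0)) c) = c"
    unfolding form_pullback_comp
    by (rule form_pullback_ident[OF keys]; simp add: face_0_deg_0 face_1_deg_0 face_1_deg_1 face_2_deg_1)+
  show "pb (d (Suc (Suc 0)) (Suc (Suc 0))) (pb (s (Suc 0) 0) c) = pb s0 (pb d1 c)"
    "pb (d (Suc (Suc 0)) 0) (pb (s (Suc 0) (Suc 0)) c) = pb s0 (pb d0 c)"
    unfolding form_pullback_comp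
    by (rule form_pullback_eqI[OF keys]; simp add: face_2_deg_0 face_0_deg_1)+
qed

text \<open>The middle faces of the two summands both give y c and cancel. The outer faces leave the
  Leibniz rule (\<partial>y) c - y \<partial>c, with elements of P_0 acting on P_1 through
  \<open>s0\<close>.\<close>

lemma hd_homotopy:
  assumes "y \<in> carrier (P (Suc 0))" "c \<in> K (Suc 0) i"
  shows "hd (Suc 0) (homotopy y c) =
    sm (Suc 0) (s0 (d0 y)) c - sm (Suc 0) (s0 (d1 y)) c - sm (Suc 0) y (pb s0 (hd 0 c))"
proof -
  have k: "pb (s (Suc 0) 0) c \<in> K (Suc (Suc 0)) i" "pb (s (Suc 0) (Suc 0)) c \<in> K (Suc (Suc 0)) i"
    using assms by (auto intro: K_pb_s)
  have c: "s (Suc 0) 0 y \<in> carrier (P (Suc (Suc 0)))" "s (Suc 0) (Suc 0) y \<in> carrier (P (Suc (Suc 0)))"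
    using assms by (auto intro: degeneracy_closed)
  show ?thesis
    unfolding homotopy_def hd_1 form_pullback_diff hd_0
    using assms k c
    by (simp add: pb_d_sm pb_d_pb_s[OF assms(2)] face_0_deg_0 face_1_deg_0 face_2_deg_0
        face_0_deg_1 face_1_deg_1 face_2_deg_1 form_pullback_diff Om.smul_diff)
qed

section \<open>Cycles and boundaries in degree zero\<close>

text \<open>A pair \<open>(x, c)\<close> stands for the class of \<open>x + c\<close> with \<open>x \<in> P\<^sub>0\<close>, \<open>c \<in> \<Omega>\<^sup>1(P\<^sub>1)\<close> in degree 0 of \<open>L\<Omega>/F\<^sup>2\<close>;
  the other summands there vanish. \<open>Z\<close> and \<open>Bd\<close> single out the cycles and the boundaries.\<close>

definition Z where
  "Z x c \<longleftrightarrow> x \<in> carrier (P 0) \<and> c \<in> K (Suc 0) (Suc 0) \<and> hd 0 c + dx \<one>\<^bsub>P 0\<^esub> x \<in> Null 0 (Suc 0)"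

definition Bd where
  "Bd x c \<longleftrightarrow> x \<in> carrier (P 0) \<and> c \<in> K (Suc 0) (Suc 0) \<and>
    (\<exists>y\<in>carrier (P (Suc 0)). \<exists>e\<in>K (Suc (Suc 0)) (Suc 0).
      x = pd y \<and> c - (hd (Suc 0) e - dx \<one>\<^bsub>P (Suc 0)\<^esub> y) \<in> Null (Suc 0) (Suc 0))"

lemma BdI:
  assumes "c \<in> K (Suc 0) (Suc 0)" "y \<in> carrier (P (Suc 0))" "e \<in> K (Suc (Suc 0)) (Suc 0)"
    "c - (hd (Suc 0) e - dx \<one>\<^bsub>P (Suc 0)\<^esub> y) \<in> Null (Suc 0) (Suc 0)"
  shows "Bd (pd y) c"
  using assms pd_closed by (auto simp: Bd_def)

lemma Z_add: "\<lbrakk>Z x c; Z x' c'\<rbrakk> \<Longrightarrow> Z (x \<oplus>\<^bsub>P 0\<^esub> x') (c + c')"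
proof -
  assume "Z x c" "Z x' c'"
  then have z: "x \<in> carrier (P 0)" "c \<in> K (Suc 0) (Suc 0)" "hd 0 c + dx \<one>\<^bsub>P 0\<^esub> x \<in> Null 0 (Suc 0)"
    "x' \<in> carrier (P 0)" "c' \<in> K (Suc 0) (Suc 0)" "hd 0 c' + dx \<one>\<^bsub>P 0\<^esub> x' \<in> Null 0 (Suc 0)"
    by (auto simp: Z_def)
  have "hd 0 (c + c') + dx \<one>\<^bsub>P 0\<^esub> (x \<oplus>\<^bsub>P 0\<^esub> x') =
     (hd 0 c + dx \<one>\<^bsub>P 0\<^esub> x) + (hd 0 c' + dx \<one>\<^bsub>P 0\<^esub> x')
     + (dx \<one>\<^bsub>P 0\<^esub> (x \<oplus>\<^bsub>P 0\<^esub> x') - dx \<one>\<^bsub>P 0\<^esub> x - dx \<one>\<^bsub>P 0\<^esub> x')"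
    by (simp add: hd_add)
  also have "\<dots> \<in> Null 0 (Suc 0)"
    by (rule Om.form_null_add[OF Om.form_null_add[OF z(3,6)] Om.dx_add_right]) (use z in auto)
  finally show ?thesis using z by (simp add: Z_def K_add)
qed

lemma Z_minus: "Z x c \<Longrightarrow> Z (\<ominus>\<^bsub>P 0\<^esub> x) (- c)"
proof -
  assume "Z x c"
  then have z: "x \<in> carrier (P 0)" "c \<in> K (Suc 0) (Suc 0)" "hd 0 c + dx \<one>\<^bsub>P 0\<^esub> x \<in> Null 0 (Suc 0)"
    by (auto simp: Z_def)
  have "hd 0 (- c) + dx \<one>\<^bsub>P 0\<^esub> (\<ominus>\<^bsub>P 0\<^esub> x) =
     (dx \<one>\<^bsub>P 0\<^esub> \<zero>\<^bsub>P 0\<^esub> - (hd 0 c + dx \<one>\<^bsub>P 0\<^esub> x))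
     - (dx \<one>\<^bsub>P 0\<^esub> (x \<oplus>\<^bsub>P 0\<^esub> \<ominus>\<^bsub>P 0\<^esub> x) - dx \<one>\<^bsub>P 0\<^esub> x - dx \<one>\<^bsub>P 0\<^esub> (\<ominus>\<^bsub>P 0\<^esub> x)) - dx \<one>\<^bsub>P 0\<^esub> x + dx \<one>\<^bsub>P 0\<^esub> x"
    using z by (simp add: hd_minus Om.R.r_neg)
  also have "\<dots> \<in> Null 0 (Suc 0)"
    using Om.form_null_diff[OF Om.form_null_diff[OF Om.dx_zero_right z(3)] Om.dx_add_right[of "\<one>\<^bsub>P 0\<^esub>" 0 x "\<ominus>\<^bsub>P 0\<^esub> x"]] z
    by simp
  finally show ?thesis using z by (simp add: Z_def K_minus)
qed

lemma Z_cst: "a \<in> carrier A \<Longrightarrow> Z (cst a) 0"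
  using Om.dx_const[of "\<one>\<^bsub>P 0\<^esub>" 0 a] by (simp add: Z_def cst_closed K_zero)

text \<open>The second component is the (1,1) part of the shuffle product. The pair is a cycle
  because d(x x') = x dx' + x' dx and \<partial> is linear over P_0.\<close>

lemma Z_mult:
  assumes "Z x c" "Z x' c'"
  shows "Z (x \<otimes>\<^bsub>P 0\<^esub> x') (sm (Suc 0) (s0 x) c' + sm (Suc 0) (s0 x') c)"
proof -
  have z: "x \<in> carrier (P 0)" "c \<in> K (Suc 0) (Suc 0)" "hd 0 c + dx \<one>\<^bsub>P 0\<^esub> x \<in> Null 0 (Suc 0)"
    "x' \<in> carrier (P 0)" "c' \<in> K (Suc 0) (Suc 0)" "hd 0 c' + dx \<one>\<^bsub>P 0\<^esub> x' \<in> Null 0 (Suc 0)"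
    using assms by (auto simp: Z_def)
  have "hd 0 (sm (Suc 0) (s0 x) c' + sm (Suc 0) (s0 x') c) + dx \<one>\<^bsub>P 0\<^esub> (x \<otimes>\<^bsub>P 0\<^esub> x') =
     sm 0 x (hd 0 c' + dx \<one>\<^bsub>P 0\<^esub> x') + sm 0 x' (hd 0 c + dx \<one>\<^bsub>P 0\<^esub> x)
     + (dx \<one>\<^bsub>P 0\<^esub> (x \<otimes>\<^bsub>P 0\<^esub> x') - dx (\<one>\<^bsub>P 0\<^esub> \<otimes>\<^bsub>P 0\<^esub> x) x' - dx (\<one>\<^bsub>P 0\<^esub> \<otimes>\<^bsub>P 0\<^esub> x') x)"
    using z by (simp add: hd_add hd_0_sm_s0 Om.smul_add)
  also have "\<dots> \<in> Null 0 (Suc 0)"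
    by (rule Om.form_null_add[OF Om.form_null_add[OF Om.smul_null[OF z(1,6)] Om.smul_null[OF z(4,3)]] Om.dx_mult])
       (use z in auto)
  finally show ?thesis using z by (simp add: Z_def K_add K_sm s0_closed)
qed

lemma Bd_null:
  assumes "c \<in> Null (Suc 0) (Suc 0)" shows "Bd \<zero>\<^bsub>P 0\<^esub> c"
  using BdI[of c "\<zero>\<^bsub>P (Suc 0)\<^esub>" 0] Null_K[OF assms] Om.form_null_add[OF assms Om.dx_zero_right[of "\<one>\<^bsub>P (Suc 0)\<^esub>" "Suc 0"]]
  by (simp add: K_zero pd_zero)

lemma Bd_hd:
  assumes "e \<in> K (Suc (Suc 0)) (Suc 0)" "c - hd (Suc 0) e \<in> Null (Suc 0) (Suc 0)" "c \<in> K (Suc 0) (Suc 0)"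
  shows "Bd \<zero>\<^bsub>P 0\<^esub> c"
  using BdI[of c "\<zero>\<^bsub>P (Suc 0)\<^esub>" e] assms Om.form_null_add[OF assms(2) Om.dx_zero_right[of "\<one>\<^bsub>P (Suc 0)\<^esub>" "Suc 0"]]
  by (simp add: pd_zero algebra_simps)

lemma Bd_add: "\<lbrakk>Bd x c; Bd x' c'\<rbrakk> \<Longrightarrow> Bd (x \<oplus>\<^bsub>P 0\<^esub> x') (c + c')"
proof -
  assume "Bd x c" "Bd x' c'"
  then obtain y e y' e' where z: "c \<in> K (Suc 0) (Suc 0)" "c' \<in> K (Suc 0) (Suc 0)"
    "y \<in> carrier (P (Suc 0))" "e \<in> K (Suc (Suc 0)) (Suc 0)"
      "c - (hd (Suc 0) e - dx \<one>\<^bsub>P (Suc 0)\<^esub> y) \<in> Null (Suc 0) (Suc 0)"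
    "y' \<in> carrier (P (Suc 0))" "e' \<in> K (Suc (Suc 0)) (Suc 0)"
      "c' - (hd (Suc 0) e' - dx \<one>\<^bsub>P (Suc 0)\<^esub> y') \<in> Null (Suc 0) (Suc 0)"
    and x: "x = pd y" "x' = pd y'"
    by (auto simp: Bd_def)
  have "c + c' - (hd (Suc 0) (e + e') - dx \<one>\<^bsub>P (Suc 0)\<^esub> (y \<oplus>\<^bsub>P (Suc 0)\<^esub> y'))
    = (c - (hd (Suc 0) e - dx \<one>\<^bsub>P (Suc 0)\<^esub> y)) + (c' - (hd (Suc 0) e' - dx \<one>\<^bsub>P (Suc 0)\<^esub> y'))
      + (dx \<one>\<^bsub>P (Suc 0)\<^esub> (y \<oplus>\<^bsub>P (Suc 0)\<^esub> y') - dx \<one>\<^bsub>P (Suc 0)\<^esub> y - dx \<one>\<^bsub>P (Suc 0)\<^esub> y')"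
    by (simp add: hd_add)
  also have "\<dots> \<in> Null (Suc 0) (Suc 0)"
    by (rule Om.form_null_add[OF Om.form_null_add[OF z(5,8)] Om.dx_add_right]) (use z in auto)
  finally have "Bd (pd (y \<oplus>\<^bsub>P (Suc 0)\<^esub> y')) (c + c')"
    by (rule BdI[OF K_add[OF z(1,2)] _ K_add[OF z(4,7)], rotated]) (use z in auto)
  then show ?thesis using z x by (simp add: pd_add)
qed

lemma Bd_minus: "Bd x c \<Longrightarrow> Bd (\<ominus>\<^bsub>P 0\<^esub> x) (- c)"
proof -
  assume "Bd x c"
  then obtain y e where z: "c \<in> K (Suc 0) (Suc 0)"
    "y \<in> carrier (P (Suc 0))" "e \<in> K (Suc (Suc 0)) (Suc 0)"
      "c - (hd (Suc 0) e - dx \<one>\<^bsub>P (Suc 0)\<^esub> y) \<in> Null (Suc 0) (Suc 0)"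
    and x: "x = pd y"
    by (auto simp: Bd_def)
  have n: "dx \<one>\<^bsub>P (Suc 0)\<^esub> \<zero>\<^bsub>P (Suc 0)\<^esub> - dx \<one>\<^bsub>P (Suc 0)\<^esub> y - dx \<one>\<^bsub>P (Suc 0)\<^esub> (\<ominus>\<^bsub>P (Suc 0)\<^esub> y) \<in> Null (Suc 0) (Suc 0)"
    using Om.dx_add_right[of "\<one>\<^bsub>P (Suc 0)\<^esub>" "Suc 0" y "\<ominus>\<^bsub>P (Suc 0)\<^esub> y"] z by (simp add: Om.R.r_neg)
  have "- c - (hd (Suc 0) (- e) - dx \<one>\<^bsub>P (Suc 0)\<^esub> (\<ominus>\<^bsub>P (Suc 0)\<^esub> y))
    = dx \<one>\<^bsub>P (Suc 0)\<^esub> \<zero>\<^bsub>P (Suc 0)\<^esub> - (c - (hd (Suc 0) e - dx \<one>\<^bsub>P (Suc 0)\<^esub> y))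
      - (dx \<one>\<^bsub>P (Suc 0)\<^esub> \<zero>\<^bsub>P (Suc 0)\<^esub> - dx \<one>\<^bsub>P (Suc 0)\<^esub> y - dx \<one>\<^bsub>P (Suc 0)\<^esub> (\<ominus>\<^bsub>P (Suc 0)\<^esub> y))"
    by (simp add: hd_minus)
  also have "\<dots> \<in> Null (Suc 0) (Suc 0)"
    by (rule Om.form_null_diff[OF Om.form_null_diff[OF Om.dx_zero_right z(4)] n]) (use z in auto)
  finally have "Bd (pd (\<ominus>\<^bsub>P (Suc 0)\<^esub> y)) (- c)"
    by (rule BdI[OF K_minus[OF z(1)] _ K_minus[OF z(3)], rotated]) (use z in auto)
  then show ?thesis using z x by (simp add: pd_minus)
qed

lemma Bd_Z:
  assumes "Bd x c" shows "Z x c"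
proof -
  obtain y e where z: "c \<in> K (Suc 0) (Suc 0)"
    "y \<in> carrier (P (Suc 0))" "e \<in> K (Suc (Suc 0)) (Suc 0)"
      "c - (hd (Suc 0) e - dx \<one>\<^bsub>P (Suc 0)\<^esub> y) \<in> Null (Suc 0) (Suc 0)"
    and x: "x = pd y"
    using assms by (auto simp: Bd_def)
  have h: "hd 0 (dx \<one>\<^bsub>P (Suc 0)\<^esub> y) = dx \<one>\<^bsub>P 0\<^esub> (d0 y) - dx \<one>\<^bsub>P 0\<^esub> (d1 y)"
    by (simp add: hd_0 d0_one d1_one)
  have "hd 0 c + dx \<one>\<^bsub>P 0\<^esub> (pd y) = hd 0 (c - (hd (Suc 0) e - dx \<one>\<^bsub>P (Suc 0)\<^esub> y))
      + (dx \<one>\<^bsub>P 0\<^esub> (pd y) - (dx \<one>\<^bsub>P 0\<^esub> (d0 y) - dx \<one>\<^bsub>P 0\<^esub> (d1 y)))"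
    using z by (simp add: hd_diff hd_hd h)
  also have "\<dots> \<in> Null 0 (Suc 0)"
    unfolding pd_def
    by (rule Om.form_null_add[OF hd_null[OF z(4)] Om.dx_diff_right]) (use z d0_closed d1_closed in auto)
  finally show ?thesis using z x by (simp add: Z_def pd_closed)
qed

text \<open>The boundaries form an ideal among the cycles; this is what makes the product of
  homology classes well defined.\<close>

lemma Bd_mult:
  assumes "Bd x c" "Z x' c'"
  shows "Bd (x \<otimes>\<^bsub>P 0\<^esub> x') (sm (Suc 0) (s0 x) c' + sm (Suc 0) (s0 x') c)"
proof -
  obtain y e where z: "c \<in> K (Suc 0) (Suc 0)"
    "y \<in> carrier (P (Suc 0))" "e \<in> K (Suc (Suc 0)) (Suc 0)"
      "c - (hd (Suc 0) e - dx \<one>\<^bsub>P (Suc 0)\<^esub> y) \<in> Null (Suc 0) (Suc 0)"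
    and x: "x = pd y"
    using assms(1) by (auto simp: Bd_def)
  have z': "x' \<in> carrier (P 0)" "c' \<in> K (Suc 0) (Suc 0)" "hd 0 c' + dx \<one>\<^bsub>P 0\<^esub> x' \<in> Null 0 (Suc 0)"
    using assms(2) by (auto simp: Z_def)
  let ?o = "\<one>\<^bsub>P (Suc 0)\<^esub>"
  \<comment> \<open>The primitive dictated by the Leibniz rule. The homotopy makes (\<partial>y) c'
    a boundary up to y \<partial>c', which is -y dx' because (x', c') is a cycle; that term is
    absorbed by the differential of \<open>?y\<close>. The second summand multiplies the given
    primitive by x'.\<close>
  let ?e = "homotopy y c' + sm (Suc (Suc 0)) (s (Suc 0) 0 (s0 x')) e"
  let ?y = "y \<otimes>\<^bsub>P (Suc 0)\<^esub> s0 x'"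
  have e1: "sm (Suc 0) (s0 x') (c - (hd (Suc 0) e - dx ?o y)) \<in> Null (Suc 0) (Suc 0)"
    using z z' by (intro Om.smul_null s0_closed) auto
  have "sm (Suc 0) (s0 (d0 y) \<ominus>\<^bsub>P (Suc 0)\<^esub> s0 (d1 y)) c' -
      (sm (Suc 0) (s0 (d0 y)) c' - sm (Suc 0) (s0 (d1 y)) c') \<in> Null (Suc 0) (Suc 0)"
    using z z' by (intro Om.smul_diff_left s0_closed d0_closed d1_closed) (auto simp: K_def)
  then have e2: "sm (Suc 0) (s0 x) c' - (sm (Suc 0) (s0 (d0 y)) c' - sm (Suc 0) (s0 (d1 y)) c') \<in> Null (Suc 0) (Suc 0)"
    using z by (simp add: x pd_def s0_diff d0_closed d1_closed)
  have e3: "sm (Suc 0) y (pb s0 (hd 0 c' + dx \<one>\<^bsub>P 0\<^esub> x')) \<in> Null (Suc 0) (Suc 0)"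
    using z z' by (intro Om.smul_null Null_pb_s) auto
  have e4: "dx ?o ?y - dx (?o \<otimes>\<^bsub>P (Suc 0)\<^esub> y) (s0 x') - dx (?o \<otimes>\<^bsub>P (Suc 0)\<^esub> s0 x') y \<in> Null (Suc 0) (Suc 0)"
    using z z' by (intro Om.dx_mult s0_closed) auto
  have "sm (Suc 0) (s0 x) c' + sm (Suc 0) (s0 x') c - (hd (Suc 0) ?e - dx ?o ?y)
    = sm (Suc 0) (s0 x') (c - (hd (Suc 0) e - dx ?o y))
      + (sm (Suc 0) (s0 x) c' - (sm (Suc 0) (s0 (d0 y)) c' - sm (Suc 0) (s0 (d1 y)) c'))
      + sm (Suc 0) y (pb s0 (hd 0 c' + dx \<one>\<^bsub>P 0\<^esub> x'))
      + (dx ?o ?y - dx (?o \<otimes>\<^bsub>P (Suc 0)\<^esub> y) (s0 x') - dx (?o \<otimes>\<^bsub>P (Suc 0)\<^esub> s0 x') y)"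
    using z z'
    by (simp add: hd_add hd_homotopy hd_1_sm_s0 Om.smul_diff Om.smul_add form_pullback_add s0_one s0_closed)
  also have "\<dots> \<in> Null (Suc 0) (Suc 0)"
    by (rule Om.form_null_add[OF Om.form_null_add[OF Om.form_null_add[OF e1 e2] e3] e4])
  finally have "Bd (pd ?y) (sm (Suc 0) (s0 x) c' + sm (Suc 0) (s0 x') c)"
    by (rule BdI[rotated 3])
       (use z z' x in \<open>auto intro!: K_add K_sm homotopy_K s0_closed degeneracy_closed pd_closed\<close>)
  then show ?thesis using z z' x by (simp add: pd_mult_s0)
qed

end

text \<open>A symbol of form degree 0 has no differential entry, so among the defining relations
  only additivity of the coefficient occurs.\<close>

lemma (in form_ring) deg0_lift_null:
  assumes "abelian_group M" "c \<in> N 0" "\<And>u. u \<in> form_symbols R 0 \<Longrightarrow> \<phi> u \<in> carrier M"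
    and "\<And>r r'. \<lbrakk>r \<in> carrier R; r' \<in> carrier R\<rbrakk> \<Longrightarrow> \<phi> (r \<oplus> r', []) = \<phi> (r, []) \<oplus>\<^bsub>M\<^esub> \<phi> (r', [])"
  shows "frag_lift M \<phi> c = \<zero>\<^bsub>M\<^esub>"
proof (rule frag_lift_null[OF assms(1,2,3)])
  interpret M: abelian_group M by fact
  fix c assume "c \<in> form_relations A R \<sigma> 0"
  then show "frag_lift M \<phi> c = \<zero>\<^bsub>M\<^esub>"
  proof cases
    case (coeff_add r xs s)
    then have rs: "xs = []" "r \<in> carrier R" "s \<in> carrier R" by (auto simp: form_symbols_def)
    then have sy: "(r, []) \<in> form_symbols R 0" "(s, []) \<in> form_symbols R 0" "(r \<oplus> s, []) \<in> form_symbols R 0"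
      by (auto simp: form_symbols_def)
    have "frag_lift M \<phi> c = frag_lift M \<phi> (frag_of (r \<oplus> s, [])) \<ominus>\<^bsub>M\<^esub> frag_lift M \<phi> (frag_of (r, []))
        \<ominus>\<^bsub>M\<^esub> frag_lift M \<phi> (frag_of (s, []))"
      unfolding coeff_add(1) rs(1) using sy assms(3)
      by (subst M.frag_lift_diff[of _ "form_symbols R 0"], simp_all add: keys_diff_subset,
          subst M.frag_lift_diff[of _ "form_symbols R 0"], simp_all)
    also have "\<dots> = \<zero>\<^bsub>M\<^esub>"
    proof -
      have "\<phi> (r, []) \<in> carrier M" "\<phi> (s, []) \<in> carrier M" using sy assms(3) by auto
      moreover from this have "\<phi> (r, []) \<oplus>\<^bsub>M\<^esub> \<phi> (s, []) \<ominus>\<^bsub>M\<^esub> \<phi> (r, []) = \<phi> (s, [])"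
        by (simp add: M.minus_eq M.a_comm[of "\<phi> (r, [])"] M.a_assoc M.r_neg)
      ultimately show ?thesis using rs sy assms(3,4) by (simp add: M.frag_lift_of M.minus_eq M.r_neg)
    qed
    finally show ?thesis .
  qed (auto simp: form_symbols_def)
qed simp

section \<open>Zero-forms, and pairs representing chains of degree 0\<close>

context algebra_map
begin

lemma K_deg0: "x \<in> carrier (P n) \<Longrightarrow> frag_of (x, []) \<in> K n 0"
  by (simp add: K_def form_symbols_def)

lemma deg0_diff:
  assumes "x \<in> carrier (P n)" "y \<in> carrier (P n)"
  shows "frag_of (x, []) - frag_of (y, []) - frag_of (x \<ominus>\<^bsub>P n\<^esub> y, []) \<in> Null n 0"
proof -
  have "(x \<ominus>\<^bsub>P n\<^esub> y) \<oplus>\<^bsub>P n\<^esub> y = x" using assms by (simp add: Om.R.minus_eq Om.R.a_assoc Om.R.l_neg)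
  moreover have "frag_of ((x \<ominus>\<^bsub>P n\<^esub> y) \<oplus>\<^bsub>P n\<^esub> y, []) - frag_of (x \<ominus>\<^bsub>P n\<^esub> y, []) - frag_of (y, []) \<in> Null n 0"
    by (rule Om.form_null_relation[OF form_relations.coeff_add]) (use assms in \<open>auto simp: form_symbols_def\<close>)
  ultimately show ?thesis by (simp add: algebra_simps)
qed

text \<open>An integer combination of coefficients collapses to a single coefficient by additivity;
  with \<open>deg0_inj\<close> this identifies the zero-forms of P_n with P_n.\<close>

lemma deg0_rep:
  assumes "c \<in> K n 0"
  obtains x where "x \<in> carrier (P n)" "C n 0 c = C n 0 (frag_of (x, []))"
proof -
  have "\<exists>x\<in>carrier (P n). c - frag_of (x, []) \<in> Null n 0"
    using assms unfolding K_def mem_Collect_eq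
  proof (rule free_Abelian_group_induct)
    have "frag_of (\<zero>\<^bsub>P n\<^esub>, []) - frag_of (\<zero>\<^bsub>P n\<^esub>, []) - frag_of (\<zero>\<^bsub>P n\<^esub> \<ominus>\<^bsub>P n\<^esub> \<zero>\<^bsub>P n\<^esub>, []) \<in> Null n 0"
      by (rule deg0_diff) auto
    then show "\<exists>x\<in>carrier (P n). 0 - frag_of (x, []) \<in> Null n 0"
      by (intro bexI[of _ "\<zero>\<^bsub>P n\<^esub>"]) (simp_all add: Om.R.minus_eq)
  next
    fix a b assume "\<exists>x\<in>carrier (P n). a - frag_of (x, []) \<in> Null n 0" "\<exists>x\<in>carrier (P n). b - frag_of (x, []) \<in> Null n 0"
    then obtain x y where xy: "x \<in> carrier (P n)" "y \<in> carrier (P n)"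
      "a - frag_of (x, []) \<in> Null n 0" "b - frag_of (y, []) \<in> Null n 0" by blast
    have "a - b - frag_of (x \<ominus>\<^bsub>P n\<^esub> y, []) = (a - frag_of (x, [])) - (b - frag_of (y, []))
      + (frag_of (x, []) - frag_of (y, []) - frag_of (x \<ominus>\<^bsub>P n\<^esub> y, []))" by simp
    also have "\<dots> \<in> Null n 0"
      by (rule Om.form_null_add[OF Om.form_null_diff[OF xy(3,4)] deg0_diff[OF xy(1,2)]])
    finally show "\<exists>x\<in>carrier (P n). a - b - frag_of (x, []) \<in> Null n 0"
      using xy by (intro bexI[of _ "x \<ominus>\<^bsub>P n\<^esub> y"]) auto
  next
    fix u assume "u \<in> form_symbols (P n) 0"
    then obtain x where "u = (x, [])" "x \<in> carrier (P n)" by (auto simp: form_symbols_def)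
    then show "\<exists>x\<in>carrier (P n). frag_of u - frag_of (x, []) \<in> Null n 0"
      by (intro bexI[of _ x]) auto
  qed
  then obtain x where "x \<in> carrier (P n)" "c - frag_of (x, []) \<in> Null n 0" by blast
  then show ?thesis using that[of x] by (simp add: Om.cls_eq_iff)
qed

text \<open>The additive extension of \<open>fst\<close> kills the relations and sends each symbol
  back to its coefficient.\<close>

lemma deg0_inj:
  assumes "x \<in> carrier (P n)" "y \<in> carrier (P n)" "frag_of (x, []) - frag_of (y, []) \<in> Null n 0"
  shows "x = y"
proof -
  have sy: "(x, []) \<in> form_symbols (P n) 0" "(y, []) \<in> form_symbols (P n) 0" using assms by (auto simp: form_symbols_def)
  have c: "fst u \<in> carrier (P n)" if "u \<in> form_symbols (P n) 0" for u using that by (auto simp: form_symbols_def)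
  let ?x = "(x, [] :: ('a, 'b) pol list)" and ?y = "(y, [] :: ('a, 'b) pol list)"
  have ab: "abelian_group (P n)" by (rule Om.R.abelian_group_axioms)
  have "frag_lift (P n) fst (frag_of ?x - frag_of ?y) = \<zero>\<^bsub>P n\<^esub>"
    using Om.deg0_lift_null[OF ab assms(3), where \<phi> = fst] c by simp
  moreover have "frag_lift (P n) fst (frag_of ?x - frag_of ?y) =
      frag_lift (P n) fst (frag_of ?x) \<ominus>\<^bsub>P n\<^esub> frag_lift (P n) fst (frag_of ?y)"
    by (rule Om.R.frag_lift_diff[where S = "form_symbols (P n) 0"]) (use sy c in simp_all)
  moreover have "frag_lift (P n) fst (frag_of (z, [] :: ('a, 'b) pol list)) = z" if "z \<in> carrier (P n)" for z
    using Om.R.frag_lift_of[of fst "(z, [] :: ('a, 'b) pol list)" n] that by simp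
  ultimately show ?thesis using assms Om.R.r_right_minus_eq by metis
qed

lemma bidegrees_0_iff [simp]: "(n, i) \<in> bidegrees 0 \<longleftrightarrow> n = i"
  by (auto simp: bidegrees_def)

text \<open>Degree 0 of the total complex has a component \<Omega>^n(P_n) for every n; those with n
  \<ge> 2 lie in F^2 and are taken to be trivial.\<close>

definition ch where
  "ch x c = mk_chain 0 {(0, 0), (Suc 0, Suc 0)} (\<lambda>(n, i). if n = 0 then frag_of (x, []) else c)"

lemma ch_closed: "\<lbrakk>x \<in> carrier (P 0); c \<in> K (Suc 0) (Suc 0)\<rbrakk> \<Longrightarrow> ch x c \<in> carrier (L 0)"
  unfolding ch_def by (rule mk_chain_closed) (auto simp: K_deg0)

lemma ch_apply: "ch x c (0, 0) = C 0 0 (frag_of (x, []))" "ch x c (Suc 0, Suc 0) = C (Suc 0) (Suc 0) c"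
  by (simp_all add: ch_def mk_chain_apply)

definition q where "q j x c = Hdg j 0 #>\<^bsub>L 0\<^esub> ch x c"

lemma less_2_iff: "i < 2 \<longleftrightarrow> i = 0 \<or> i = Suc 0"
  by auto

lemma coset_eq_q:
  assumes "j \<le> 2" "\<omega> \<in> carrier (L 0)" "x \<in> carrier (P 0)" "c \<in> K (Suc 0) (Suc 0)"
    "\<omega> (0, 0) = C 0 0 (frag_of (x, []))" "\<omega> (Suc 0, Suc 0) = C (Suc 0) (Suc 0) c"
  shows "Hdg j 0 #>\<^bsub>L 0\<^esub> \<omega> = q j x c"
  unfolding q_def Hodge_coset_eq_iff[OF assms(2) ch_closed[OF assms(3,4)]]
proof (intro allI impI)
  fix n i assume "(n, i) \<in> bidegrees 0" "i < j"
  then have "n = i" "i < 2" using assms(1) by simp_all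
  then consider "n = 0" "i = 0" | "n = Suc 0" "i = Suc 0" using less_2_iff[of i] by blast
  then show "\<omega> (n, i) = ch x c (n, i)" by cases (simp_all add: ch_apply assms(5,6))
qed

lemma L0_coset_q:
  assumes "j \<le> 2" "\<omega> \<in> carrier (L 0)"
  obtains x c where "x \<in> carrier (P 0)" "c \<in> K (Suc 0) (Suc 0)" "Hdg j 0 #>\<^bsub>L 0\<^esub> \<omega> = q j x c"
    "\<omega> (0, 0) = C 0 0 (frag_of (x, []))"
proof -
  obtain c0 where c0: "c0 \<in> K 0 0" "\<omega> (0, 0) = C 0 0 c0" using L_rep[OF assms(2), of 0 0] by auto
  obtain c where c: "c \<in> K (Suc 0) (Suc 0)" "\<omega> (Suc 0, Suc 0) = C (Suc 0) (Suc 0) c"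
    using L_rep[OF assms(2), of "Suc 0" "Suc 0"] by auto
  obtain x where x: "x \<in> carrier (P 0)" "C 0 0 c0 = C 0 0 (frag_of (x, []))" using deg0_rep[OF c0(1)] .
  show ?thesis using that coset_eq_q[OF assms x(1) c(1)] c0 c x by simp
qed

lemma q_eq_fst:
  assumes "0 < j" "x \<in> carrier (P 0)" "c \<in> K (Suc 0) (Suc 0)" "x' \<in> carrier (P 0)" "c' \<in> K (Suc 0) (Suc 0)"
    "q j x c = q j x' c'"
  shows "x = x'"
proof -
  have "ch x c (0, 0) = ch x' c' (0, 0)"
    using assms(1,6) unfolding q_def Hodge_coset_eq_iff[OF ch_closed[OF assms(2,3)] ch_closed[OF assms(4,5)]] by simp
  then show ?thesis using deg0_inj[OF assms(2,4)] by (simp add: ch_apply Om.cls_eq_iff)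
qed

lemma q_2_eq_iff:
  assumes "x \<in> carrier (P 0)" "c \<in> K (Suc 0) (Suc 0)" "x' \<in> carrier (P 0)" "c' \<in> K (Suc 0) (Suc 0)"
  shows "q 2 x c = q 2 x' c' \<longleftrightarrow> x = x' \<and> c - c' \<in> Null (Suc 0) (Suc 0)"
proof
  assume eq: "q 2 x c = q 2 x' c'"
  then have "ch x c (Suc 0, Suc 0) = ch x' c' (Suc 0, Suc 0)"
    unfolding q_def Hodge_coset_eq_iff[OF ch_closed[OF assms(1,2)] ch_closed[OF assms(3,4)]] by simp
  then show "x = x' \<and> c - c' \<in> Null (Suc 0) (Suc 0)"
    using q_eq_fst[OF _ assms eq] by (simp add: ch_apply Om.cls_eq_iff)
next
  assume "x = x' \<and> c - c' \<in> Null (Suc 0) (Suc 0)"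
  then show "q 2 x c = q 2 x' c'"
    using coset_eq_q[of 2 "ch x c" x' c'] assms ch_closed by (simp add: ch_apply Om.cls_eq_iff q_def)
qed

lemma q_1_eq:
  assumes "x \<in> carrier (P 0)" "c \<in> K (Suc 0) (Suc 0)" "c' \<in> K (Suc 0) (Suc 0)"
  shows "q 1 x c = q 1 x c'"
  unfolding q_def Hodge_coset_eq_iff[OF ch_closed[OF assms(1,2)] ch_closed[OF assms(1,3)]]
  by (simp add: ch_apply)

lemma q_mult:
  assumes "j \<le> 2" "x \<in> carrier (P 0)" "c \<in> K (Suc 0) (Suc 0)" "x' \<in> carrier (P 0)" "c' \<in> K (Suc 0) (Suc 0)"
  shows "q j x c <#>\<^bsub>L 0\<^esub> q j x' c' = q j (x \<oplus>\<^bsub>P 0\<^esub> x') (c + c')"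
proof -
  interpret L: comm_group "L 0" by (rule L_comm_group)
  note cl = ch_closed[OF assms(2,3)] ch_closed[OF assms(4,5)]
  have "q j x c <#>\<^bsub>L 0\<^esub> q j x' c' = Hdg j 0 #>\<^bsub>L 0\<^esub> (ch x c \<otimes>\<^bsub>L 0\<^esub> ch x' c')"
    unfolding q_def by (rule L.mult_rcoset[OF Hodge_subgroup cl])
  also have "\<dots> = q j (x \<oplus>\<^bsub>P 0\<^esub> x') (c + c')"
  proof (rule coset_eq_q[OF assms(1)])
    have "frag_of (x \<oplus>\<^bsub>P 0\<^esub> x', []) - frag_of (x, []) - frag_of (x', []) \<in> Null 0 0"
      by (rule Om.form_null_relation[OF form_relations.coeff_add]) (use assms in \<open>auto simp: form_symbols_def\<close>)
    from Om.form_null_minus[OF this]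
    show "(ch x c \<otimes>\<^bsub>L 0\<^esub> ch x' c') (0, 0) = C 0 0 (frag_of (x \<oplus>\<^bsub>P 0\<^esub> x', []))"
      using assms by (simp add: L_mult_apply ch_apply \<Omega>_mult K_deg0 Om.cls_eq_iff algebra_simps)
    show "(ch x c \<otimes>\<^bsub>L 0\<^esub> ch x' c') (Suc 0, Suc 0) = C (Suc 0) (Suc 0) (c + c')"
      using assms by (simp add: L_mult_apply ch_apply \<Omega>_mult)
  qed (use assms cl in \<open>auto simp: K_add\<close>)
  finally show ?thesis .
qed

lemma L_quot_carrier: "carrier (L\<Omega>_quot A B j k) = (\<lambda>\<omega>. Hdg j k #>\<^bsub>L k\<^esub> \<omega>) ` carrier (L k)"
  by (simp add: L\<Omega>_quot_def carrier_FactGroup)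

text \<open>In degree -1 the components are the (n + 1)-forms of P_n. Modulo F^2 only the one-forms
  of P_0 survive and give the cycle condition; modulo F^1 nothing survives, hence the guard
  \<open>1 < j\<close>.\<close>

lemma kernel_condition:
  assumes "j \<le> 2" "x \<in> carrier (P 0)" "c \<in> K (Suc 0) (Suc 0)"
  shows "L\<Omega>_quot_d A B f j 0 (q j x c) = \<one>\<^bsub>L\<Omega>_quot A B j (0 - 1)\<^esub> \<longleftrightarrow>
    (1 < j \<longrightarrow> hd 0 c + dx \<one>\<^bsub>P 0\<^esub> x \<in> Null 0 (Suc 0))"
proof -
  let ?k = "0 - 1 :: int"
  interpret L: comm_group "L ?k" by (rule L_comm_group)
  note cl = ch_closed[OF assms(2,3)]
  have one: "\<one>\<^bsub>L\<Omega>_quot A B j ?k\<^esub> = Hdg j ?k #>\<^bsub>L ?k\<^esub> \<one>\<^bsub>L ?k\<^esub>"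
    using L.coset_mult_one[OF subgroup.subset[OF Hodge_subgroup]] by (simp add: L\<Omega>_quot_def)
  have d: "L\<Omega>_d A B f 0 (ch x c) (0, Suc 0) = C 0 (Suc 0) (hd 0 c + dx \<one>\<^bsub>P 0\<^esub> x)"
    using L_d_apply[of 0 "Suc 0" 0 "ch x c" c "\<lambda>_. frag_of (x, [])"] assms
    by (simp add: bidegrees_def ch_apply K_deg0 dR_def)
  have b: "(n, i) \<in> bidegrees ?k \<longleftrightarrow> i = Suc n" for n i by (auto simp: bidegrees_def)
  have "L\<Omega>_quot_d A B f j 0 (q j x c) = \<one>\<^bsub>L\<Omega>_quot A B j ?k\<^esub> \<longleftrightarrow>
    (\<forall>n i. (n, i) \<in> bidegrees ?k \<longrightarrow> i < j \<longrightarrow> L\<Omega>_d A B f 0 (ch x c) (n, i) = \<one>\<^bsub>L ?k\<^esub> (n, i))"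
    unfolding one q_def quot_d_coset[OF cl] by (rule Hodge_coset_eq_iff[OF L_d_closed[OF cl] L.one_closed])
  also have "\<dots> \<longleftrightarrow> (\<forall>n. Suc n < j \<longrightarrow> L\<Omega>_d A B f 0 (ch x c) (n, Suc n) = C n (Suc n) 0)"
    using b by (simp add: L_one_apply Om.forms_one)
  finally have *: "L\<Omega>_quot_d A B f j 0 (q j x c) = \<one>\<^bsub>L\<Omega>_quot A B j ?k\<^esub> \<longleftrightarrow>
    (\<forall>n. Suc n < j \<longrightarrow> L\<Omega>_d A B f 0 (ch x c) (n, Suc n) = C n (Suc n) 0)" .
  show ?thesis unfolding *
  proof
    assume "\<forall>n. Suc n < j \<longrightarrow> L\<Omega>_d A B f 0 (ch x c) (n, Suc n) = C n (Suc n) 0"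
    then show "1 < j \<longrightarrow> hd 0 c + dx \<one>\<^bsub>P 0\<^esub> x \<in> Null 0 (Suc 0)"
      using d by (metis One_nat_def Om.cls_eq_iff diff_zero)
  next
    assume h: "1 < j \<longrightarrow> hd 0 c + dx \<one>\<^bsub>P 0\<^esub> x \<in> Null 0 (Suc 0)"
    show "\<forall>n. Suc n < j \<longrightarrow> L\<Omega>_d A B f 0 (ch x c) (n, Suc n) = C n (Suc n) 0"
    proof (intro allI impI)
      fix n assume "Suc n < j"
      then have "n = 0" "1 < j" using assms(1) by auto
      then show "L\<Omega>_d A B f 0 (ch x c) (n, Suc n) = C n (Suc n) 0"
        using d h by (simp add: Om.cls_eq_iff)
    qed
  qed
qed

lemma L0_quot_q:
  assumes "j \<le> 2"
  shows "carrier (L\<Omega>_quot A B j 0) = {q j x c |x c. x \<in> carrier (P 0) \<and> c \<in> K (Suc 0) (Suc 0)}"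
proof (rule Set.set_eqI, rule iffI)
  fix z assume "z \<in> carrier (L\<Omega>_quot A B j 0)"
  then obtain \<omega> where "\<omega> \<in> carrier (L 0)" "z = Hdg j 0 #>\<^bsub>L 0\<^esub> \<omega>" by (auto simp: L_quot_carrier)
  moreover obtain x c where "x \<in> carrier (P 0)" "c \<in> K (Suc 0) (Suc 0)" "Hdg j 0 #>\<^bsub>L 0\<^esub> \<omega> = q j x c"
    by (rule L0_coset_q[OF assms \<open>\<omega> \<in> carrier (L 0)\<close>])
  ultimately show "z \<in> {q j x c |x c. x \<in> carrier (P 0) \<and> c \<in> K (Suc 0) (Suc 0)}" by blast
next
  fix z assume "z \<in> {q j x c |x c. x \<in> carrier (P 0) \<and> c \<in> K (Suc 0) (Suc 0)}"
  then show "z \<in> carrier (L\<Omega>_quot A B j 0)" by (auto simp: L_quot_carrier q_def ch_closed)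
qed

lemma cycles_carrier:
  assumes "j \<le> 2"
  shows "carrier (cycles A B f j 0) = {q j x c |x c. x \<in> carrier (P 0) \<and> c \<in> K (Suc 0) (Suc 0) \<and>
    (1 < j \<longrightarrow> hd 0 c + dx \<one>\<^bsub>P 0\<^esub> x \<in> Null 0 (Suc 0))}"
proof -
  have k: "L\<Omega>_quot_d A B f j 0 (q j x c) = \<one>\<^bsub>L\<Omega>_quot A B j (- 1)\<^esub> \<longleftrightarrow>
      (1 < j \<longrightarrow> hd 0 c + dx \<one>\<^bsub>P 0\<^esub> x \<in> Null 0 (Suc 0))"
    if "x \<in> carrier (P 0)" "c \<in> K (Suc 0) (Suc 0)" for x c
    using kernel_condition[OF assms that] by simp
  have "carrier (cycles A B f j 0) = {z. (\<exists>x c. z = q j x c \<and> x \<in> carrier (P 0) \<and> c \<in> K (Suc 0) (Suc 0)) \<and>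
      L\<Omega>_quot_d A B f j 0 z = \<one>\<^bsub>L\<Omega>_quot A B j (- 1)\<^esub>}"
    by (simp add: cycles_def kernel_def L0_quot_q[OF assms])
  also have "\<dots> = {q j x c |x c. x \<in> carrier (P 0) \<and> c \<in> K (Suc 0) (Suc 0) \<and>
    (1 < j \<longrightarrow> hd 0 c + dx \<one>\<^bsub>P 0\<^esub> x \<in> Null 0 (Suc 0))}"
    by (rule Collect_cong) (metis (no_types, lifting) k)
  finally show ?thesis .
qed

lemma cycles_2_carrier: "carrier (cycles A B f 2 0) = {q 2 x c |x c. Z x c}"
  by (simp add: cycles_carrier Z_def)

lemma boundary_q:
  assumes "j \<le> 2" "\<omega> \<in> carrier (L 1)" "y \<in> carrier (P (Suc 0))" "e \<in> K (Suc (Suc 0)) (Suc 0)"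
    "\<omega> (Suc 0, 0) = C (Suc 0) 0 (frag_of (y, []))" "\<omega> (Suc (Suc 0), Suc 0) = C (Suc (Suc 0)) (Suc 0) e"
  shows "L\<Omega>_quot_d A B f j 1 (Hdg j 1 #>\<^bsub>L 1\<^esub> \<omega>) = q j (pd y) (hd (Suc 0) e - dx \<one>\<^bsub>P (Suc 0)\<^esub> y)"
proof -
  have dc: "L\<Omega>_d A B f 1 \<omega> \<in> carrier (L 0)" using L_d_closed[OF assms(2)] by simp
  have 0: "L\<Omega>_d A B f 1 \<omega> (0, 0) = C 0 0 (hd 0 (frag_of (y, [])))"
    using L_d_apply[of 0 0 1 \<omega> "frag_of (y, [])"] assms by (simp add: K_deg0)
  have "frag_of (d0 y, []) - frag_of (d1 y, []) - frag_of (pd y, []) \<in> Null 0 0"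
    unfolding pd_def using assms by (intro deg0_diff d0_closed d1_closed)
  then have "C 0 0 (hd 0 (frag_of (y, []))) = C 0 0 (frag_of (pd y, []))"
    by (simp add: hd_0 Om.cls_eq_iff)
  \<comment> \<open>The vertical differential carries the sign (-1)^n, here with n = 1; this is the
    origin of the minus sign in \<open>Bd\<close>.\<close>
  moreover have "L\<Omega>_d A B f 1 \<omega> (Suc 0, Suc 0) = C (Suc 0) (Suc 0) (hd (Suc 0) e - dx \<one>\<^bsub>P (Suc 0)\<^esub> y)"
    using L_d_apply[of "Suc 0" "Suc 0" 1 \<omega> e "\<lambda>_. frag_of (y, [])"] assms by (simp add: K_deg0 dR_def)
  ultimately have "Hdg j 0 #>\<^bsub>L 0\<^esub> L\<Omega>_d A B f 1 \<omega> = q j (pd y) (hd (Suc 0) e - dx \<one>\<^bsub>P (Suc 0)\<^esub> y)"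
    using assms 0 by (intro coset_eq_q dc K_diff hd_K K_dx pd_closed) auto
  then show ?thesis using quot_d_coset[OF assms(2), of j] by simp
qed

lemma boundaries_q:
  assumes "j \<le> 2"
  shows "boundaries A B f j 0 = {q j (pd y) (hd (Suc 0) e - dx \<one>\<^bsub>P (Suc 0)\<^esub> y) |y e.
    y \<in> carrier (P (Suc 0)) \<and> e \<in> K (Suc (Suc 0)) (Suc 0)}" (is "_ = ?R")
proof (rule Set.set_eqI, rule iffI)
  fix z assume "z \<in> boundaries A B f j 0"
  then obtain \<omega> where w: "\<omega> \<in> carrier (L 1)" "z = L\<Omega>_quot_d A B f j 1 (Hdg j 1 #>\<^bsub>L 1\<^esub> \<omega>)"
    by (auto simp: boundaries_def L_quot_carrier)
  obtain c where c: "c \<in> K (Suc 0) 0" "\<omega> (Suc 0, 0) = C (Suc 0) 0 c"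
    using L_rep[OF w(1), of "Suc 0" 0] by (auto simp: bidegrees_def)
  obtain e where e: "e \<in> K (Suc (Suc 0)) (Suc 0)" "\<omega> (Suc (Suc 0), Suc 0) = C (Suc (Suc 0)) (Suc 0) e"
    using L_rep[OF w(1), of "Suc (Suc 0)" "Suc 0"] by (auto simp: bidegrees_def)
  obtain y where y: "y \<in> carrier (P (Suc 0))" "C (Suc 0) 0 c = C (Suc 0) 0 (frag_of (y, []))" using deg0_rep[OF c(1)] .
  have "z = q j (pd y) (hd (Suc 0) e - dx \<one>\<^bsub>P (Suc 0)\<^esub> y)"
    unfolding w(2) by (rule boundary_q[OF assms w(1) y(1) e(1) _ e(2)]) (simp add: c(2) y(2))
  then show "z \<in> ?R" using y(1) e(1) by blast
next
  fix z assume "z \<in> ?R"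
  then obtain y e where ye: "y \<in> carrier (P (Suc 0))" "e \<in> K (Suc (Suc 0)) (Suc 0)"
    and z: "z = q j (pd y) (hd (Suc 0) e - dx \<one>\<^bsub>P (Suc 0)\<^esub> y)" by blast
  define \<omega> where "\<omega> = mk_chain 1 {(Suc 0, 0), (Suc (Suc 0), Suc 0)} (\<lambda>(n, i). if i = 0 then frag_of (y, []) else e)"
  have w: "\<omega> \<in> carrier (L 1)" unfolding \<omega>_def using ye by (intro mk_chain_closed) (auto simp: K_deg0)
  have "z = L\<Omega>_quot_d A B f j 1 (Hdg j 1 #>\<^bsub>L 1\<^esub> \<omega>)"
    unfolding z using boundary_q[OF assms w ye] by (simp add: \<omega>_def mk_chain_apply bidegrees_def)
  then show "z \<in> boundaries A B f j 0" using w by (auto simp: boundaries_def L_quot_carrier)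
qed

lemma boundaries_2_q: "boundaries A B f 2 0 = {q 2 x c |x c. Bd x c}"
proof (rule Set.set_eqI, rule iffI)
  fix z assume "z \<in> boundaries A B f 2 0"
  then obtain y e where ye: "y \<in> carrier (P (Suc 0))" "e \<in> K (Suc (Suc 0)) (Suc 0)"
    and z: "z = q 2 (pd y) (hd (Suc 0) e - dx \<one>\<^bsub>P (Suc 0)\<^esub> y)" by (auto simp: boundaries_q)
  have "Bd (pd y) (hd (Suc 0) e - dx \<one>\<^bsub>P (Suc 0)\<^esub> y)"
    by (rule BdI[OF _ ye]) (use ye in \<open>auto intro!: K_diff hd_K K_dx\<close>)
  then show "z \<in> {q 2 x c |x c. Bd x c}" using z by blast
next
  fix z assume "z \<in> {q 2 x c |x c. Bd x c}"
  then obtain y e c where ye: "y \<in> carrier (P (Suc 0))" "e \<in> K (Suc (Suc 0)) (Suc 0)" "c \<in> K (Suc 0) (Suc 0)"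
    and z: "z = q 2 (pd y) c" "c - (hd (Suc 0) e - dx \<one>\<^bsub>P (Suc 0)\<^esub> y) \<in> Null (Suc 0) (Suc 0)"
    by (auto simp: Bd_def)
  then have "z = q 2 (pd y) (hd (Suc 0) e - dx \<one>\<^bsub>P (Suc 0)\<^esub> y)"
    by (subst z(1), subst q_2_eq_iff) (auto intro!: K_diff hd_K K_dx pd_closed)
  then show "z \<in> boundaries A B f 2 0" using ye by (auto simp: boundaries_q)
qed

lemma Bd_carrier: "Bd x c \<Longrightarrow> x \<in> carrier (P 0)" "Bd x c \<Longrightarrow> c \<in> K (Suc 0) (Suc 0)"
  by (auto simp: Bd_def)

lemma Z_carrier: "Z x c \<Longrightarrow> x \<in> carrier (P 0)" "Z x c \<Longrightarrow> c \<in> K (Suc 0) (Suc 0)"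
  by (auto simp: Z_def)

lemma Bd_cong: "\<lbrakk>Bd x c; c' - c \<in> Null (Suc 0) (Suc 0)\<rbrakk> \<Longrightarrow> Bd x c'"
  using Bd_add[OF _ Bd_null, of x c "c' - c"] Bd_carrier[of x c] by simp

lemma Bd_diff: "\<lbrakk>Bd x c; Bd x' c'\<rbrakk> \<Longrightarrow> Bd (x \<ominus>\<^bsub>P 0\<^esub> x') (c - c')"
  using Bd_add[OF _ Bd_minus] by (simp add: a_minus_def)

lemma mult_cycles: "monoid.mult (cycles A B f j 0) = (\<lambda>z z'. z <#>\<^bsub>L 0\<^esub> z')"
  by (auto simp: cycles_def L\<Omega>_quot_def)

section \<open>Homology classes in degree 0 and their addition\<close>

definition cl where "cl x c = boundaries A B f 2 0 #>\<^bsub>cycles A B f 2 0\<^esub> q 2 x c"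

lemma cl_set:
  assumes "x \<in> carrier (P 0)" "c \<in> K (Suc 0) (Suc 0)"
  shows "cl x c = {q 2 (a \<oplus>\<^bsub>P 0\<^esub> x) (b + c) |a b. Bd a b}"
proof -
  have "q 2 a b <#>\<^bsub>L 0\<^esub> q 2 x c = q 2 (a \<oplus>\<^bsub>P 0\<^esub> x) (b + c)" if "Bd a b" for a b
    using that assms Bd_carrier by (intro q_mult) auto
  then show ?thesis
    unfolding cl_def r_coset_def mult_cycles boundaries_2_q by fastforce
qed

lemma cl_mem:
  assumes "Z x c" "z \<in> cl x c"
  obtains a b where "Bd a b" "z = q 2 (a \<oplus>\<^bsub>P 0\<^esub> x) (b + c)" "Z (a \<oplus>\<^bsub>P 0\<^esub> x) (b + c)"
proof -
  obtain a b where "Bd a b" "z = q 2 (a \<oplus>\<^bsub>P 0\<^esub> x) (b + c)"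
    using assms(2) unfolding cl_set[OF Z_carrier[OF assms(1)]] by blast
  then show ?thesis using that Z_add[OF Bd_Z assms(1)] by blast
qed

lemma Bd_zero: "Bd \<zero>\<^bsub>P 0\<^esub> 0"
  by (rule Bd_null) simp

lemma q_in_cl: "Z x c \<Longrightarrow> q 2 x c \<in> cl x c"
  using Bd_zero Z_carrier[of x c] by (auto simp: cl_set intro!: exI[of _ "\<zero>\<^bsub>P 0\<^esub>"] exI[of _ 0])

lemma cl_eq_iff:
  assumes "Z x c" "Z x' c'"
  shows "cl x c = cl x' c' \<longleftrightarrow> Bd (x \<ominus>\<^bsub>P 0\<^esub> x') (c - c')"
proof
  note z = Z_carrier[OF assms(1)] Z_carrier[OF assms(2)]
  assume "cl x c = cl x' c'"
  then have "q 2 x c \<in> cl x' c'" using q_in_cl[OF assms(1)] by simp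
  then obtain a b where ab: "Bd a b" "q 2 x c = q 2 (a \<oplus>\<^bsub>P 0\<^esub> x') (b + c')" using cl_set[OF z(3,4)] by auto
  have "x = a \<oplus>\<^bsub>P 0\<^esub> x'" "c - (b + c') \<in> Null (Suc 0) (Suc 0)"
    using ab z Bd_carrier[OF ab(1)] by (auto simp: q_2_eq_iff K_add)
  then show "Bd (x \<ominus>\<^bsub>P 0\<^esub> x') (c - c')"
    using Bd_cong[OF ab(1), of "c - c'"] z Bd_carrier[OF ab(1)]
    by (simp add: algebra_simps a_minus_def Om.R.a_assoc Om.R.r_neg)
next
  have *: "cl x c \<subseteq> cl x' c'" if "Z x c" "Z x' c'" "Bd (x \<ominus>\<^bsub>P 0\<^esub> x') (c - c')" for x c x' c'
  proof
    note z = Z_carrier[OF that(1)] Z_carrier[OF that(2)]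
    fix w assume "w \<in> cl x c"
    then obtain a b where ab: "Bd a b" "w = q 2 (a \<oplus>\<^bsub>P 0\<^esub> x) (b + c)" using cl_set[OF z(1,2)] by auto
    have "(a \<oplus>\<^bsub>P 0\<^esub> (x \<ominus>\<^bsub>P 0\<^esub> x')) \<oplus>\<^bsub>P 0\<^esub> x' = a \<oplus>\<^bsub>P 0\<^esub> x"
      using z Bd_carrier[OF ab(1)] by (simp add: a_minus_def Om.R.a_assoc Om.R.l_neg)
    then have "w = q 2 ((a \<oplus>\<^bsub>P 0\<^esub> (x \<ominus>\<^bsub>P 0\<^esub> x')) \<oplus>\<^bsub>P 0\<^esub> x') ((b + (c - c')) + c')" using ab(2) by simp
    then show "w \<in> cl x' c'" using Bd_add[OF ab(1) that(3)] cl_set[OF z(3,4)] by blast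
  qed
  note z = Z_carrier[OF assms(1)] Z_carrier[OF assms(2)]
  assume b: "Bd (x \<ominus>\<^bsub>P 0\<^esub> x') (c - c')"
  then have "Bd (x' \<ominus>\<^bsub>P 0\<^esub> x) (c' - c)"
    using Bd_minus[OF b] z by (simp add: a_minus_def Om.R.minus_add Om.R.a_comm)
  then show "cl x c = cl x' c'" using * assms b by blast
qed

lemma H0_carrier: "carrier (H0 A B f 2) = {cl x c |x c. Z x c}"
  by (auto simp: H0_def carrier_FactGroup cycles_2_carrier cl_def)

lemma H0_zero: "\<zero>\<^bsub>H0 A B f 2\<^esub> = cl \<zero>\<^bsub>P 0\<^esub> 0"
proof -
  have "cl \<zero>\<^bsub>P 0\<^esub> 0 = boundaries A B f 2 0"
  proof -
    have "q 2 (a \<oplus>\<^bsub>P 0\<^esub> \<zero>\<^bsub>P 0\<^esub>) (b + 0) = q 2 a b" if "Bd a b" for a b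
      using Bd_carrier[OF that] by simp
    then show ?thesis
      unfolding cl_set[OF Om.R.zero_closed K_zero] boundaries_2_q by (intro Collect_cong) metis
  qed
  then show ?thesis by (simp add: H0_def)
qed

lemma H0_of_eq: "H0_of A B f 2 r = cl r 0"
proof -
  have "L\<Omega>_incl A B r = ch r 0"
    unfolding L\<Omega>_incl_def ch_def mk_chain_def
  proof (rule restrict_ext)
    fix x :: "nat \<times> nat" assume "x \<in> bidegrees 0"
    then obtain n where "x = (n, n)" by (cases x) simp
    moreover consider "n = 0" | "n = Suc 0" | "n \<noteq> 0" "n \<noteq> Suc 0" by blast
    ultimately show "(case x of (n, i) \<Rightarrow> if (n, i) = (0, 0)
        then Null 0 0 #>\<^bsub>free_Abelian_group (form_symbols (P 0) 0)\<^esub> frag_of (r, []) else \<one>\<^bsub>\<Omega>f n i\<^esub>)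
      = (case x of (n, i) \<Rightarrow> if (n, i) \<in> {(0, 0), (Suc 0, Suc 0)}
        then C n i (case (n, i) of (n, i) \<Rightarrow> if n = 0 then frag_of (r, []) else 0) else \<one>\<^bsub>\<Omega>f n i\<^esub>)"
      by cases (simp_all add: Om.cls_def Om.forms_one)
  qed
  then show ?thesis by (simp add: H0_of_def cl_def q_def)
qed

lemma H0_one: "\<one>\<^bsub>H0 A B f 2\<^esub> = cl \<one>\<^bsub>P 0\<^esub> 0"
  by (simp add: H0_def H0_of_eq)

lemma H0_structure: "H0_structure_map A B f 2 a = cl (cst a) 0"
  by (simp add: H0_structure_map_def H0_of_eq)

lemma H0_add:
  assumes "Z x c" "Z x' c'"
  shows "cl x c \<oplus>\<^bsub>H0 A B f 2\<^esub> cl x' c' = cl (x \<oplus>\<^bsub>P 0\<^esub> x') (c + c')"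
proof -
  note z = Z_carrier[OF assms(1)] Z_carrier[OF assms(2)]
  have m: "q 2 (a \<oplus>\<^bsub>P 0\<^esub> x) (b + c) <#>\<^bsub>L 0\<^esub> q 2 (a' \<oplus>\<^bsub>P 0\<^esub> x') (b' + c')
      = q 2 ((a \<oplus>\<^bsub>P 0\<^esub> a') \<oplus>\<^bsub>P 0\<^esub> (x \<oplus>\<^bsub>P 0\<^esub> x')) ((b + b') + (c + c'))" if "Bd a b" "Bd a' b'" for a b a' b'
  proof -
    note ab = Bd_carrier[OF that(1)] Bd_carrier[OF that(2)]
    have "(a \<oplus>\<^bsub>P 0\<^esub> x) \<oplus>\<^bsub>P 0\<^esub> (a' \<oplus>\<^bsub>P 0\<^esub> x') = (a \<oplus>\<^bsub>P 0\<^esub> a') \<oplus>\<^bsub>P 0\<^esub> (x \<oplus>\<^bsub>P 0\<^esub> x')"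
      using ab z by (simp add: Om.R.a_ac)
    moreover have "b + c + (b' + c') = (b + b') + (c + c')" by simp
    moreover have "q 2 (a \<oplus>\<^bsub>P 0\<^esub> x) (b + c) <#>\<^bsub>L 0\<^esub> q 2 (a' \<oplus>\<^bsub>P 0\<^esub> x') (b' + c')
      = q 2 ((a \<oplus>\<^bsub>P 0\<^esub> x) \<oplus>\<^bsub>P 0\<^esub> (a' \<oplus>\<^bsub>P 0\<^esub> x')) (b + c + (b' + c'))"
      using ab z by (intro q_mult K_add Om.R.a_closed) auto
    ultimately show ?thesis by (simp only:)
  qed
  have "cl x c \<oplus>\<^bsub>H0 A B f 2\<^esub> cl x' c' = (\<Union>h\<in>cl x c. \<Union>k\<in>cl x' c'. {h <#>\<^bsub>L 0\<^esub> k})"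
    by (simp add: H0_def set_mult_def mult_cycles)
  also have "\<dots> = cl (x \<oplus>\<^bsub>P 0\<^esub> x') (c + c')"
  proof (rule Set.set_eqI, rule iffI)
    fix w assume "w \<in> (\<Union>h\<in>cl x c. \<Union>k\<in>cl x' c'. {h <#>\<^bsub>L 0\<^esub> k})"
    then obtain h k where hk: "h \<in> cl x c" "k \<in> cl x' c'" "w = h <#>\<^bsub>L 0\<^esub> k" by blast
    obtain a b where "Bd a b" "h = q 2 (a \<oplus>\<^bsub>P 0\<^esub> x) (b + c)" using hk(1) unfolding cl_set[OF z(1,2)] by blast
    moreover obtain a' b' where "Bd a' b'" "k = q 2 (a' \<oplus>\<^bsub>P 0\<^esub> x') (b' + c')"
      using hk(2) unfolding cl_set[OF z(3,4)] by blast
    ultimately have ab: "Bd a b" "Bd a' b'"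
      "w = q 2 (a \<oplus>\<^bsub>P 0\<^esub> x) (b + c) <#>\<^bsub>L 0\<^esub> q 2 (a' \<oplus>\<^bsub>P 0\<^esub> x') (b' + c')"
      using hk(3) by auto
    show "w \<in> cl (x \<oplus>\<^bsub>P 0\<^esub> x') (c + c')"
      using Bd_add[OF ab(1,2)] unfolding ab(3) m[OF ab(1,2)] cl_set[OF Om.R.a_closed[OF z(1,3)] K_add[OF z(2,4)]] by blast
  next
    fix w assume "w \<in> cl (x \<oplus>\<^bsub>P 0\<^esub> x') (c + c')"
    then obtain a b where ab: "Bd a b" "w = q 2 (a \<oplus>\<^bsub>P 0\<^esub> (x \<oplus>\<^bsub>P 0\<^esub> x')) (b + (c + c'))"
      unfolding cl_set[OF Om.R.a_closed[OF z(1,3)] K_add[OF z(2,4)]] by blast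
    \<comment> \<open>The whole boundary is attributed to the first factor; the second factor uses
      the trivial boundary.\<close>
    have "w = q 2 (a \<oplus>\<^bsub>P 0\<^esub> x) (b + c) <#>\<^bsub>L 0\<^esub> q 2 (\<zero>\<^bsub>P 0\<^esub> \<oplus>\<^bsub>P 0\<^esub> x') (0 + c')"
      using m[OF ab(1) Bd_zero] ab(2) Bd_carrier[OF ab(1)] by simp
    then show "w \<in> (\<Union>h\<in>cl x c. \<Union>k\<in>cl x' c'. {h <#>\<^bsub>L 0\<^esub> k})"
      unfolding cl_set[OF z(1,2)] cl_set[OF z(3,4)] using ab(1) Bd_zero by blast
  qed
  finally show ?thesis .
qed

section \<open>The ring structure\<close>

lemma shuffle_symbols_00: "shuffle_symbols 0 0 (x, []) (x', []) = frag_of (x \<otimes>\<^bsub>P 0\<^esub> x', [])"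
proof -
  have "{M :: nat set. M \<subseteq> {..<0 + 0} \<and> card M = 0} = {{}}" by auto
  then show ?thesis by (simp add: shuffle_symbols_def form_wedge_def)
qed

text \<open>With one factor in column 0 there is a single shuffle. Its sign is +1, and the factor
  from column 0 is lifted by \<open>s0\<close>.\<close>

lemma shuffle_symbols_01:
  "shuffle_symbols 0 (Suc 0) (x, []) (t, ys) = frag_of (s0 x \<otimes>\<^bsub>P (Suc 0)\<^esub> t, ys)"
proof -
  have 1: "{M :: nat set. M \<subseteq> {..<0 + Suc 0} \<and> card M = 0} = {{}}" by (auto simp: card_eq_0_iff finite_subset)
  have 2: "{..<0 + Suc 0} - {} = {0::nat}" by auto
  show ?thesis unfolding shuffle_symbols_def 1 by (simp add: form_wedge_def 2)
qed

lemma shuffle_symbols_10: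
  "shuffle_symbols (Suc 0) 0 (t, ys) (x, []) = frag_of (t \<otimes>\<^bsub>P (Suc 0)\<^esub> s0 x, ys)"
proof -
  have 1: "{M :: nat set. M \<subseteq> {..<Suc 0 + 0} \<and> card M = Suc 0} = {{0}}"
    by (auto simp: card_Suc_eq)
  have 2: "{..<Suc 0} - {0} = ({} :: nat set)" by auto
  have 3: "{(m :: nat, n :: nat). m = 0 \<and> n = 0 \<and> 0 < n \<and> n < m} = {}" by auto
  show ?thesis unfolding shuffle_symbols_def 1 by (simp add: form_wedge_def 2 3)
qed

lemma shuffle_frag_01: "shuffle_frag 0 (Suc 0) (frag_of (x, [])) c = sm (Suc 0) (s0 x) c"
proof -
  have "shuffle_symbols 0 (Suc 0) (x, []) = (\<lambda>(t, ys). frag_of (s0 x \<otimes>\<^bsub>P (Suc 0)\<^esub> t, ys))"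
    by (auto simp: shuffle_symbols_01)
  then show ?thesis by (simp add: shuffle_frag_def Om.smul_def)
qed

lemma shuffle_frag_10:
  assumes "c \<in> K (Suc 0) i" "x \<in> carrier (P 0)"
  shows "shuffle_frag (Suc 0) 0 c (frag_of (x, [])) = sm (Suc 0) (s0 x) c"
  unfolding shuffle_frag_def Om.smul_def frag_extend_of
proof (rule frag_extend_eq)
  fix u assume "u \<in> Poly_Mapping.keys c"
  then obtain t ys where "u = (t, ys)" "t \<in> carrier (P (Suc 0))"
    using assms(1) by (auto simp: K_def form_symbols_def)
  then show "shuffle_symbols (Suc 0) 0 u (x, []) = (case u of (t, ys) \<Rightarrow> frag_of (s0 x \<otimes>\<^bsub>P (Suc 0)\<^esub> t, ys))"
    using s0_closed[OF assms(2)] by (simp add: shuffle_symbols_10 Om.R.m_comm)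
qed

text \<open>In form degree 1 there are two contributions, one factor having bidegree (0,0) and the
  other (1,1). The sign exponent \<open>a * q\<close> is 0 in both.\<close>

lemma quot_mult_q:
  assumes "x \<in> carrier (P 0)" "c \<in> K (Suc 0) (Suc 0)" "x' \<in> carrier (P 0)" "c' \<in> K (Suc 0) (Suc 0)"
  shows "L\<Omega>_quot_mult A B 2 0 0 (q 2 x c) (q 2 x' c')
    = q 2 (x \<otimes>\<^bsub>P 0\<^esub> x') (sm (Suc 0) (s0 x) c' + sm (Suc 0) (s0 x') c)"
proof -
  note cl = ch_closed[OF assms(1,2)] ch_closed[OF assms(3,4)]
  let ?m = "L\<Omega>_mult A B 0 0 (ch x c) (ch x' c')"
  have "?m (0, 0) = C 0 0 (frag_of (x \<otimes>\<^bsub>P 0\<^esub> x', []))"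
  proof -
    interpret O: comm_group "\<Omega>f 0 0" by (rule Om.forms_comm_group)
    have p: "pairs 0 0 = {((0, 0), (0, 0))}" by auto
    have s: "shuffle A B 0 0 0 0 (ch x c (0, 0)) (ch x' c' (0, 0)) = C 0 0 (frag_of (x \<otimes>\<^bsub>P 0\<^esub> x', []))"
      using shuffle_C[OF K_deg0[OF assms(1)] K_deg0[OF assms(3)]]
      by (simp add: ch_apply shuffle_frag_def shuffle_symbols_00)
    have "C 0 0 (frag_of (x \<otimes>\<^bsub>P 0\<^esub> x', [])) \<in> carrier (\<Omega>f 0 0)"
      using assms by (intro \<Omega>_closed K_deg0) auto
    then have "finprod (\<Omega>f 0 0) (\<lambda>((p, a), (q, b)). shuffle A B p a q b (ch x c (p, a)) (ch x' c' (q, b)) [^]\<^bsub>\<Omega>f 0 0\<^esub> ((-1) ^ (a * q) :: int)) (pairs 0 0)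
        = C 0 0 (frag_of (x \<otimes>\<^bsub>P 0\<^esub> x', []))"
      unfolding p by (simp add: s)
    then show ?thesis by (simp add: L\<Omega>_mult_def)
  qed
  moreover have "?m (Suc 0, Suc 0) = C (Suc 0) (Suc 0) (sm (Suc 0) (s0 x) c' + sm (Suc 0) (s0 x') c)"
  proof -
    interpret O: comm_group "\<Omega>f (Suc 0) (Suc 0)" by (rule Om.forms_comm_group)
    have p: "pairs (Suc 0) (Suc 0) = {((0, 0), (Suc 0, Suc 0)), ((Suc 0, Suc 0), (0, 0))}"
      by (auto simp: add_is_1)
    have s1: "shuffle A B 0 0 (Suc 0) (Suc 0) (ch x c (0, 0)) (ch x' c' (Suc 0, Suc 0))
        = C (Suc 0) (Suc 0) (sm (Suc 0) (s0 x) c')"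
      using shuffle_C[OF K_deg0[OF assms(1)] assms(4)] by (simp add: ch_apply shuffle_frag_01)
    have s2: "shuffle A B (Suc 0) (Suc 0) 0 0 (ch x c (Suc 0, Suc 0)) (ch x' c' (0, 0))
        = C (Suc 0) (Suc 0) (sm (Suc 0) (s0 x') c)"
      using shuffle_C[OF assms(2) K_deg0[OF assms(3)]] assms by (simp add: ch_apply shuffle_frag_10)
    have k: "sm (Suc 0) (s0 x) c' \<in> K (Suc 0) (Suc 0)" "sm (Suc 0) (s0 x') c \<in> K (Suc 0) (Suc 0)"
      using assms by (auto intro!: K_sm s0_closed)
    have "finprod (\<Omega>f (Suc 0) (Suc 0)) (\<lambda>((p, a), (q, b)). shuffle A B p a q b (ch x c (p, a)) (ch x' c' (q, b)) [^]\<^bsub>\<Omega>f (Suc 0) (Suc 0)\<^esub> ((-1) ^ (a * q) :: int)) (pairs (Suc 0) (Suc 0))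
        = C (Suc 0) (Suc 0) (sm (Suc 0) (s0 x) c' + sm (Suc 0) (s0 x') c)"
      using k \<Omega>_closed[OF k(1)] \<Omega>_closed[OF k(2)] unfolding p by (simp add: s1 s2 \<Omega>_mult)
    then show ?thesis by (simp add: L\<Omega>_mult_def)
  qed
  ultimately have "Hdg 2 0 #>\<^bsub>L 0\<^esub> ?m = q 2 (x \<otimes>\<^bsub>P 0\<^esub> x') (sm (Suc 0) (s0 x) c' + sm (Suc 0) (s0 x') c)"
    using assms by (intro coset_eq_q L_mult_closed[OF cl] K_add K_sm s0_closed) auto
  then show ?thesis unfolding q_def quot_mult_coset[OF cl] by (simp add: q_def)
qed

text \<open>The difference of the first components splits as a(a' + x') + a'x. Each summand is a
  boundary times a cycle, so \<open>Bd_mult\<close> applies twice.\<close>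

lemma product_well_defined:
  assumes z: "Z x c" "Z x' c'" and b: "Bd a b" "Bd a' b'"
  shows "Bd ((a \<oplus>\<^bsub>P 0\<^esub> x) \<otimes>\<^bsub>P 0\<^esub> (a' \<oplus>\<^bsub>P 0\<^esub> x') \<ominus>\<^bsub>P 0\<^esub> x \<otimes>\<^bsub>P 0\<^esub> x')
    (sm (Suc 0) (s0 (a \<oplus>\<^bsub>P 0\<^esub> x)) (b' + c') + sm (Suc 0) (s0 (a' \<oplus>\<^bsub>P 0\<^esub> x')) (b + c)
      - (sm (Suc 0) (s0 x) c' + sm (Suc 0) (s0 x') c))"
proof -
  note k = Z_carrier[OF z(1)] Z_carrier[OF z(2)] Bd_carrier[OF b(1)] Bd_carrier[OF b(2)]
  have B1: "Bd (a \<otimes>\<^bsub>P 0\<^esub> (a' \<oplus>\<^bsub>P 0\<^esub> x'))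
      (sm (Suc 0) (s0 a) (b' + c') + sm (Suc 0) (s0 (a' \<oplus>\<^bsub>P 0\<^esub> x')) b)"
    by (rule Bd_mult[OF b(1) Z_add[OF Bd_Z[OF b(2)] z(2)]])
  have B2: "Bd (a' \<otimes>\<^bsub>P 0\<^esub> x) (sm (Suc 0) (s0 a') c + sm (Suc 0) (s0 x) b')"
    by (rule Bd_mult[OF b(2) z(1)])
  have e: "(a \<oplus>\<^bsub>P 0\<^esub> x) \<otimes>\<^bsub>P 0\<^esub> (a' \<oplus>\<^bsub>P 0\<^esub> x') \<ominus>\<^bsub>P 0\<^esub> x \<otimes>\<^bsub>P 0\<^esub> x'
      = a \<otimes>\<^bsub>P 0\<^esub> (a' \<oplus>\<^bsub>P 0\<^esub> x') \<oplus>\<^bsub>P 0\<^esub> a' \<otimes>\<^bsub>P 0\<^esub> x"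
  proof -
    have "(a \<oplus>\<^bsub>P 0\<^esub> x) \<otimes>\<^bsub>P 0\<^esub> (a' \<oplus>\<^bsub>P 0\<^esub> x')
      = (a \<otimes>\<^bsub>P 0\<^esub> (a' \<oplus>\<^bsub>P 0\<^esub> x') \<oplus>\<^bsub>P 0\<^esub> a' \<otimes>\<^bsub>P 0\<^esub> x) \<oplus>\<^bsub>P 0\<^esub> x \<otimes>\<^bsub>P 0\<^esub> x'"
      using k by (simp add: Om.R.l_distr Om.R.r_distr Om.R.a_ac Om.R.m_comm)
    then show ?thesis using k by (simp add: a_minus_def Om.R.a_assoc Om.R.r_neg)
  qed
  have n1: "sm (Suc 0) (s0 a \<oplus>\<^bsub>P (Suc 0)\<^esub> s0 x) (b' + c') - (sm (Suc 0) (s0 a) (b' + c') + sm (Suc 0) (s0 x) (b' + c'))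
      \<in> Null (Suc 0) (Suc 0)"
    using k K_add[OF k(8,4)] by (intro Om.smul_add_left s0_closed) (auto simp: K_def)
  have n2: "sm (Suc 0) (s0 a' \<oplus>\<^bsub>P (Suc 0)\<^esub> s0 x') c - (sm (Suc 0) (s0 a') c + sm (Suc 0) (s0 x') c)
      \<in> Null (Suc 0) (Suc 0)"
    using k by (intro Om.smul_add_left s0_closed) (auto simp: K_def)
  show ?thesis unfolding e
  proof (rule Bd_cong[OF Bd_add[OF B1 B2]])
    have "sm (Suc 0) (s0 (a \<oplus>\<^bsub>P 0\<^esub> x)) (b' + c') + sm (Suc 0) (s0 (a' \<oplus>\<^bsub>P 0\<^esub> x')) (b + c)
      - (sm (Suc 0) (s0 x) c' + sm (Suc 0) (s0 x') c)
      - (sm (Suc 0) (s0 a) (b' + c') + sm (Suc 0) (s0 (a' \<oplus>\<^bsub>P 0\<^esub> x')) b + (sm (Suc 0) (s0 a') c + sm (Suc 0) (s0 x) b'))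
      = (sm (Suc 0) (s0 a \<oplus>\<^bsub>P (Suc 0)\<^esub> s0 x) (b' + c') - (sm (Suc 0) (s0 a) (b' + c') + sm (Suc 0) (s0 x) (b' + c')))
        + (sm (Suc 0) (s0 a' \<oplus>\<^bsub>P (Suc 0)\<^esub> s0 x') c - (sm (Suc 0) (s0 a') c + sm (Suc 0) (s0 x') c))"
      using k by (simp add: s0_add Om.smul_add)
    then show "sm (Suc 0) (s0 (a \<oplus>\<^bsub>P 0\<^esub> x)) (b' + c') + sm (Suc 0) (s0 (a' \<oplus>\<^bsub>P 0\<^esub> x')) (b + c)
      - (sm (Suc 0) (s0 x) c' + sm (Suc 0) (s0 x') c)
      - (sm (Suc 0) (s0 a) (b' + c') + sm (Suc 0) (s0 (a' \<oplus>\<^bsub>P 0\<^esub> x')) b + (sm (Suc 0) (s0 a') c + sm (Suc 0) (s0 x) b'))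
      \<in> Null (Suc 0) (Suc 0)"
      using Om.form_null_add[OF n1 n2] by (simp only:)
  qed
qed

lemma H0_mult:
  assumes "Z x c" "Z x' c'"
  shows "cl x c \<otimes>\<^bsub>H0 A B f 2\<^esub> cl x' c' = cl (x \<otimes>\<^bsub>P 0\<^esub> x') (sm (Suc 0) (s0 x) c' + sm (Suc 0) (s0 x') c)"
proof -
  have "quot_map2 (cycles A B f 2 0) (boundaries A B f 2 0) (L\<Omega>_quot_mult A B 2 0 0) (cl x c) (cl x' c')
    = cl (x \<otimes>\<^bsub>P 0\<^esub> x') (sm (Suc 0) (s0 x) c' + sm (Suc 0) (s0 x') c)"
  proof (rule quot_map2_eqI)
    show "cl x c \<noteq> {}" "cl x' c' \<noteq> {}" using q_in_cl assms by blast+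
    fix w w' assume w: "w \<in> cl x c" and w': "w' \<in> cl x' c'"
    obtain a b where ab: "Bd a b" "w = q 2 (a \<oplus>\<^bsub>P 0\<^esub> x) (b + c)" "Z (a \<oplus>\<^bsub>P 0\<^esub> x) (b + c)"
      by (rule cl_mem[OF assms(1) w])
    obtain a' b' where ab': "Bd a' b'" "w' = q 2 (a' \<oplus>\<^bsub>P 0\<^esub> x') (b' + c')" "Z (a' \<oplus>\<^bsub>P 0\<^esub> x') (b' + c')"
      by (rule cl_mem[OF assms(2) w'])
    have "boundaries A B f 2 0 #>\<^bsub>cycles A B f 2 0\<^esub> L\<Omega>_quot_mult A B 2 0 0 w w'
      = cl ((a \<oplus>\<^bsub>P 0\<^esub> x) \<otimes>\<^bsub>P 0\<^esub> (a' \<oplus>\<^bsub>P 0\<^esub> x'))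
         (sm (Suc 0) (s0 (a \<oplus>\<^bsub>P 0\<^esub> x)) (b' + c') + sm (Suc 0) (s0 (a' \<oplus>\<^bsub>P 0\<^esub> x')) (b + c))"
      unfolding cl_def ab(2) ab'(2)
      by (simp only: quot_mult_q[OF Z_carrier[OF ab(3)] Z_carrier[OF ab'(3)]])
    also have "\<dots> = cl (x \<otimes>\<^bsub>P 0\<^esub> x') (sm (Suc 0) (s0 x) c' + sm (Suc 0) (s0 x') c)"
      using product_well_defined[OF assms ab(1) ab'(1)]
      by (rule cl_eq_iff[OF Z_mult[OF ab(3) ab'(3)] Z_mult[OF assms], THEN iffD2])
    finally show "boundaries A B f 2 0 #>\<^bsub>cycles A B f 2 0\<^esub> L\<Omega>_quot_mult A B 2 0 0 w w'
      = cl (x \<otimes>\<^bsub>P 0\<^esub> x') (sm (Suc 0) (s0 x) c' + sm (Suc 0) (s0 x') c)" .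
  qed
  then show ?thesis by (simp add: H0_def)
qed

lemma cl_eqI:
  assumes "Z x c" "Z x' c'" "x = x'" "c - c' \<in> Null (Suc 0) (Suc 0)"
  shows "cl x c = cl x' c'"
  unfolding cl_eq_iff[OF assms(1,2)] using Bd_null[OF assms(4)] assms(3) Z_carrier[OF assms(2)]
  by (simp add: Om.R.r_right_minus_eq[THEN iffD2])

lemma Z_zero: "Z \<zero>\<^bsub>P 0\<^esub> 0"
  by (rule Bd_Z[OF Bd_zero])

lemma Z_one: "Z \<one>\<^bsub>P 0\<^esub> 0"
  using Z_cst[OF A.one_closed] ring_hom_one[OF cst_hom[of 0]] by simp

lemma H0_cring: "cring (H0 A B f 2)"
proof -
  let ?Y = "H0 A B f 2"
  have repE: "\<exists>x c. Z x c \<and> w = cl x c" if "w \<in> carrier ?Y" for w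
    using that unfolding H0_carrier by blast
  have clc: "cl x c \<in> carrier ?Y" if "Z x c" for x c
    using that unfolding H0_carrier by blast
  show ?thesis
  proof (rule cringI)
    show "abelian_group ?Y"
    proof (rule abelian_groupI)
      fix u v w assume u: "u \<in> carrier ?Y" and v: "v \<in> carrier ?Y" and w: "w \<in> carrier ?Y"
      obtain x c where xc: "Z x c" "u = cl x c" using repE[OF u] by blast
      obtain y d where yd: "Z y d" "v = cl y d" using repE[OF v] by blast
      obtain z e where ze: "Z z e" "w = cl z e" using repE[OF w] by blast
      show "(u \<oplus>\<^bsub>?Y\<^esub> v) \<oplus>\<^bsub>?Y\<^esub> w = u \<oplus>\<^bsub>?Y\<^esub> (v \<oplus>\<^bsub>?Y\<^esub> w)"
        using xc yd ze Z_carrier by (simp add: H0_add Z_add Om.R.a_assoc add.assoc)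
    next
      fix u v assume u: "u \<in> carrier ?Y" and v: "v \<in> carrier ?Y"
      obtain x c where xc: "Z x c" "u = cl x c" using repE[OF u] by blast
      obtain y d where yd: "Z y d" "v = cl y d" using repE[OF v] by blast
      show "u \<oplus>\<^bsub>?Y\<^esub> v \<in> carrier ?Y" using xc yd by (simp add: H0_add Z_add clc)
      show "u \<oplus>\<^bsub>?Y\<^esub> v = v \<oplus>\<^bsub>?Y\<^esub> u"
        using xc yd Z_carrier by (simp add: H0_add Z_add Om.R.a_comm[of x 0 y] add.commute)
    next
      fix u assume u: "u \<in> carrier ?Y"
      obtain x c where xc: "Z x c" "u = cl x c" using repE[OF u] by blast
      show "\<zero>\<^bsub>?Y\<^esub> \<oplus>\<^bsub>?Y\<^esub> u = u" using xc Z_carrier[OF xc(1)] by (simp add: H0_zero H0_add Z_zero)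
      have "cl (\<ominus>\<^bsub>P 0\<^esub> x) (- c) \<oplus>\<^bsub>?Y\<^esub> u = \<zero>\<^bsub>?Y\<^esub>"
        using xc Z_carrier[OF xc(1)] by (simp add: H0_add Z_minus H0_zero Om.R.l_neg)
      then show "\<exists>v\<in>carrier ?Y. v \<oplus>\<^bsub>?Y\<^esub> u = \<zero>\<^bsub>?Y\<^esub>"
        using clc[OF Z_minus[OF xc(1)]] by blast
    qed (simp add: H0_zero clc Z_zero)
    show "comm_monoid ?Y"
    proof (rule comm_monoidI)
      fix u v w assume u: "u \<in> carrier ?Y" and v: "v \<in> carrier ?Y" and w: "w \<in> carrier ?Y"
      obtain x c where xc: "Z x c" "u = cl x c" using repE[OF u] by blast
      obtain y d where yd: "Z y d" "v = cl y d" using repE[OF v] by blast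
      obtain z e where ze: "Z z e" "w = cl z e" using repE[OF w] by blast
      note k = Z_carrier[OF xc(1)] Z_carrier[OF yd(1)] Z_carrier[OF ze(1)]
      have a: "sm (Suc 0) (s0 p) (sm (Suc 0) (s0 r) h) = sm (Suc 0) (s0 (p \<otimes>\<^bsub>P 0\<^esub> r)) h"
        if "p \<in> carrier (P 0)" "r \<in> carrier (P 0)" "h \<in> K (Suc 0) (Suc 0)" for p r h
        using that by (simp add: s0_mult K_def Om.smul_assoc s0_closed)
      have "sm (Suc 0) (s0 (x \<otimes>\<^bsub>P 0\<^esub> y)) e + sm (Suc 0) (s0 z) (sm (Suc 0) (s0 x) d + sm (Suc 0) (s0 y) c)
        = sm (Suc 0) (s0 x) (sm (Suc 0) (s0 y) e + sm (Suc 0) (s0 z) d) + sm (Suc 0) (s0 (y \<otimes>\<^bsub>P 0\<^esub> z)) c"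
        using k by (simp add: Om.smul_add a Om.R.m_comm add_ac)
      then show "(u \<otimes>\<^bsub>?Y\<^esub> v) \<otimes>\<^bsub>?Y\<^esub> w = u \<otimes>\<^bsub>?Y\<^esub> (v \<otimes>\<^bsub>?Y\<^esub> w)"
        using xc yd ze k by (simp add: H0_mult Z_mult Om.R.m_assoc)
    next
      fix u v assume u: "u \<in> carrier ?Y" and v: "v \<in> carrier ?Y"
      obtain x c where xc: "Z x c" "u = cl x c" using repE[OF u] by blast
      obtain y d where yd: "Z y d" "v = cl y d" using repE[OF v] by blast
      show "u \<otimes>\<^bsub>?Y\<^esub> v \<in> carrier ?Y" using xc yd by (simp add: H0_mult Z_mult clc)
      show "u \<otimes>\<^bsub>?Y\<^esub> v = v \<otimes>\<^bsub>?Y\<^esub> u"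
        using xc yd Z_carrier by (simp add: H0_mult Z_mult Om.R.m_comm[of x 0 y] add.commute)
    next
      fix u assume u: "u \<in> carrier ?Y"
      obtain x c where xc: "Z x c" "u = cl x c" using repE[OF u] by blast
      show "\<one>\<^bsub>?Y\<^esub> \<otimes>\<^bsub>?Y\<^esub> u = u"
        using xc Z_carrier[OF xc(1)] Om.smul_one[of c "Suc 0" "Suc 0"]
        by (simp add: H0_one H0_mult Z_one s0_one K_def)
    qed (simp add: H0_one clc Z_one)
    fix u v w assume u: "u \<in> carrier ?Y" and v: "v \<in> carrier ?Y" and w: "w \<in> carrier ?Y"
    obtain x c where xc: "Z x c" "u = cl x c" using repE[OF u] by blast
    obtain y d where yd: "Z y d" "v = cl y d" using repE[OF v] by blast
    obtain z e where ze: "Z z e" "w = cl z e" using repE[OF w] by blast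
    note k = Z_carrier[OF xc(1)] Z_carrier[OF yd(1)] Z_carrier[OF ze(1)]
    \<comment> \<open>Distributivity needs an equality of classes, since \<open>smul\<close> is
      additive in the scalar only modulo relations. Associativity and commutativity hold already for
      the representing pairs.\<close>
    have "cl ((x \<oplus>\<^bsub>P 0\<^esub> y) \<otimes>\<^bsub>P 0\<^esub> z) (sm (Suc 0) (s0 (x \<oplus>\<^bsub>P 0\<^esub> y)) e + sm (Suc 0) (s0 z) (c + d))
      = cl (x \<otimes>\<^bsub>P 0\<^esub> z \<oplus>\<^bsub>P 0\<^esub> y \<otimes>\<^bsub>P 0\<^esub> z)
         (sm (Suc 0) (s0 x) e + sm (Suc 0) (s0 z) c + (sm (Suc 0) (s0 y) e + sm (Suc 0) (s0 z) d))"
    proof (rule cl_eqI)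
      show "Z ((x \<oplus>\<^bsub>P 0\<^esub> y) \<otimes>\<^bsub>P 0\<^esub> z) (sm (Suc 0) (s0 (x \<oplus>\<^bsub>P 0\<^esub> y)) e + sm (Suc 0) (s0 z) (c + d))"
        using xc yd ze by (intro Z_mult Z_add)
      show "Z (x \<otimes>\<^bsub>P 0\<^esub> z \<oplus>\<^bsub>P 0\<^esub> y \<otimes>\<^bsub>P 0\<^esub> z)
         (sm (Suc 0) (s0 x) e + sm (Suc 0) (s0 z) c + (sm (Suc 0) (s0 y) e + sm (Suc 0) (s0 z) d))"
        using xc yd ze by (intro Z_mult Z_add)
      show "(x \<oplus>\<^bsub>P 0\<^esub> y) \<otimes>\<^bsub>P 0\<^esub> z = x \<otimes>\<^bsub>P 0\<^esub> z \<oplus>\<^bsub>P 0\<^esub> y \<otimes>\<^bsub>P 0\<^esub> z"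
        using k by (simp add: Om.R.l_distr)
      have "sm (Suc 0) (s0 x \<oplus>\<^bsub>P (Suc 0)\<^esub> s0 y) e - (sm (Suc 0) (s0 x) e + sm (Suc 0) (s0 y) e) \<in> Null (Suc 0) (Suc 0)"
        using k by (intro Om.smul_add_left s0_closed) (auto simp: K_def)
      then show "sm (Suc 0) (s0 (x \<oplus>\<^bsub>P 0\<^esub> y)) e + sm (Suc 0) (s0 z) (c + d)
        - (sm (Suc 0) (s0 x) e + sm (Suc 0) (s0 z) c + (sm (Suc 0) (s0 y) e + sm (Suc 0) (s0 z) d)) \<in> Null (Suc 0) (Suc 0)"
        using k by (simp add: s0_add Om.smul_add algebra_simps)
    qed
    then show "(u \<oplus>\<^bsub>?Y\<^esub> v) \<otimes>\<^bsub>?Y\<^esub> w = u \<otimes>\<^bsub>?Y\<^esub> w \<oplus>\<^bsub>?Y\<^esub> v \<otimes>\<^bsub>?Y\<^esub> w"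
      using xc yd ze by (simp add: H0_mult H0_add Z_mult Z_add)
  qed
qed

section \<open>The thickening\<close>

lemma the_elem_constI:
  assumes "U \<noteq> {}" "\<And>x. x \<in> U \<Longrightarrow> h x = c"
  shows "the_elem (h ` U) = c"
proof -
  have "h ` U = {c}" using assms by auto
  then show ?thesis by simp
qed

lemma q_mem:
  assumes "j \<le> 2" "x \<in> carrier (P 0)" "c \<in> K (Suc 0) (Suc 0)" "\<omega> \<in> q j x c" "(n, n) \<in> bidegrees 0" "n < j"
  shows "\<omega> \<in> carrier (L 0)" and "\<omega> (n, n) = ch x c (n, n)"
proof -
  note w = Hodge_coset_mem[OF ch_closed[OF assms(2,3)] assms(4)[unfolded q_def]]
  show "\<omega> \<in> carrier (L 0)" by (rule w)
  show "\<omega> (n, n) = ch x c (n, n)"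
    using w(2) assms(5,6) unfolding Hodge_coset_eq_iff[OF w(1) ch_closed[OF assms(2,3)]] by blast
qed

lemma ch_in_q: "\<lbrakk>x \<in> carrier (P 0); c \<in> K (Suc 0) (Suc 0)\<rbrakk> \<Longrightarrow> ch x c \<in> q j x c"
  unfolding q_def using group.rcos_self[OF L_group ch_closed Hodge_subgroup] .

lemma reduce_q:
  assumes "x \<in> carrier (P 0)" "c \<in> K (Suc 0) (Suc 0)"
  shows "quot_map (L 0) (Hdg 1 0) id (q 2 x c) = q 1 x 0"
proof (rule quot_map_eqI)
  show "q 2 x c \<noteq> {}" using ch_in_q[OF assms] by blast
  fix \<omega> assume w: "\<omega> \<in> q 2 x c"
  have "Hdg 1 0 #>\<^bsub>L 0\<^esub> \<omega> = q 1 x c"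
  proof (rule coset_eq_q[OF one_le_numeral _ assms])
    show "\<omega> \<in> carrier (L 0)" by (rule q_mem(1)[OF order_refl assms w, of 0]) simp_all
    have "\<omega> (0, 0) = ch x c (0, 0)" by (rule q_mem(2)[OF order_refl assms w]) simp_all
    then show "\<omega> (0, 0) = C 0 0 (frag_of (x, []))" by (simp only: ch_apply)
    have "\<omega> (Suc 0, Suc 0) = ch x c (Suc 0, Suc 0)" by (rule q_mem(2)[OF order_refl assms w]) simp_all
    then show "\<omega> (Suc 0, Suc 0) = C (Suc 0) (Suc 0) c" by (simp only: ch_apply)
  qed
  then show "Hdg 1 0 #>\<^bsub>L 0\<^esub> id \<omega> = q 1 x 0" using q_1_eq[OF assms K_zero] by simp
qed

definition W where "W x = boundaries A B f 1 0 #>\<^bsub>cycles A B f 1 0\<^esub> q 1 x 0"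

text \<open>Modulo F^1 the second component disappears and the first components of boundaries are
  the elements \<open>pd y\<close>, which fill the kernel of the augmentation. The coset of
  \<open>x\<close> is therefore a fibre of \<open>aug\<close>.\<close>

lemma W_set:
  assumes "x \<in> carrier (P 0)"
  shows "W x = {q 1 x' 0 |x'. x' \<in> carrier (P 0) \<and> aug x' = aug x}"
proof -
  have m: "q 1 (pd y) (hd (Suc 0) e - dx \<one>\<^bsub>P (Suc 0)\<^esub> y) <#>\<^bsub>L 0\<^esub> q 1 x 0 = q 1 (pd y \<oplus>\<^bsub>P 0\<^esub> x) 0"
    if "y \<in> carrier (P (Suc 0))" "e \<in> K (Suc (Suc 0)) (Suc 0)" for y e
  proof -
    have k: "hd (Suc 0) e - dx \<one>\<^bsub>P (Suc 0)\<^esub> y \<in> K (Suc 0) (Suc 0)" using that by (intro K_diff hd_K K_dx) auto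
    show ?thesis
      using q_mult[of 1 "pd y" "hd (Suc 0) e - dx \<one>\<^bsub>P (Suc 0)\<^esub> y" x 0] k that assms
        q_1_eq[of "pd y \<oplus>\<^bsub>P 0\<^esub> x" "hd (Suc 0) e - dx \<one>\<^bsub>P (Suc 0)\<^esub> y" 0]
      by (simp add: K_zero pd_closed)
  qed
  show ?thesis
  proof (rule Set.set_eqI, rule iffI)
    fix z assume "z \<in> W x"
    then obtain w where w: "w \<in> boundaries A B f 1 0" "z = w <#>\<^bsub>L 0\<^esub> q 1 x 0"
      unfolding W_def r_coset_def mult_cycles by blast
    then obtain y e where ye: "y \<in> carrier (P (Suc 0))" "e \<in> K (Suc (Suc 0)) (Suc 0)"
      "w = q 1 (pd y) (hd (Suc 0) e - dx \<one>\<^bsub>P (Suc 0)\<^esub> y)"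
      using boundaries_q[of 1] by auto
    have z: "z = q 1 (pd y \<oplus>\<^bsub>P 0\<^esub> x) 0" using w(2) ye m by simp
    have "pd y \<oplus>\<^bsub>P 0\<^esub> x \<in> carrier (P 0)" using ye(1) assms by (simp add: pd_closed)
    moreover have "aug (pd y \<oplus>\<^bsub>P 0\<^esub> x) = aug x"
      using ye(1) assms by (simp add: ring_hom_add[OF aug_hom] pd_closed aug_pd aug_closed)
    ultimately show "z \<in> {q 1 x' 0 |x'. x' \<in> carrier (P 0) \<and> aug x' = aug x}" using z by blast
  next
    fix z assume "z \<in> {q 1 x' 0 |x'. x' \<in> carrier (P 0) \<and> aug x' = aug x}"
    then obtain x' where x': "z = q 1 x' 0" "x' \<in> carrier (P 0)" "aug x' = aug x" by blast
    obtain y where y: "y \<in> carrier (P (Suc 0))" "x' \<ominus>\<^bsub>P 0\<^esub> x = pd y" by (rule aug_eq_pd[OF x'(2) assms x'(3)])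
    have "pd y \<oplus>\<^bsub>P 0\<^esub> x = x'"
      unfolding y(2)[symmetric] using x'(2) assms by (simp add: a_minus_def Om.R.a_assoc Om.R.l_neg)
    then have "z = q 1 (pd y) (hd (Suc 0) 0 - dx \<one>\<^bsub>P (Suc 0)\<^esub> y) <#>\<^bsub>L 0\<^esub> q 1 x 0"
      using m[OF y(1) K_zero] x'(1) by simp
    moreover have "q 1 (pd y) (hd (Suc 0) 0 - dx \<one>\<^bsub>P (Suc 0)\<^esub> y) \<in> boundaries A B f 1 0"
      unfolding boundaries_q[OF one_le_numeral] using y(1) K_zero[of "Suc (Suc 0)" "Suc 0"] by blast
    ultimately show "z \<in> W x" unfolding W_def r_coset_def mult_cycles by blast
  qed
qed

lemma H0_reduction_cl:
  assumes "Z x c" shows "H0_reduction A B f (cl x c) = W x"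
  unfolding H0_reduction_def
proof (rule quot_map_eqI)
  note k = Z_carrier[OF assms]
  show "cl x c \<noteq> {}" using q_in_cl[OF assms] by blast
  fix w assume "w \<in> cl x c"
  then obtain a b where ab: "Bd a b" "w = q 2 (a \<oplus>\<^bsub>P 0\<^esub> x) (b + c)" "Z (a \<oplus>\<^bsub>P 0\<^esub> x) (b + c)"
    by (rule cl_mem[OF assms])
  have "aug a = \<zero>\<^bsub>B\<^esub>" using ab(1) by (auto simp: Bd_def aug_pd)
  then have e: "aug (a \<oplus>\<^bsub>P 0\<^esub> x) = aug x"
    using Bd_carrier[OF ab(1)] k by (simp add: ring_hom_add[OF aug_hom] aug_closed)
  show "boundaries A B f 1 0 #>\<^bsub>cycles A B f 1 0\<^esub> quot_map (L 0) (Hdg 1 0) id w = W x"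
    unfolding ab(2) reduce_q[OF Z_carrier[OF ab(3)]] W_def[symmetric]
      W_set[OF k(1)] W_set[OF Z_carrier(1)[OF ab(3)]] e ..
qed

lemma L_augmentation_ch:
  assumes "x \<in> carrier (P 0)" "\<omega> (0, 0) = C 0 0 (frag_of (x, []))"
  shows "L\<Omega>_augmentation A B f \<omega> = aug x"
proof -
  let ?x = "(x, [] :: ('a, 'b) pol list)" and ?\<phi> = "\<lambda>u :: ('a, 'b) pol \<times> ('a, 'b) pol list. aug (fst u)"
  have c: "?\<phi> u \<in> carrier B" if "u \<in> form_symbols (P 0) 0" for u
    using that by (auto simp: form_symbols_def aug_closed)
  \<comment> \<open>The sum over keys is the additive extension of the augmentation on symbols; it
    remains to show that it is constant on the class.\<close>
  have "L\<Omega>_augmentation A B f \<omega> = the_elem (frag_lift B ?\<phi> ` C 0 0 (frag_of ?x))"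
    using assms(2) by (simp add: L\<Omega>_augmentation_def frag_lift_def)
  also have "\<dots> = aug x"
  proof (rule the_elem_constI)
  show "C 0 0 (frag_of ?x) \<noteq> {}" using Om.cls_self by blast
  fix e assume e: "e \<in> C 0 0 (frag_of ?x)"
  have k: "Poly_Mapping.keys (frag_of ?x) \<subseteq> form_symbols (P 0) 0" using assms(1) by (simp add: form_symbols_def)
  have ek: "Poly_Mapping.keys e \<subseteq> form_symbols (P 0) 0" by (rule Om.cls_mem_keys[OF e k])
  have n: "e - frag_of ?x \<in> Null 0 0" using Om.cls_memD[OF e] by (simp add: Om.cls_eq_iff)
  have "frag_lift B ?\<phi> (e - frag_of ?x) = \<zero>\<^bsub>B\<^esub>"
    by (rule Om.deg0_lift_null[OF B.abelian_group_axioms n]) (use c in \<open>auto simp: ring_hom_add[OF aug_hom]\<close>)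
  moreover have "frag_lift B ?\<phi> (e - frag_of ?x) = frag_lift B ?\<phi> e \<ominus>\<^bsub>B\<^esub> frag_lift B ?\<phi> (frag_of ?x)"
    by (rule B.frag_lift_diff[OF ek k c])
  moreover have "frag_lift B ?\<phi> e \<in> carrier B" by (rule B.frag_lift_closed) (use c ek in auto)
  moreover have "frag_lift B ?\<phi> (frag_of ?x) = aug x"
    using B.frag_lift_of[of ?\<phi> ?x] assms(1) by (simp add: aug_closed)
  ultimately show "frag_lift B ?\<phi> e = aug x" using assms(1) by (simp add: B.r_right_minus_eq aug_closed)
  qed
  finally show ?thesis .
qed

lemma H0_F1_iso_W:
  assumes "x \<in> carrier (P 0)" shows "H0_F1_iso A B f (W x) = aug x"
  unfolding H0_F1_iso_def
proof (rule the_elem_constI)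
  show "W x \<noteq> {}" unfolding W_set[OF assms] using assms by blast
  fix z assume "z \<in> W x"
  then obtain x' where x': "z = q 1 x' 0" "x' \<in> carrier (P 0)" "aug x' = aug x" unfolding W_set[OF assms] by blast
  have "the_elem (L\<Omega>_augmentation A B f ` q 1 x' 0) = aug x'"
  proof (rule the_elem_constI)
    show "q 1 x' 0 \<noteq> {}" using ch_in_q[OF x'(2) K_zero] by blast
    fix \<omega> assume "\<omega> \<in> q 1 x' 0"
    then have "\<omega> (0, 0) = C 0 0 (frag_of (x', []))" using q_mem(2)[OF _ x'(2) K_zero, of 1 \<omega> 0] by (simp add: ch_apply)
    then show "L\<Omega>_augmentation A B f \<omega> = aug x'" by (rule L_augmentation_ch[OF x'(2)])
  qed
  then show "the_elem (L\<Omega>_augmentation A B f ` z) = aug x" using x' by simp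
qed

abbreviation (input) \<pi>Y where "\<pi>Y \<equiv> H0_F1_iso A B f \<circ> H0_reduction A B f"

lemma \<pi>_cl: "Z x c \<Longrightarrow> \<pi>Y (cl x c) = aug x"
  by (simp add: H0_reduction_cl H0_F1_iso_W Z_carrier)

section \<open>Surjectivity of the boundary map onto the one-forms of P_0\<close>

definition Im where
  "Im = {c \<in> K 0 (Suc 0). \<exists>e\<in>K (Suc 0) (Suc 0). c - hd 0 e \<in> Null 0 (Suc 0)}"

lemma ImI: "\<lbrakk>c \<in> K 0 (Suc 0); e \<in> K (Suc 0) (Suc 0); c - hd 0 e \<in> Null 0 (Suc 0)\<rbrakk> \<Longrightarrow> c \<in> Im"
  by (auto simp: Im_def)

lemma Im_null: "c \<in> Null 0 (Suc 0) \<Longrightarrow> c \<in> Im"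
  using ImI[OF Null_K K_zero] by simp

lemma Im_diff: "\<lbrakk>c \<in> Im; c' \<in> Im\<rbrakk> \<Longrightarrow> c - c' \<in> Im"
proof -
  assume "c \<in> Im" "c' \<in> Im"
  then obtain e e' where e: "c \<in> K 0 (Suc 0)" "c' \<in> K 0 (Suc 0)" "e \<in> K (Suc 0) (Suc 0)" "e' \<in> K (Suc 0) (Suc 0)"
    "c - hd 0 e \<in> Null 0 (Suc 0)" "c' - hd 0 e' \<in> Null 0 (Suc 0)" by (auto simp: Im_def)
  show ?thesis
    by (rule ImI[OF K_diff[OF e(1,2)] K_diff[OF e(3,4)]])
       (use Om.form_null_diff[OF e(5,6)] in \<open>simp add: hd_diff algebra_simps\<close>)
qed

lemma Im_add: "\<lbrakk>c \<in> Im; c' \<in> Im\<rbrakk> \<Longrightarrow> c + c' \<in> Im"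
  using Im_diff[OF _ Im_diff[OF Im_null[OF Om.form_null_zero]]] by fastforce

lemma Im_cong: "\<lbrakk>c \<in> Im; c' - c \<in> Im\<rbrakk> \<Longrightarrow> c' \<in> Im"
  using Im_add[of c "c' - c"] by simp

text \<open>Write the difference of the coefficients as \<open>pd y\<close>. The form y d(s0 b) has
  boundary (d0 y) db - (d1 y) db, because both faces undo \<open>s0\<close>.\<close>

lemma Im_left:
  assumes "a \<in> carrier (P 0)" "a' \<in> carrier (P 0)" "b \<in> carrier (P 0)" "aug a = aug a'"
  shows "dx a b - dx a' b \<in> Im"
proof -
  obtain y where y: "y \<in> carrier (P (Suc 0))" "a \<ominus>\<^bsub>P 0\<^esub> a' = pd y" by (rule aug_eq_pd[OF assms(1,2,4)])
  have h: "hd 0 (dx y (s0 b)) = dx (d0 y) b - dx (d1 y) b"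
    using assms by (simp add: hd_0 face_0_deg_0 face_1_deg_0_base)
  have "dx a b - dx a' b - hd 0 (dx y (s0 b))
    = (dx (pd y) b - (dx (d0 y) b - dx (d1 y) b)) - (dx (a \<ominus>\<^bsub>P 0\<^esub> a') b - (dx a b - dx a' b))"
    unfolding h y(2) by simp
  also have "\<dots> \<in> Null 0 (Suc 0)"
    unfolding pd_def
    by (rule Om.form_null_diff[OF Om.dx_diff_left Om.dx_diff_left]) (use assms y d0_closed d1_closed in auto)
  finally show ?thesis
    by (rule ImI[rotated 2]) (use assms y s0_closed in \<open>auto intro!: K_diff K_dx\<close>)
qed

text \<open>Here the lifted element is the coefficient: the form (s0 a) dy has boundary a d(d0 y) -
  a d(d1 y).\<close>

lemma Im_right:
  assumes "a \<in> carrier (P 0)" "b \<in> carrier (P 0)" "b' \<in> carrier (P 0)" "aug b = aug b'"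
  shows "dx a b - dx a b' \<in> Im"
proof -
  obtain y where y: "y \<in> carrier (P (Suc 0))" "b \<ominus>\<^bsub>P 0\<^esub> b' = pd y" by (rule aug_eq_pd[OF assms(2,3,4)])
  have h: "hd 0 (dx (s0 a) y) = dx a (d0 y) - dx a (d1 y)"
    using assms by (simp add: hd_0 face_0_deg_0 face_1_deg_0_base)
  have "dx a b - dx a b' - hd 0 (dx (s0 a) y)
    = (dx a (pd y) - (dx a (d0 y) - dx a (d1 y))) - (dx a (b \<ominus>\<^bsub>P 0\<^esub> b') - (dx a b - dx a b'))"
    unfolding h y(2) by simp
  also have "\<dots> \<in> Null 0 (Suc 0)"
    unfolding pd_def
    by (rule Om.form_null_diff[OF Om.dx_diff_right Om.dx_diff_right]) (use assms y d0_closed d1_closed in auto)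
  finally show ?thesis
    by (rule ImI[rotated 2]) (use assms y s0_closed in \<open>auto intro!: K_diff K_dx\<close>)
qed

abbreviation (input) \<iota> where "\<iota> b \<equiv> ind (Base b)"

lemma \<iota>_closed: "b \<in> carrier B \<Longrightarrow> \<iota> b \<in> carrier (P 0)"
  by (rule ind_closed) (simp add: res_vars.simps)

text \<open>Sending b to its variable is only a set-theoretic section of the augmentation. By
  \<open>Im_left\<close> and \<open>Im_right\<close> its failure to respect sums, products and
  constants is invisible modulo \<open>Im\<close>, so it induces a map from \<Omega>^1(B) to the
  cokernel of \<partial>.\<close>

lemma Im_of_null:
  assumes "c \<in> form_null A B f (Suc 0)"
  shows "form_pullback (\<lambda>b. \<iota> b) c \<in> Im"
proof -
  interpret Bf: form_ring B A f by (simp add: form_ring_def B.cring_axioms)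
  have a: "aug (x \<oplus>\<^bsub>P 0\<^esub> y) = aug x \<oplus>\<^bsub>B\<^esub> aug y" "aug (x \<otimes>\<^bsub>P 0\<^esub> y) = aug x \<otimes>\<^bsub>B\<^esub> aug y"
    if "x \<in> carrier (P 0)" "y \<in> carrier (P 0)" for x y
    using that by (simp_all add: ring_hom_add[OF aug_hom] ring_hom_mult[OF aug_hom])
  show ?thesis
  proof (rule Bf.form_null_induct[OF assms])
    fix c assume "c \<in> form_relations A B f (Suc 0)"
    then show "form_pullback (\<lambda>b. \<iota> b) c \<in> Im"
    proof cases
      case (coeff_add r xs s)
      then obtain x where k: "xs = [x]" "r \<in> carrier B" "s \<in> carrier B" "x \<in> carrier B"
        by (auto simp: form_symbols_def length_Suc_conv)
      note l = \<iota>_closed[OF k(2)] \<iota>_closed[OF k(3)] \<iota>_closed[OF k(4)]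
      have "dx (\<iota> (r \<oplus>\<^bsub>B\<^esub> s)) (\<iota> x) - dx (\<iota> r \<oplus>\<^bsub>P 0\<^esub> \<iota> s) (\<iota> x) \<in> Im"
        by (rule Im_left) (use k l in \<open>simp_all add: \<iota>_closed aug_X a\<close>)
      from Im_add[OF this Im_null[OF Om.dx_add_left[OF l]]] show ?thesis
        unfolding coeff_add(1) k(1) by (simp add: form_pullback_diff form_pullback_add algebra_simps)
    next
      case (d_add r us x vs y)
      then have k: "us = []" "vs = []" "r \<in> carrier B" "x \<in> carrier B" "y \<in> carrier B"
        by (auto simp: form_symbols_def)
      note l = \<iota>_closed[OF k(3)] \<iota>_closed[OF k(4)] \<iota>_closed[OF k(5)]
      have "dx (\<iota> r) (\<iota> (x \<oplus>\<^bsub>B\<^esub> y)) - dx (\<iota> r) (\<iota> x \<oplus>\<^bsub>P 0\<^esub> \<iota> y) \<in> Im"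
        by (rule Im_right) (use k l in \<open>simp_all add: \<iota>_closed aug_X a\<close>)
      from Im_add[OF this Im_null[OF Om.dx_add_right[OF l]]] show ?thesis
        unfolding d_add(1) k(1,2) by (simp add: form_pullback_diff form_pullback_add algebra_simps)
    next
      case (d_mult r us x vs y)
      then have k: "us = []" "vs = []" "r \<in> carrier B" "x \<in> carrier B" "y \<in> carrier B"
        by (auto simp: form_symbols_def)
      note l = \<iota>_closed[OF k(3)] \<iota>_closed[OF k(4)] \<iota>_closed[OF k(5)]
      have 1: "dx (\<iota> r) (\<iota> (x \<otimes>\<^bsub>B\<^esub> y)) - dx (\<iota> r) (\<iota> x \<otimes>\<^bsub>P 0\<^esub> \<iota> y) \<in> Im"
        by (rule Im_right) (use k l in \<open>simp_all add: \<iota>_closed aug_X a\<close>)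
      have 2: "dx (\<iota> (r \<otimes>\<^bsub>B\<^esub> x)) (\<iota> y) - dx (\<iota> r \<otimes>\<^bsub>P 0\<^esub> \<iota> x) (\<iota> y) \<in> Im"
        by (rule Im_left) (use k l in \<open>simp_all add: \<iota>_closed aug_X a\<close>)
      have 3: "dx (\<iota> (r \<otimes>\<^bsub>B\<^esub> y)) (\<iota> x) - dx (\<iota> r \<otimes>\<^bsub>P 0\<^esub> \<iota> y) (\<iota> x) \<in> Im"
        by (rule Im_left) (use k l in \<open>simp_all add: \<iota>_closed aug_X a\<close>)
      from Im_add[OF Im_diff[OF Im_diff[OF 1 2] 3] Im_null[OF Om.dx_mult[OF l]]] show ?thesis
        unfolding d_mult(1) k(1,2) by (simp add: form_pullback_diff form_pullback_add algebra_simps)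
    next
      case (d_const r us e vs)
      then have k: "us = []" "vs = []" "r \<in> carrier B" "e \<in> carrier A" "f e \<in> carrier B"
        by (auto simp: form_symbols_def)
      have "dx (\<iota> r) (\<iota> (f e)) - dx (\<iota> r) (cst e) \<in> Im"
        by (rule Im_right) (use k in \<open>simp_all add: \<iota>_closed aug_X aug_cst cst_closed\<close>)
      from Im_add[OF this Im_null[OF Om.dx_const[OF \<iota>_closed[OF k(3)] k(4) cst_closed[OF k(4)]]]] show ?thesis
        unfolding d_const(1) k(1,2) by simp
    next
      case (alternating r us x vs ws)
      then show ?thesis by (auto simp: form_symbols_def)
    qed
  next
    show "form_pullback (\<lambda>b. \<iota> b) 0 \<in> Im" by (simp add: Im_null)
  next
    fix c c' assume "form_pullback (\<lambda>b. \<iota> b) c \<in> Im" "form_pullback (\<lambda>b. \<iota> b) c' \<in> Im"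
    then show "form_pullback (\<lambda>b. \<iota> b) (c - c') \<in> Im" by (simp add: form_pullback_diff Im_diff)
  qed
qed

end

locale unramified_algebra_map = algebra_map +
  assumes unramified: "trivial_group (forms A B f 1)"
begin

text \<open>The vanishing of \<Omega>^1(B) enters here. Modulo \<open>Im\<close>, a form r dx equals
  the image of (aug r) d(aug x) under the map obtained from \<open>Im_of_null\<close>, and that form
  is zero over B.\<close>

lemma Im_all:
  assumes "c \<in> K 0 (Suc 0)" shows "c \<in> Im"
proof -
  interpret Bf: form_ring B A f by (simp add: form_ring_def B.cring_axioms)
  have null: "frag_of (r, [x]) \<in> form_null A B f (Suc 0)" if "r \<in> carrier B" "x \<in> carrier B" for r x
  proof -
    have "Bf.cls (Suc 0) (frag_of (r, [x])) \<in> carrier (forms A B f (Suc 0))"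
      using that by (intro Bf.cls_closed) (simp add: form_symbols_def)
    then have "Bf.cls (Suc 0) (frag_of (r, [x])) = Bf.cls (Suc 0) 0"
      using unramified by (simp add: trivial_group_def Bf.forms_one)
    then show ?thesis by (simp add: Bf.cls_eq_iff)
  qed
  show ?thesis
    using assms unfolding K_def mem_Collect_eq
  proof (rule free_Abelian_group_induct)
    fix u assume "u \<in> form_symbols (P 0) (Suc 0)"
    then obtain r x where u: "u = (r, [x])" and k: "r \<in> carrier (P 0)" "x \<in> carrier (P 0)"
      by (auto simp: form_symbols_def length_Suc_conv)
    note l = aug_closed[OF k(1)] aug_closed[OF k(2)]
    have "dx r x - dx (\<iota> (aug r)) x \<in> Im"
      by (rule Im_left) (use k l in \<open>simp_all add: \<iota>_closed aug_X\<close>)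
    moreover have "dx (\<iota> (aug r)) x - dx (\<iota> (aug r)) (\<iota> (aug x)) \<in> Im"
      by (rule Im_right) (use k l in \<open>simp_all add: \<iota>_closed aug_X\<close>)
    moreover have "dx (\<iota> (aug r)) (\<iota> (aug x)) \<in> Im"
      using Im_of_null[OF null[OF l]] by simp
    ultimately show "frag_of u \<in> Im" unfolding u by (metis Im_cong)
  qed (auto intro: Im_diff Im_null)
qed

lemma Z_exists:
  assumes "x \<in> carrier (P 0)" obtains c where "Z x c"
proof -
  have "dx \<one>\<^bsub>P 0\<^esub> x \<in> Im" using assms by (intro Im_all K_dx) auto
  then obtain e where e: "e \<in> K (Suc 0) (Suc 0)" "dx \<one>\<^bsub>P 0\<^esub> x - hd 0 e \<in> Null 0 (Suc 0)" by (auto simp: Im_def)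
  then have "Z x (- e)" using assms by (simp add: Z_def K_minus hd_minus)
  then show ?thesis by (rule that)
qed

text \<open>As \<open>x\<close> has augmentation zero, it equals some \<open>pd y\<close>;
  subtracting the boundary (pd y, -dy) removes the first component.\<close>

lemma kernel_rep:
  assumes "Z x c" "aug x = \<zero>\<^bsub>B\<^esub>"
  obtains c' where "Z \<zero>\<^bsub>P 0\<^esub> c'" "cl x c = cl \<zero>\<^bsub>P 0\<^esub> c'"
proof -
  note k = Z_carrier[OF assms(1)]
  have "aug x = aug \<zero>\<^bsub>P 0\<^esub>" using assms(2) ring_hom_zero[OF aug_hom P_ring B.ring_axioms] by simp
  then obtain y where y: "y \<in> carrier (P (Suc 0))" "x \<ominus>\<^bsub>P 0\<^esub> \<zero>\<^bsub>P 0\<^esub> = pd y"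
    by (rule aug_eq_pd[OF k(1) Om.R.zero_closed])
  have xy: "x = pd y" using y(2) k by (simp add: a_minus_def)
  let ?b = "- dx \<one>\<^bsub>P (Suc 0)\<^esub> y"
  have b: "Bd x ?b"
    unfolding xy by (rule BdI[OF _ y(1) K_zero]) (use y in \<open>auto intro!: K_minus K_dx\<close>)
  have z: "Z (x \<oplus>\<^bsub>P 0\<^esub> \<ominus>\<^bsub>P 0\<^esub> x) (c + - ?b)" by (rule Z_add[OF assms(1) Z_minus[OF Bd_Z[OF b]]])
  then have z': "Z \<zero>\<^bsub>P 0\<^esub> (c - ?b)" using k by (simp add: Om.R.r_neg)
  have "cl x c = cl \<zero>\<^bsub>P 0\<^esub> (c - ?b)"
    unfolding cl_eq_iff[OF assms(1) z'] using b k by (simp add: a_minus_def)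
  then show ?thesis using that z' by blast
qed

abbreviation (input) Y where "Y \<equiv> H0 A B f 2"

lemma Y_rep:
  assumes "u \<in> carrier Y" obtains x c where "Z x c" "u = cl x c"
  using assms unfolding H0_carrier by blast

lemma Y_closed: "Z x c \<Longrightarrow> cl x c \<in> carrier Y"
  unfolding H0_carrier by blast

lemma thickening_Y: "first_order_thickening A B f Y (H0_structure_map A B f 2) \<pi>Y"
proof -
  interpret Y: cring Y by (rule H0_cring)
  have \<phi>: "H0_structure_map A B f 2 \<in> ring_hom A Y"
  proof (rule ring_hom_memI)
    fix x y assume xy: "x \<in> carrier A" "y \<in> carrier A"
    show "H0_structure_map A B f 2 x \<in> carrier Y" using xy by (simp add: H0_structure Y_closed Z_cst)
    show "H0_structure_map A B f 2 (x \<otimes>\<^bsub>A\<^esub> y) = H0_structure_map A B f 2 x \<otimes>\<^bsub>Y\<^esub> H0_structure_map A B f 2 y"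
      using xy by (simp add: H0_structure H0_mult Z_cst ring_hom_mult[OF cst_hom[of 0]])
    show "H0_structure_map A B f 2 (x \<oplus>\<^bsub>A\<^esub> y) = H0_structure_map A B f 2 x \<oplus>\<^bsub>Y\<^esub> H0_structure_map A B f 2 y"
      using xy by (simp add: H0_structure H0_add Z_cst ring_hom_add[OF cst_hom[of 0]])
  next
    show "H0_structure_map A B f 2 \<one>\<^bsub>A\<^esub> = \<one>\<^bsub>Y\<^esub>" by (simp add: H0_structure H0_one ring_hom_one[OF cst_hom[of 0]])
  qed
  have \<pi>: "\<pi>Y \<in> ring_hom Y B"
  proof (rule ring_hom_memI)
    fix u v assume u: "u \<in> carrier Y" and v: "v \<in> carrier Y"
    obtain x c where xc: "Z x c" "u = cl x c" by (rule Y_rep[OF u])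
    obtain y e where ye: "Z y e" "v = cl y e" by (rule Y_rep[OF v])
    note k = Z_carrier[OF xc(1)] Z_carrier[OF ye(1)]
    show "\<pi>Y u \<in> carrier B" unfolding xc(2) \<pi>_cl[OF xc(1)] by (rule aug_closed[OF k(1)])
    show "\<pi>Y (u \<otimes>\<^bsub>Y\<^esub> v) = \<pi>Y u \<otimes>\<^bsub>B\<^esub> \<pi>Y v"
      unfolding xc(2) ye(2) H0_mult[OF xc(1) ye(1)] \<pi>_cl[OF xc(1)] \<pi>_cl[OF ye(1)] \<pi>_cl[OF Z_mult[OF xc(1) ye(1)]]
      by (rule ring_hom_mult[OF aug_hom k(1,3)])
    show "\<pi>Y (u \<oplus>\<^bsub>Y\<^esub> v) = \<pi>Y u \<oplus>\<^bsub>B\<^esub> \<pi>Y v"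
      unfolding xc(2) ye(2) H0_add[OF xc(1) ye(1)] \<pi>_cl[OF xc(1)] \<pi>_cl[OF ye(1)] \<pi>_cl[OF Z_add[OF xc(1) ye(1)]]
      by (rule ring_hom_add[OF aug_hom k(1,3)])
  next
    show "\<pi>Y \<one>\<^bsub>Y\<^esub> = \<one>\<^bsub>B\<^esub>" unfolding H0_one \<pi>_cl[OF Z_one] by (rule ring_hom_one[OF aug_hom])
  qed
  have surj: "\<pi>Y ` carrier Y = carrier B"
  proof (rule subset_antisym)
    show "\<pi>Y ` carrier Y \<subseteq> carrier B" using ring_hom_closed[OF \<pi>] by blast
    show "carrier B \<subseteq> \<pi>Y ` carrier Y"
    proof
      fix b assume b: "b \<in> carrier B"
      obtain c where c: "Z (\<iota> b) c" by (rule Z_exists[OF \<iota>_closed[OF b]])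
      show "b \<in> \<pi>Y ` carrier Y"
        by (rule image_eqI[OF _ Y_closed[OF c]]) (simp only: \<pi>_cl[OF c] aug_X[OF b])
    qed
  qed
  have prod0: "u \<otimes>\<^bsub>Y\<^esub> v = \<zero>\<^bsub>Y\<^esub>" if uk: "u \<in> a_kernel Y B \<pi>Y" and vk: "v \<in> a_kernel Y B \<pi>Y" for u v
  proof -
    have *: "\<exists>c. Z \<zero>\<^bsub>P 0\<^esub> c \<and> u = cl \<zero>\<^bsub>P 0\<^esub> c" if u: "u \<in> a_kernel Y B \<pi>Y" for u
    proof -
      have "u \<in> carrier Y" "\<pi>Y u = \<zero>\<^bsub>B\<^esub>" using u by (simp_all add: a_kernel_def' del: comp_apply)
      then obtain x c where xc: "Z x c" "u = cl x c" by (elim Y_rep)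
      then have "aug x = \<zero>\<^bsub>B\<^esub>" using \<open>\<pi>Y u = \<zero>\<^bsub>B\<^esub>\<close> \<pi>_cl[OF xc(1)] by simp
      obtain c' where "Z \<zero>\<^bsub>P 0\<^esub> c'" "cl x c = cl \<zero>\<^bsub>P 0\<^esub> c'"
        by (rule kernel_rep[OF xc(1) \<open>aug x = \<zero>\<^bsub>B\<^esub>\<close>])
      then show ?thesis using xc(2) by auto
    qed
    obtain c c' where c: "Z \<zero>\<^bsub>P 0\<^esub> c" "u = cl \<zero>\<^bsub>P 0\<^esub> c" and c': "Z \<zero>\<^bsub>P 0\<^esub> c'" "v = cl \<zero>\<^bsub>P 0\<^esub> c'"
      using *[OF uk] *[OF vk] by blast
    \<comment> \<open>In the product formula both scalars are \<open>s0\<close> of zero, so each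
      summand is a relation.\<close>
    have n: "sm (Suc 0) \<zero>\<^bsub>P (Suc 0)\<^esub> e \<in> Null (Suc 0) (Suc 0)" if "Z \<zero>\<^bsub>P 0\<^esub> e" for e
      using Z_carrier(2)[OF that] by (intro Om.smul_zero_left) (simp add: K_def)
    have zm: "Z (\<zero>\<^bsub>P 0\<^esub> \<otimes>\<^bsub>P 0\<^esub> \<zero>\<^bsub>P 0\<^esub>) (sm (Suc 0) (s0 \<zero>\<^bsub>P 0\<^esub>) c' + sm (Suc 0) (s0 \<zero>\<^bsub>P 0\<^esub>) c)"
      by (rule Z_mult[OF c(1) c'(1)])
    show ?thesis
      unfolding c(2) c'(2) H0_mult[OF c(1) c'(1)] H0_zero
      by (rule cl_eqI[OF zm Z_zero])
         (use Om.form_null_add[OF n[OF c'(1)] n[OF c(1)]] in \<open>simp_all add: s0_zero\<close>)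
  qed
  have zk: "\<zero>\<^bsub>Y\<^esub> \<in> a_kernel Y B \<pi>Y"
    using ring_hom_zero[OF \<pi> Y.ring_axioms B.ring_axioms] by (simp add: a_kernel_def' del: comp_apply)
  have "ideal_prod Y (a_kernel Y B \<pi>Y) (a_kernel Y B \<pi>Y) = {\<zero>\<^bsub>Y\<^esub>}"
  proof (rule subset_antisym)
    show "ideal_prod Y (a_kernel Y B \<pi>Y) (a_kernel Y B \<pi>Y) \<subseteq> {\<zero>\<^bsub>Y\<^esub>}"
    proof
      fix u assume "u \<in> ideal_prod Y (a_kernel Y B \<pi>Y) (a_kernel Y B \<pi>Y)"
      then show "u \<in> {\<zero>\<^bsub>Y\<^esub>}" by (induction rule: ideal_prod.induct) (simp_all add: prod0)
    qed
    show "{\<zero>\<^bsub>Y\<^esub>} \<subseteq> ideal_prod Y (a_kernel Y B \<pi>Y) (a_kernel Y B \<pi>Y)"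
      using ideal_prod.prod[OF zk zk, of Y] prod0[OF zk zk] by simp
  qed
  moreover have "\<pi>Y (H0_structure_map A B f 2 a) = f a" if "a \<in> carrier A" for a
    unfolding H0_structure \<pi>_cl[OF Z_cst[OF that]] by (rule aug_cst[OF that])
  ultimately show ?thesis
    unfolding first_order_thickening_def using H0_cring \<phi> \<pi> surj by blast
qed

end

section \<open>Universality\<close>

context cring
begin

lemma mult_minus_distrib:
  "\<lbrakk>x \<in> carrier R; y \<in> carrier R; z \<in> carrier R\<rbrakk> \<Longrightarrow> x \<otimes> y \<ominus> x \<otimes> z = x \<otimes> (y \<ominus> z)"
  by algebra

lemma minus_add_swap:
  "\<lbrakk>x \<in> carrier R; x' \<in> carrier R; y \<in> carrier R; y' \<in> carrier R\<rbrakk> \<Longrightarrow>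
  (x \<ominus> x') \<oplus> (y \<ominus> y') = (x \<oplus> y) \<ominus> (x' \<oplus> y')"
  by algebra

lemma add_add_swap:
  "\<lbrakk>x \<in> carrier R; x' \<in> carrier R; y \<in> carrier R; y' \<in> carrier R\<rbrakk> \<Longrightarrow>
  (x \<oplus> x') \<oplus> (y \<oplus> y') = (x \<oplus> y) \<oplus> (x' \<oplus> y')"
  by algebra

lemma expand_product:
  "\<lbrakk>x \<in> carrier R; x' \<in> carrier R; y \<in> carrier R; y' \<in> carrier R\<rbrakk> \<Longrightarrow>
  x \<otimes> y \<oplus> (x \<otimes> y' \<oplus> y \<otimes> x') \<oplus> x' \<otimes> y' = (x \<oplus> x') \<otimes> (y \<oplus> y')"
  by algebra

text \<open>With \<open>x\<close>, \<open>y\<close> and \<open>x'\<close>, \<open>y'\<close> the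
  values of two homomorphisms, the left side measures how far their difference is from a derivation.
  The defect contains a product of two differences. Here the primed map supplies the
  coefficients.\<close>

lemma derivation_defect_left:
  "\<lbrakk>r \<in> carrier R; x \<in> carrier R; x' \<in> carrier R; y \<in> carrier R; y' \<in> carrier R\<rbrakk> \<Longrightarrow>
  r \<otimes> (x \<otimes> y \<ominus> x' \<otimes> y') \<ominus> r \<otimes> x' \<otimes> (y \<ominus> y') \<ominus> r \<otimes> y' \<otimes> (x \<ominus> x')
    = r \<otimes> ((x \<ominus> x') \<otimes> (y \<ominus> y'))"
  by algebra

text \<open>The same with coefficients from the unprimed map, which changes the sign of the
  defect.\<close>

lemma derivation_defect_right:
  "\<lbrakk>r \<in> carrier R; x \<in> carrier R; x' \<in> carrier R; y \<in> carrier R; y' \<in> carrier R\<rbrakk> \<Longrightarrow>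
  r \<otimes> (x \<otimes> y \<ominus> x' \<otimes> y') \<ominus> r \<otimes> x \<otimes> (y \<ominus> y') \<ominus> r \<otimes> y \<otimes> (x \<ominus> x')
    = \<ominus> (r \<otimes> ((x \<ominus> x') \<otimes> (y \<ominus> y')))"
  by algebra

text \<open>The alternating sum that arises from \<open>psi\<close> of the boundary of a form on P_2
  once the simplicial identities have identified repeated faces; it collapses to a product of two
  differences.\<close>

lemma simplicial_defect:
  "\<lbrakk>r \<in> carrier R; s \<in> carrier R; p \<in> carrier R; q \<in> carrier R; e \<in> carrier R\<rbrakk> \<Longrightarrow>
  r \<otimes> (p \<ominus> q) \<ominus> s \<otimes> (p \<ominus> e) \<oplus> s \<otimes> (q \<ominus> e) = (r \<ominus> s) \<otimes> (p \<ominus> q)"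
  by algebra

lemma additivity_left:
  "\<lbrakk>r \<in> carrier R; s \<in> carrier R; x \<in> carrier R\<rbrakk> \<Longrightarrow> (r \<oplus> s) \<otimes> x \<ominus> r \<otimes> x \<ominus> s \<otimes> x = \<zero>"
  by algebra

lemma additivity_right:
  "\<lbrakk>r \<in> carrier R; x \<in> carrier R; x' \<in> carrier R; y \<in> carrier R; y' \<in> carrier R\<rbrakk> \<Longrightarrow>
  r \<otimes> ((x \<oplus> y) \<ominus> (x' \<oplus> y')) \<ominus> r \<otimes> (x \<ominus> x') \<ominus> r \<otimes> (y \<ominus> y') = \<zero>"
  by algebra

end

lemma (in abelian_group) frag_lift_relation:
  assumes "u \<in> S" "v \<in> S" "w \<in> S" "\<And>x. x \<in> S \<Longrightarrow> \<phi> x \<in> carrier G"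
  shows "frag_lift G \<phi> (frag_of u - frag_of v - frag_of w) = \<phi> u \<ominus> \<phi> v \<ominus> \<phi> w"
proof -
  have k: "Poly_Mapping.keys (frag_of u) \<subseteq> S" "Poly_Mapping.keys (frag_of v) \<subseteq> S" "Poly_Mapping.keys (frag_of w) \<subseteq> S"
    using assms by simp_all
  show ?thesis
    using frag_lift_diff[OF keys_diff_subset[OF k(1,2)] k(3), of \<phi>] frag_lift_diff[OF k(1,2), of \<phi>] assms
    by (simp add: frag_lift_of)
qed

section \<open>The conormal map on one-forms of P_1\<close>

context algebra_map
begin

text \<open>The coefficient is taken along \<open>d1\<close>. Along \<open>d0\<close> the value
  would change by a product of two elements of the augmentation kernel, which every lift to a
  thickening kills.\<close>

definition psym :: "('a, 'b) pol \<times> ('a, 'b) pol list \<Rightarrow> ('a, 'b) pol" where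
  "psym u = d1 (fst u) \<otimes>\<^bsub>P 0\<^esub> pd (snd u ! 0)"

text \<open>The map \<open>\<Omega>\<^sup>1(P\<^sub>1) \<rightarrow> J/J\<^sup>2\<close>, \<open>r dy \<mapsto> r (d\<^sub>0 y - d\<^sub>1 y)\<close>, lifted to \<open>P\<^sub>0\<close>.\<close>

definition psi :: "('a, 'b) pol form_chain \<Rightarrow> ('a, 'b) pol" where
  "psi = frag_lift (P 0) psym"

lemma form_symbols_1E:
  assumes "u \<in> form_symbols R (Suc 0)"
  obtains r x where "u = (r, [x])" "r \<in> carrier R" "x \<in> carrier R"
  using assms by (auto simp: form_symbols_def length_Suc_conv)

lemma symbol_1: "\<lbrakk>r \<in> carrier R; x \<in> carrier R\<rbrakk> \<Longrightarrow> (r, [x]) \<in> form_symbols R (Suc 0)"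
  by (simp add: form_symbols_def)

lemma psym_closed: "u \<in> form_symbols (P (Suc 0)) (Suc 0) \<Longrightarrow> psym u \<in> carrier (P 0)"
  by (erule form_symbols_1E) (simp add: psym_def d1_closed pd_closed)

lemma psi_closed: "c \<in> K (Suc 0) (Suc 0) \<Longrightarrow> psi c \<in> carrier (P 0)"
  unfolding psi_def by (rule Om.R.frag_lift_closed) (auto simp: K_def intro!: psym_closed)

lemma psi_add: "\<lbrakk>c \<in> K (Suc 0) (Suc 0); c' \<in> K (Suc 0) (Suc 0)\<rbrakk> \<Longrightarrow> psi (c + c') = psi c \<oplus>\<^bsub>P 0\<^esub> psi c'"
  unfolding psi_def K_def mem_Collect_eq by (rule Om.R.frag_lift_add) (auto intro!: psym_closed)

lemma psi_diff: "\<lbrakk>c \<in> K (Suc 0) (Suc 0); c' \<in> K (Suc 0) (Suc 0)\<rbrakk> \<Longrightarrow> psi (c - c') = psi c \<ominus>\<^bsub>P 0\<^esub> psi c'"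
  unfolding psi_def K_def mem_Collect_eq by (rule Om.R.frag_lift_diff) (auto intro!: psym_closed)

lemma psi_zero: "psi 0 = \<zero>\<^bsub>P 0\<^esub>"
  unfolding psi_def by (rule Om.R.frag_lift_zero)

lemma psi_dx: "\<lbrakk>r \<in> carrier (P (Suc 0)); y \<in> carrier (P (Suc 0))\<rbrakk> \<Longrightarrow> psi (dx r y) = d1 r \<otimes>\<^bsub>P 0\<^esub> pd y"
  unfolding psi_def using Om.R.frag_lift_of[of psym "(r, [y])" 0] psym_closed[OF symbol_1, of r y] by (simp add: psym_def)

lemma K_induct [consumes 1, case_names zero diff symbol]:
  assumes "c \<in> K n (Suc 0)" "Q 0"
    "\<And>c c'. \<lbrakk>c \<in> K n (Suc 0); c' \<in> K n (Suc 0); Q c; Q c'\<rbrakk> \<Longrightarrow> Q (c - c')"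
    "\<And>r x. \<lbrakk>r \<in> carrier (P n); x \<in> carrier (P n)\<rbrakk> \<Longrightarrow> Q (dx r x)"
  shows "Q c"
  using assms(1) unfolding K_def mem_Collect_eq
proof (rule free_Abelian_group_induct)
  show "Q (frag_of u)" if "u \<in> form_symbols (P n) (Suc 0)" for u
    using that by (rule form_symbols_1E) (simp add: assms(4))
qed (use assms(2,3) in \<open>auto simp: K_def\<close>)

lemma aug_psi: "c \<in> K (Suc 0) (Suc 0) \<Longrightarrow> aug (psi c) = \<zero>\<^bsub>B\<^esub>"
proof (induction rule: K_induct)
  case zero
  then show ?case using ring_hom_zero[OF aug_hom P_ring B.ring_axioms] by (simp add: psi_zero)
next
  case (diff c c')
  then show ?case
    by (simp add: psi_diff ring_hom_diff[OF aug_hom P_ring B.ring_axioms] psi_closed B.minus_eq)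
next
  case (symbol r x)
  then show ?case by (simp add: psi_dx ring_hom_mult[OF aug_hom] d1_closed pd_closed aug_pd aug_closed)
qed

lemma psi_sm:
  assumes "x \<in> carrier (P 0)"
  shows "c \<in> K (Suc 0) (Suc 0) \<Longrightarrow> psi (sm (Suc 0) (s0 x) c) = x \<otimes>\<^bsub>P 0\<^esub> psi c"
proof (induction rule: K_induct)
  case zero
  then show ?case using assms by (simp add: psi_zero)
next
  case (diff c c')
  have "x \<otimes>\<^bsub>P 0\<^esub> psi c \<ominus>\<^bsub>P 0\<^esub> x \<otimes>\<^bsub>P 0\<^esub> psi c' = x \<otimes>\<^bsub>P 0\<^esub> (psi c \<ominus>\<^bsub>P 0\<^esub> psi c')"
    using assms psi_closed[OF diff.hyps(1)] psi_closed[OF diff.hyps(2)] by (rule Om.R.mult_minus_distrib)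
  then show ?case
    using diff assms by (simp add: Om.smul_diff psi_diff K_sm s0_closed)
next
  case (symbol r y)
  then show ?case using assms
    by (simp add: psi_dx d1_mult s0_closed face_1_deg_0_base Om.R.m_assoc d1_closed pd_closed)
qed

end

section \<open>Lifts of the augmentation to a thickening and the morphisms they induce\<close>

locale thickening_target = algebra_map A B f + T: cring T
  for A :: "('a, 'm) ring_scheme" (structure) and B :: "('b, 'n) ring_scheme" (structure) and f
    and T :: "('c, 't) ring_scheme" (structure) +
  fixes \<phi>' :: "'a \<Rightarrow> 'c" and \<pi>' :: "'c \<Rightarrow> 'b"
  assumes thick: "first_order_thickening A B f T \<phi>' \<pi>'"
begin

lemma \<phi>'_hom: "\<phi>' \<in> ring_hom A T" and \<pi>'_hom: "\<pi>' \<in> ring_hom T B"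
  and \<pi>'\<phi>': "a \<in> carrier A \<Longrightarrow> \<pi>' (\<phi>' a) = f a" and \<pi>'_surj: "\<pi>' ` carrier T = carrier B"
  using thick by (auto simp: first_order_thickening_def)

lemma kernel_mult_zero:
  assumes "t \<in> carrier T" "\<pi>' t = \<zero>\<^bsub>B\<^esub>" "t' \<in> carrier T" "\<pi>' t' = \<zero>\<^bsub>B\<^esub>"
  shows "t \<otimes>\<^bsub>T\<^esub> t' = \<zero>\<^bsub>T\<^esub>"
proof -
  have "t \<in> a_kernel T B \<pi>'" "t' \<in> a_kernel T B \<pi>'" using assms by (simp_all add: a_kernel_def')
  then have "t \<otimes>\<^bsub>T\<^esub> t' \<in> ideal_prod T (a_kernel T B \<pi>') (a_kernel T B \<pi>')" by (rule ideal_prod.prod)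
  then show ?thesis using thick by (simp add: first_order_thickening_def)
qed

definition lift where
  "lift g \<longleftrightarrow> g \<in> ring_hom (P 0) T \<and> (\<forall>a\<in>carrier A. g (cst a) = \<phi>' a) \<and> (\<forall>x\<in>carrier (P 0). \<pi>' (g x) = aug x)"

text \<open>P_0 is a polynomial algebra on the elements of B, so the variables may be sent to
  arbitrary preimages under \<pi>'; the composite with \<pi>' then agrees with \<open>aug\<close> on
  generators.\<close>

lemma lift_exists: "\<exists>g. lift g"
proof -
  define t where "t = inv_into (carrier T) \<pi>'"
  have t: "t b \<in> carrier T \<and> \<pi>' (t b) = b" if "b \<in> carrier B" for b
  proof -
    have "b \<in> \<pi>' ` carrier T" using \<pi>'_surj that by simp
    then show ?thesis unfolding t_def using inv_into_into[of b \<pi>' "carrier T"] f_inv_into_f[of b \<pi>' "carrier T"] by simp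
  qed
  let ?\<rho> = "case_var t (\<lambda>_. \<zero>\<^bsub>T\<^esub>) :: ('a, 'b) var \<Rightarrow> 'c"
  let ?g = "poly_alg_eval A T \<phi>' ?\<rho>"
  have \<rho>: "?\<rho> v \<in> carrier T" if "v \<in> res_vars A B 0" for v
    using that t by (auto simp: res_vars.simps)
  note g = eval_facts[OF T.cring_axioms \<phi>'_hom \<rho>]
  have "(\<pi>' \<circ> ?g) x = aug x" if "x \<in> carrier (P 0)" for x
  proof (rule P_hom_eq[OF ring_hom_trans[OF g(1) \<pi>'_hom] aug_hom _ _ that])
    show "(\<pi>' \<circ> ?g) (cst a) = aug (cst a)" if "a \<in> carrier A" for a
      using that by (simp add: g(2) \<pi>'\<phi>' aug_cst)
    fix v assume v: "v \<in> res_vars A B 0"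
    then obtain b where "v = Base b" "b \<in> carrier B" by (auto simp: res_vars.simps)
    then show "(\<pi>' \<circ> ?g) (ind v) = aug (ind v)" using v t by (simp add: g(3) aug_X)
  qed
  then have "lift ?g" using g(1,2) by (simp add: lift_def)
  then show ?thesis by blast
qed

context
  fixes g assumes g: "lift g"
begin

lemma g_hom: "g \<in> ring_hom (P 0) T" and g_cst: "a \<in> carrier A \<Longrightarrow> g (cst a) = \<phi>' a"
  and g_aug: "x \<in> carrier (P 0) \<Longrightarrow> \<pi>' (g x) = aug x"
  using g by (auto simp: lift_def)

lemmas g_closed = ring_hom_closed[OF g_hom]
  and g_add = ring_hom_add[OF g_hom]
  and g_mult = ring_hom_mult[OF g_hom]
  and g_one = ring_hom_one[OF g_hom]
  and g_zero = ring_hom_zero[OF g_hom P_ring T.ring_axioms]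
  and g_diff = ring_hom_diff[OF g_hom P_ring T.ring_axioms]

lemma g_J2:
  assumes "x \<in> carrier (P 0)" "aug x = \<zero>\<^bsub>B\<^esub>" "y \<in> carrier (P 0)" "aug y = \<zero>\<^bsub>B\<^esub>"
  shows "g x \<otimes>\<^bsub>T\<^esub> g y = \<zero>\<^bsub>T\<^esub>"
  using assms by (intro kernel_mult_zero) (simp_all add: g_closed g_aug)

text \<open>\<open>psi\<close> respects additivity exactly, and it kills constants because both
  faces fix them. For the product rule the defect is \<open>d1 r\<close> times a product of two
  values of \<open>pd\<close>, which \<open>g\<close> sends to zero.\<close>

lemma g_psi_null:
  assumes "c \<in> Null (Suc 0) (Suc 0)" shows "g (psi c) = \<zero>\<^bsub>T\<^esub>"
proof (rule Om.form_null_induct[OF assms])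
  show "g (psi 0) = \<zero>\<^bsub>T\<^esub>" by (simp add: psi_zero g_zero)
next
  fix c c' assume "c \<in> Null (Suc 0) (Suc 0)" "c' \<in> Null (Suc 0) (Suc 0)" "g (psi c) = \<zero>\<^bsub>T\<^esub>" "g (psi c') = \<zero>\<^bsub>T\<^esub>"
  then show "g (psi (c - c')) = \<zero>\<^bsub>T\<^esub>"
    using Null_K by (simp add: psi_diff g_diff psi_closed T.minus_eq)
next
  have rel: "psi (frag_of u - frag_of v - frag_of w) = psym u \<ominus>\<^bsub>P 0\<^esub> psym v \<ominus>\<^bsub>P 0\<^esub> psym w"
    if "u \<in> form_symbols (P (Suc 0)) (Suc 0)" "v \<in> form_symbols (P (Suc 0)) (Suc 0)" "w \<in> form_symbols (P (Suc 0)) (Suc 0)" for u v w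
    unfolding psi_def by (rule Om.R.frag_lift_relation[OF that psym_closed])
  note cl = d0_closed d1_closed
  fix c assume "c \<in> form_relations A (P (Suc 0)) cst (Suc 0)"
  then show "g (psi c) = \<zero>\<^bsub>T\<^esub>"
  proof cases
    case (coeff_add r xs s)
    then obtain x where k: "xs = [x]" "r \<in> carrier (P (Suc 0))" "s \<in> carrier (P (Suc 0))" "x \<in> carrier (P (Suc 0))"
      by (auto simp: form_symbols_def length_Suc_conv)
    have "psi c = (d1 r \<oplus>\<^bsub>P 0\<^esub> d1 s) \<otimes>\<^bsub>P 0\<^esub> pd x \<ominus>\<^bsub>P 0\<^esub> d1 r \<otimes>\<^bsub>P 0\<^esub> pd x \<ominus>\<^bsub>P 0\<^esub> d1 s \<otimes>\<^bsub>P 0\<^esub> pd x"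
      unfolding coeff_add(1) k(1) using k by (subst rel) (simp_all add: symbol_1 psym_def d1_add)
    also have "\<dots> = \<zero>\<^bsub>P 0\<^esub>" using k by (intro Om.R.additivity_left cl pd_closed)
    finally show ?thesis by (simp add: g_zero)
  next
    case (d_add r us x vs y)
    then have k: "us = []" "vs = []" "r \<in> carrier (P (Suc 0))" "x \<in> carrier (P (Suc 0))" "y \<in> carrier (P (Suc 0))"
      by (auto simp: form_symbols_def)
    have "psi c = d1 r \<otimes>\<^bsub>P 0\<^esub> ((d0 x \<oplus>\<^bsub>P 0\<^esub> d0 y) \<ominus>\<^bsub>P 0\<^esub> (d1 x \<oplus>\<^bsub>P 0\<^esub> d1 y))
        \<ominus>\<^bsub>P 0\<^esub> d1 r \<otimes>\<^bsub>P 0\<^esub> (d0 x \<ominus>\<^bsub>P 0\<^esub> d1 x) \<ominus>\<^bsub>P 0\<^esub> d1 r \<otimes>\<^bsub>P 0\<^esub> (d0 y \<ominus>\<^bsub>P 0\<^esub> d1 y)"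
      unfolding d_add(1) k(1,2) using k by (simp add: rel symbol_1 psym_def pd_def d0_add d1_add)
    also have "\<dots> = \<zero>\<^bsub>P 0\<^esub>" using k by (intro Om.R.additivity_right cl)
    finally show ?thesis by (simp add: g_zero)
  next
    case (d_mult r us x vs y)
    then have k: "us = []" "vs = []" "r \<in> carrier (P (Suc 0))" "x \<in> carrier (P (Suc 0))" "y \<in> carrier (P (Suc 0))"
      by (auto simp: form_symbols_def)
    have "psi c = d1 r \<otimes>\<^bsub>P 0\<^esub> (d0 x \<otimes>\<^bsub>P 0\<^esub> d0 y \<ominus>\<^bsub>P 0\<^esub> d1 x \<otimes>\<^bsub>P 0\<^esub> d1 y)
        \<ominus>\<^bsub>P 0\<^esub> d1 r \<otimes>\<^bsub>P 0\<^esub> d1 x \<otimes>\<^bsub>P 0\<^esub> (d0 y \<ominus>\<^bsub>P 0\<^esub> d1 y)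
        \<ominus>\<^bsub>P 0\<^esub> d1 r \<otimes>\<^bsub>P 0\<^esub> d1 y \<otimes>\<^bsub>P 0\<^esub> (d0 x \<ominus>\<^bsub>P 0\<^esub> d1 x)"
      unfolding d_mult(1) k(1,2) using k by (simp add: rel symbol_1 psym_def pd_def d0_mult d1_mult)
    also have "\<dots> = d1 r \<otimes>\<^bsub>P 0\<^esub> (pd x \<otimes>\<^bsub>P 0\<^esub> pd y)"
      unfolding pd_def using k by (intro Om.R.derivation_defect_left cl)
    finally have "g (psi c) = g (d1 r) \<otimes>\<^bsub>T\<^esub> (g (pd x) \<otimes>\<^bsub>T\<^esub> g (pd y))"
      using k by (simp add: g_mult cl pd_closed)
    also have "g (pd x) \<otimes>\<^bsub>T\<^esub> g (pd y) = \<zero>\<^bsub>T\<^esub>" using k by (intro g_J2 pd_closed aug_pd)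
    finally show ?thesis using k by (simp add: g_closed cl)
  next
    case (d_const r us a vs)
    then have k: "us = []" "vs = []" "r \<in> carrier (P (Suc 0))" "a \<in> carrier A"
      by (auto simp: form_symbols_def)
    have "pd (cst a) = \<zero>\<^bsub>P 0\<^esub>" using k by (simp add: pd_def face_cst Om.R.r_right_minus_eq cst_closed)
    then show ?thesis unfolding d_const(1) k(1,2) using k by (simp add: psi_dx cst_closed cl g_zero)
  next
    case (alternating r us x vs ws)
    then show ?thesis by (auto simp: form_symbols_def)
  qed
qed

text \<open>The three faces of r dz combine into a product of two elements with augmentation zero,
  so the composite of \<open>psi\<close> with \<partial> vanishes after applying
  \<open>g\<close>.\<close>

lemma g_psi_hd: "e \<in> K (Suc (Suc 0)) (Suc 0) \<Longrightarrow> g (psi (hd (Suc 0) e)) = \<zero>\<^bsub>T\<^esub>"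
proof (induction rule: K_induct)
  case zero
  then show ?case by (simp add: psi_zero g_zero)
next
  case (diff c c')
  then show ?case by (simp add: hd_diff psi_diff hd_K g_diff psi_closed T.minus_eq)
next
  case (symbol r z)
  let ?d = "d (Suc (Suc 0))"
  have c: "?d j r \<in> carrier (P (Suc 0))" "?d j z \<in> carrier (P (Suc 0))" if "j \<le> Suc (Suc 0)" for j
    using that symbol by (simp_all add: face_closed)
  have cl: "d0 (?d j r) \<in> carrier (P 0)" "d1 (?d j r) \<in> carrier (P 0)" "d0 (?d j z) \<in> carrier (P 0)" "d1 (?d j z) \<in> carrier (P 0)"
    if "j \<le> Suc (Suc 0)" for j
    using c[OF that] by (simp_all add: d0_closed d1_closed)
  note id = face_0_1[OF symbol(2)] face_0_2[OF symbol(2)] face_1_2[OF symbol(2)]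
    face_0_1[OF symbol(1)] face_0_2[OF symbol(1)] face_1_2[OF symbol(1)]
  have "psi (hd (Suc 0) (dx r z)) = d1 (?d 0 r) \<otimes>\<^bsub>P 0\<^esub> pd (?d 0 z) \<ominus>\<^bsub>P 0\<^esub> d1 (?d (Suc 0) r) \<otimes>\<^bsub>P 0\<^esub> pd (?d (Suc 0) z)
      \<oplus>\<^bsub>P 0\<^esub> d1 (?d (Suc (Suc 0)) r) \<otimes>\<^bsub>P 0\<^esub> pd (?d (Suc (Suc 0)) z)"
    using c by (simp add: hd_1 psi_add psi_diff psi_dx K_dx K_diff)
  also have "\<dots> = d1 (?d 0 r) \<otimes>\<^bsub>P 0\<^esub> (d0 (?d 0 z) \<ominus>\<^bsub>P 0\<^esub> d1 (?d 0 z))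
      \<ominus>\<^bsub>P 0\<^esub> d1 (?d (Suc 0) r) \<otimes>\<^bsub>P 0\<^esub> (d0 (?d 0 z) \<ominus>\<^bsub>P 0\<^esub> d1 (?d (Suc 0) z))
      \<oplus>\<^bsub>P 0\<^esub> d1 (?d (Suc 0) r) \<otimes>\<^bsub>P 0\<^esub> (d1 (?d 0 z) \<ominus>\<^bsub>P 0\<^esub> d1 (?d (Suc 0) z))"
    by (simp add: pd_def id)
  also have "\<dots> = (d1 (?d 0 r) \<ominus>\<^bsub>P 0\<^esub> d1 (?d (Suc 0) r)) \<otimes>\<^bsub>P 0\<^esub> pd (?d 0 z)"
    unfolding pd_def by (rule Om.R.simplicial_defect) (use cl in simp_all)
  finally have "g (psi (hd (Suc 0) (dx r z))) = g (d1 (?d 0 r) \<ominus>\<^bsub>P 0\<^esub> d1 (?d (Suc 0) r)) \<otimes>\<^bsub>T\<^esub> g (pd (?d 0 z))"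
    using c cl by (simp add: g_mult pd_closed)
  also have "\<dots> = \<zero>\<^bsub>T\<^esub>"
  proof (rule g_J2)
    \<comment> \<open>The two vertices are joined through the face
      \<open>?d (Suc (Suc 0)) r\<close>, whose own faces have the same augmentation.\<close>
    have "aug (d1 (?d 0 r)) = aug (d0 (?d (Suc (Suc 0)) r))" by (simp only: id)
    also have "\<dots> = aug (d1 (?d (Suc (Suc 0)) r))" using c by (intro aug_face) simp
    also have "\<dots> = aug (d1 (?d (Suc 0) r))" by (simp only: id)
    finally show "aug (d1 (?d 0 r) \<ominus>\<^bsub>P 0\<^esub> d1 (?d (Suc 0) r)) = \<zero>\<^bsub>B\<^esub>"
      using cl by (simp add: ring_hom_diff[OF aug_hom P_ring B.ring_axioms] aug_closed B.r_right_minus_eq)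
  qed (use c cl in \<open>simp_all add: pd_closed aug_pd\<close>)
  finally show ?case .
qed

text \<open>The minus sign in the boundaries makes the terms cancel: \<open>psi\<close> sends 1 dy
  to \<open>pd y\<close>, while \<open>g\<close> kills \<open>psi\<close> of the horizontal
  boundary.\<close>

lemma g_Bd:
  assumes "Bd x c" shows "g (x \<oplus>\<^bsub>P 0\<^esub> psi c) = \<zero>\<^bsub>T\<^esub>"
proof -
  obtain y e where z: "c \<in> K (Suc 0) (Suc 0)" "y \<in> carrier (P (Suc 0))" "e \<in> K (Suc (Suc 0)) (Suc 0)"
    "c - (hd (Suc 0) e - dx \<one>\<^bsub>P (Suc 0)\<^esub> y) \<in> Null (Suc 0) (Suc 0)" and x: "x = pd y"
    using assms by (auto simp: Bd_def)
  have k: "hd (Suc 0) e \<in> K (Suc 0) (Suc 0)" "dx \<one>\<^bsub>P (Suc 0)\<^esub> y \<in> K (Suc 0) (Suc 0)"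
    using z by (auto intro: hd_K K_dx)
  have "\<zero>\<^bsub>T\<^esub> = g (psi (c - (hd (Suc 0) e - dx \<one>\<^bsub>P (Suc 0)\<^esub> y)))" using g_psi_null[OF z(4)] by simp
  also have "\<dots> = g (psi c) \<ominus>\<^bsub>T\<^esub> (\<zero>\<^bsub>T\<^esub> \<ominus>\<^bsub>T\<^esub> g (pd y))"
    using z k by (simp add: psi_diff K_diff g_diff psi_closed g_psi_hd psi_dx d1_one pd_closed)
  also have "\<dots> = g (pd y) \<oplus>\<^bsub>T\<^esub> g (psi c)"
    using z by (simp add: T.minus_eq g_closed psi_closed pd_closed T.a_comm)
  finally show ?thesis using z x by (simp add: g_add psi_closed pd_closed)
qed

lemma g_cl:
  assumes "Z x c" "Z x' c'" "cl x c = cl x' c'"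
  shows "g (x \<oplus>\<^bsub>P 0\<^esub> psi c) = g (x' \<oplus>\<^bsub>P 0\<^esub> psi c')"
proof -
  note k = Z_carrier[OF assms(1)] Z_carrier[OF assms(2)]
  have "g ((x \<ominus>\<^bsub>P 0\<^esub> x') \<oplus>\<^bsub>P 0\<^esub> psi (c - c')) = \<zero>\<^bsub>T\<^esub>"
    using g_Bd assms cl_eq_iff[OF assms(1,2)] by simp
  moreover have "(x \<ominus>\<^bsub>P 0\<^esub> x') \<oplus>\<^bsub>P 0\<^esub> psi (c - c') = (x \<oplus>\<^bsub>P 0\<^esub> psi c) \<ominus>\<^bsub>P 0\<^esub> (x' \<oplus>\<^bsub>P 0\<^esub> psi c')"
    unfolding psi_diff[OF k(2,4)] by (rule Om.R.minus_add_swap) (use k psi_closed in auto)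
  ultimately have "g (x \<oplus>\<^bsub>P 0\<^esub> psi c) \<ominus>\<^bsub>T\<^esub> g (x' \<oplus>\<^bsub>P 0\<^esub> psi c') = \<zero>\<^bsub>T\<^esub>"
    using k by (simp add: g_diff psi_closed)
  then show ?thesis using k by (simp add: T.r_right_minus_eq g_closed psi_closed)
qed

text \<open>The value is read off from all representing pairs at once, and \<open>g_cl\<close> shows
  that they agree. The restriction to the carrier gives the extensionality demanded of
  morphisms.\<close>

definition ext where
  "ext = (\<lambda>u\<in>carrier (H0 A B f 2). the_elem ((\<lambda>(x, c). g (x \<oplus>\<^bsub>P 0\<^esub> psi c)) ` {(x, c). Z x c \<and> u = cl x c}))"

lemma ext_cl: "Z x c \<Longrightarrow> ext (cl x c) = g (x \<oplus>\<^bsub>P 0\<^esub> psi c)"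
proof -
  assume z: "Z x c"
  then have "cl x c \<in> carrier (H0 A B f 2)" unfolding H0_carrier by blast
  moreover have "the_elem ((\<lambda>(x, c). g (x \<oplus>\<^bsub>P 0\<^esub> psi c)) ` {(x', c'). Z x' c' \<and> cl x c = cl x' c'}) = g (x \<oplus>\<^bsub>P 0\<^esub> psi c)"
  proof (rule the_elem_constI)
    show "{(x', c'). Z x' c' \<and> cl x c = cl x' c'} \<noteq> {}" using z by blast
    fix w assume "w \<in> {(x', c'). Z x' c' \<and> cl x c = cl x' c'}"
    then obtain x' c' where w: "w = (x', c')" "Z x' c'" "cl x c = cl x' c'" by blast
    show "(case w of (x, c) \<Rightarrow> g (x \<oplus>\<^bsub>P 0\<^esub> psi c)) = g (x \<oplus>\<^bsub>P 0\<^esub> psi c)"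
      unfolding w(1) prod.case by (rule g_cl[OF z w(2,3), symmetric])
  qed
  ultimately show ?thesis by (simp add: ext_def)
qed

lemma ext_hom: "ext \<in> thickening_hom A (H0 A B f 2) (H0_structure_map A B f 2) \<pi>Y T \<phi>' \<pi>'"
proof -
  let ?Y = "H0 A B f 2"
  have rep: "\<exists>x c. Z x c \<and> w = cl x c" if "w \<in> carrier ?Y" for w
    using that unfolding H0_carrier by blast
  have hom: "ext \<in> ring_hom ?Y T"
  proof (rule ring_hom_memI)
    fix u v assume u: "u \<in> carrier ?Y" and v: "v \<in> carrier ?Y"
    obtain x c where xc: "Z x c" "u = cl x c" using rep[OF u] by blast
    obtain y e where ye: "Z y e" "v = cl y e" using rep[OF v] by blast
    note k = Z_carrier[OF xc(1)] Z_carrier[OF ye(1)]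
    note pc = psi_closed[OF k(2)] psi_closed[OF k(4)]
      show "ext u \<in> carrier T" unfolding xc(2) ext_cl[OF xc(1)] using k pc by (intro g_closed) simp
    have "(x \<oplus>\<^bsub>P 0\<^esub> y) \<oplus>\<^bsub>P 0\<^esub> (psi c \<oplus>\<^bsub>P 0\<^esub> psi e) = (x \<oplus>\<^bsub>P 0\<^esub> psi c) \<oplus>\<^bsub>P 0\<^esub> (y \<oplus>\<^bsub>P 0\<^esub> psi e)"
      by (rule Om.R.add_add_swap) (use k pc in auto)
    then show "ext (u \<oplus>\<^bsub>?Y\<^esub> v) = ext u \<oplus>\<^bsub>T\<^esub> ext v"
      unfolding xc(2) ye(2) H0_add[OF xc(1) ye(1)] ext_cl[OF xc(1)] ext_cl[OF ye(1)] ext_cl[OF Z_add[OF xc(1) ye(1)]]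
        psi_add[OF k(2,4)]
      using k pc by (simp add: g_add)
    have p: "psi (sm (Suc 0) (s0 x) e + sm (Suc 0) (s0 y) c) = x \<otimes>\<^bsub>P 0\<^esub> psi e \<oplus>\<^bsub>P 0\<^esub> y \<otimes>\<^bsub>P 0\<^esub> psi c"
      using k by (simp add: psi_add K_sm s0_closed psi_sm)
    \<comment> \<open>A product of two kernel elements; it may be added to complete the product of g
      x + g(psi c) with g y + g(psi e).\<close>
    have j: "g (psi c) \<otimes>\<^bsub>T\<^esub> g (psi e) = \<zero>\<^bsub>T\<^esub>" using k pc by (intro g_J2 aug_psi)
    have "g (x \<otimes>\<^bsub>P 0\<^esub> y \<oplus>\<^bsub>P 0\<^esub> (x \<otimes>\<^bsub>P 0\<^esub> psi e \<oplus>\<^bsub>P 0\<^esub> y \<otimes>\<^bsub>P 0\<^esub> psi c))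
      = g x \<otimes>\<^bsub>T\<^esub> g y \<oplus>\<^bsub>T\<^esub> (g x \<otimes>\<^bsub>T\<^esub> g (psi e) \<oplus>\<^bsub>T\<^esub> g y \<otimes>\<^bsub>T\<^esub> g (psi c))"
      using k pc by (simp add: g_add g_mult)
    also have "\<dots> = g x \<otimes>\<^bsub>T\<^esub> g y \<oplus>\<^bsub>T\<^esub> (g x \<otimes>\<^bsub>T\<^esub> g (psi e) \<oplus>\<^bsub>T\<^esub> g y \<otimes>\<^bsub>T\<^esub> g (psi c)) \<oplus>\<^bsub>T\<^esub> g (psi c) \<otimes>\<^bsub>T\<^esub> g (psi e)"
      unfolding j using k pc by (simp add: g_closed)
    also have "\<dots> = (g x \<oplus>\<^bsub>T\<^esub> g (psi c)) \<otimes>\<^bsub>T\<^esub> (g y \<oplus>\<^bsub>T\<^esub> g (psi e))"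
      by (rule T.expand_product) (use g_closed k pc in auto)
    finally show "ext (u \<otimes>\<^bsub>?Y\<^esub> v) = ext u \<otimes>\<^bsub>T\<^esub> ext v"
      unfolding xc(2) ye(2) H0_mult[OF xc(1) ye(1)] ext_cl[OF xc(1)] ext_cl[OF ye(1)] ext_cl[OF Z_mult[OF xc(1) ye(1)]] p
      using k pc by (simp add: g_add)
  next
    show "ext \<one>\<^bsub>?Y\<^esub> = \<one>\<^bsub>T\<^esub>" unfolding H0_one ext_cl[OF Z_one] by (simp add: psi_zero g_one)
  qed
  have a: "ext (H0_structure_map A B f 2 a) = \<phi>' a" if "a \<in> carrier A" for a
    unfolding H0_structure ext_cl[OF Z_cst[OF that]] using that by (simp add: psi_zero cst_closed g_cst)
  have p: "\<pi>' (ext u) = \<pi>Y u" if u: "u \<in> carrier ?Y" for u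
  proof -
    obtain x c where xc: "Z x c" "u = cl x c" using rep[OF u] by blast
    note k = Z_carrier[OF xc(1)]
    show ?thesis unfolding xc(2) ext_cl[OF xc(1)] \<pi>_cl[OF xc(1)]
      using k psi_closed[OF k(2)] by (simp add: g_aug ring_hom_add[OF aug_hom] aug_psi aug_closed)
  qed
  have "ext \<in> extensional (carrier ?Y)" by (simp add: ext_def)
  then show ?thesis using hom a p unfolding thickening_hom_def by blast
qed

end

end

context cring
begin

lemma minus_minus_swap:
  "\<lbrakk>x \<in> carrier R; x' \<in> carrier R; y \<in> carrier R; y' \<in> carrier R\<rbrakk> \<Longrightarrow>
  (x \<ominus> x') \<ominus> (y \<ominus> y') = (x \<ominus> y) \<ominus> (x' \<ominus> y')"
  by algebra

text \<open>To be read with r0, r1, y0, y1 the values of one lift g at the faces of r and y, with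
  z0, z1 those of another lift h at the faces of y, and with t = h(d1 r). The first two summands are
  then products of kernel elements. The second is added and subtracted again, which leaves the
  difference taken at the single coefficient r1.\<close>

lemma lift_difference_expand:
  "\<lbrakk>r0 \<in> carrier R; r1 \<in> carrier R; t \<in> carrier R; y0 \<in> carrier R; y1 \<in> carrier R; z0 \<in> carrier R; z1 \<in> carrier R\<rbrakk> \<Longrightarrow>
  r0 \<otimes> (y0 \<ominus> z0) \<ominus> r1 \<otimes> (y1 \<ominus> z1) = (r0 \<ominus> r1) \<otimes> (y0 \<ominus> z0) \<oplus> (r1 \<ominus> t) \<otimes> (z0 \<ominus> z1)
    \<oplus> (r1 \<otimes> (y0 \<ominus> y1) \<ominus> r1 \<otimes> (z0 \<ominus> z1)) \<ominus> (r1 \<ominus> t) \<otimes> (z0 \<ominus> z1)"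
  by algebra

lemma eq_of_diff_mult_zero:
  assumes "x \<in> carrier R" "y \<in> carrier R" "z \<in> carrier R" "(x \<ominus> y) \<otimes> z = \<zero>"
  shows "x \<otimes> z = y \<otimes> z"
proof -
  have "(x \<ominus> y) \<otimes> z = x \<otimes> z \<ominus> y \<otimes> z" using assms(1-3) by algebra
  then have "x \<otimes> z \<ominus> y \<otimes> z = \<zero>" using assms(4) by (rule trans[OF sym])
  then show ?thesis by (rule r_right_minus_eq[THEN iffD1, rotated 2]) (use assms in simp_all)
qed

end

section \<open>The homomorphism from P_0 to Y and the description of all classes through it\<close>

context unramified_algebra_map
begin

abbreviation (input) \<phi>Y where "\<phi>Y \<equiv> H0_structure_map A B f 2"

lemma \<phi>Y_hom: "\<phi>Y \<in> ring_hom A Y"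
  using thickening_Y by (simp add: first_order_thickening_def)

definition section_hom where
  "section_hom = poly_alg_eval A Y \<phi>Y (\<lambda>v. cl (ind v) (SOME c. Z (ind v) c))"

lemma section_hom_facts:
  "section_hom \<in> ring_hom (P 0) Y"
  "a \<in> carrier A \<Longrightarrow> section_hom (cst a) = \<phi>Y a"
  "v \<in> res_vars A B 0 \<Longrightarrow> \<exists>c. Z (ind v) c \<and> section_hom (ind v) = cl (ind v) c"
proof -
  have z: "Z (ind v) (SOME c. Z (ind v) c)" if "v \<in> res_vars A B 0" for v
    using Z_exists[OF ind_closed[OF that]] by (metis someI)
  have c: "cl (ind v) (SOME c. Z (ind v) c) \<in> carrier Y" if "v \<in> res_vars A B 0" for v
    by (rule Y_closed[OF z[OF that]])
  note ev = eval_facts[where \<rho> = "\<lambda>v. cl (ind v) (SOME c. Z (ind v) c)", OF H0_cring \<phi>Y_hom c]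
  show "section_hom \<in> ring_hom (P 0) Y" unfolding section_hom_def by (rule ev(1))
  show "a \<in> carrier A \<Longrightarrow> section_hom (cst a) = \<phi>Y a" unfolding section_hom_def by (rule ev(2))
  show "\<exists>c. Z (ind v) c \<and> section_hom (ind v) = cl (ind v) c" if "v \<in> res_vars A B 0"
    unfolding section_hom_def by (rule exI, rule conjI, rule z[OF that], rule ev(3)[OF _ that])
qed

text \<open>The representative has first component exactly \<open>x\<close>, not merely an element
  with the same augmentation. This holds for variables by construction, and it persists because sums
  and products of pairs add and multiply the first components.\<close>

lemma section_rep:
  assumes "x \<in> carrier (P 0)" shows "\<exists>c. Z x c \<and> section_hom x = cl x c"
proof -
  note h = section_hom_facts(1)
  from assms have "x \<in> carrier (poly_alg A (res_vars A B 0))" by (simp add: res_def)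
  then show ?thesis
  proof (induction rule: A.poly_alg_induct)
    case (const k)
    have "section_hom (cst k) = cl (cst k) 0" using section_hom_facts(2)[OF const] by (simp add: H0_structure)
    then show ?case using Z_cst[OF const] by blast
  next
    case (add p q)
    then obtain c c' where c: "Z p c" "section_hom p = cl p c" "Z q c'" "section_hom q = cl q c'" by blast
    have "section_hom (p \<oplus>\<^bsub>P 0\<^esub> q) = cl (p \<oplus>\<^bsub>P 0\<^esub> q) (c + c')"
      using ring_hom_add[OF h Z_carrier(1)[OF c(1)] Z_carrier(1)[OF c(3)]] H0_add[OF c(1,3)] c(2,4) by simp
    then show ?case using Z_add[OF c(1,3)] unfolding res_def by blast
  next
    case (mult_var p v)
    then obtain c where c: "Z p c" "section_hom p = cl p c" by blast
    obtain c' where c': "Z (ind v) c'" "section_hom (ind v) = cl (ind v) c'"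
      using section_hom_facts(3)[OF mult_var(2)] by blast
    have "ring.indexed_pmult A p v = p \<otimes>\<^bsub>P 0\<^esub> ind v"
      unfolding res_def by (rule A.indexed_pmult_eq[OF mult_var(1)])
    moreover have "section_hom (p \<otimes>\<^bsub>P 0\<^esub> ind v) = cl (p \<otimes>\<^bsub>P 0\<^esub> ind v) (sm (Suc 0) (s0 p) c' + sm (Suc 0) (s0 (ind v)) c)"
      using ring_hom_mult[OF h Z_carrier(1)[OF c(1)] Z_carrier(1)[OF c'(1)]] H0_mult[OF c(1) c'(1)] c(2) c'(2) by simp
    ultimately show ?case using Z_mult[OF c(1) c'(1)] by auto
  qed
qed

text \<open>The pair (x, \<rho> x) is a cycle representing \<open>section_hom x\<close>, so -\<rho>
  x is a preimage of dx under \<partial>. The choices are additive and satisfy the product rule up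
  to boundaries only.\<close>

definition \<rho> where "\<rho> x = (SOME c. Z x c \<and> section_hom x = cl x c)"

lemma \<rho>: "x \<in> carrier (P 0) \<Longrightarrow> Z x (\<rho> x)" "x \<in> carrier (P 0) \<Longrightarrow> section_hom x = cl x (\<rho> x)"
  unfolding \<rho>_def using someI_ex[OF section_rep] by blast+

lemma \<rho>_K: "x \<in> carrier (P 0) \<Longrightarrow> \<rho> x \<in> K (Suc 0) (Suc 0)"
  using Z_carrier(2)[OF \<rho>(1)] .

lemmas section_add = ring_hom_add[OF section_hom_facts(1)]
  and section_mult = ring_hom_mult[OF section_hom_facts(1)]

lemma Bd_of_eq:
  assumes "Z x c" "Z x c'" "cl x c = cl x c'" shows "Bd \<zero>\<^bsub>P 0\<^esub> (c - c')"
  using assms(3) Z_carrier(1)[OF assms(1)] unfolding cl_eq_iff[OF assms(1,2)]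
  by (simp add: Om.R.minus_eq Om.R.r_neg)

text \<open>The boundary is multiplied by a cycle over \<open>r\<close>; the other summand of the
  product has scalar \<open>s0\<close> of zero and is a relation.\<close>

lemma Bd_sm:
  assumes "Bd \<zero>\<^bsub>P 0\<^esub> c" "r \<in> carrier (P 0)" shows "Bd \<zero>\<^bsub>P 0\<^esub> (sm (Suc 0) (s0 r) c)"
proof -
  have "Bd (\<zero>\<^bsub>P 0\<^esub> \<otimes>\<^bsub>P 0\<^esub> r) (sm (Suc 0) (s0 \<zero>\<^bsub>P 0\<^esub>) (\<rho> r) + sm (Suc 0) (s0 r) c)"
    by (rule Bd_mult[OF assms(1) \<rho>(1)[OF assms(2)]])
  then have b: "Bd \<zero>\<^bsub>P 0\<^esub> (sm (Suc 0) \<zero>\<^bsub>P (Suc 0)\<^esub> (\<rho> r) + sm (Suc 0) (s0 r) c)" using assms by (simp add: s0_zero)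
  have n: "sm (Suc 0) \<zero>\<^bsub>P (Suc 0)\<^esub> (\<rho> r) \<in> Null (Suc 0) (Suc 0)"
    using \<rho>_K[OF assms(2)] by (intro Om.smul_zero_left) (simp add: K_def)
  show ?thesis by (rule Bd_cong[OF b]) (use Om.form_null_minus[OF n] in simp)
qed

text \<open>Up to sign, a section of \<open>\<Omega>\<^sup>1(P\<^sub>1) \<rightarrow> \<Omega>\<^sup>1(P\<^sub>0)\<close>, well defined modulo boundaries because \<open>section_hom\<close> is a
  ring homomorphism.\<close>

definition contract where
  "contract = frag_extend (\<lambda>u. sm (Suc 0) (s0 (fst u)) (\<rho> (snd u ! 0)))"

lemma contract_dx: "contract (dx r x) = sm (Suc 0) (s0 r) (\<rho> x)"
  by (simp add: contract_def)

lemma contract_diff: "contract (c - c') = contract c - contract c'"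
  and contract_add: "contract (c + c') = contract c + contract c'"
  and contract_zero: "contract 0 = 0"
  by (simp_all add: contract_def frag_extend_diff frag_extend_add)

lemma contract_null:
  assumes "c \<in> Null 0 (Suc 0)" shows "Bd \<zero>\<^bsub>P 0\<^esub> (contract c)"
proof (rule Om.form_null_induct[OF assms])
  show "Bd \<zero>\<^bsub>P 0\<^esub> (contract 0)" by (simp add: contract_zero Bd_zero)
next
  fix c c' assume "Bd \<zero>\<^bsub>P 0\<^esub> (contract c)" "Bd \<zero>\<^bsub>P 0\<^esub> (contract c')"
  from Bd_diff[OF this] show "Bd \<zero>\<^bsub>P 0\<^esub> (contract (c - c'))" by (simp add: contract_diff Om.R.minus_eq)
next
  fix c assume "c \<in> form_relations A (P 0) cst (Suc 0)"
  then show "Bd \<zero>\<^bsub>P 0\<^esub> (contract c)"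
  proof cases
    case (coeff_add r xs s)
    then obtain x where k: "xs = [x]" "r \<in> carrier (P 0)" "s \<in> carrier (P 0)" "x \<in> carrier (P 0)"
      by (auto simp: form_symbols_def length_Suc_conv)
    have "sm (Suc 0) (s0 r \<oplus>\<^bsub>P (Suc 0)\<^esub> s0 s) (\<rho> x) - (sm (Suc 0) (s0 r) (\<rho> x) + sm (Suc 0) (s0 s) (\<rho> x)) \<in> Null (Suc 0) (Suc 0)"
      using k \<rho>_K[OF k(4)] by (intro Om.smul_add_left s0_closed) (auto simp: K_def)
    then have "contract c \<in> Null (Suc 0) (Suc 0)"
      unfolding coeff_add(1) k(1) using k by (simp add: contract_diff contract_add contract_dx s0_add diff_diff_eq)
    then show ?thesis by (rule Bd_null)
  next
    case (d_add r us x vs y)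
    then have k: "us = []" "vs = []" "r \<in> carrier (P 0)" "x \<in> carrier (P 0)" "y \<in> carrier (P 0)"
      by (auto simp: form_symbols_def)
    have xy: "x \<oplus>\<^bsub>P 0\<^esub> y \<in> carrier (P 0)" using k by simp
    \<comment> \<open>Both pairs represent \<open>section_hom\<close> of the sum and have the same
      first component, so the second components differ by a boundary.\<close>
    have "cl (x \<oplus>\<^bsub>P 0\<^esub> y) (\<rho> (x \<oplus>\<^bsub>P 0\<^esub> y)) = cl (x \<oplus>\<^bsub>P 0\<^esub> y) (\<rho> x + \<rho> y)"
      unfolding \<rho>(2)[OF xy, symmetric] section_add[OF k(4,5)] \<rho>(2)[OF k(4)] \<rho>(2)[OF k(5)]
      by (rule H0_add[OF \<rho>(1)[OF k(4)] \<rho>(1)[OF k(5)]])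
    then have "Bd \<zero>\<^bsub>P 0\<^esub> (\<rho> (x \<oplus>\<^bsub>P 0\<^esub> y) - (\<rho> x + \<rho> y))"
      by (rule Bd_of_eq[OF \<rho>(1)[OF xy] Z_add[OF \<rho>(1)[OF k(4)] \<rho>(1)[OF k(5)]]])
    from Bd_sm[OF this k(3)] show ?thesis
      unfolding d_add(1) k(1,2) by (simp add: contract_diff contract_add contract_dx Om.smul_diff Om.smul_add diff_diff_eq)
  next
    case (d_mult r us x vs y)
    then have k: "us = []" "vs = []" "r \<in> carrier (P 0)" "x \<in> carrier (P 0)" "y \<in> carrier (P 0)"
      by (auto simp: form_symbols_def)
    have xy: "x \<otimes>\<^bsub>P 0\<^esub> y \<in> carrier (P 0)" using k by simp
    have "cl (x \<otimes>\<^bsub>P 0\<^esub> y) (\<rho> (x \<otimes>\<^bsub>P 0\<^esub> y)) = cl (x \<otimes>\<^bsub>P 0\<^esub> y) (sm (Suc 0) (s0 x) (\<rho> y) + sm (Suc 0) (s0 y) (\<rho> x))"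
      unfolding \<rho>(2)[OF xy, symmetric] section_mult[OF k(4,5)] \<rho>(2)[OF k(4)] \<rho>(2)[OF k(5)]
      by (rule H0_mult[OF \<rho>(1)[OF k(4)] \<rho>(1)[OF k(5)]])
    then have "Bd \<zero>\<^bsub>P 0\<^esub> (\<rho> (x \<otimes>\<^bsub>P 0\<^esub> y) - (sm (Suc 0) (s0 x) (\<rho> y) + sm (Suc 0) (s0 y) (\<rho> x)))"
      by (rule Bd_of_eq[OF \<rho>(1)[OF xy] Z_mult[OF \<rho>(1)[OF k(4)] \<rho>(1)[OF k(5)]]])
    note b = Bd_sm[OF this k(3)]
    have a: "sm (Suc 0) (s0 (r \<otimes>\<^bsub>P 0\<^esub> p)) (\<rho> t) = sm (Suc 0) (s0 r) (sm (Suc 0) (s0 p) (\<rho> t))"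
      if "p \<in> carrier (P 0)" "t \<in> carrier (P 0)" for p t
      using that k \<rho>_K[OF that(2)] by (simp add: s0_mult K_def Om.smul_assoc s0_closed)
    show ?thesis
      using b a[OF k(4,5)] a[OF k(5,4)]
      unfolding d_mult(1) k(1,2) by (simp add: contract_diff contract_add contract_dx Om.smul_diff Om.smul_add diff_diff_eq)
  next
    case (d_const r us a vs)
    then have k: "us = []" "vs = []" "r \<in> carrier (P 0)" "a \<in> carrier A"
      by (auto simp: form_symbols_def)
    note ca = cst_closed[OF k(4), of 0]
    have "cl (cst a) (\<rho> (cst a)) = cl (cst a) 0"
      unfolding \<rho>(2)[OF ca, symmetric] section_hom_facts(2)[OF k(4)] H0_structure ..
    then have "Bd \<zero>\<^bsub>P 0\<^esub> (\<rho> (cst a) - 0)" by (rule Bd_of_eq[OF \<rho>(1)[OF ca] Z_cst[OF k(4)]])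
    from Bd_sm[OF this k(3)] show ?thesis unfolding d_const(1) k(1,2) by (simp add: contract_dx)
  next
    case (alternating r us x vs ws)
    then show ?thesis by (auto simp: form_symbols_def)
  qed
qed

text \<open>\<open>contract\<close> inverts \<partial> only up to sign and on one side. For the form
  r dy the error of the other composite is, modulo boundaries, a multiple by \<open>d1 r\<close> of
  an expression in \<open>y\<close> alone; this is the shape that \<open>section_psi\<close>
  compares with \<open>psi\<close>.\<close>

lemma homotopy_formula:
  assumes r: "r \<in> carrier (P (Suc 0))" and y: "y \<in> carrier (P (Suc 0))"
  shows "Bd \<zero>\<^bsub>P 0\<^esub> (contract (hd 0 (dx r y)) + dx r y
    - sm (Suc 0) (s0 (d1 r)) (\<rho> (d0 y) - \<rho> (d1 y) + dx \<one>\<^bsub>P (Suc 0)\<^esub> y))"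
proof -
  let ?\<rho> = "\<rho> (d0 y)"
  \<comment> \<open>The first term moves the scalar acting on \<open>?\<rho>\<close> from
    \<open>d0 r\<close> to \<open>d1 r\<close>, at the cost of r times \<partial> of
    \<open>?\<rho>\<close>, that is of -r d(s0 (d0 y)). The second term removes this cost and also
    replaces r dy by s0(d1 r) dy.\<close>
  let ?e = "homotopy r ?\<rho> - dx (s (Suc 0) 0 r) (s (Suc 0) (Suc 0) y)"
  let ?D = "contract (hd 0 (dx r y)) + dx r y - sm (Suc 0) (s0 (d1 r)) (\<rho> (d0 y) - \<rho> (d1 y) + dx \<one>\<^bsub>P (Suc 0)\<^esub> y)"
  have yc: "d0 y \<in> carrier (P 0)" "d1 y \<in> carrier (P 0)" "d0 r \<in> carrier (P 0)" "d1 r \<in> carrier (P 0)"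
    using r y by (simp_all add: d0_closed d1_closed)
  note k = \<rho>_K[OF yc(1)] \<rho>_K[OF yc(2)]
  have "sm (Suc 0) r (pb s0 (hd 0 ?\<rho> + dx \<one>\<^bsub>P 0\<^esub> (d0 y))) \<in> Null (Suc 0) (Suc 0)"
    using \<rho>(1)[OF yc(1)] r by (intro Om.smul_null Null_pb_s) (auto simp: Z_def)
  then have n: "sm (Suc 0) r (pb s0 (hd 0 ?\<rho>)) + dx r (s0 (d0 y)) \<in> Null (Suc 0) (Suc 0)"
    using r by (simp add: form_pullback_add Om.smul_add s0_one)
  have D: "?D = sm (Suc 0) (s0 (d0 r)) ?\<rho> - sm (Suc 0) (s0 (d1 r)) ?\<rho> + dx r y - dx (s0 (d1 r)) y"
    using yc by (simp add: hd_0 contract_diff contract_dx Om.smul_add Om.smul_diff s0_closed)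
  have h2: "hd (Suc 0) (dx (s (Suc 0) 0 r) (s (Suc 0) (Suc 0) y)) = dx r (s0 (d0 y)) - dx r y + dx (s0 (d1 r)) y"
    using r y by (simp add: hd_1 face_0_deg_0 face_1_deg_0 face_2_deg_0 face_0_deg_1 face_1_deg_1 face_2_deg_1)
  have "?D - hd (Suc 0) ?e = sm (Suc 0) r (pb s0 (hd 0 ?\<rho>)) + dx r (s0 (d0 y))"
    unfolding D hd_diff h2 hd_homotopy[OF r k(1)] by simp
  then have "?D - hd (Suc 0) ?e \<in> Null (Suc 0) (Suc 0)" using n by simp
  moreover have "?e \<in> K (Suc (Suc 0)) (Suc 0)"
    using r y k by (intro K_diff homotopy_K K_dx degeneracy_closed) auto
  moreover have "?D \<in> K (Suc 0) (Suc 0)"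
    unfolding D using r y yc k by (intro K_diff K_add K_sm K_dx s0_closed) auto
  ultimately show ?thesis by (intro Bd_hd)
qed

text \<open>On r dy the left side is s(d1 r)(s(d0 y) - s(d1 y)), computed from the representatives
  \<rho>; \<open>homotopy_formula\<close> identifies the result with the stated class.\<close>

lemma section_psi:
  "c \<in> K (Suc 0) (Suc 0) \<Longrightarrow> Z \<zero>\<^bsub>P 0\<^esub> (contract (hd 0 c) + c) \<and> section_hom (psi c) = cl \<zero>\<^bsub>P 0\<^esub> (contract (hd 0 c) + c)"
proof (induction rule: K_induct)
  case zero
  have "section_hom \<zero>\<^bsub>P 0\<^esub> = \<zero>\<^bsub>Y\<^esub>"
    using ring_hom_zero[OF section_hom_facts(1) P_ring] H0_cring cring.axioms(1) by blast
  then show ?case by (simp add: contract_zero psi_zero Z_zero H0_zero)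
next
  case (diff c c')
  interpret Y: cring Y by (rule H0_cring)
  let ?u = "contract (hd 0 c) + c" and ?v = "contract (hd 0 c') + c'"
  have uv: "Z \<zero>\<^bsub>P 0\<^esub> ?u" "section_hom (psi c) = cl \<zero>\<^bsub>P 0\<^esub> ?u" "Z \<zero>\<^bsub>P 0\<^esub> ?v" "section_hom (psi c') = cl \<zero>\<^bsub>P 0\<^esub> ?v"
    using diff by auto
  have e: "contract (hd 0 (c - c')) + (c - c') = ?u - ?v" by (simp add: hd_diff contract_diff)
  have z: "Z \<zero>\<^bsub>P 0\<^esub> (?u - ?v)" using Z_add[OF uv(1) Z_minus[OF uv(3)]] unfolding Om.R.r_neg[OF Om.R.zero_closed] add_uminus_conv_diff .
  have "cl \<zero>\<^bsub>P 0\<^esub> (?u - ?v) \<oplus>\<^bsub>Y\<^esub> cl \<zero>\<^bsub>P 0\<^esub> ?v = cl \<zero>\<^bsub>P 0\<^esub> ?u"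
    using H0_add[OF z uv(3)] by simp
  then have "cl \<zero>\<^bsub>P 0\<^esub> (?u - ?v) = cl \<zero>\<^bsub>P 0\<^esub> ?u \<ominus>\<^bsub>Y\<^esub> cl \<zero>\<^bsub>P 0\<^esub> ?v"
    using Y_closed[OF z] Y_closed[OF uv(3)] by (metis Y.a_assoc Y.minus_eq Y.r_neg Y.r_zero Y.a_inv_closed)
  also have "\<dots> = section_hom (psi (c - c'))"
    using diff.hyps uv(2,4) ring_hom_diff[OF section_hom_facts(1) P_ring Y.ring_axioms]
    by (simp add: psi_diff psi_closed)
  finally show ?case unfolding e using z by simp
next
  case (symbol r y)
  interpret Y: cring Y by (rule H0_cring)
  note yc = d0_closed[OF symbol(2)] d1_closed[OF symbol(2)] d0_closed[OF symbol(1)] d1_closed[OF symbol(1)]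
  note z = \<rho>(1)[OF yc(1)] \<rho>(1)[OF yc(2)] \<rho>(1)[OF yc(4)]
  let ?\<kappa> = "\<rho> (d0 y) - \<rho> (d1 y)"
  let ?o = "\<one>\<^bsub>P (Suc 0)\<^esub>"
  have zk: "Z (pd y) ?\<kappa>" using Z_add[OF z(1) Z_minus[OF z(2)]] by (simp add: pd_def a_minus_def)
  \<comment> \<open>The boundary of \<open>y\<close>. Subtracting it from (pd y, ?\<kappa>) moves
    the class into the form with first component zero.\<close>
  have b: "Bd (pd y) (- dx ?o y)"
    by (rule BdI[OF _ symbol(2) K_zero]) (use symbol in \<open>auto intro!: K_minus K_dx\<close>)
  have z0: "Z \<zero>\<^bsub>P 0\<^esub> (?\<kappa> + dx ?o y)"
    using Z_add[OF zk Z_minus[OF Bd_Z[OF b]]] pd_closed[OF symbol(2)] by (simp add: Om.R.r_neg)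
  have "cl (pd y) ?\<kappa> \<oplus>\<^bsub>Y\<^esub> cl (d1 y) (\<rho> (d1 y)) = cl (d0 y) (\<rho> (d0 y))"
    using H0_add[OF zk z(2)] yc by (simp add: pd_def a_minus_def Om.R.a_assoc Om.R.l_neg)
  then have "cl (pd y) ?\<kappa> = section_hom (d0 y) \<ominus>\<^bsub>Y\<^esub> section_hom (d1 y)"
    unfolding \<rho>(2)[OF yc(1)] \<rho>(2)[OF yc(2)]
    using Y_closed[OF zk] Y_closed[OF z(2)] by (metis Y.a_assoc Y.minus_eq Y.r_neg Y.r_zero Y.a_inv_closed)
  also have "\<dots> = section_hom (pd y)"
    unfolding pd_def by (rule ring_hom_diff[OF section_hom_facts(1) P_ring Y.ring_axioms yc(1,2), symmetric])
  finally have s1: "section_hom (pd y) = cl (pd y) ?\<kappa>" by simp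
  also have "\<dots> = cl \<zero>\<^bsub>P 0\<^esub> (?\<kappa> + dx ?o y)"
    unfolding cl_eq_iff[OF zk z0] using b pd_closed[OF symbol(2)] by (simp add: Om.R.minus_eq)
  finally have s2: "section_hom (pd y) = cl \<zero>\<^bsub>P 0\<^esub> (?\<kappa> + dx ?o y)" .
  let ?w = "sm (Suc 0) (s0 (d1 r)) (?\<kappa> + dx ?o y)"
  have "section_hom (psi (dx r y)) = section_hom (d1 r) \<otimes>\<^bsub>Y\<^esub> section_hom (pd y)"
    using symbol yc by (simp add: psi_dx section_mult pd_closed)
  also have "\<dots> = cl (d1 r \<otimes>\<^bsub>P 0\<^esub> \<zero>\<^bsub>P 0\<^esub>) (?w + sm (Suc 0) (s0 \<zero>\<^bsub>P 0\<^esub>) (\<rho> (d1 r)))"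
    unfolding s2 \<rho>(2)[OF yc(4)] by (rule H0_mult[OF z(3) z0])
  finally have s3: "section_hom (psi (dx r y)) = cl \<zero>\<^bsub>P 0\<^esub> (?w + sm (Suc 0) \<zero>\<^bsub>P (Suc 0)\<^esub> (\<rho> (d1 r)))"
    using yc by (simp add: s0_zero)
  have z3: "Z \<zero>\<^bsub>P 0\<^esub> (?w + sm (Suc 0) \<zero>\<^bsub>P (Suc 0)\<^esub> (\<rho> (d1 r)))"
    using Z_mult[OF z(3) z0] yc by (simp add: s0_zero)
  have n: "sm (Suc 0) \<zero>\<^bsub>P (Suc 0)\<^esub> (\<rho> (d1 r)) \<in> Null (Suc 0) (Suc 0)"
    using Z_carrier(2)[OF z(3)] by (intro Om.smul_zero_left) (simp add: K_def)
  let ?t = "contract (hd 0 (dx r y)) + dx r y"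
  have b0: "Bd \<zero>\<^bsub>P 0\<^esub> (?t - (?w + sm (Suc 0) \<zero>\<^bsub>P (Suc 0)\<^esub> (\<rho> (d1 r))))"
    by (rule Bd_cong[OF homotopy_formula[OF symbol]]) (use Om.form_null_minus[OF n] in simp)
  have zt: "Z \<zero>\<^bsub>P 0\<^esub> ?t" using Z_add[OF Bd_Z[OF b0] z3] by simp
  have "cl \<zero>\<^bsub>P 0\<^esub> ?t = cl \<zero>\<^bsub>P 0\<^esub> (?w + sm (Suc 0) \<zero>\<^bsub>P (Suc 0)\<^esub> (\<rho> (d1 r)))"
    unfolding cl_eq_iff[OF zt z3] using b0 by (simp add: Om.R.minus_eq)
  then show ?case using zt s3 by simp
qed

text \<open>The right side has the representative with first component x and second component \<rho>
  x + contract (\<partial>c) + c. Since \<rho> x + contract (\<partial>c) is \<open>contract\<close>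
  of 1 dx + \<partial>c up to relations, and that form is null by the cycle condition, only c
  remains modulo boundaries.\<close>

lemma cl_section:
  assumes "Z x c" shows "cl x c = section_hom (x \<oplus>\<^bsub>P 0\<^esub> psi c)"
proof -
  note k = Z_carrier[OF assms]
  note z = \<rho>(1)[OF k(1)] section_psi[OF k(2), THEN conjunct1]
  let ?t = "\<rho> x + (contract (hd 0 c) + c)"
  have "hd 0 c + dx \<one>\<^bsub>P 0\<^esub> x \<in> Null 0 (Suc 0)" using assms by (simp add: Z_def)
  from contract_null[OF this] have "Bd \<zero>\<^bsub>P 0\<^esub> (contract (hd 0 c) + \<rho> x)"
    using \<rho>_K[OF k(1)] Om.smul_one[of "\<rho> x" "Suc 0" "Suc 0"]
    by (simp add: contract_add contract_dx s0_one K_def)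
  then have b: "Bd \<zero>\<^bsub>P 0\<^esub> (?t - c)" by (simp add: add.commute)
  have zt: "Z x ?t" using Z_add[OF z] k by simp
  have "section_hom (x \<oplus>\<^bsub>P 0\<^esub> psi c) = cl x (\<rho> x) \<oplus>\<^bsub>Y\<^esub> cl \<zero>\<^bsub>P 0\<^esub> (contract (hd 0 c) + c)"
    unfolding section_add[OF k(1) psi_closed[OF k(2)]] section_psi[OF k(2), THEN conjunct2] \<rho>(2)[OF k(1), symmetric] ..
  also have "\<dots> = cl x ?t" using H0_add[OF z] k by simp
  also have "\<dots> = cl x c" unfolding cl_eq_iff[OF zt assms] using b k by (simp add: Om.R.minus_eq Om.R.r_neg)
  finally show ?thesis by simp
qed

end

section \<open>Independence of the lift\<close>

context thickening_target
begin

text \<open>The difference of two lifts is a derivation into the square-zero kernel, hence factors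
  through \<open>\<Omega>\<^sup>1(P\<^sub>0)\<close>.\<close>

lemma lifts_agree:
  assumes g: "lift g" and h: "lift h" and z: "Z x c"
  shows "g (x \<oplus>\<^bsub>P 0\<^esub> psi c) = h (x \<oplus>\<^bsub>P 0\<^esub> psi c)"
proof -
  note k = Z_carrier[OF z]
  let ?S = "form_symbols (P 0) (Suc 0)"
  \<comment> \<open>The map on one-forms of P_0 induced by the derivation g - h. Coefficients act
    through \<open>g\<close>; acting through \<open>h\<close> would give the same values, since the
    kernel squares to zero.\<close>
  let ?\<gamma> = "\<lambda>u. g (fst u) \<otimes>\<^bsub>T\<^esub> (g (snd u ! 0) \<ominus>\<^bsub>T\<^esub> h (snd u ! 0))"
  let ?\<Gamma> = "frag_lift T ?\<gamma>"
  have ker: "g p \<ominus>\<^bsub>T\<^esub> h p \<in> carrier T" "\<pi>' (g p \<ominus>\<^bsub>T\<^esub> h p) = \<zero>\<^bsub>B\<^esub>" if "p \<in> carrier (P 0)" for p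
    using that by (simp_all add: g_closed[OF g] g_closed[OF h] ring_hom_diff[OF \<pi>'_hom T.ring_axioms B.ring_axioms]
        g_aug[OF g] g_aug[OF h] aug_closed B.minus_eq B.r_neg)
  have \<gamma>c: "?\<gamma> u \<in> carrier T" if "u \<in> ?S" for u
    using that by (rule form_symbols_1E) (simp add: g_closed[OF g] ker)
  have \<Gamma>_dx: "?\<Gamma> (dx r p) = g r \<otimes>\<^bsub>T\<^esub> (g p \<ominus>\<^bsub>T\<^esub> h p)" if "r \<in> carrier (P 0)" "p \<in> carrier (P 0)" for r p
    using T.frag_lift_of[of ?\<gamma> "(r, [p])"] \<gamma>c[OF symbol_1[OF that]] by simp
  have \<Gamma>_diff: "?\<Gamma> (a - b) = ?\<Gamma> a \<ominus>\<^bsub>T\<^esub> ?\<Gamma> b" if "a \<in> K 0 (Suc 0)" "b \<in> K 0 (Suc 0)" for a b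
    using that unfolding K_def mem_Collect_eq by (rule T.frag_lift_diff[OF _ _ \<gamma>c])
  have \<Gamma>_add: "?\<Gamma> (a + b) = ?\<Gamma> a \<oplus>\<^bsub>T\<^esub> ?\<Gamma> b" if "a \<in> K 0 (Suc 0)" "b \<in> K 0 (Suc 0)" for a b
    using that unfolding K_def mem_Collect_eq by (rule T.frag_lift_add[OF _ _ \<gamma>c])
  have \<Gamma>_null: "?\<Gamma> e = \<zero>\<^bsub>T\<^esub>" if "e \<in> Null 0 (Suc 0)" for e
  proof (rule Om.frag_lift_null[OF T.abelian_group_axioms that \<gamma>c])
    have rel: "?\<Gamma> (frag_of u - frag_of v - frag_of w) = ?\<gamma> u \<ominus>\<^bsub>T\<^esub> ?\<gamma> v \<ominus>\<^bsub>T\<^esub> ?\<gamma> w" if "u \<in> ?S" "v \<in> ?S" "w \<in> ?S" for u v w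
      by (rule T.frag_lift_relation[OF that \<gamma>c])
    note gc = g_closed[OF g] and hc = g_closed[OF h]
    fix e assume "e \<in> form_relations A (P 0) cst (Suc 0)"
    then show "?\<Gamma> e = \<zero>\<^bsub>T\<^esub>"
    proof cases
      case (coeff_add r xs s)
      then obtain p where k: "xs = [p]" "r \<in> carrier (P 0)" "s \<in> carrier (P 0)" "p \<in> carrier (P 0)"
        by (auto simp: form_symbols_def length_Suc_conv)
      have "?\<Gamma> e = (g r \<oplus>\<^bsub>T\<^esub> g s) \<otimes>\<^bsub>T\<^esub> (g p \<ominus>\<^bsub>T\<^esub> h p) \<ominus>\<^bsub>T\<^esub> g r \<otimes>\<^bsub>T\<^esub> (g p \<ominus>\<^bsub>T\<^esub> h p) \<ominus>\<^bsub>T\<^esub> g s \<otimes>\<^bsub>T\<^esub> (g p \<ominus>\<^bsub>T\<^esub> h p)"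
        unfolding coeff_add(1) k(1) using k by (simp add: rel symbol_1 g_add[OF g])
      also have "\<dots> = \<zero>\<^bsub>T\<^esub>" using k by (intro T.additivity_left gc ker)
      finally show ?thesis .
    next
      case (d_add r us p vs q)
      then have k: "us = []" "vs = []" "r \<in> carrier (P 0)" "p \<in> carrier (P 0)" "q \<in> carrier (P 0)"
        by (auto simp: form_symbols_def)
      have "?\<Gamma> e = g r \<otimes>\<^bsub>T\<^esub> ((g p \<oplus>\<^bsub>T\<^esub> g q) \<ominus>\<^bsub>T\<^esub> (h p \<oplus>\<^bsub>T\<^esub> h q)) \<ominus>\<^bsub>T\<^esub> g r \<otimes>\<^bsub>T\<^esub> (g p \<ominus>\<^bsub>T\<^esub> h p) \<ominus>\<^bsub>T\<^esub> g r \<otimes>\<^bsub>T\<^esub> (g q \<ominus>\<^bsub>T\<^esub> h q)"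
        unfolding d_add(1) k(1,2) using k by (simp add: rel symbol_1 g_add[OF g] g_add[OF h])
      also have "\<dots> = \<zero>\<^bsub>T\<^esub>" using k by (intro T.additivity_right gc hc)
      finally show ?thesis .
    next
      case (d_mult r us p vs q)
      then have k: "us = []" "vs = []" "r \<in> carrier (P 0)" "p \<in> carrier (P 0)" "q \<in> carrier (P 0)"
        by (auto simp: form_symbols_def)
      have "?\<Gamma> e = g r \<otimes>\<^bsub>T\<^esub> (g p \<otimes>\<^bsub>T\<^esub> g q \<ominus>\<^bsub>T\<^esub> h p \<otimes>\<^bsub>T\<^esub> h q) \<ominus>\<^bsub>T\<^esub> g r \<otimes>\<^bsub>T\<^esub> g p \<otimes>\<^bsub>T\<^esub> (g q \<ominus>\<^bsub>T\<^esub> h q)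
          \<ominus>\<^bsub>T\<^esub> g r \<otimes>\<^bsub>T\<^esub> g q \<otimes>\<^bsub>T\<^esub> (g p \<ominus>\<^bsub>T\<^esub> h p)"
        unfolding d_mult(1) k(1,2) using k by (simp add: rel symbol_1 g_mult[OF g] g_mult[OF h])
      also have "\<dots> = \<ominus>\<^bsub>T\<^esub> (g r \<otimes>\<^bsub>T\<^esub> ((g p \<ominus>\<^bsub>T\<^esub> h p) \<otimes>\<^bsub>T\<^esub> (g q \<ominus>\<^bsub>T\<^esub> h q)))"
        using k by (intro T.derivation_defect_right gc hc)
      also have "(g p \<ominus>\<^bsub>T\<^esub> h p) \<otimes>\<^bsub>T\<^esub> (g q \<ominus>\<^bsub>T\<^esub> h q) = \<zero>\<^bsub>T\<^esub>" using k by (intro kernel_mult_zero ker)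
      finally show ?thesis using k by (simp add: gc)
    next
      case (d_const r us a vs)
      then have k: "us = []" "vs = []" "r \<in> carrier (P 0)" "a \<in> carrier A"
        by (auto simp: form_symbols_def)
      have "\<phi>' a \<in> carrier T" by (rule ring_hom_closed[OF \<phi>'_hom k(4)])
      then have "\<phi>' a \<ominus>\<^bsub>T\<^esub> \<phi>' a = \<zero>\<^bsub>T\<^esub>" by (simp add: T.minus_eq T.r_neg)
      moreover have "?\<Gamma> e = g r \<otimes>\<^bsub>T\<^esub> (\<phi>' a \<ominus>\<^bsub>T\<^esub> \<phi>' a)"
        using \<Gamma>_dx[OF k(3) cst_closed[OF k(4)]] unfolding d_const(1) k(1,2) g_cst[OF g k(4)] g_cst[OF h k(4)] by simp
      ultimately show ?thesis using gc[OF k(3)] by simp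
    next
      case (alternating r us p vs ws)
      then show ?thesis by (auto simp: form_symbols_def)
    qed
  qed
  \<comment> \<open>The compatibility behind the proof: on boundaries of forms on P_1, the induced
    map is the difference g - h evaluated at \<open>psi\<close>.\<close>
  have \<Gamma>_hd: "e \<in> K (Suc 0) (Suc 0) \<Longrightarrow> ?\<Gamma> (hd 0 e) = g (psi e) \<ominus>\<^bsub>T\<^esub> h (psi e)" for e
  proof (induction rule: K_induct)
    case zero
    then show ?case by (simp add: psi_zero T.frag_lift_zero g_zero[OF g] g_zero[OF h] T.minus_eq)
  next
    case (diff e e')
    have "(g (psi e) \<ominus>\<^bsub>T\<^esub> h (psi e)) \<ominus>\<^bsub>T\<^esub> (g (psi e') \<ominus>\<^bsub>T\<^esub> h (psi e'))
      = (g (psi e) \<ominus>\<^bsub>T\<^esub> g (psi e')) \<ominus>\<^bsub>T\<^esub> (h (psi e) \<ominus>\<^bsub>T\<^esub> h (psi e'))"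
      by (rule T.minus_minus_swap)
         (use diff.hyps in \<open>simp_all add: psi_closed g_closed[OF g] g_closed[OF h]\<close>)
    then show ?case
      using diff by (simp add: hd_diff \<Gamma>_diff hd_K psi_diff psi_closed g_diff[OF g] g_diff[OF h])
  next
    case (symbol r y)
    note yc = d0_closed[OF symbol(1)] d1_closed[OF symbol(1)] d0_closed[OF symbol(2)] d1_closed[OF symbol(2)]
    note gc = g_closed[OF g] and hc = g_closed[OF h]
    have a: "(g (d0 r) \<ominus>\<^bsub>T\<^esub> g (d1 r)) \<otimes>\<^bsub>T\<^esub> (g (d0 y) \<ominus>\<^bsub>T\<^esub> h (d0 y)) = \<zero>\<^bsub>T\<^esub>"
    proof (rule kernel_mult_zero)
      show "g (d0 r) \<ominus>\<^bsub>T\<^esub> g (d1 r) \<in> carrier T" using yc by (simp add: gc)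
      show "\<pi>' (g (d0 r) \<ominus>\<^bsub>T\<^esub> g (d1 r)) = \<zero>\<^bsub>B\<^esub>"
        using yc symbol by (simp add: gc ring_hom_diff[OF \<pi>'_hom T.ring_axioms B.ring_axioms] g_aug[OF g] aug_face aug_closed B.minus_eq B.r_neg)
    qed (use ker yc in auto)
    have b: "(g (d1 r) \<ominus>\<^bsub>T\<^esub> h (d1 r)) \<otimes>\<^bsub>T\<^esub> (h (d0 y) \<ominus>\<^bsub>T\<^esub> h (d1 y)) = \<zero>\<^bsub>T\<^esub>"
    proof (rule kernel_mult_zero)
      show "h (d0 y) \<ominus>\<^bsub>T\<^esub> h (d1 y) \<in> carrier T" using yc by (simp add: hc)
      show "\<pi>' (h (d0 y) \<ominus>\<^bsub>T\<^esub> h (d1 y)) = \<zero>\<^bsub>B\<^esub>"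
        using yc symbol by (simp add: hc ring_hom_diff[OF \<pi>'_hom T.ring_axioms B.ring_axioms] g_aug[OF h] aug_face aug_closed B.minus_eq B.r_neg)
    qed (use ker yc in auto)
    have "?\<Gamma> (hd 0 (dx r y)) = g (d0 r) \<otimes>\<^bsub>T\<^esub> (g (d0 y) \<ominus>\<^bsub>T\<^esub> h (d0 y)) \<ominus>\<^bsub>T\<^esub> g (d1 r) \<otimes>\<^bsub>T\<^esub> (g (d1 y) \<ominus>\<^bsub>T\<^esub> h (d1 y))"
      using yc by (simp add: hd_0 \<Gamma>_diff K_dx \<Gamma>_dx)
    also have "\<dots> = (g (d0 r) \<ominus>\<^bsub>T\<^esub> g (d1 r)) \<otimes>\<^bsub>T\<^esub> (g (d0 y) \<ominus>\<^bsub>T\<^esub> h (d0 y))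
        \<oplus>\<^bsub>T\<^esub> (g (d1 r) \<ominus>\<^bsub>T\<^esub> h (d1 r)) \<otimes>\<^bsub>T\<^esub> (h (d0 y) \<ominus>\<^bsub>T\<^esub> h (d1 y)) \<oplus>\<^bsub>T\<^esub>
      (g (d1 r) \<otimes>\<^bsub>T\<^esub> (g (d0 y) \<ominus>\<^bsub>T\<^esub> g (d1 y)) \<ominus>\<^bsub>T\<^esub> g (d1 r) \<otimes>\<^bsub>T\<^esub> (h (d0 y) \<ominus>\<^bsub>T\<^esub> h (d1 y)))
      \<ominus>\<^bsub>T\<^esub> (g (d1 r) \<ominus>\<^bsub>T\<^esub> h (d1 r)) \<otimes>\<^bsub>T\<^esub> (h (d0 y) \<ominus>\<^bsub>T\<^esub> h (d1 y))"
      by (rule T.lift_difference_expand) (use gc hc yc in auto)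
    also have "\<dots> = g (d1 r) \<otimes>\<^bsub>T\<^esub> (g (d0 y) \<ominus>\<^bsub>T\<^esub> g (d1 y)) \<ominus>\<^bsub>T\<^esub> g (d1 r) \<otimes>\<^bsub>T\<^esub> (h (d0 y) \<ominus>\<^bsub>T\<^esub> h (d1 y))"
      unfolding a b using gc hc yc by (simp add: T.minus_eq)
    \<comment> \<open>The vanishing product \<open>b\<close> also permits the coefficient to change
      from \<open>g\<close> to \<open>h\<close>, which turns the second term into \<open>h\<close>
      of \<open>psi\<close>.\<close>
    also have "g (d1 r) \<otimes>\<^bsub>T\<^esub> (h (d0 y) \<ominus>\<^bsub>T\<^esub> h (d1 y)) = h (d1 r) \<otimes>\<^bsub>T\<^esub> (h (d0 y) \<ominus>\<^bsub>T\<^esub> h (d1 y))"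
      by (rule T.eq_of_diff_mult_zero[OF _ _ _ b]) (use gc hc yc in auto)
    also have "g (d1 r) \<otimes>\<^bsub>T\<^esub> (g (d0 y) \<ominus>\<^bsub>T\<^esub> g (d1 y)) \<ominus>\<^bsub>T\<^esub> h (d1 r) \<otimes>\<^bsub>T\<^esub> (h (d0 y) \<ominus>\<^bsub>T\<^esub> h (d1 y))
      = g (psi (dx r y)) \<ominus>\<^bsub>T\<^esub> h (psi (dx r y))"
      using symbol yc by (simp add: psi_dx pd_def g_mult[OF g] g_mult[OF h] g_diff[OF g] g_diff[OF h])
    finally show ?case .
  qed
  have pc: "psi c \<in> carrier (P 0)" by (rule psi_closed[OF k(2)])
  \<comment> \<open>The cycle condition says that this form is null; its two summands contribute the
    differences of g and h at \<open>psi c\<close> and at \<open>x\<close>.\<close>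
  have "\<zero>\<^bsub>T\<^esub> = ?\<Gamma> (hd 0 c + dx \<one>\<^bsub>P 0\<^esub> x)" using z by (simp add: \<Gamma>_null Z_def)
  also have "\<dots> = (g (psi c) \<ominus>\<^bsub>T\<^esub> h (psi c)) \<oplus>\<^bsub>T\<^esub> (g x \<ominus>\<^bsub>T\<^esub> h x)"
    using k ker(1)[OF k(1)] by (simp add: \<Gamma>_add hd_K K_dx \<Gamma>_hd \<Gamma>_dx g_one[OF g])
  also have "\<dots> = (g (psi c) \<oplus>\<^bsub>T\<^esub> g x) \<ominus>\<^bsub>T\<^esub> (h (psi c) \<oplus>\<^bsub>T\<^esub> h x)"
    by (rule T.minus_add_swap) (use k pc g_closed[OF g] g_closed[OF h] in auto)
  also have "\<dots> = g (x \<oplus>\<^bsub>P 0\<^esub> psi c) \<ominus>\<^bsub>T\<^esub> h (x \<oplus>\<^bsub>P 0\<^esub> psi c)"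
    using k pc by (simp add: g_add[OF g] g_add[OF h] T.a_comm g_closed[OF g] g_closed[OF h])
  finally show ?thesis
    using k pc T.r_right_minus_eq[of "g (x \<oplus>\<^bsub>P 0\<^esub> psi c)" "h (x \<oplus>\<^bsub>P 0\<^esub> psi c)"]
    by (simp add: g_closed[OF g] g_closed[OF h])
qed

end

theorem theorem2p4:
  fixes A :: "('a, 'm) ring_scheme" and B :: "('b, 'n) ring_scheme" and f :: "'a \<Rightarrow> 'b"
  assumes "cring A" and "cring B" and "f \<in> ring_hom A B"
    and "trivial_group (forms A B f 1)"
  defines "Y \<equiv> H0 A B f 2"
    and "\<phi> \<equiv> H0_structure_map A B f 2"
    and "\<pi> \<equiv> H0_F1_iso A B f \<circ> H0_reduction A B f"
  shows "first_order_thickening A B f Y \<phi> \<pi> \<and>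
    (\<forall>(T :: 'c ring) \<phi>' \<pi>'. first_order_thickening A B f T \<phi>' \<pi>' \<longrightarrow>
      (\<exists>!h. h \<in> thickening_hom A Y \<phi> \<pi> T \<phi>' \<pi>'))"
proof -
  interpret U: unramified_algebra_map A B f
    by (intro unramified_algebra_map.intro algebra_map.intro algebra_map_axioms.intro unramified_algebra_map_axioms.intro assms(1-4))
  have "\<exists>!h. h \<in> thickening_hom A Y \<phi> \<pi> T \<phi>' \<pi>'" if T: "first_order_thickening A B f T \<phi>' \<pi>'"
    for T :: "'c ring" and \<phi>' \<pi>'
  proof -
    interpret T: thickening_target A B f T \<phi>' \<pi>'
      unfolding thickening_target_def thickening_target_axioms_def
      using T U.algebra_map_axioms by (simp add: first_order_thickening_def)
    obtain g where "T.lift g" using T.lift_exists by blast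
    from T.ext_hom[OF this] have ex: "T.ext g \<in> thickening_hom A Y \<phi> \<pi> T \<phi>' \<pi>'"
      unfolding Y_def \<phi>_def \<pi>_def .
    \<comment> \<open>\<open>section_hom x\<close> has a representative with first component x and
      hence lies over \<open>aug x\<close>; a morphism of thickenings preserves this.\<close>
    have lift: "T.lift (h \<circ> U.section_hom)" if h: "h \<in> thickening_hom A Y \<phi> \<pi> T \<phi>' \<pi>'" for h
      unfolding T.lift_def
    proof (intro conjI ballI)
      have h': "h \<in> ring_hom Y T" "\<forall>a\<in>carrier A. h (\<phi> a) = \<phi>' a" "\<forall>y\<in>carrier Y. \<pi>' (h y) = \<pi> y"
        using h unfolding thickening_hom_def by blast+
      note s = U.section_hom_facts[folded Y_def \<phi>_def]
      show "h \<circ> U.section_hom \<in> ring_hom (res A B 0) T"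
        by (rule ring_hom_trans[OF s(1) h'(1)])
      show "(h \<circ> U.section_hom) (U.A.indexed_const a) = \<phi>' a" if "a \<in> carrier A" for a
        using that h'(2) s(2) by simp
      show "\<pi>' ((h \<circ> U.section_hom) x) = augmentation A B f x" if x: "x \<in> carrier (res A B 0)" for x
      proof -
        obtain c where c: "U.Z x c" "U.section_hom x = U.cl x c" using U.section_rep[OF x] by blast
        have "\<pi>' (h (U.section_hom x)) = \<pi> (U.section_hom x)"
          using h'(3) ring_hom_closed[OF s(1) x] by blast
        then show ?thesis using U.\<pi>_cl[OF c(1)] unfolding comp_apply c(2) \<pi>_def by simp
      qed
    qed
    have uniq: "h = h'"
      if h: "h \<in> thickening_hom A Y \<phi> \<pi> T \<phi>' \<pi>'" and h': "h' \<in> thickening_hom A Y \<phi> \<pi> T \<phi>' \<pi>'" for h h'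
    proof (rule extensionalityI[of _ "carrier Y"])
      show "h \<in> extensional (carrier Y)" "h' \<in> extensional (carrier Y)"
        using h h' unfolding thickening_hom_def by blast+
      fix u assume "u \<in> carrier Y"
      then obtain x c where c: "U.Z x c" "u = U.cl x c" unfolding Y_def U.H0_carrier by blast
      show "h u = h' u"
        using T.lifts_agree[OF lift[OF h] lift[OF h'] c(1)] unfolding c(2) U.cl_section[OF c(1)] comp_apply .
    qed
    show ?thesis using ex uniq by blast
  qed
  then show ?thesis using U.thickening_Y unfolding Y_def \<phi>_def \<pi>_def by blast
qed

end
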